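(* Consider walks with steps $(\pm1,\pm1)$ (all four sign choices), starting at $(0,0)$ and confined to $\mathcal C=\{(i,j)\in\mathbb Z^2:i\ge0\text{ or }j\ge0\}$. The generating function of those walks ending in the first quadrant ($i\ge0$ and $j\ge0$) (resp. at a negative abscissa $i<0$) is $$\frac13Q(x,y)+P(x,y),\qquad\Big(\text{resp. }-\frac13\,\bar x^2Q(\bar x,y)+\bar xM(\bar x,y)\Big),$$ where $M(x,y)$ and $P(x,y)$ (series in $t$ with coefficients in $\mathbb Q[x,y]$) are algebraic series of degree $72$ over $\mathbb Q(x,y,t)$. More precisely, $P$ can be expressed in terms of $M$ by $$P(x,y)=\bar x\big(M(x,y)-M(0,y)\big)+\bar y\big(M(y,x)-M(0,x)\big),$$ $M$ satisfies the functional equation $$\begin{aligned}\big(1-t(x+\bar x)(y+\bar y)\big)\big(2M(x,y)-M(0,y)\big)=\;&\frac{2x}3-2t\bar y(x+\bar x)M(x,0)\\&+t(x-\bar x)(y+\bar y)M(0,y)+t(1+\bar y^2)M(y,0)-t\bar yM_{1,0},\end{aligned}$$ where $M_{1,0}$ is the coefficient of $x^1y^0$ in $M(x,y)$, and the specializations $M(x,0)$ and $M(0,y)$ have respective degrees $24$ and $12$ over $\mathbb Q(t,x)$ and $\mathbb Q(t,y)$. Moreover, these algebraic series admit rational parametrizations. Let $T$ be the unique series in $t$ with constant term $1$ satisfying $T=1+256\,t^2\frac{T^3}{(T+3)^3}$, let $Z=\sqrt T$, and let $V$ be the only series in $t$, with constant term $0$ (and coefficients in $\mathbb Q[x]$),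 satisfying $$1-T+3V+VT=xV^2(3+V+T-VT).$$ Then the series $\sqrt x\,M(\sqrt x,0)$ and $t\sqrt x\,M(0,\sqrt x)$ (both even series in $t$ with polynomial coefficients in $x$) admit rational expressions in terms of $Z$ and $V$, given (with $T=Z^2$; note that $t^2$ and $x$ are rational in $Z$ and $V$ by the defining equations) by $$\frac{t^2}{\sqrt x}M(\sqrt x,0)=\frac{V(VT-T-V-3)N(Z,V)}{48Z^3(V+1)^2(VZ-V-Z-1)^2},$$ $$t\sqrt x\,M(0,\sqrt x)=\frac{(TV-T+3V+1)(-TV^2-2TV+V^2+T+2V+3)}{2(V+1)(T^2V^2-2T^2V+2TV^2+T^2-3V^2+2T-6V-3)},$$ where $$\begin{aligned}N(z,v)=&-(z^2+3)(z-1)^2v^3+(z-1)(3z^3+9z^2+z+11)v^2\\&+(z+1)(3z^3-9z^2+z-11)v-(z^2+3)(z+1)^2.\end{aligned}$$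
   Context: Notation: $\bar x=1/x$, $\bar y=1/y$. A walk is confined to a set if all its vertices lie in it. The generating function of a family of walks is $\sum t^nx^iy^j$ over the walks in the family, where $n$ is the length and $(i,j)$ the endpoint. $Q(x,y)$ (dependence on $t$ omitted) is the generating function of walks with steps $(\pm1,\pm1)$ starting at $(0,0)$ and confined to $\{(i,j):i\ge0,\ j\ge0\}$: $$Q(x,y)=\sum_{i,j,n\ge0}\frac{(i+1)(j+1)}{\left(1+\frac{n+i}2\right)\left(1+\frac{n+j}2\right)}\binom n{\frac{n+i}2}\binom n{\frac{n+j}2}x^iy^jt^n,$$ the sum being restricted to $i,j,n$ having the same parity. "Algebraic of degree $d$" over a field means algebraic with minimal polynomial of degree $d$ over that field. *)

theory Defs
  imports "HOL-Computational_Algebra.Computational_Algebra"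
begin

text \<open>
  A walk is given by the list of its vertices; its length is one less than that of the list.
\<close>

definition diagonal_walks :: "(int \<times> int) set \<Rightarrow> (int \<times> int) list set" where
  "diagonal_walks C = {w. w \<noteq> [] \<and> hd w = (0, 0) \<and> set w \<subseteq> C \<and>
     successively (\<lambda>p q. (fst q - fst p, snd q - snd p) \<in> {-1, 1} \<times> {-1, 1}) w}"

definition quadrant :: "(int \<times> int) set" where
  "quadrant = {(i, j). i \<ge> 0 \<and> j \<ge> 0}"

definition three_quadrants :: "(int \<times> int) set" where
  "three_quadrants = {(i, j). i \<ge> 0 \<or> j \<ge> 0}"

text \<open>
  The generating function of a family of walks is a series in \<open>t = fls_X\<close>; the variables marking
  the end point are specialized to elements \<open>a\<close>, \<open>b\<close> of a field. Coordinates of end points may be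
  negative, hence the integer powers.
\<close>

definition walk_gf :: "(int \<times> int) list set \<Rightarrow> 'a::field \<Rightarrow> 'a \<Rightarrow> 'a fls" where
  "walk_gf F a b = fps_to_fls (Abs_fps (\<lambda>n.
     \<Sum>w | w \<in> F \<and> length w = Suc n. (a powi fst (last w)) * (b powi snd (last w))))"

definition Q_gf :: "'a::field \<Rightarrow> 'a \<Rightarrow> 'a fls" where
  "Q_gf a b = walk_gf (diagonal_walks quadrant) a b"

text \<open>
  The field \<open>\<rat>(x,y)\<close>. In \<open>rat poly poly\<close> the inner variable is \<open>x\<close> and the outer one is \<open>y\<close>.
\<close>

type_synonym ratfun = "rat poly poly fract"

definition indet_x :: ratfun where "indet_x = Fract [:[:0, 1:]:] 1"
definition indet_y :: ratfun where "indet_y = Fract [:0, 1:] 1"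

text \<open>
  Coefficientwise specialization of series in \<open>t\<close> with coefficients in \<open>\<rat>[x,y]\<close>, \<open>\<rat>[x]\<close>
  and \<open>\<rat>\<close>: for example, \<open>eval2 F a b\<close> is \<open>F(a,b)\<close>.
\<close>

definition eval2 :: "rat poly poly fps \<Rightarrow> 'a::field_char_0 \<Rightarrow> 'a \<Rightarrow> 'a fls" where
  "eval2 F a b = fps_to_fls (Abs_fps (\<lambda>n.
     poly (map_poly (\<lambda>c. poly (map_poly of_rat c) a) (fps_nth F n)) b))"

definition eval1 :: "rat poly fps \<Rightarrow> 'a::field_char_0 \<Rightarrow> 'a fls" where
  "eval1 F a = fps_to_fls (Abs_fps (\<lambda>n. poly (map_poly of_rat (fps_nth F n)) a))"

definition eval0 :: "rat fps \<Rightarrow> 'a::field_char_0 fls" where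
  "eval0 F = fps_to_fls (Abs_fps (\<lambda>n. of_rat (fps_nth F n)))"

definition coeff_series :: "rat poly poly fps \<Rightarrow> nat \<Rightarrow> nat \<Rightarrow> rat fps" where
  "coeff_series F i j = Abs_fps (\<lambda>n. coeff (coeff (fps_nth F n) j) i)"

text \<open>
  The subfield generated by a set. In characteristic zero it contains \<open>\<rat>\<close>, so it is \<open>\<rat>(S)\<close>.
\<close>

inductive_set gen_field :: "'a::field set \<Rightarrow> 'a set" for S where
  incl: "a \<in> S \<Longrightarrow> a \<in> gen_field S"
| one: "1 \<in> gen_field S"
| diff: "a \<in> gen_field S \<Longrightarrow> b \<in> gen_field S \<Longrightarrow> a - b \<in> gen_field S"
| mult: "a \<in> gen_field S \<Longrightarrow> b \<in> gen_field S \<Longrightarrow> a * b \<in> gen_field S"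
| inverse: "a \<in> gen_field S \<Longrightarrow> inverse a \<in> gen_field S"

definition minimal_polynomial :: "'a::field set \<Rightarrow> 'a \<Rightarrow> 'a poly \<Rightarrow> bool" where
  "minimal_polynomial K a p \<longleftrightarrow>
     lead_coeff p = 1 \<and> set (coeffs p) \<subseteq> K \<and> poly p a = 0 \<and>
     (\<forall>q. q \<noteq> 0 \<and> set (coeffs q) \<subseteq> K \<and> poly q a = 0 \<longrightarrow> degree p \<le> degree q)"

definition algebraic_of_degree :: "'a::field set \<Rightarrow> 'a \<Rightarrow> nat \<Rightarrow> bool" where
  "algebraic_of_degree K a d \<longleftrightarrow> (\<exists>p. minimal_polynomial K a p \<and> degree p = d)"

definition is_T :: "rat fps \<Rightarrow> bool" where
  "is_T T \<longleftrightarrow> fps_nth T 0 = 1 \<and> T = 1 + 256 * fps_X ^ 2 * (T ^ 3 / (T + 3) ^ 3)"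

text \<open>The constant term \<open>1\<close> selects the branch of the square root.\<close>

definition is_sqrt :: "rat fps \<Rightarrow> rat fps \<Rightarrow> bool" where
  "is_sqrt T Z \<longleftrightarrow> fps_nth Z 0 = 1 \<and> Z ^ 2 = T"

definition is_V :: "rat fps \<Rightarrow> rat poly fps \<Rightarrow> bool" where
  "is_V T V \<longleftrightarrow> fps_nth V 0 = 0 \<and>
     (let T' = Abs_fps (\<lambda>n. [:fps_nth T n:]); x = fps_const [:0, 1:]
      in 1 - T' + 3 * V + V * T' = x * V ^ 2 * (3 + V + T' - V * T'))"

definition N_poly :: "'a::comm_ring_1 \<Rightarrow> 'a \<Rightarrow> 'a" where
  "N_poly z v =
     - (z^2 + 3) * (z - 1)^2 * v^3
     + (z - 1) * (3*z^3 + 9*z^2 + z + 11) * v^2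
     + (z + 1) * (3*z^3 - 9*z^2 + z - 11) * v
     - (z^2 + 3) * (z + 1)^2"

end

theory Submission
  imports Defs "Berlekamp_Zassenhaus.Finite_Field"
begin

text \<open>
  The number of walks in the three-quadrant cone, antisymmetrized under the reflections
  \<open>i \<mapsto> -2-i\<close> and \<open>j \<mapsto> -2-j\<close>, obeys the recurrence and the boundary conditions of the quadrant
  walks (\<open>cone_count_orbit_sum\<close>). This expresses the walks that end in the first quadrant
  by those that end at a negative coordinate. Adding a third of the quadrant series to each of the
  two reflected parts splits the quadrant series evenly among them and the first quadrant; what is
  left are \<open>M\<close> and \<open>P\<close>, and the recurrence for the cone becomes a functional equation for \<open>M\<close>
  alone (\<open>M_ser_functional_equation\<close>).

  The unknowns in this equation are \<open>A(x) = M(x,0)\<close> and \<open>B(y) = M(0,y)\<close>. Let \<open>Y\<close> be the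
  series with \<open>Y = t (a + 1/a) (1 + Y\<^sup>2)\<close>. The kernel vanishes at \<open>(a,Y)\<close> and at \<open>(1/a,Y)\<close>; the
  sum and the difference of the two resulting equations relate \<open>A(Y)\<close>, respectively \<open>B(Y)\<close>, to \<open>A(a)\<close>
  and \<open>A(1/a)\<close> (\<open>kernel_sum\<close>, \<open>kernel_difference\<close>). The first relation determines \<open>A\<close>, because
  the lowest coefficient in \<open>t\<close> of a solution of its homogeneous form is a polynomial \<open>p\<close> with
  \<open>p(a) + p(1/a) = 0\<close> and \<open>p(0) = 0\<close>, hence zero (\<open>homogeneous_zero\<close>); the second then determines \<open>B\<close>.
  It remains to verify that the closed forms satisfy these relations. In the coordinate \<open>m = (1-V)/(1+V)\<close>
  the equation of \<open>V\<close> becomes \<open>2e (1 - T m\<^sup>2) = m (3 - T - (1+T) m\<^sup>2)\<close> with \<open>e = (x-1)/(x+1)\<close>. As \<open>e\<close>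
  changes sign under \<open>x \<mapsto> 1/x\<close>, the value \<open>m1\<close> of \<open>m\<close> at \<open>a\<^sup>2\<close> and minus its value \<open>m2\<close> at \<open>1/a\<^sup>2\<close>
  are roots of one cubic. Its third root \<open>r\<close> expresses \<open>m1 - m2\<close> and \<open>m1 m2\<close> rationally, and the kernel
  equation links \<open>r\<^sup>2\<close> to the square of the value \<open>m3\<close> of \<open>m\<close> at \<open>Y\<^sup>2\<close> by a Moebius transformation
  (\<open>kernel_mobius\<close>). Up to elementary terms the closed form of \<open>A\<close> is a function \<open>h\<close> of \<open>m\<^sup>2\<close>
  with \<open>h(m3\<^sup>2) = h(m1\<^sup>2) + h(m2\<^sup>2)\<close> (\<open>kernel_h_additive\<close>), and that of \<open>B\<close> comes from
  the corresponding difference (\<open>kernel_h_difference\<close>).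

  The degrees are at most the asserted ones since \<open>Z\<close> satisfies an equation of degree 8 over \<open>\<rat>(t)\<close>, and
  \<open>V(x\<^sup>2)\<close> and \<open>V(y\<^sup>2)\<close> satisfy cubic equations over \<open>\<rat>(T,x)\<close> and \<open>\<rat>(T,y)\<close>. For
  the lower bounds, reduce modulo the prime 571: at \<open>(t,x,y) = (218, 253, 73)\<close> these equations have
  \<open>8 \<sqdot> 3 \<sqdot> 3\<close> distinct simple solutions, and \<open>M\<close> and \<open>P\<close> take 72 distinct values there. The solutions
  lift to power series in the offsets from this point. Now \<open>Z\<close>, \<open>V(x\<^sup>2)\<close>, \<open>V(y\<^sup>2)\<close> are algebraically
  independent (\<open>parameters_independent\<close>), and \<open>t\<close>, \<open>x\<close>, \<open>y\<close> are square roots of rational functions of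
  them, each of which has an automorphism that changes its sign and fixes everything else. Hence every
  polynomial relation among the six quantities survives at each lifted solution
  (\<open>adjoin_square_root\<close>). A polynomial over \<open>\<int>[t,x,y]\<close> that annihilates \<open>M\<close>, cleared of factors 571,
  becomes a nonzero polynomial with 72 distinct roots (\<open>degree_at_least_values\<close>).
\<close>

section \<open>Homomorphisms on power series\<close>


lemma poly_eval_hom:
  assumes "comm_ring_hom h"
  shows "comm_ring_hom (\<lambda>p. poly (map_poly h p) a)"
proof -
  interpret h: comm_ring_hom h by fact
  interpret m: map_poly_comm_ring_hom h ..
  show ?thesis by unfold_locales (simp_all add: m.hom_add m.hom_mult)
qed

lemma comp_ring_hom:
  assumes "comm_ring_hom f" and "comm_ring_hom g"
  shows "comm_ring_hom (\<lambda>x. f (g x))"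
proof -
  interpret f: comm_ring_hom f by fact
  interpret g: comm_ring_hom g by fact
  show ?thesis by unfold_locales (simp_all add: f.hom_add f.hom_mult g.hom_add g.hom_mult)
qed

lemma fps_const_hom: "comm_ring_hom (fps_const :: 'a::comm_ring_1 \<Rightarrow> 'a fps)"
  by unfold_locales (simp_all add: fps_const_add[symmetric] fps_const_mult[symmetric] del: fps_const_add fps_const_mult)

lemma fps_to_fls_hom: "comm_ring_hom (fps_to_fls :: 'a::comm_ring_1 fps \<Rightarrow> 'a fls)"
  by unfold_locales (simp_all add: fls_times_fps_to_fls)

lemma fps_nth_0_hom: "comm_ring_hom (\<lambda>F :: 'a::comm_ring_1 fps. fps_nth F 0)"
  by unfold_locales simp_all

text \<open>Substituting power series for the variables in the coefficients of a series in \<open>t\<close>: the coefficient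
  of \<open>t\<^sup>k\<close> is mapped by \<open>\<phi>\<close> to a series in \<open>t\<close>, and the sum over \<open>k\<close> converges because of the factor \<open>t\<^sup>k\<close>.\<close>

definition series_eval :: "('a::comm_ring_1 \<Rightarrow> 'b::comm_ring_1 fps) \<Rightarrow> 'a fps \<Rightarrow> 'b fps" where
  "series_eval \<phi> F = Abs_fps (\<lambda>n. \<Sum>k\<le>n. fps_nth (\<phi> (fps_nth F k)) (n - k))"

lemma series_eval_nth:
  "fps_nth (series_eval \<phi> F) n = (\<Sum>k\<le>n. fps_nth (\<phi> (fps_nth F k)) (n - k))"
  by (simp add: series_eval_def)

lemma series_eval_hom:
  assumes "comm_ring_hom \<phi>"
  shows "comm_ring_hom (series_eval \<phi>)"
proof -
  interpret \<phi>: comm_ring_hom \<phi> by fact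
  have mult: "series_eval \<phi> (F * G) = series_eval \<phi> F * series_eval \<phi> G" for F G
  proof (rule fps_ext)
    fix n
    let ?f = "\<lambda>i. \<phi> (fps_nth F i)" and ?g = "\<lambda>i. \<phi> (fps_nth G i)"
    have "fps_nth (series_eval \<phi> (F * G)) n
        = (\<Sum>k\<le>n. \<Sum>i\<le>k. \<Sum>j\<le>n-k. fps_nth (?f i) j * fps_nth (?g (k - i)) (n - k - j))"
      by (simp add: series_eval_nth fps_mult_nth \<phi>.hom_sum \<phi>.hom_mult fps_sum_nth atLeast0AtMost)
    also have "\<dots> = (\<Sum>(k,i,j)\<in>(SIGMA k:{..n}. SIGMA i:{..k}. {..n-k}).
        fps_nth (?f i) j * fps_nth (?g (k - i)) (n - k - j))"
      by (simp add: sum.Sigma)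
    also have "\<dots> = (\<Sum>(l,i,i')\<in>(SIGMA l:{..n}. SIGMA i:{..l}. {..n-l}).
        fps_nth (?f i) (l - i) * fps_nth (?g i') (n - l - i'))"
      by (rule sum.reindex_bij_witness[where i = "\<lambda>(l,i,i'). (i + i', i, l - i)" and
            j = "\<lambda>(k,i,j). (i + j, i, k - i)"]) (auto simp: add.commute)
    also have "\<dots> = (\<Sum>l\<le>n. \<Sum>i\<le>l. \<Sum>i'\<le>n-l. fps_nth (?f i) (l - i) * fps_nth (?g i') (n - l - i'))"
      by (simp add: sum.Sigma)
    also have "\<dots> = fps_nth (series_eval \<phi> F * series_eval \<phi> G) n"
      by (simp add: series_eval_nth fps_mult_nth sum_product atLeast0AtMost)
    finally show "fps_nth (series_eval \<phi> (F * G)) n = fps_nth (series_eval \<phi> F * series_eval \<phi> G) n" .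
  qed
  have one: "series_eval \<phi> 1 = 1"
  proof (rule fps_ext)
    fix n
    have "fps_nth (series_eval \<phi> 1) n = (\<Sum>k\<le>n. if k = 0 then fps_nth 1 n else 0)"
      unfolding series_eval_nth by (rule sum.cong) auto
    then show "fps_nth (series_eval \<phi> 1) n = fps_nth 1 n" by simp
  qed
  show ?thesis
    by unfold_locales (auto intro!: fps_ext simp: series_eval_nth \<phi>.hom_add sum.distrib mult one)
qed

lemma series_eval_const:
  assumes "comm_ring_hom \<phi>"
  shows "series_eval \<phi> (fps_const c) = \<phi> c"
proof (rule fps_ext)
  interpret \<phi>: comm_ring_hom \<phi> by fact
  fix n
  have "fps_nth (series_eval \<phi> (fps_const c)) n = (\<Sum>k\<le>n. if k = 0 then fps_nth (\<phi> c) n else 0)"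
    unfolding series_eval_nth by (rule sum.cong) auto
  then show "fps_nth (series_eval \<phi> (fps_const c)) n = fps_nth (\<phi> c) n" by simp
qed

lemma series_eval_X:
  assumes "comm_ring_hom \<phi>"
  shows "series_eval \<phi> fps_X = fps_X"
proof (rule fps_ext)
  interpret \<phi>: comm_ring_hom \<phi> by fact
  fix n
  have "fps_nth (series_eval \<phi> fps_X) n = (\<Sum>k\<le>n. if k = 1 then fps_nth 1 (n - 1) else 0)"
    unfolding series_eval_nth by (rule sum.cong) (auto simp: fps_X_def)
  then show "fps_nth (series_eval \<phi> fps_X) n = fps_nth fps_X n" by (auto simp: fps_X_def)
qed

section \<open>Hensel's lemma\<close>

lemma poly_taylor:
  fixes f :: "'a::idom poly"
  shows "\<exists>h. poly f (v + d) = poly f v + d * poly (pderiv f) v + d^2 * h"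
proof (induction f)
  case 0
  then show ?case by (intro exI[of _ 0]) simp
next
  case (pCons a f)
  then obtain h where h: "poly f (v + d) = poly f v + d * poly (pderiv f) v + d^2 * h" by blast
  show ?case
    by (rule exI[of _ "poly (pderiv f) v + v * h + d * h"])
      (simp only: poly_pCons pderiv_pCons poly_add h, simp add: algebra_simps power2_eq_square)
qed

definition fps_cong :: "nat \<Rightarrow> 'a::comm_ring_1 fps \<Rightarrow> 'a fps \<Rightarrow> bool" where
  "fps_cong n F G \<longleftrightarrow> (\<forall>k<n. fps_nth F k = fps_nth G k)"

lemma fps_cong_iff: "fps_cong n F G \<longleftrightarrow> (\<exists>H. F - G = fps_X^n * H)"
proof
  assume "fps_cong n F G"
  then have "F - G = fps_X^n * fps_shift n (F - G)"
    by (intro fps_ext) (auto simp: fps_cong_def fps_X_power_mult_nth)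
  then show "\<exists>H. F - G = fps_X^n * H" by blast
next
  assume "\<exists>H. F - G = fps_X^n * H"
  then obtain H where "F - G = fps_X^n * H" by blast
  then have "fps_nth (F - G) k = 0" if "k < n" for k
    using that by (simp add: fps_X_power_mult_nth)
  then show "fps_cong n F G" by (simp add: fps_cong_def)
qed

text \<open>The fixed point theorem for the \<open>t\<close>-adic metric: iterates of \<open>\<Phi>\<close> stabilize one more coefficient at
  each step.\<close>

lemma fps_contraction:
  fixes \<Phi> :: "'a::comm_ring_1 fps \<Rightarrow> 'a fps"
  assumes start: "\<And>v. fps_nth v 0 = a \<Longrightarrow> fps_nth (\<Phi> v) 0 = a"
    and contr: "\<And>n v w. n > 0 \<Longrightarrow> fps_nth v 0 = a \<Longrightarrow> fps_nth w 0 = a \<Longrightarrow> fps_cong n v w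
      \<Longrightarrow> fps_cong (Suc n) (\<Phi> v) (\<Phi> w)"
  shows "\<exists>!v. fps_nth v 0 = a \<and> \<Phi> v = v"
proof -
  define s where "s n = (\<Phi> ^^ n) (fps_const a)" for n
  have s0: "fps_nth (s n) 0 = a" for n by (induction n) (auto simp: s_def start)
  have steps: "fps_cong (Suc n) (s n) (s (Suc n))" for n
  proof (induction n)
    case 0
    then show ?case using s0 by (auto simp: fps_cong_def)
  next
    case (Suc n)
    then have "fps_cong (Suc (Suc n)) (\<Phi> (s n)) (\<Phi> (s (Suc n)))" using contr s0 by blast
    then show ?case by (simp add: s_def)
  qed
  have cauchy: "fps_nth (s m) n = fps_nth (s n) n" if "m \<ge> n" for n m
    using that
  proof (induction m rule: dec_induct)
    case (step m)
    have "fps_nth (s m) n = fps_nth (s (Suc m)) n"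
      using step(1) steps[of m] unfolding fps_cong_def by auto
    then show ?case using step(3) by simp
  qed simp
  define v where "v = Abs_fps (\<lambda>n. fps_nth (s n) n)"
  have v0: "fps_nth v 0 = a" by (simp add: v_def s0)
  have vs: "fps_cong (Suc n) v (s n)" for n
    using cauchy[of _ n] unfolding fps_cong_def v_def by simp
  have "fps_nth (\<Phi> v) n = fps_nth v n" for n
  proof -
    have "fps_cong (Suc (Suc n)) (\<Phi> v) (\<Phi> (s n))" using contr[OF _ v0 s0 vs] by blast
    then have "fps_nth (\<Phi> v) n = fps_nth (s (Suc n)) n" by (simp add: fps_cong_def s_def)
    then show ?thesis using cauchy[of n "Suc n"] unfolding v_def by simp
  qed
  then have "\<Phi> v = v" by (rule fps_ext)
  moreover have "w = v" if "fps_nth w 0 = a" "\<Phi> w = w" for w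
  proof -
    have "fps_cong (Suc n) w v" for n
    proof (induction n)
      case 0
      then show ?case using that v0 by (auto simp: fps_cong_def)
    next
      case (Suc n)
      then have "fps_cong (Suc (Suc n)) (\<Phi> w) (\<Phi> v)" using contr that v0 by blast
      then show ?case using that \<open>\<Phi> v = v\<close> by simp
    qed
    then show ?thesis by (intro fps_ext) (auto simp: fps_cong_def)
  qed
  ultimately show ?thesis using v0 by blast
qed

text \<open>Newton's iteration with the derivative frozen at the approximate root is a contraction, so
  only an inverse \<open>w\<close> of the constant term of the derivative is required of the ground ring.\<close>

lemma hensel:
  fixes f :: "'a::idom fps poly"
  assumes root: "fps_nth (poly f (fps_const a)) 0 = 0"
    and unit: "fps_nth (poly (pderiv f) (fps_const a)) 0 * w = 1"
  shows "\<exists>!v. fps_nth v 0 = a \<and> poly f v = 0"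
proof -
  have c0: "fps_nth (poly g v) 0 = fps_nth (poly g (fps_const a)) 0" if "fps_nth v 0 = a" for g v
    by (induction g) (auto simp: that)
  define \<Phi> where "\<Phi> v = v - fps_const w * poly f v" for v
  have "\<exists>!v. fps_nth v 0 = a \<and> \<Phi> v = v"
  proof (rule fps_contraction)
    fix v :: "'a fps" assume "fps_nth v 0 = a"
    then show "fps_nth (\<Phi> v) 0 = a" by (simp add: \<Phi>_def c0 root)
  next
    fix n and v u :: "'a fps"
    assume n: "n > 0" and v: "fps_nth v 0 = a" and u: "fps_nth u 0 = a" and c: "fps_cong n v u"
    obtain d where "v - u = fps_X^n * d" using c by (auto simp: fps_cong_iff)
    then have d: "v = u + fps_X^n * d" by (simp add: algebra_simps)
    obtain h where h: "poly f v = poly f u + fps_X^n * d * poly (pderiv f) u + (fps_X^n * d)^2 * h"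
      using poly_taylor[of f u "fps_X^n * d"] d by auto
    define e where "e = 1 - fps_const w * poly (pderiv f) u"
    have "fps_nth e 0 = 0" using unit by (simp add: e_def c0[OF u] mult.commute)
    then have "fps_cong 1 e 0" by (simp add: fps_cong_def)
    then obtain e' where e': "e = fps_X * e'" by (auto simp: fps_cong_iff)
    obtain k where k: "n = Suc k" using n by (cases n) auto
    have "\<Phi> v - \<Phi> u = fps_X^n * d * e - fps_const w * ((fps_X^n * d)^2 * h)"
      unfolding \<Phi>_def e_def h using d by (simp add: algebra_simps)
    also have "\<dots> = fps_X^Suc n * (d * e' - fps_const w * (fps_X^k * d^2 * h))"
      by (simp add: e' k algebra_simps power2_eq_square)
    finally show "fps_cong (Suc n) (\<Phi> v) (\<Phi> u)" unfolding fps_cong_iff by blast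
  qed
  moreover have "fps_nth v 0 = a \<and> \<Phi> v = v \<longleftrightarrow> fps_nth v 0 = a \<and> poly f v = 0" for v
  proof -
    have "poly f v = 0" if "\<Phi> v = v"
    proof -
      let ?u = "fps_nth (poly (pderiv f) (fps_const a)) 0"
      have "poly f v = fps_const (?u * w) * poly f v" by (simp only: unit) simp
      also have "\<dots> = fps_const ?u * (fps_const w * poly f v)"
        by (simp only: fps_const_mult[symmetric] mult.assoc)
      also have "fps_const w * poly f v = 0" using that by (simp add: \<Phi>_def)
      finally show ?thesis by simp
    qed
    then show ?thesis by (auto simp: \<Phi>_def)
  qed
  ultimately show ?thesis by simp
qed

hide_const (open) up_ring.monom up_ring.coeff module.smult

section \<open>Counting walks\<close>

definition walks_to :: "(int \<times> int) set \<Rightarrow> nat \<Rightarrow> int \<times> int \<Rightarrow> (int \<times> int) list set" where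
  "walks_to C n p = {w \<in> diagonal_walks C. length w = Suc n \<and> last w = p}"

lemma walks_to_0:
  "walks_to C 0 p = (if p = (0, 0) \<and> p \<in> C then {[(0, 0)]} else {})"
  by (auto simp: walks_to_def diagonal_walks_def length_Suc_conv)

text \<open>A walk is decomposed at its last step, so that the confinement has to be checked only at the end
  point.\<close>

lemma walks_to_Suc:
  "walks_to C (Suc n) (i, j) = (if (i, j) \<in> C
     then (\<lambda>w. w @ [(i, j)]) ` (\<Union>s \<in> {-1, 1} \<times> {-1, 1}. walks_to C n (i - fst s, j - snd s)) else {})"
  (is "?L = ?R")
proof (intro subset_antisym subsetI)
  fix w assume w: "w \<in> ?L"
  then have len: "length w = Suc (Suc n)" and l: "last w = (i, j)"
    by (auto simp: walks_to_def)
  define v where "v = butlast w"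
  have wv: "w = v @ [(i, j)]" using l len by (metis append_butlast_last_id length_0_conv nat.distinct(1) v_def)
  have v: "v \<noteq> []" "length v = Suc n" using len wv by auto
  have step: "(i - fst (last v), j - snd (last v)) \<in> {-1, 1} \<times> {-1, 1}"
    and vw: "v \<in> diagonal_walks C" and c: "(i, j) \<in> C"
    using w v by (auto simp: walks_to_def diagonal_walks_def wv successively_append_iff)
  have "v \<in> walks_to C n (i - (i - fst (last v)), j - (j - snd (last v)))"
    using vw v by (simp add: walks_to_def)
  then have "v \<in> (\<Union>s \<in> {-1, 1} \<times> {-1, 1}. walks_to C n (i - fst s, j - snd s))"
    using step by (intro UN_I[OF step]) simp
  then show "w \<in> ?R" using wv c by simp
next
  fix w assume w: "w \<in> ?R"
  then have c: "(i, j) \<in> C" by (auto split: if_splits)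
  from w c obtain v s where v: "v \<in> walks_to C n (i - fst s, j - snd s)" and s: "s \<in> {-1, 1} \<times> {-1, 1}"
    and wv: "w = v @ [(i, j)]" by (simp only: if_True) (elim imageE UN_E)
  have "(i - (i - fst s), j - (j - snd s)) \<in> {-1, 1} \<times> {-1, 1}" using s by auto
  then show "w \<in> ?L" using c v wv
    by (auto simp: walks_to_def diagonal_walks_def successively_append_iff)
qed

lemma finite_walks_to: "finite (walks_to C n p)"
proof (induction n arbitrary: p)
  case (Suc n)
  then show ?case by (cases p) (auto simp: walks_to_Suc)
qed (auto simp: walks_to_0)

primrec walk_count :: "(int \<times> int) set \<Rightarrow> nat \<Rightarrow> int \<Rightarrow> int \<Rightarrow> rat" where
  "walk_count C 0 i j = (if i = 0 \<and> j = 0 \<and> (0, 0) \<in> C then 1 else 0)"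
| "walk_count C (Suc n) i j = (if (i, j) \<in> C then
     walk_count C n (i - 1) (j - 1) + walk_count C n (i - 1) (j + 1)
     + walk_count C n (i + 1) (j - 1) + walk_count C n (i + 1) (j + 1) else 0)"

lemma card_walks_to: "of_nat (card (walks_to C n (i, j))) = walk_count C n i j"
proof (induction n arbitrary: i j)
  case 0
  then show ?case by (auto simp: walks_to_0)
next
  case (Suc n)
  let ?U = "\<Union>s \<in> {-1, 1} \<times> {-1, 1}. walks_to C n (i - fst s, j - snd s)"
  show ?case
  proof (cases "(i, j) \<in> C")
    case True
    have "card (walks_to C (Suc n) (i, j)) = card ?U"
      using True by (simp add: walks_to_Suc card_image inj_on_def del: UN_insert UN_simps)
    also have "\<dots> = (\<Sum>s \<in> {-1, 1} \<times> {-1, 1}. card (walks_to C n (i - fst s, j - snd s)))"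
      by (rule card_UN_disjoint) (simp_all add: finite_walks_to, auto simp: walks_to_def)
    also have "\<dots> = (\<Sum>a \<in> {-1, 1}. \<Sum>b \<in> {-1, 1}. card (walks_to C n (i - a, j - b)))"
      by (simp add: sum.cartesian_product case_prod_unfold del: sum.insert)
    finally show ?thesis using True by (simp add: Suc algebra_simps)
  qed (simp add: walks_to_Suc)
qed

lemma walk_count_outside: "(i, j) \<notin> C \<Longrightarrow> walk_count C n i j = 0"
  by (cases n) auto

lemma walk_count_bounded: "walk_count C n i j \<noteq> 0 \<Longrightarrow> \<bar>i\<bar> \<le> int n \<and> \<bar>j\<bar> \<le> int n"
proof (induction n arbitrary: i j)
  case (Suc n)
  from Suc.prems have "walk_count C n (i - 1) (j - 1) \<noteq> 0 \<or> walk_count C n (i - 1) (j + 1) \<noteq> 0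
      \<or> walk_count C n (i + 1) (j - 1) \<noteq> 0 \<or> walk_count C n (i + 1) (j + 1) \<noteq> 0"
    by (auto split: if_splits)
  then show ?case by (elim disjE) (drule Suc.IH, erule conjE, rule conjI, linarith, linarith)+
qed (auto split: if_splits)

lemma walk_count_parity:
  "walk_count C n i j \<noteq> 0 \<Longrightarrow> even (i - int n) \<and> even (j - int n)"
proof (induction n arbitrary: i j)
  case (Suc n)
  from Suc.prems have "walk_count C n (i - 1) (j - 1) \<noteq> 0 \<or> walk_count C n (i - 1) (j + 1) \<noteq> 0
      \<or> walk_count C n (i + 1) (j - 1) \<noteq> 0 \<or> walk_count C n (i + 1) (j + 1) \<noteq> 0"
    by (auto split: if_splits)
  then show ?case by (elim disjE) (drule Suc.IH, simp only: of_nat_Suc, presburger)+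
qed (auto split: if_splits)

lemma walk_count_commute:
  assumes "\<And>i j. (i, j) \<in> C \<longleftrightarrow> (j, i) \<in> C"
  shows "walk_count C n i j = walk_count C n j i"
proof (induction n arbitrary: i j)
  case (Suc n)
  show ?case
    unfolding walk_count.simps assms[of i j] Suc[of "i-1" "j-1"] Suc[of "i-1" "j+1"]
      Suc[of "i+1" "j-1"] Suc[of "i+1" "j+1"] by simp
qed auto

abbreviation "cone_count \<equiv> walk_count three_quadrants"
abbreviation "quad_count \<equiv> walk_count quadrant"

lemma cone_count_commute: "cone_count n i j = cone_count n j i"
  by (rule walk_count_commute) (auto simp: three_quadrants_def)

lemma cone_count_0: "i < 0 \<Longrightarrow> j < 0 \<Longrightarrow> cone_count n i j = 0"
  by (rule walk_count_outside) (auto simp: three_quadrants_def)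

lemma quad_count_0: "i < 0 \<or> j < 0 \<Longrightarrow> quad_count n i j = 0"
  by (rule walk_count_outside) (auto simp: quadrant_def)

text \<open>Both sides vanish on the lines \<open>i = -1\<close> and \<open>j = -1\<close>, which the reflections fix. At a point of the
  quadrant all steps into the point and into its first two mirror images are allowed in the cone, while
  the third image lies outside; the recurrences therefore agree as well.\<close>

lemma cone_count_orbit_sum:
  assumes "i \<ge> -1" and "j \<ge> -1"
  shows "cone_count n i j - cone_count n (-2-i) j - cone_count n i (-2-j) + cone_count n (-2-i) (-2-j)
    = quad_count n i j"
  using assms
proof (induction n arbitrary: i j)
  case 0
  then show ?case by (auto simp: three_quadrants_def quadrant_def)
next
  case (Suc n)
  consider "i = -1" | "j = -1" | "i \<ge> 0" "j \<ge> 0" using Suc.prems by linarith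
  then show ?case
  proof cases
    case 1
    then show ?thesis by (simp add: quad_count_0 del: walk_count.simps)
  next
    case 2
    then show ?thesis by (simp add: quad_count_0 del: walk_count.simps)
  next
    case 3
    then have c: "(i, j) \<in> quadrant" "(i, j) \<in> three_quadrants" "(-2-i, j) \<in> three_quadrants"
      "(i, -2-j) \<in> three_quadrants" "(-2-i, -2-j) \<notin> three_quadrants"
      by (auto simp: quadrant_def three_quadrants_def)
    have z: "cone_count n a b = 0" if "a \<le> -1" "b \<le> -1" for a b
      using cone_count_0[of a b n] that by auto
    note F = Suc.IH[of "i-1" "j-1"] Suc.IH[of "i-1" "j+1"] Suc.IH[of "i+1" "j-1"] Suc.IH[of "i+1" "j+1"]
    have e: "-2-(i-1) = -2-i+1" "-2-(i+1) = -2-i-1" "-2-(j-1) = -2-j+1" "-2-(j+1) = -2-j-1"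
      by auto
    have "cone_count n (-2-i+1) (-2-j+1) = 0" "cone_count n (-2-i+1) (-2-j-1) = 0"
      "cone_count n (-2-i-1) (-2-j+1) = 0" "cone_count n (-2-i-1) (-2-j-1) = 0"
      using 3 by (auto intro!: z)
    then show ?thesis using F 3 c unfolding e walk_count.simps
      by simp
  qed
qed

lemma cone_count_reflect:
  assumes "i \<ge> 0" and "j \<ge> 0"
  shows "cone_count n i j = quad_count n i j + cone_count n (-2-i) j + cone_count n (-2-j) i"
  using cone_count_orbit_sum[of i j n] assms cone_count_0[of "-2-i" "-2-j" n]
  by (simp add: cone_count_commute[of n i "-2-j"])

section \<open>The coefficients of \<open>M\<close>\<close>

text \<open>Here \<open>k = -1 - i\<close> for an end point of abscissa \<open>i < 0\<close>, whose reflection is \<open>-2 - i = k - 1\<close>.\<close>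

definition M_coeff :: "nat \<Rightarrow> int \<Rightarrow> int \<Rightarrow> rat" where
  "M_coeff n k j = (if k < 0 \<or> j < 0 then 0
     else cone_count n (-1-k) j + quad_count n (k-1) j / 3)"

definition P_coeff :: "nat \<Rightarrow> int \<Rightarrow> int \<Rightarrow> rat" where
  "P_coeff n i j = (if i < 0 \<or> j < 0 then 0 else cone_count n i j - quad_count n i j / 3)"

lemma M_coeff_bounded:
  assumes "M_coeff n k j \<noteq> 0"
  shows "k \<le> int n + 1 \<and> j \<le> int n"
proof -
  have "cone_count n (-1-k) j \<noteq> 0 \<or> quad_count n (k-1) j \<noteq> 0"
    using assms by (auto simp: M_coeff_def split: if_splits)
  then show ?thesis by (elim disjE) (drule walk_count_bounded, erule conjE, rule conjI, linarith, linarith)+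
qed

lemma P_coeff_bounded:
  assumes "P_coeff n i j \<noteq> 0"
  shows "i \<le> int n \<and> j \<le> int n"
proof -
  have "cone_count n i j \<noteq> 0 \<or> quad_count n i j \<noteq> 0"
    using assms by (auto simp: P_coeff_def split: if_splits)
  then show ?thesis by (elim disjE) (drule walk_count_bounded, erule conjE, rule conjI, linarith, linarith)+
qed

lemma M_coeff_parity: "M_coeff n k j \<noteq> 0 \<Longrightarrow> odd (k - int n) \<and> even (j - int n)"
proof -
  assume "M_coeff n k j \<noteq> 0"
  then have "cone_count n (-1-k) j \<noteq> 0 \<or> quad_count n (k-1) j \<noteq> 0"
    by (auto simp: M_coeff_def split: if_splits)
  then show ?thesis
    by (elim disjE) (drule walk_count_parity, presburger)+
qed

text \<open>The reflection identity, with the quadrant walks distributed evenly over its three terms.\<close>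

lemma P_coeff_eq:
  assumes "i \<ge> 0" and "j \<ge> 0"
  shows "P_coeff n i j = M_coeff n (i + 1) j + M_coeff n (j + 1) i"
proof -
  have "quad_count n j i = quad_count n i j" by (rule walk_count_commute) (auto simp: quadrant_def)
  moreover have "-1 - (i + 1) = -2 - i" "-1 - (j + 1) = -2 - j" by auto
  ultimately show ?thesis using assms cone_count_reflect[of i j n]
    unfolding P_coeff_def M_coeff_def by simp
qed

lemma M_coeff_00: "M_coeff n 0 0 = 0"
  using M_coeff_parity[of n 0 0] by fastforce

lemma M_coeff_step_positive:
  assumes "k \<ge> 1" and "j \<ge> 0"
  shows "M_coeff (Suc n) k j = M_coeff n (k-1) (j-1) + M_coeff n (k-1) (j+1)
    + M_coeff n (k+1) (j-1) + M_coeff n (k+1) (j+1)"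
proof -
  have c: "(-1-k, j) \<in> three_quadrants" "(k-1, j) \<in> quadrant"
    using assms by (auto simp: three_quadrants_def quadrant_def)
  have e: "-1-k-1 = -1-(k+1)" "-1-k+1 = -1-(k-1)" by auto
  have "M_coeff n a i = cone_count n (-1-a) i + quad_count n (a-1) i / 3"
    if "a \<ge> 0" "i \<ge> -1" for a i
    using that by (cases "i = -1") (auto simp: M_coeff_def quad_count_0 cone_count_0)
  then show ?thesis using assms c
    unfolding M_coeff_def[of "Suc n"] walk_count.simps e by (simp add: add_divide_distrib)
qed

text \<open>For \<open>k = 0\<close>, that is for end points on the line \<open>i = -1\<close>, half of the predecessors have abscissa
  \<open>0\<close>. Those are not counted by \<open>M\<close> and are replaced by means of the reflection identity.\<close>

lemma M_coeff_step_zero: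
  assumes "j \<ge> 0"
  shows "M_coeff (Suc n) 0 j = 2 * M_coeff n 1 (j-1) + 2 * M_coeff n 1 (j+1)
    + M_coeff n (j+2) 0 + M_coeff n j 0"
proof (cases "j = 0")
  case True
  have "M_coeff (Suc n) 0 0 = 0" "M_coeff n 0 0 = 0" "M_coeff n 1 (-1) = 0"
    using M_coeff_00 by (auto simp: M_coeff_def[of n 1])
  moreover have "M_coeff n 1 1 = 0" using M_coeff_parity[of n 1 1] by auto
  moreover have "M_coeff n 2 0 = 0" using M_coeff_parity[of n 2 0] by fastforce
  ultimately show ?thesis using True by simp
next
  case False
  then have j: "j \<ge> 1" using assms by auto
  have split: "cone_count n 0 i + cone_count n (-2) i = 2 * M_coeff n 1 i + M_coeff n (i+1) 0"
    if "i \<ge> 0" for i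
  proof -
    have "quad_count n i 0 = quad_count n 0 i" by (rule walk_count_commute) (auto simp: quadrant_def)
    moreover have "-1 - (i + 1) = -2 - i" by simp
    ultimately show ?thesis using cone_count_reflect[of 0 i n] that
      unfolding M_coeff_def by simp
  qed
  have c: "(-1, j) \<in> three_quadrants" using assms by (auto simp: three_quadrants_def)
  have "M_coeff (Suc n) 0 j = (cone_count n 0 (j-1) + cone_count n (-2) (j-1))
      + (cone_count n 0 (j+1) + cone_count n (-2) (j+1))"
    using j c quad_count_0[of "-1" j "Suc n"] by (simp add: M_coeff_def del: walk_count.simps(2)) simp
  also have "\<dots> = (2 * M_coeff n 1 (j-1) + M_coeff n j 0) + (2 * M_coeff n 1 (j+1) + M_coeff n (j+2) 0)"
    using split[of "j-1"] split[of "j+1"] j by (simp add: add.commute)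
  finally show ?thesis by simp
qed

text \<open>The coefficient array of the part of exponent \<open>0\<close> in a variable.\<close>

definition on_axis :: "int \<Rightarrow> rat \<Rightarrow> rat" where "on_axis k a = (if k = 0 then a else 0)"

text \<open>The coefficient of \<open>x\<^sup>k y\<^sup>j\<close> in the functional equation. The two recurrences cover \<open>k, j \<ge> 0\<close>; all other
  cases say that the boundary terms remove exactly the monomials with a negative exponent.\<close>

lemma M_coeff_functional_equation:
  defines "D \<equiv> \<lambda>n k j. 2 * M_coeff n k j - on_axis k (M_coeff n 0 j)"
    and "By \<equiv> \<lambda>n k j. on_axis k (M_coeff n 0 j)"
    and "Ax \<equiv> \<lambda>n k j. on_axis j (M_coeff n k 0)"
    and "Ay \<equiv> \<lambda>n k j. on_axis k (M_coeff n j 0)"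
  shows "D (Suc n) k j = D n (k-1) (j-1) + D n (k-1) (j+1) + D n (k+1) (j-1) + D n (k+1) (j+1)
    - 2 * (Ax n (k+1) (j+1) + Ax n (k-1) (j+1))
    + (By n (k-1) (j+1) + By n (k-1) (j-1) - By n (k+1) (j+1) - By n (k+1) (j-1))
    + (Ay n k (j+2) + Ay n k j) - on_axis k (on_axis (j+1) (M_coeff n 1 0))"
proof -
  have neg: "M_coeff n k j = 0" if "k < 0 \<or> j < 0" for n k j
    using that by (simp add: M_coeff_def)
  consider "k < -1" | "k = -1" | "k \<ge> 0" "j < -2" | "k \<ge> 0" "j = -2" | "k \<ge> 0" "j = -1"
    | "k \<ge> 1" "j \<ge> 0" | "k = 0" "j \<ge> 0" by linarith
  then show ?thesis
  proof cases
    case 6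
    then show ?thesis by (simp add: D_def By_def Ax_def Ay_def on_axis_def M_coeff_step_positive)
  next
    case 7
    then show ?thesis by (simp add: D_def By_def Ax_def Ay_def on_axis_def M_coeff_step_zero neg)
  qed (auto simp: D_def By_def Ax_def Ay_def on_axis_def neg M_coeff_00)
qed

section \<open>From arrays of coefficients to polynomials\<close>

definition poly2_of :: "nat \<Rightarrow> (int \<Rightarrow> int \<Rightarrow> rat) \<Rightarrow> rat poly poly" where
  "poly2_of N f = (\<Sum>j\<le>N. monom (\<Sum>k\<le>N. monom (f (int k) (int j)) k) j)"

text \<open>The array is extended by zero to negative exponents, so that multiplication by a variable is a
  shift. An identity between polynomials then follows from an identity between arrays, with no case
  distinction at the boundary.\<close>

definition has_coeffs :: "rat poly poly \<Rightarrow> (int \<Rightarrow> int \<Rightarrow> rat) \<Rightarrow> bool" where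
  "has_coeffs F f \<longleftrightarrow> (\<forall>k j. coeff (coeff F j) k = f (int k) (int j))
     \<and> (\<forall>k j. k < 0 \<or> j < 0 \<longrightarrow> f k j = 0)"

lemma has_coeffs_poly2_of:
  assumes "\<And>k j. f k j \<noteq> 0 \<Longrightarrow> 0 \<le> k \<and> k \<le> int N \<and> 0 \<le> j \<and> j \<le> int N"
  shows "has_coeffs (poly2_of N f) f"
proof -
  have "coeff (coeff (poly2_of N f) j) k = f (int k) (int j)" for k j
    using assms[of "int k" "int j"] by (auto simp: poly2_of_def coeff_sum)
  then show ?thesis using assms by (fastforce simp: has_coeffs_def)
qed

lemma has_coeffs_unique: "has_coeffs F f \<Longrightarrow> has_coeffs G f \<Longrightarrow> F = G"
  by (intro poly_eqI) (simp add: has_coeffs_def)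

lemma has_coeffs_add: "has_coeffs F f \<Longrightarrow> has_coeffs G g \<Longrightarrow> has_coeffs (F + G) (\<lambda>k j. f k j + g k j)"
  by (simp add: has_coeffs_def)

lemma has_coeffs_diff: "has_coeffs F f \<Longrightarrow> has_coeffs G g \<Longrightarrow> has_coeffs (F - G) (\<lambda>k j. f k j - g k j)"
  by (simp add: has_coeffs_def)

lemma has_coeffs_numeral: "has_coeffs F f \<Longrightarrow> has_coeffs (numeral c * F) (\<lambda>k j. numeral c * f k j)"
proof -
  have "numeral c * F = smult [:numeral c:] F" by (simp add: numeral_poly)
  moreover assume "has_coeffs F f"
  ultimately show ?thesis by (simp add: has_coeffs_def)
qed

abbreviation "var_x \<equiv> ([:[:0, 1:]:] :: rat poly poly)"
abbreviation "var_y \<equiv> ([:0, 1:] :: rat poly poly)"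

lemma has_coeffs_x: "has_coeffs F f \<Longrightarrow> has_coeffs (var_x * F) (\<lambda>k j. f (k - 1) j)"
proof -
  assume F: "has_coeffs F f"
  have "coeff (coeff (var_x * F) j) k = f (int k - 1) (int j)" for k j
    using F by (cases k) (auto simp: has_coeffs_def coeff_pCons)
  then show ?thesis using F by (simp add: has_coeffs_def)
qed

lemma has_coeffs_y: "has_coeffs F f \<Longrightarrow> has_coeffs (var_y * F) (\<lambda>k j. f k (j - 1))"
proof -
  assume F: "has_coeffs F f"
  have "coeff (coeff (var_y * F) j) k = f (int k) (int j - 1)" for k j
    using F by (cases j) (auto simp: has_coeffs_def coeff_pCons)
  then show ?thesis using F by (simp add: has_coeffs_def)
qed

lemma has_coeffs_const:
  "has_coeffs [:[:c:]:] (\<lambda>k j. on_axis k (on_axis j c))"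
  by (auto simp: has_coeffs_def on_axis_def coeff_pCons split: nat.splits)

lemma has_coeffs_at_y0: "has_coeffs F f \<Longrightarrow> has_coeffs [:coeff F 0:] (\<lambda>k j. on_axis j (f k 0))"
  by (auto simp: has_coeffs_def on_axis_def coeff_pCons split: nat.splits)

lemma has_coeffs_at_x0:
  "has_coeffs F f \<Longrightarrow> has_coeffs (map_poly (\<lambda>c. [:coeff c 0:]) F) (\<lambda>k j. on_axis k (f 0 j))"
  by (auto simp: has_coeffs_def on_axis_def coeff_pCons coeff_map_poly split: nat.splits)

lemma has_coeffs_at_y0_swap:
  "has_coeffs F f \<Longrightarrow> has_coeffs (map_poly (\<lambda>c. [:c:]) (coeff F 0)) (\<lambda>k j. on_axis k (f j 0))"
  by (auto simp: has_coeffs_def on_axis_def coeff_pCons coeff_map_poly split: nat.splits)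

section \<open>The series \<open>M\<close> and its functional equation\<close>

definition M_ser :: "rat poly poly fps" where
  "M_ser = Abs_fps (\<lambda>n. poly2_of (n + 1) (M_coeff n))"

definition P_ser :: "rat poly poly fps" where
  "P_ser = Abs_fps (\<lambda>n. poly2_of (n + 1) (P_coeff n))"

definition A_ser :: "rat poly fps" where
  "A_ser = Abs_fps (\<lambda>n. coeff (fps_nth M_ser n) 0)"

definition B_ser :: "rat poly fps" where
  "B_ser = Abs_fps (\<lambda>n. map_poly (\<lambda>c. coeff c 0) (fps_nth M_ser n))"

lemma M_ser_coeffs: "has_coeffs (fps_nth M_ser n) (M_coeff n)"
  unfolding M_ser_def fps_nth_Abs_fps
proof (rule has_coeffs_poly2_of)
  fix k j assume "M_coeff n k j \<noteq> 0"
  then show "0 \<le> k \<and> k \<le> int (n + 1) \<and> 0 \<le> j \<and> j \<le> int (n + 1)"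
    using M_coeff_bounded[of n k j] by (auto simp: M_coeff_def split: if_splits)
qed

lemma P_ser_coeffs: "has_coeffs (fps_nth P_ser n) (P_coeff n)"
  unfolding P_ser_def fps_nth_Abs_fps
proof (rule has_coeffs_poly2_of)
  fix k j assume "P_coeff n k j \<noteq> 0"
  then show "0 \<le> k \<and> k \<le> int (n + 1) \<and> 0 \<le> j \<and> j \<le> int (n + 1)"
    using P_coeff_bounded[of n k j] by (auto simp: P_coeff_def split: if_splits)
qed

definition in_x :: "rat poly fps \<Rightarrow> rat poly poly fps" where
  "in_x F = Abs_fps (\<lambda>n. [:fps_nth F n:])"

definition in_y :: "rat poly fps \<Rightarrow> rat poly poly fps" where
  "in_y F = Abs_fps (\<lambda>n. map_poly (\<lambda>c. [:c:]) (fps_nth F n))"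

definition in_const :: "rat fps \<Rightarrow> rat poly poly fps" where
  "in_const F = Abs_fps (\<lambda>n. [:[:fps_nth F n:]:])"

text \<open>The functional equation multiplied by \<open>x y\<^sup>2\<close>, which makes it an identity between series with polynomial
  coefficients that can be specialized at any point.\<close>

lemma M_ser_functional_equation:
  defines "x \<equiv> fps_const var_x" and "y \<equiv> fps_const var_y" and "t \<equiv> fps_X"
  shows "y * (x * y - t * (x^2 + 1) * (y^2 + 1)) * (2 * M_ser - in_y B_ser)
    = fps_const [:[:2/3:]:] * x^2 * y^2 - 2 * t * y * (x^2 + 1) * in_x A_ser
      + t * y * (x^2 - 1) * (y^2 + 1) * in_y B_ser + t * x * (y^2 + 1) * in_y A_ser
      - t * x * y * in_const (coeff_series M_ser 1 0)"
proof -
  define D where "D = 2 * M_ser - in_y B_ser"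
  have B: "map_poly (\<lambda>c. [:c:]) (map_poly (\<lambda>c. coeff c 0) F) = map_poly (\<lambda>c. [:coeff c 0:]) F"
    for F :: "rat poly poly" by (intro poly_eqI) (simp add: coeff_map_poly)
  have hB: "has_coeffs (fps_nth (in_y B_ser) n) (\<lambda>k j. on_axis k (M_coeff n 0 j))" for n
    using has_coeffs_at_x0[OF M_ser_coeffs] by (simp add: in_y_def B_ser_def B)
  have hD: "has_coeffs (fps_nth D n) (\<lambda>k j. 2 * M_coeff n k j - on_axis k (M_coeff n 0 j))" for n
  proof -
    have "fps_nth (2 * M_ser) n = 2 * fps_nth M_ser n"
      by (metis fps_mult_left_const_nth numeral_fps_const)
    then show ?thesis unfolding D_def fps_sub_nth
      by (simp only:) (intro has_coeffs_diff has_coeffs_numeral M_ser_coeffs hB)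
  qed
  have hAx: "has_coeffs (fps_nth (in_x A_ser) n) (\<lambda>k j. on_axis j (M_coeff n k 0))" for n
    using has_coeffs_at_y0[OF M_ser_coeffs] by (simp add: in_x_def A_ser_def)
  have hAy: "has_coeffs (fps_nth (in_y A_ser) n) (\<lambda>k j. on_axis k (M_coeff n j 0))" for n
    using has_coeffs_at_y0_swap[OF M_ser_coeffs] by (simp add: in_y_def A_ser_def)
  have hc: "has_coeffs (fps_nth (in_const (coeff_series M_ser 1 0)) n)
      (\<lambda>k j. on_axis k (on_axis j (M_coeff n 1 0)))" for n
    using has_coeffs_const M_ser_coeffs[of n] by (simp add: in_const_def coeff_series_def has_coeffs_def)
  let ?x = var_x and ?y = var_y
  have step: "?y * (?x * (?y * fps_nth D (Suc n)))
    = (?y * fps_nth D n + ?y * (?x * (?x * fps_nth D n)) + ?y * (?y * (?y * fps_nth D n))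
        + ?y * (?y * (?y * (?x * (?x * fps_nth D n)))))
      - 2 * (?y * fps_nth (in_x A_ser) n + ?y * (?x * (?x * fps_nth (in_x A_ser) n)))
      + (?y * (?x * (?x * fps_nth (in_y B_ser) n)) + ?y * (?y * (?y * (?x * (?x * fps_nth (in_y B_ser) n))))
        - ?y * fps_nth (in_y B_ser) n - ?y * (?y * (?y * fps_nth (in_y B_ser) n)))
      + (?x * fps_nth (in_y A_ser) n + ?x * (?y * (?y * fps_nth (in_y A_ser) n)))
      - ?x * (?y * fps_nth (in_const (coeff_series M_ser 1 0)) n)" (is "?l = ?r") for n
  proof -
    note intros = has_coeffs_add has_coeffs_diff has_coeffs_x has_coeffs_y has_coeffs_numeral
      hD hB hAx hAy hc
    have "\<exists>f g. has_coeffs ?l f \<and> has_coeffs ?r g \<and> f = g"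
      apply (rule exI, rule exI, rule conjI)
       apply (rule intros)+
      apply (rule conjI)
       apply (rule intros)+
      apply (intro ext)
      subgoal for k j
        using M_coeff_functional_equation[of n "k-1" "j-2"] by (simp add: algebra_simps)
      done
    then show ?thesis by (auto intro: has_coeffs_unique)
  qed
  have init: "?y * (?x * (?y * fps_nth D 0)) = [:[:2/3:]:] * ?x^2 * ?y^2"
  proof -
    have "2 * M_coeff 0 k j - on_axis k (M_coeff 0 0 j) = on_axis (k-1) (on_axis j (2/3))" for k j
      by (auto simp: M_coeff_def on_axis_def quadrant_def)
    then have "fps_nth D 0 = ?x * [:[:2/3:]:]"
      using has_coeffs_unique[OF hD[of 0]] has_coeffs_x[OF has_coeffs_const[of "2/3"]] by simp
    then show ?thesis by (simp add: power2_eq_square)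
  qed
  interpret c: comm_ring_hom "fps_const :: rat poly poly \<Rightarrow> _" by (rule fps_const_hom)
  let ?c = "fps_const :: rat poly poly \<Rightarrow> _"
  have hom: "x = ?c ?x" "y = ?c ?y" "x^2 + 1 = ?c (?x^2 + 1)" "x^2 - 1 = ?c (?x^2 - 1)" "y^2 + 1 = ?c (?y^2 + 1)"
    by (simp_all only: x_def y_def c.hom_add c.hom_power c.hom_one c.hom_minus)
  have "y * (x * y - t * (x^2 + 1) * (y^2 + 1)) * D
      = ?c (?y * ?x * ?y) * D - t * (?c (?y * (?x^2 + 1) * (?y^2 + 1)) * D)"
    by (simp only: c.hom_mult hom[symmetric]) (simp add: algebra_simps)
  moreover have "?c [:[:2/3:]:] * x^2 * y^2 - 2 * t * y * (x^2 + 1) * in_x A_ser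
      + t * y * (x^2 - 1) * (y^2 + 1) * in_y B_ser + t * x * (y^2 + 1) * in_y A_ser
      - t * x * y * in_const (coeff_series M_ser 1 0)
    = ?c ([:[:2/3:]:] * ?x^2 * ?y^2) + t * (- (?c (2 * ?y * (?x^2 + 1)) * in_x A_ser)
      + ?c (?y * (?x^2 - 1) * (?y^2 + 1)) * in_y B_ser + ?c (?x * (?y^2 + 1)) * in_y A_ser
      - ?c (?x * ?y) * in_const (coeff_series M_ser 1 0))"
    by (simp only: c.hom_mult c.hom_power c.hom_numeral hom[symmetric]) (simp add: algebra_simps)
  moreover have "?c (?y * ?x * ?y) * D - t * (?c (?y * (?x^2 + 1) * (?y^2 + 1)) * D)
    = ?c ([:[:2/3:]:] * ?x^2 * ?y^2) + t * (- (?c (2 * ?y * (?x^2 + 1)) * in_x A_ser)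
      + ?c (?y * (?x^2 - 1) * (?y^2 + 1)) * in_y B_ser + ?c (?x * (?y^2 + 1)) * in_y A_ser
      - ?c (?x * ?y) * in_const (coeff_series M_ser 1 0))"
  proof (rule fps_ext)
    fix n
    show "fps_nth (?c (?y * ?x * ?y) * D - t * (?c (?y * (?x^2 + 1) * (?y^2 + 1)) * D)) n
      = fps_nth (?c ([:[:2/3:]:] * ?x^2 * ?y^2) + t * (- (?c (2 * ?y * (?x^2 + 1)) * in_x A_ser)
      + ?c (?y * (?x^2 - 1) * (?y^2 + 1)) * in_y B_ser + ?c (?x * (?y^2 + 1)) * in_y A_ser
      - ?c (?x * ?y) * in_const (coeff_series M_ser 1 0))) n"
    proof (cases n)
      case 0
      then show ?thesis using init by (simp add: t_def fps_X_mult_nth mult.assoc del: mult_pCons_left mult_pCons_right)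
    next
      case (Suc m)
      have eq: "?y * ?x * ?y * fps_nth D (Suc m) = (?y * (?x^2 + 1) * (?y^2 + 1)) * fps_nth D m
        + (- ((2 * ?y * (?x^2 + 1)) * fps_nth (in_x A_ser) m)
        + (?y * (?x^2 - 1) * (?y^2 + 1)) * fps_nth (in_y B_ser) m + (?x * (?y^2 + 1)) * fps_nth (in_y A_ser) m
        - (?x * ?y) * fps_nth (in_const (coeff_series M_ser 1 0)) m)" (is "?a = ?b")
      proof -
        have "?a = ?y * (?x * (?y * fps_nth D (Suc m)))" by (simp only: mult.assoc)
        also note step[of m]
        finally show ?thesis by (simp only: algebra_simps power2_eq_square)
      qed
      have "fps_nth (?c a) (Suc m) = 0" for a by simp
      then show ?thesis unfolding Suc t_def fps_sub_nth fps_add_nth fps_neg_nth fps_X_mult_nth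
          fps_mult_left_const_nth using eq by (simp del: mult_pCons_left mult_pCons_right)
    qed
  qed
  ultimately show ?thesis by (simp only: D_def)
qed

section \<open>Evaluation of the coefficients\<close>

lemma of_rat_hom: "comm_ring_hom (of_rat :: rat \<Rightarrow> 'a::field_char_0)"
  by unfold_locales (simp_all add: of_rat_add of_rat_mult)

lemma fls_const_hom: "field_hom (fls_const :: 'a::field \<Rightarrow> 'a fls)"
  by unfold_locales (simp_all add: fls_plus_const)

lemma series_eval_consts: "series_eval (\<lambda>c. fps_const (h c)) F = Abs_fps (\<lambda>n. h (fps_nth F n))"
proof (rule fps_ext)
  fix n
  have "fps_nth (series_eval (\<lambda>c. fps_const (h c)) F) n = (\<Sum>k\<le>n. if k = n then h (fps_nth F n) else 0)"
    unfolding series_eval_nth by (rule sum.cong) auto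
  then show "fps_nth (series_eval (\<lambda>c. fps_const (h c)) F) n = fps_nth (Abs_fps (\<lambda>n. h (fps_nth F n))) n"
    by simp
qed

text \<open>A homomorphism of the coefficients, followed by \<open>fps_const\<close>, is a substitution to which \<open>series_eval_hom\<close>
  applies.\<close>

lemma coefficientwise_hom:
  assumes "comm_ring_hom h"
  shows "comm_ring_hom (\<lambda>F. Abs_fps (\<lambda>n. h (fps_nth F n)))"
  using series_eval_hom[OF comp_ring_hom[OF fps_const_hom assms]]
  unfolding series_eval_consts[abs_def] .

definition poly_at :: "'a::field_char_0 \<Rightarrow> rat poly \<Rightarrow> 'a" where
  "poly_at a c = poly (map_poly of_rat c) a"

definition poly2_at :: "'a::field_char_0 \<Rightarrow> 'a \<Rightarrow> rat poly poly \<Rightarrow> 'a" where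
  "poly2_at a b c = poly (map_poly (poly_at a) c) b"

lemma poly_at_hom: "comm_ring_hom (poly_at a)"
  unfolding poly_at_def by (rule poly_eval_hom) (rule of_rat_hom)

lemma poly2_at_hom: "comm_ring_hom (poly2_at a b)"
  unfolding poly2_at_def by (rule poly_eval_hom) (rule poly_at_hom)

lemma eval2_alt: "eval2 F a b = fps_to_fls (Abs_fps (\<lambda>n. poly2_at a b (fps_nth F n)))"
  by (simp add: eval2_def poly2_at_def poly_at_def[abs_def])

lemma eval1_alt: "eval1 F a = fps_to_fls (Abs_fps (\<lambda>n. poly_at a (fps_nth F n)))"
  by (simp add: eval1_def poly_at_def)

lemma eval2_hom: "comm_ring_hom (\<lambda>F. eval2 F a b)"
  unfolding eval2_alt by (intro comp_ring_hom[OF fps_to_fls_hom] coefficientwise_hom poly2_at_hom)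

lemma eval1_hom: "comm_ring_hom (\<lambda>F. eval1 F a)"
  unfolding eval1_alt by (intro comp_ring_hom[OF fps_to_fls_hom] coefficientwise_hom poly_at_hom)

lemma eval0_hom: "comm_ring_hom (eval0 :: rat fps \<Rightarrow> 'a::field_char_0 fls)"
  unfolding eval0_def by (intro comp_ring_hom[OF fps_to_fls_hom] coefficientwise_hom of_rat_hom)

lemma poly_at_const [simp]: "poly_at a [:c:] = of_rat c"
  by (simp add: poly_at_def Polynomial.map_poly_pCons)

lemma poly_at_var [simp]: "poly_at a [:0, 1:] = a"
  by (simp add: poly_at_def Polynomial.map_poly_pCons)

lemma poly_at_0 [simp]: "poly_at 0 c = of_rat (coeff c 0)"
  by (simp add: poly_at_def poly_0_coeff_0 coeff_map_poly)

lemma poly2_at_const [simp]: "poly2_at a b [:c:] = poly_at a c"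
proof -
  interpret comm_ring_hom "poly_at a" by (rule poly_at_hom)
  show ?thesis by (simp add: poly2_at_def Polynomial.map_poly_pCons)
qed

lemma poly2_at_y [simp]: "poly2_at a b [:0, 1:] = b"
proof -
  interpret comm_ring_hom "poly_at a" by (rule poly_at_hom)
  show ?thesis by (simp add: poly2_at_def Polynomial.map_poly_pCons)
qed

lemma poly2_at_in_y [simp]: "poly2_at a b (map_poly (\<lambda>c. [:c:]) p) = poly_at b p"
proof -
  interpret comm_ring_hom "poly_at a" by (rule poly_at_hom)
  have "map_poly (poly_at a) (map_poly (\<lambda>c. [:c:]) p) = map_poly of_rat p"
    by (subst map_poly_map_poly) (simp_all add: o_def)
  then show ?thesis by (simp add: poly2_at_def poly_at_def)
qed

lemma poly2_at_y0: "poly2_at a 0 p = poly_at a (coeff p 0)"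
proof -
  interpret comm_ring_hom "poly_at a" by (rule poly_at_hom)
  show ?thesis by (simp add: poly2_at_def poly_0_coeff_0 coeff_map_poly)
qed

lemma poly2_at_x0: "poly2_at 0 (b :: 'a::field_char_0) p = poly_at b (map_poly (\<lambda>c. coeff c 0) p)"
proof -
  have "map_poly (poly_at (0::'a)) p = map_poly of_rat (map_poly (\<lambda>c. coeff c 0) p)"
    by (intro poly_eqI) (simp add: coeff_map_poly)
  then show ?thesis by (simp add: poly2_at_def poly_at_def)
qed

lemma eval2_in_x: "eval2 (in_x F) a b = eval1 F a"
  by (simp add: eval2_alt eval1_alt in_x_def)

lemma eval2_in_y: "eval2 (in_y F) a b = eval1 F b"
  by (simp add: eval2_alt eval1_alt in_y_def)

lemma eval2_in_const: "eval2 (in_const F) a b = eval0 F"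
  by (simp add: eval2_alt eval0_def in_const_def)

lemma eval2_M_y0: "eval2 M_ser a 0 = eval1 A_ser a"
  by (simp add: eval2_alt eval1_alt A_ser_def poly2_at_y0)

lemma eval2_M_x0: "eval2 M_ser 0 b = eval1 B_ser b"
  by (simp add: eval2_alt eval1_alt B_ser_def poly2_at_x0)

lemma fps_to_fls_const_Abs: "fps_to_fls (Abs_fps (\<lambda>n. poly2_at a b (fps_nth (fps_const c) n)))
    = fls_const (poly2_at a b c)"
proof -
  interpret comm_ring_hom "poly2_at a b" by (rule poly2_at_hom)
  have "Abs_fps (\<lambda>n. poly2_at a b (fps_nth (fps_const c) n)) = fps_const (poly2_at a b c)"
    by (intro fps_ext) auto
  then show ?thesis by simp
qed

lemma eval2_fps_const: "eval2 (fps_const c) a b = fls_const (poly2_at a b c)"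
  unfolding eval2_alt by (rule fps_to_fls_const_Abs)

lemma eval2_fps_X: "eval2 fps_X a b = fls_X"
proof -
  interpret comm_ring_hom "poly2_at a b" by (rule poly2_at_hom)
  have "Abs_fps (\<lambda>n. poly2_at a b (fps_nth fps_X n)) = fps_X"
    by (intro fps_ext) (auto simp: fps_X_def)
  then show ?thesis by (simp add: eval2_alt)
qed

lemma M_functional_equation:
  fixes a b :: "'a::field_char_0"
  assumes "a \<noteq> 0" and "b \<noteq> 0"
  defines "x \<equiv> fls_const a" and "y \<equiv> fls_const b" and "t \<equiv> fls_X"
  shows "(1 - t * (x + 1/x) * (y + 1/y)) * (2 * eval2 M_ser a b - eval2 M_ser 0 b)
      = 2 * x / 3 - 2 * t * (1/y) * (x + 1/x) * eval2 M_ser a 0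
        + t * (x - 1/x) * (y + 1/y) * eval2 M_ser 0 b
        + t * (1 + (1/y)^2) * eval2 M_ser b 0
        - t * (1/y) * eval0 (coeff_series M_ser 1 0)"
proof -
  interpret e: comm_ring_hom "\<lambda>F. eval2 F a b" by (rule eval2_hom)
  have nz: "x \<noteq> 0" "y \<noteq> 0" using assms by (auto simp: x_def y_def)
  have vx: "eval2 (fps_const var_x) a b = x" and vy: "eval2 (fps_const var_y) a b = y"
    by (simp_all add: eval2_fps_const x_def y_def)
  have c: "eval2 (fps_const [:[:2/3:]:]) a b = 2/3"
  proof -
    have "of_rat (2/3) = (2/3 :: 'a)" by (simp only: of_rat_divide of_rat_numeral_eq)
    then have "eval2 (fps_const [:[:2/3:]:]) a b = fls_const (2/3)"
      by (simp only: eval2_fps_const poly2_at_const poly_at_const)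
    also have "\<dots> = 2/3" by (metis fls_const_divide_const fls_const_numeral)
    finally show ?thesis .
  qed
  note arg_cong[OF M_ser_functional_equation, of "\<lambda>F. eval2 F a b"]
  note fe = this[unfolded e.hom_mult e.hom_add e.hom_minus e.hom_power e.hom_one e.hom_numeral
      vx vy c eval2_fps_X eval2_in_x eval2_in_y eval2_in_const]
  have "(x * y\<^sup>2) * ((1 - t * (x + 1/x) * (y + 1/y)) * (2 * eval2 M_ser a b - eval2 M_ser 0 b))
     = y * (x * y - t * (x\<^sup>2 + 1) * (y\<^sup>2 + 1)) * (2 * eval2 M_ser a b - eval2 M_ser 0 b)"
    using nz by (simp add: field_simps power2_eq_square)
  also have "\<dots> = 2 / 3 * x\<^sup>2 * y\<^sup>2 - 2 * t * y * (x\<^sup>2 + 1) * eval2 M_ser a 0 +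
    t * y * (x\<^sup>2 - 1) * (y\<^sup>2 + 1) * eval2 M_ser 0 b +
    t * x * (y\<^sup>2 + 1) * eval2 M_ser b 0 -
    t * x * y * eval0 (coeff_series M_ser 1 0)"
    using fe by (simp add: eval2_M_x0 eval2_M_y0 t_def)
  also have "\<dots> = (x * y\<^sup>2) * (2 * x / 3 - 2 * t * (1/y) * (x + 1/x) * eval2 M_ser a 0
        + t * (x - 1/x) * (y + 1/y) * eval2 M_ser 0 b
        + t * (1 + (1/y)^2) * eval2 M_ser b 0
        - t * (1/y) * eval0 (coeff_series M_ser 1 0))"
    using nz by (simp add: field_simps power2_eq_square)
  finally show ?thesis using nz by simp
qed

section \<open>Generating functions of walks\<close>

lemma poly_bounded_sum:
  fixes p :: "'a::comm_semiring_1 poly"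
  assumes "\<And>k. k > N \<Longrightarrow> coeff p k = 0"
  shows "poly p a = (\<Sum>k\<le>N. coeff p k * a ^ k)"
proof -
  have "degree p \<le> N" using assms by (intro degree_le) auto
  then show ?thesis unfolding poly_altdef
    by (intro sum.mono_neutral_left) (auto simp: coeff_eq_0)
qed

lemma poly2_at_sum:
  assumes "has_coeffs F f" and "\<And>k j. f k j \<noteq> 0 \<Longrightarrow> k \<le> int K \<and> j \<le> int J"
  shows "poly2_at a b F = (\<Sum>j\<le>J. \<Sum>k\<le>K. of_rat (f (int k) (int j)) * a ^ k * b ^ j)"
proof -
  interpret comm_ring_hom "poly_at a" by (rule poly_at_hom)
  have z: "f (int k) (int j) = 0" if "k > K \<or> j > J" for k j
    using assms(2)[of "int k" "int j"] that by (cases "f (int k) (int j) = 0") auto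
  have c: "coeff (coeff F j) k = f (int k) (int j)" for k j
    using assms(1) by (simp add: has_coeffs_def)
  have "poly_at a (coeff F j) = (\<Sum>k\<le>K. of_rat (f (int k) (int j)) * a ^ k)" for j
    unfolding poly_at_def by (subst poly_bounded_sum[of K]) (auto simp: coeff_map_poly c z)
  moreover have "coeff F j = 0" if "j > J" for j
    by (rule poly_eqI) (simp add: c z that)
  ultimately have "poly2_at a b F = (\<Sum>j\<le>J. (\<Sum>k\<le>K. of_rat (f (int k) (int j)) * a ^ k) * b ^ j)"
    unfolding poly2_at_def by (subst poly_bounded_sum[of J]) (auto simp: coeff_map_poly)
  then show ?thesis by (simp add: sum_distrib_right)
qed

lemma eval2_M_sum:
  assumes "n + 1 \<le> K" and "n \<le> J"
  shows "poly2_at a b (fps_nth M_ser n) = (\<Sum>j\<le>J. \<Sum>k\<le>K. of_rat (M_coeff n (int k) (int j)) * a ^ k * b ^ j)"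
  by (rule poly2_at_sum[OF M_ser_coeffs]) (use assms M_coeff_bounded in fastforce)

lemma eval2_P_sum:
  assumes "n \<le> K" and "n \<le> J"
  shows "poly2_at a b (fps_nth P_ser n) = (\<Sum>j\<le>J. \<Sum>k\<le>K. of_rat (P_coeff n (int k) (int j)) * a ^ k * b ^ j)"
  by (rule poly2_at_sum[OF P_ser_coeffs]) (use assms P_coeff_bounded in fastforce)

lemma eval2_P_eq:
  fixes a b :: "'a::field_char_0"
  assumes "a \<noteq> 0" and "b \<noteq> 0"
  shows "eval2 P_ser a b = 1 / fls_const a * (eval2 M_ser a b - eval2 M_ser 0 b)
    + 1 / fls_const b * (eval2 M_ser b a - eval2 M_ser 0 a)"
proof -
  have d: "poly2_at c d (fps_nth M_ser n) - poly2_at 0 d (fps_nth M_ser n)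
      = c * (\<Sum>j\<le>n. \<Sum>k\<le>n. of_rat (M_coeff n (int k + 1) (int j)) * c ^ k * d ^ j)" for c d :: 'a and n
  proof -
    have "poly2_at e d (fps_nth M_ser n) = (\<Sum>j\<le>n. of_rat (M_coeff n 0 (int j)) * d ^ j)
        + e * (\<Sum>j\<le>n. \<Sum>k\<le>n. of_rat (M_coeff n (int k + 1) (int j)) * e ^ k * d ^ j)" for e :: 'a
      by (subst eval2_M_sum[of n "Suc n" n])
        (simp_all add: sum.atMost_Suc_shift sum.distrib sum_distrib_left algebra_simps del: sum.atMost_Suc)
    from this[of c] this[of 0] show ?thesis by simp
  qed
  have "a * b * poly2_at a b (fps_nth P_ser n)
    = b * (poly2_at a b (fps_nth M_ser n) - poly2_at 0 b (fps_nth M_ser n))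
      + a * (poly2_at b a (fps_nth M_ser n) - poly2_at 0 a (fps_nth M_ser n))" for n
  proof -
    have "poly2_at a b (fps_nth P_ser n)
      = (\<Sum>j\<le>n. \<Sum>k\<le>n. of_rat (M_coeff n (int k + 1) (int j)) * a ^ k * b ^ j)
        + (\<Sum>j\<le>n. \<Sum>k\<le>n. of_rat (M_coeff n (int j + 1) (int k)) * a ^ k * b ^ j)"
      by (subst eval2_P_sum[of n n n]) (simp_all add: P_coeff_eq of_rat_add algebra_simps sum.distrib)
    also have "(\<Sum>j\<le>n. \<Sum>k\<le>n. of_rat (M_coeff n (int j + 1) (int k)) * a ^ k * b ^ j)
      = (\<Sum>j\<le>n. \<Sum>k\<le>n. of_rat (M_coeff n (int k + 1) (int j)) * b ^ k * a ^ j)"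
      by (subst sum.swap) (simp add: mult_ac)
    finally show ?thesis unfolding d by (simp add: algebra_simps)
  qed
  then have "fls_const a * fls_const b * eval2 P_ser a b
    = fls_const b * (eval2 M_ser a b - eval2 M_ser 0 b) + fls_const a * (eval2 M_ser b a - eval2 M_ser 0 a)"
    unfolding eval2_alt fps_const_to_fls[symmetric] fps_to_fls_minus[symmetric]
      fls_times_fps_to_fls[symmetric] fps_to_fls_plus[symmetric] fps_to_fls_eq_iff
    by (intro fps_ext) (simp add: mult.assoc)
  moreover have "fls_const a \<noteq> 0" "fls_const b \<noteq> 0" using assms by auto
  ultimately show ?thesis by (simp add: field_simps)
qed

text \<open>All walks of length \<open>n\<close> end in the box of radius \<open>n\<close>. A larger box is allowed, so that
  shifted end points can be summed over the same range.\<close>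

lemma sum_over_walks:
  fixes g :: "int \<times> int \<Rightarrow> 'a::field_char_0"
  assumes "n \<le> N"
  shows "(\<Sum>w | w \<in> {w \<in> diagonal_walks C. R (last w)} \<and> length w = Suc n. g (last w))
    = (\<Sum>p \<in> {-int N..int N} \<times> {-int N..int N}.
        if R p then of_rat (walk_count C n (fst p) (snd p)) * g p else 0)"
proof -
  let ?B = "{-int N..int N} \<times> {-int N..int N}"
  have W: "{w. w \<in> {w \<in> diagonal_walks C. R (last w)} \<and> length w = Suc n}
      = (\<Union>p \<in> {p \<in> ?B. R p}. walks_to C n p)"
  proof (intro subset_antisym subsetI)
    fix w assume w: "w \<in> {w. w \<in> {w \<in> diagonal_walks C. R (last w)} \<and> length w = Suc n}"
    then have w': "w \<in> walks_to C n (last w)" by (simp add: walks_to_def)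
    then have "card (walks_to C n (last w)) \<noteq> 0" using finite_walks_to by (metis card_0_eq empty_iff)
    then have "walk_count C n (fst (last w)) (snd (last w)) \<noteq> 0"
      by (simp flip: card_walks_to)
    then have "\<bar>fst (last w)\<bar> \<le> int n \<and> \<bar>snd (last w)\<bar> \<le> int n" by (rule walk_count_bounded)
    then have "- int n \<le> fst (last w)" "fst (last w) \<le> int n" "- int n \<le> snd (last w)" "snd (last w) \<le> int n"
      by (simp_all only: abs_le_iff) linarith+
    moreover have "int n \<le> int N" using assms by simp
    ultimately have "- int N \<le> fst (last w)" "fst (last w) \<le> int N" "- int N \<le> snd (last w)" "snd (last w) \<le> int N"
      by linarith+
    then have "last w \<in> ?B" unfolding mem_Times_iff atLeastAtMost_iff by blast
    moreover have "R (last w)" using w by simp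
    ultimately show "w \<in> (\<Union>p \<in> {p \<in> ?B. R p}. walks_to C n p)" using w' by (intro UN_I[of "last w"]) simp_all
  qed (auto simp: walks_to_def)
  have "(\<Sum>w | w \<in> {w \<in> diagonal_walks C. R (last w)} \<and> length w = Suc n. g (last w))
      = (\<Sum>p \<in> {p \<in> ?B. R p}. \<Sum>w \<in> walks_to C n p. g (last w))"
    unfolding W by (rule sum.UNION_disjoint) (auto simp: finite_walks_to, auto simp: walks_to_def)
  also have "\<dots> = (\<Sum>p \<in> {p \<in> ?B. R p}. of_rat (walk_count C n (fst p) (snd p)) * g p)"
  proof (rule sum.cong[OF refl])
    fix p
    have "(\<Sum>w \<in> walks_to C n p. g (last w)) = (\<Sum>w \<in> walks_to C n p. g p)"
      by (rule sum.cong) (auto simp: walks_to_def)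
    also have "\<dots> = of_rat (walk_count C n (fst p) (snd p)) * g p"
      by (simp flip: card_walks_to)
    finally show "(\<Sum>w \<in> walks_to C n p. g (last w)) = of_rat (walk_count C n (fst p) (snd p)) * g p" .
  qed
  also have "\<dots> = (\<Sum>p \<in> ?B. if R p then of_rat (walk_count C n (fst p) (snd p)) * g p else 0)"
    by (rule sum.inter_filter) simp
  finally show ?thesis .
qed

lemma sum_box_nonneg:
  fixes h :: "int \<times> int \<Rightarrow> 'a::comm_monoid_add"
  assumes "\<And>i j. i < 0 \<or> j < 0 \<Longrightarrow> h (i, j) = 0"
  shows "(\<Sum>p \<in> {-int N..int N} \<times> {-int N..int N}. h p) = (\<Sum>j\<le>N. \<Sum>k\<le>N. h (int k, int j))"
proof -
  have "(\<Sum>j\<le>N. \<Sum>k\<le>N. h (int k, int j)) = (\<Sum>(j, k) \<in> {..N} \<times> {..N}. h (int k, int j))"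
    by (simp add: sum.cartesian_product)
  also have "\<dots> = (\<Sum>p \<in> (\<lambda>(j, k). (int k, int j)) ` ({..N} \<times> {..N}). h p)"
    by (subst sum.reindex) (auto simp: inj_on_def case_prod_unfold intro!: sum.cong)
  also have "\<dots> = (\<Sum>p \<in> {-int N..int N} \<times> {-int N..int N}. h p)"
  proof (rule sum.mono_neutral_left)
    show "\<forall>p \<in> {-int N..int N} \<times> {-int N..int N} - (\<lambda>(j, k). (int k, int j)) ` ({..N} \<times> {..N}). h p = 0"
    proof
      fix p assume p: "p \<in> {-int N..int N} \<times> {-int N..int N} - (\<lambda>(j, k). (int k, int j)) ` ({..N} \<times> {..N})"
      have "fst p < 0 \<or> snd p < 0"
      proof (rule ccontr)
        assume nn: "\<not> ?thesis"
        obtain i j where ij: "p = (i, j)" by (cases p)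
        then have "p = (\<lambda>(j, k). (int k, int j)) (nat j, nat i)" "(nat j, nat i) \<in> {..N} \<times> {..N}"
          using p nn by auto
        then show False using p by blast
      qed
      then show "h p = 0" using assms[of "fst p" "snd p"] by simp
    qed
  qed auto
  finally show ?thesis by simp
qed

lemma sum_box_negative:
  fixes h :: "int \<times> int \<Rightarrow> 'a::comm_monoid_add"
  assumes "\<And>i j. i \<ge> 0 \<or> j < 0 \<or> i \<le> - int N \<Longrightarrow> h (i, j) = 0"
  shows "(\<Sum>p \<in> {-int N..int N} \<times> {-int N..int N}. h p) = (\<Sum>j\<le>N. \<Sum>k\<le>N. h (-1 - int k, int j))"
proof -
  let ?B = "{-int N..int N} \<times> {-int N..int N}"
  have "(\<Sum>p \<in> ?B. h p) = (\<Sum>p \<in> {-int N<..<0} \<times> {-int N..int N}. h p)"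
  proof (rule sum.mono_neutral_right)
    show "\<forall>p \<in> ?B - {-int N<..<0} \<times> {-int N..int N}. h p = 0"
    proof
      fix p assume "p \<in> ?B - {-int N<..<0} \<times> {-int N..int N}"
      then have "fst p \<ge> 0 \<or> fst p \<le> - int N" by (auto simp: mem_Times_iff)
      then show "h p = 0" using assms[of "fst p" "snd p"] by auto
    qed
  qed auto
  also have "\<dots> = (\<Sum>p \<in> {-1<..<int N - 1} \<times> {-int N..int N}. h (-1 - fst p, snd p))"
    by (rule sum.reindex_bij_witness[where i = "\<lambda>p. (-1 - fst p, snd p)" and j = "\<lambda>p. (-1 - fst p, snd p)"])
      auto
  also have "\<dots> = (\<Sum>p \<in> ?B. (\<lambda>(i, j). if i < 0 then 0 else h (-1 - i, j)) p)"
  proof (rule sum.mono_neutral_cong_left)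
    show "\<forall>p \<in> ?B - {-1<..<int N - 1} \<times> {-int N..int N}. (\<lambda>(i, j). if i < 0 then 0 else h (-1 - i, j)) p = 0"
    proof
      fix p assume "p \<in> ?B - {-1<..<int N - 1} \<times> {-int N..int N}"
      then have "fst p < 0 \<or> -1 - fst p \<le> - int N" by (auto simp: mem_Times_iff)
      then show "(\<lambda>(i, j). if i < 0 then 0 else h (-1 - i, j)) p = 0"
        using assms[of "-1 - fst p" "snd p"] by (auto simp: case_prod_unfold)
    qed
  qed (auto simp: case_prod_unfold)
  also have "\<dots> = (\<Sum>j\<le>N. \<Sum>k\<le>N. (\<lambda>(i, j). if i < 0 then 0 else h (-1 - i, j)) (int k, int j))"
    by (rule sum_box_nonneg) (auto simp: assms)
  finally show ?thesis by simp
qed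

lemma walk_gf_quadrant_part:
  fixes a b :: "'a::field_char_0"
  shows "walk_gf {w \<in> diagonal_walks three_quadrants. fst (last w) \<ge> 0 \<and> snd (last w) \<ge> 0} a b
    = 1/3 * Q_gf a b + eval2 P_ser a b"
proof -
  let ?m = "\<lambda>p. a powi fst p * b powi snd p"
  have Q: "(\<Sum>w | w \<in> diagonal_walks quadrant \<and> length w = Suc n. ?m (last w))
    = (\<Sum>j\<le>n. \<Sum>k\<le>n. of_rat (quad_count n (int k) (int j)) * a ^ k * b ^ j)" for n
    using sum_over_walks[where n=n and N=n and g="?m" and C=quadrant and R="\<lambda>_. True"]
    by (simp, subst sum_box_nonneg) (auto simp: quad_count_0 mult.assoc)
  have C: "(\<Sum>w | w \<in> {w \<in> diagonal_walks three_quadrants. fst (last w) \<ge> 0 \<and> snd (last w) \<ge> 0}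
      \<and> length w = Suc n. ?m (last w))
    = (\<Sum>j\<le>n. \<Sum>k\<le>n. of_rat (cone_count n (int k) (int j)) * a ^ k * b ^ j)" for n
    unfolding sum_over_walks[where n=n and N=n and g="?m" and C=three_quadrants and R="\<lambda>p. fst p \<ge> 0 \<and> snd p \<ge> 0", OF order_refl]
    by (subst sum_box_nonneg) (auto simp: mult.assoc)
  have "3 * (\<Sum>w | w \<in> {w \<in> diagonal_walks three_quadrants. fst (last w) \<ge> 0 \<and> snd (last w) \<ge> 0}
      \<and> length w = Suc n. ?m (last w))
    = (\<Sum>w | w \<in> diagonal_walks quadrant \<and> length w = Suc n. ?m (last w))
      + 3 * poly2_at a b (fps_nth P_ser n)" for n
    unfolding Q C by (subst eval2_P_sum[of n n n])
      (simp_all add: P_coeff_def of_rat_diff of_rat_divide sum_distrib_left sum.distrib[symmetric] algebra_simps)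
  then have "3 * walk_gf {w \<in> diagonal_walks three_quadrants. fst (last w) \<ge> 0 \<and> snd (last w) \<ge> 0} a b
      = Q_gf a b + 3 * eval2 P_ser a b"
    unfolding eval2_alt walk_gf_def Q_gf_def fps_to_fls_numeral[symmetric]
      fls_times_fps_to_fls[symmetric] fps_to_fls_plus[symmetric] fps_to_fls_eq_iff
    by (intro fps_ext) (simp add: numeral_fps_const)
  then show ?thesis by (simp add: field_simps)
qed

lemma walk_gf_negative_part:
  fixes a b :: "'a::field_char_0"
  assumes "a \<noteq> 0"
  shows "walk_gf {w \<in> diagonal_walks three_quadrants. fst (last w) < 0} a b
    = - (1/3) * (1 / fls_const a)^2 * Q_gf (1 / a) b + 1 / fls_const a * eval2 M_ser (1 / a) b"
proof -
  interpret c: field_hom "fls_const :: 'a \<Rightarrow> 'a fls" by (rule fls_const_hom)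
  let ?m = "\<lambda>a p. a powi fst p * b powi snd p"
  have Q: "(\<Sum>w | w \<in> diagonal_walks quadrant \<and> length w = Suc n. ?m (1/a) (last w))
    = (\<Sum>j\<le>Suc n. \<Sum>k\<le>Suc n. of_rat (quad_count n (int k) (int j)) * (1/a) ^ k * b ^ j)" for n
  proof -
    let ?B = "{-int (Suc n)..int (Suc n)}"
    have "(\<Sum>w | w \<in> diagonal_walks quadrant \<and> length w = Suc n. ?m (1/a) (last w))
      = (\<Sum>p \<in> ?B \<times> ?B. of_rat (quad_count n (fst p) (snd p)) * ?m (1/a) p)"
      using sum_over_walks[where n=n and N="Suc n" and g="?m (1/a)" and C=quadrant and R="\<lambda>_. True"] by simp
    then show ?thesis
      by (simp only:, subst sum_box_nonneg) (auto simp: quad_count_0 mult.assoc simp del: sum.atMost_Suc)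
  qed
  have C: "(\<Sum>w | w \<in> {w \<in> diagonal_walks three_quadrants. fst (last w) < 0}
      \<and> length w = Suc n. ?m a (last w))
    = (\<Sum>j\<le>Suc n. \<Sum>k\<le>Suc n. of_rat (cone_count n (-1 - int k) (int j)) * (1/a) ^ Suc k * b ^ j)" for n
  proof -
    have p: "a powi (-1 - int k) = (1/a) ^ Suc k" for k
    proof -
      have "a powi (-1 - int k) = inverse (a powi int (Suc k))"
        by (metis diff_conv_add_uminus minus_add_distrib of_nat_Suc power_int_minus add.commute)
      then show ?thesis by (simp add: power_int_of_nat inverse_eq_divide power_divide del: of_nat_Suc)
    qed
    have z: "cone_count n i j = 0" if "i \<le> - int (Suc n)" for i j
      using walk_count_bounded[of three_quadrants n i j] that by auto
    show ?thesis
      unfolding sum_over_walks[where n=n and N="Suc n" and g="?m a" and C=three_quadrants and R="\<lambda>p. fst p < 0", OF le_SucI[OF order_refl]]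
      by (subst sum_box_negative) (auto simp: mult.assoc p z cone_count_0 simp del: power_Suc of_nat_Suc)
  qed
  have M: "poly2_at (1/a) b (fps_nth M_ser n) = (\<Sum>j\<le>Suc n. \<Sum>k\<le>Suc n.
      of_rat (cone_count n (-1 - int k) (int j)) * (1/a) ^ k * b ^ j)
      + 1/3 * (1/a) * (\<Sum>j\<le>Suc n. \<Sum>k\<le>Suc n. of_rat (quad_count n (int k) (int j)) * (1/a) ^ k * b ^ j)" for n
  proof -
    let ?q = "\<lambda>k j. of_rat (quad_count n k (int j)) * b ^ j"
    have q0: "(\<Sum>k\<le>Suc n. ?q (int k - 1) j * (1/a) ^ k) = (1/a) * (\<Sum>k\<le>Suc n. ?q (int k) j * (1/a) ^ k)" for j
    proof -
      have "quad_count n (1 + int n) (int j) = 0" using walk_count_bounded[of quadrant n "1 + int n" "int j"] by auto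
      moreover have "(\<Sum>k\<le>Suc n. ?q (int k - 1) j * (1/a) ^ k)
          = (1/a) * (\<Sum>k\<le>n. ?q (int k) j * (1/a) ^ k)"
        by (subst sum.atMost_Suc_shift) (simp add: quad_count_0 sum_distrib_left mult_ac)
      ultimately show ?thesis by simp
    qed
    have "poly2_at (1/a) b (fps_nth M_ser n) = (\<Sum>j\<le>Suc n. \<Sum>k\<le>Suc n.
      of_rat (cone_count n (-1 - int k) (int j)) * (1/a) ^ k * b ^ j)
      + 1/3 * (\<Sum>j\<le>Suc n. \<Sum>k\<le>Suc n. ?q (int k - 1) j * (1/a) ^ k)"
      by (subst eval2_M_sum[of n "Suc n" "Suc n"])
        (simp_all add: M_coeff_def of_rat_add of_rat_divide sum_distrib_left sum.distrib[symmetric]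
           algebra_simps del: sum.atMost_Suc)
    also have "(\<Sum>j\<le>Suc n. \<Sum>k\<le>Suc n. ?q (int k - 1) j * (1/a) ^ k)
      = (1/a) * (\<Sum>j\<le>Suc n. \<Sum>k\<le>Suc n. of_rat (quad_count n (int k) (int j)) * (1/a) ^ k * b ^ j)"
      unfolding q0 by (subst sum_distrib_left[symmetric]) (simp only: mult_ac)
    finally show ?thesis by (simp only: mult.assoc)
  qed
  have "(\<Sum>w | w \<in> {w \<in> diagonal_walks three_quadrants. fst (last w) < 0}
      \<and> length w = Suc n. ?m a (last w))
    = - (1/3) * (1/a)^2 * (\<Sum>w | w \<in> diagonal_walks quadrant \<and> length w = Suc n. ?m (1/a) (last w))
      + (1/a) * poly2_at (1/a) b (fps_nth M_ser n)" for n
  proof -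
    have "(\<Sum>j\<le>Suc n. \<Sum>k\<le>Suc n. of_rat (cone_count n (-1 - int k) (int j)) * (1/a) ^ Suc k * b ^ j)
      = (1/a) * (\<Sum>j\<le>Suc n. \<Sum>k\<le>Suc n. of_rat (cone_count n (-1 - int k) (int j)) * (1/a) ^ k * b ^ j)"
      by (simp add: sum_distrib_left mult_ac del: sum.atMost_Suc)
    then show ?thesis unfolding Q C M by (simp add: algebra_simps power2_eq_square del: sum.atMost_Suc)
  qed
  then have "walk_gf {w \<in> diagonal_walks three_quadrants. fst (last w) < 0} a b
    = fls_const (- (1/3) * (1/a)^2) * Q_gf (1 / a) b + fls_const (1/a) * eval2 M_ser (1 / a) b"
    unfolding eval2_alt walk_gf_def Q_gf_def fps_const_to_fls[symmetric]
      fls_times_fps_to_fls[symmetric] fps_to_fls_plus[symmetric] fps_to_fls_eq_iff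
    by (intro fps_ext) simp
  moreover have "fls_const (1/a) = 1 / fls_const a"
    by (simp only: fls_const_divide_const[symmetric] fls_const_1)
  moreover have "fls_const (- (1/3) * (1/a)^2) = - (1/3) * (1 / fls_const a)^2"
    by (simp only: c.hom_mult c.hom_uminus c.hom_power fls_const_divide_const[symmetric] fls_const_1
        fls_const_numeral)
  ultimately show ?thesis by simp
qed

lemma coeff_A_ser: "coeff (fps_nth A_ser n) k = M_coeff n (int k) 0"
  using M_ser_coeffs[of n] by (simp add: A_ser_def has_coeffs_def)

section \<open>Algebraic identities on the kernel curve\<close>

text \<open>The equation of \<open>V\<close> in the coordinates \<open>m\<close> and \<open>e\<close>. It is odd in \<open>m\<close> and linear in \<open>e\<close>: changing the
  sign of \<open>e\<close> changes the sign of the roots.\<close>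

lemma cubic_in_m:
  fixes V T X m e :: "'a::field_char_0"
  assumes "V \<noteq> -1" and "X \<noteq> -1" and m: "m = (1 - V) / (1 + V)" and e: "e = (X - 1) / (X + 1)"
    and cubic: "1 - T + 3 * V + V * T = X * V^2 * (3 + V + T - V * T)"
  shows "2 * e * (1 - T * m^2) = m * (3 - T - (1 + T) * m^2)"
proof -
  have nz: "1 + V \<noteq> 0" "X + 1 \<noteq> 0" using assms(1,2) by (simp_all add: eq_neg_iff_add_eq_0 add.commute)
  have mV: "m * (1 + V) = 1 - V" and eX: "e * (X + 1) = X - 1" using nz by (simp_all add: m e)
  have "(1 + V)^3 * (X + 1) * (2 * e * (1 - T * m^2))
      = 2 * (e * (X + 1)) * ((1 + V)^2 - T * (m * (1 + V))^2) * (1 + V)"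
    by (simp add: algebra_simps power2_eq_square power3_eq_cube)
  also have "\<dots> = 2 * (X - 1) * ((1 + V)^2 - T * (1 - V)^2) * (1 + V)" unfolding mV eX ..
  also have "\<dots> = (X + 1) * (1 - V) * ((3 - T) * (1 + V)^2 - (1 + T) * (1 - V)^2)"
    using cubic by Groebner_Basis.algebra
  also have "\<dots> = (X + 1) * (m * (1 + V)) * ((3 - T) * (1 + V)^2 - (1 + T) * (m * (1 + V))^2)"
    unfolding mV ..
  also have "\<dots> = (1 + V)^3 * (X + 1) * (m * (3 - T - (1 + T) * m^2))"
    by (simp add: algebra_simps power2_eq_square power3_eq_cube)
  finally show ?thesis using nz by simp
qed

text \<open>The part of the closed form of \<open>t\<^sup>2 (x + 1/x) A(x)\<close> that is not elementary, in terms of \<open>n = m\<^sup>2\<close>. Its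
  only poles are \<open>n = 1\<close> and \<open>n = 1/T\<close>.\<close>

definition h_fun :: "'a::field_char_0 \<Rightarrow> 'a \<Rightarrow> 'a" where
  "h_fun z n = ((1 + z^2)^2 - (z^2 - 1) * (z^2 + 3) / (1 - n) - (z^2 - 1)^2 / (1 - z^2 * n)) / (12 * z^3)"

text \<open>The value of \<open>t\<^sup>2 M\<^bsub>1,0\<^esub>\<close>.\<close>

definition g0_fun :: "'a::field_char_0 \<Rightarrow> 'a" where
  "g0_fun z = 1/6 - (1 + z^2)^2 / (24 * z^3)"

definition R_num :: "'a::comm_ring_1 \<Rightarrow> 'a \<Rightarrow> 'a" where
  "R_num z v = v * (v * z^2 - z^2 - v - 3) * N_poly z v"

definition R_den :: "'a::comm_ring_1 \<Rightarrow> 'a \<Rightarrow> 'a" where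
  "R_den z v = 48 * z^3 * (v + 1)^2 * (v * z - v - z - 1)^2"

lemma N_poly_in_m:
  fixes z v m :: "'a::field_char_0"
  assumes "m * (1 + v) = 1 - v"
  shows "N_poly z v * (1 + m)^3
    = 4 * (2*z*(z^2+1)*m^3 - (3*z^4+2*z^2-1)*m^2 - 2*z*(3*z^2+7)*m + z^4 - 6*z^2 - 7)"
proof -
  have v: "v * (1 + m) = 1 - m" using assms by (simp add: algebra_simps)
  have "N_poly z v * (1 + m)^3 = - (z^2 + 3) * (z - 1)^2 * (v * (1 + m))^3
     + (z - 1) * (3*z^3 + 9*z^2 + z + 11) * (v * (1 + m))^2 * (1 + m)
     + (z + 1) * (3*z^3 - 9*z^2 + z - 11) * (v * (1 + m)) * (1 + m)^2
     - (z^2 + 3) * (z + 1)^2 * (1 + m)^3"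
    unfolding N_poly_def by Groebner_Basis.algebra
  also have "\<dots> = 4 * (2*z*(z^2+1)*m^3 - (3*z^4+2*z^2-1)*m^2 - 2*z*(3*z^2+7)*m + z^4 - 6*z^2 - 7)"
    unfolding v by Groebner_Basis.algebra
  finally show ?thesis .
qed

text \<open>Although \<open>R_num\<close> and \<open>R_den\<close> are not even in \<open>m\<close>, their quotient times \<open>1 + x\<close> becomes so once a multiple
  of \<open>e\<close> is split off, because the cubic equation trades odd powers of \<open>m\<close> for \<open>e\<close>.\<close>

lemma h_fun_eq:
  fixes z v m e X :: "'a::field_char_0"
  assumes m: "m = (1 - v) / (1 + v)" and e: "e = (X - 1) / (X + 1)"
    and cubic: "1 - z^2 + 3 * v + v * z^2 = X * v^2 * (3 + v + z^2 - v * z^2)"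
    and nz: "v \<noteq> -1" "X \<noteq> -1" "z \<noteq> 0" "v \<noteq> 0" "1 - z^2 * m^2 \<noteq> 0" "v * z - v - z - 1 \<noteq> 0"
  shows "(1 + X) * (R_num z v / R_den z v) = h_fun z (m^2) - e / 6 + 1/6 - g0_fun z"
proof -
  define a where "a = 1 + z^2"
  let ?N = "2*z*(z^2+1)*m^3 - (3*z^4+2*z^2-1)*m^2 - 2*z*(3*z^2+7)*m + z^4 - 6*z^2 - 7"
  have v1: "1 + v \<noteq> 0" and X1: "1 + X \<noteq> 0" using nz(1,2) by (simp_all add: eq_neg_iff_add_eq_0 add.commute)
  have mv: "m * (1 + v) = 1 - v" using v1 by (simp add: m)
  then have vm: "v * (1 + m) = 1 - m" and m1': "(1 + v) * (1 + m) = 2" by (simp_all add: algebra_simps)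
  have m1: "1 + m \<noteq> 0" using m1' by auto
  have m2: "1 - m \<noteq> 0" using vm nz(4) m1 by auto
  have D: "1 - z^2 * m^2 = (1 - z * m) * (1 + z * m)" by (simp add: algebra_simps power2_eq_square)
  have D1: "1 - z * m \<noteq> 0" and D2: "1 + z * m \<noteq> 0" using nz(5) unfolding D by auto
  have c: "2 * e * (1 - z^2 * m^2) = m * (3 - z^2 - (1 + z^2) * m^2)"
    by (rule cubic_in_m[OF nz(1,2) m e cubic])
  have e1: "(1 - e) * (1 + X) = 2"
  proof -
    have "e * (X + 1) = X - 1" using X1 by (simp add: e add.commute)
    then show ?thesis by (simp add: algebra_simps)
  qed
  have ee: "2 * (1 - e) * (1 - z^2 * m^2) = (2 + a * m) * (1 - m)^2"
    using c unfolding a_def by Groebner_Basis.algebra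
  have am: "2 + a * m \<noteq> 0"
  proof
    assume "2 + a * m = 0"
    then have "(1 - e) * (1 - z^2 * m^2) = 0" using ee by simp
    then have "1 - e = 0" using nz(5) by simp
    then show False using e1 by simp
  qed
  have num: "R_num z v * (1 + m)^5 = - 8 * (1 - m) * (2 + a * m) * ?N"
  proof -
    have "(v * z^2 - z^2 - v - 3) * (1 + m) = - 2 * (2 + a * m)"
      using vm unfolding a_def by Groebner_Basis.algebra
    moreover have "R_num z v * (1 + m)^5
        = (v * (1 + m)) * ((v * z^2 - z^2 - v - 3) * (1 + m)) * (N_poly z v * (1 + m)^3)"
      unfolding R_num_def by Groebner_Basis.algebra
    ultimately show ?thesis unfolding N_poly_in_m[OF mv] vm by Groebner_Basis.algebra
  qed
  have den: "R_den z v * (1 + m)^4 = 768 * z^3 * (1 + z * m)^2"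
  proof -
    have "(v * z - v - z - 1) * (1 + m) = - 2 * (1 + z * m)" using vm by Groebner_Basis.algebra
    moreover have "(v + 1) * (1 + m) = 2" using m1' by (simp add: add.commute)
    moreover have "R_den z v * (1 + m)^4
        = 48 * z^3 * ((v + 1) * (1 + m))^2 * ((v * z - v - z - 1) * (1 + m))^2"
      unfolding R_den_def by Groebner_Basis.algebra
    ultimately show ?thesis by Groebner_Basis.algebra
  qed
  have den0: "R_den z v \<noteq> 0" using den nz(3) D2 by auto
  define q where "q = R_num z v / R_den z v"
  have qR: "q * R_den z v = R_num z v" using den0 by (simp add: q_def)
  have "8 * (q * (96 * z^3 * (1 + z*m)^2 * (1 + m))) = 8 * (- (1 - m) * (2 + a * m) * ?N)"
  proof -
    have "8 * (q * (96 * z^3 * (1 + z*m)^2 * (1 + m))) = q * (768 * z^3 * (1 + z*m)^2) * (1 + m)"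
      by (simp add: algebra_simps)
    also have "\<dots> = (q * R_den z v) * (1 + m)^5"
      unfolding den[symmetric] by Groebner_Basis.algebra
    also have "\<dots> = - 8 * (1 - m) * (2 + a * m) * ?N"
      using qR num by simp
    finally show ?thesis by (simp only: mult.assoc mult_minus_left mult_minus_right)
  qed
  then have q: "q * (96 * z^3 * (1 + z*m)^2 * (1 + m)) = - (1 - m) * (2 + a * m) * ?N"
    by (rule mult_left_cancel[THEN iffD1, rotated]) simp
  define N where "N = ?N"
  have A: "(2 + a * m) * (1 - m)^2 * ((1 + X) * q) = 4 * ((1 - z * m) * (1 + z * m)) * q"
  proof -
    have "(2 + a * m) * (1 - m)^2 * ((1 + X) * q) = 2 * ((1 - e) * (1 + X)) * (1 - z^2 * m^2) * q"
      unfolding ee[symmetric] by (simp only: mult_ac)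
    then show ?thesis unfolding e1 D by simp
  qed
  have "((2 + a * m) * (1 - m) * (1 + z * m)) * ((1 + X) * q * (96 * z^3 * (1 - m) * (1 + m) * (1 + z * m)))
      = ((2 + a * m) * (1 - m)^2 * ((1 + X) * q)) * (96 * z^3 * (1 + m) * (1 + z * m)^2)"
    by (simp only: power2_eq_square mult_ac)
  also have "\<dots> = 4 * ((1 - z * m) * (1 + z * m)) * (q * (96 * z^3 * (1 + z*m)^2 * (1 + m)))"
    unfolding A by (simp only: mult_ac)
  also have "\<dots> = ((2 + a * m) * (1 - m) * (1 + z * m)) * (- 4 * (1 - z * m) * N)"
    unfolding q N_def[symmetric] by (simp add: algebra_simps)
  finally have G: "(1 + X) * q * (96 * z^3 * (1 - m) * (1 + m) * (1 + z * m)) = - 4 * (1 - z * m) * N"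
    using am m2 D2 by simp
  define p1 p2 where "p1 = 1 / (1 - m^2)" and "p2 = 1 / (1 - z^2 * m^2)"
  have "1 - m^2 = (1 - m) * (1 + m)" by (simp add: algebra_simps power2_eq_square)
  then have n0: "1 - m^2 \<noteq> 0" using m1 m2 by simp
  have p: "p1 * (1 - m^2) = 1" "p2 * (1 - z^2 * m^2) = 1" using n0 nz(5) by (simp_all add: p1_def p2_def)
  have h: "12 * z^3 * h_fun z (m^2) = (1 + z^2)^2 - (z^2 - 1) * (z^2 + 3) * p1 - (z^2 - 1)^2 * p2"
    using nz(3) by (simp add: h_fun_def p1_def p2_def)
  have g: "24 * z^3 * g0_fun z = 4 * z^3 - (1 + z^2)^2" using nz(3) by (simp add: g0_fun_def field_simps)
  define H where "H = h_fun z (m^2) - e / 6 + 1/6 - g0_fun z"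
  have "6 * H = 6 * h_fun z (m^2) - e + 1 - 6 * g0_fun z" by (simp add: H_def field_simps)
  then have "24 * z^3 * H = 2 * (12 * z^3 * h_fun z (m^2)) - 4 * z^3 * e + 4 * z^3 - 24 * z^3 * g0_fun z"
    by Groebner_Basis.algebra
  then have "24 * z^3 * H = 3 * (1 + z^2)^2 - 2 * (z^2 - 1) * (z^2 + 3) * p1 - 2 * (z^2 - 1)^2 * p2 - 4 * z^3 * e"
    unfolding h g by (simp add: algebra_simps)
  then have "H * (96 * z^3 * (1 - m^2) * (1 - z^2 * m^2))
      = 4 * (3 * (1 + z^2)^2 * ((1 - m^2) * (1 - z^2 * m^2))
        - 2 * (z^2 - 1) * (z^2 + 3) * (p1 * (1 - m^2)) * (1 - z^2 * m^2)
        - 2 * (z^2 - 1)^2 * (p2 * (1 - z^2 * m^2)) * (1 - m^2)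
        - 2 * z^3 * (1 - m^2) * (2 * e * (1 - z^2 * m^2)))"
    by Groebner_Basis.algebra
  also have "\<dots> = - 4 * (1 - z * m)^2 * N"
    unfolding p c N_def by Groebner_Basis.algebra
  finally have "H * (96 * z^3 * (1 - m^2) * (1 - z^2 * m^2)) = - 4 * (1 - z * m)^2 * N" .
  moreover have "(1 + X) * q * (96 * z^3 * (1 - m^2) * (1 - z^2 * m^2)) = - 4 * (1 - z * m)^2 * N"
  proof -
    have "(1 + X) * q * (96 * z^3 * (1 - m^2) * (1 - z^2 * m^2))
        = (1 + X) * q * (96 * z^3 * (1 - m) * (1 + m) * (1 + z * m)) * (1 - z * m)"
      unfolding D by (simp add: algebra_simps power2_eq_square)
    then show ?thesis unfolding G by Groebner_Basis.algebra
  qed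
  ultimately have "(1 + X) * q = H" using nz(3) n0 nz(5) by (metis (no_types, lifting) mult_eq_0_iff
      mult_right_cancel power_not_zero zero_neq_numeral)
  then show ?thesis by (simp add: q_def H_def)
qed

text \<open>The hypotheses say that \<open>m1\<close> and \<open>-m2\<close> are roots of the cubic for \<open>e = d\<close>, and that the sum of its roots is
  right for \<open>r\<close> to be the third one. The other two symmetric functions give the remaining claims.\<close>

lemma kernel_vieta:
  fixes T d m1 m2 r :: "'a::field_char_0"
  defines "a \<equiv> 1 + T" and "b \<equiv> 3 - T"
  assumes c1: "2 * d * (1 - T * m1^2) = m1 * (b - a * m1^2)"
    and c2: "- 2 * d * (1 - T * m2^2) = m2 * (b - a * m2^2)"
    and r: "a * (r + m1 - m2) = 2 * d * T"
    and nz: "m1 + m2 \<noteq> 0" "r \<noteq> 0" "a \<noteq> 0"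
  shows "2 * d * (1 - T * r^2) = r * (b - a * r^2)"
    and "(m1 - m2) * (a * (1 - T * r^2)) = - r * (T - 1)^2"
    and "m1 * m2 * (a * (1 - T * r^2)) = b - a * r^2"
proof -
  have "(m1 + m2) * (a * (m1^2 - m1 * m2 + m2^2) - 2 * d * T * (m1 - m2) - b) = 0"
    using c1 c2 by Groebner_Basis.algebra
  then have v1: "a * (m1^2 - m1 * m2 + m2^2) - 2 * d * T * (m1 - m2) - b = 0" using nz by simp
  have v2: "a * m1 * m2 * r = 2 * d" using v1 c1 r by Groebner_Basis.algebra
  have v3: "2 * d * (1 - T * r^2) = r * (b - a * r^2)"
  proof -
    have "a * (2 * d * (1 - T * r^2) - r * (b - a * r^2)) = 0" using v1 v2 r by Groebner_Basis.algebra
    then show ?thesis using nz by simp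
  qed
  then show "2 * d * (1 - T * r^2) = r * (b - a * r^2)" .
  show "(m1 - m2) * (a * (1 - T * r^2)) = - r * (T - 1)^2"
    using v3 r unfolding a_def b_def by Groebner_Basis.algebra
  have "r * (m1 * m2 * (a * (1 - T * r^2)) - (b - a * r^2)) = 0" using v2 v3 by Groebner_Basis.algebra
  then show "m1 * m2 * (a * (1 - T * r^2)) = b - a * r^2" using nz by simp
qed

text \<open>The factor that has to be excluded in \<open>kernel_mobius\<close>.\<close>

definition quad_factor :: "'a::comm_ring_1 \<Rightarrow> 'a \<Rightarrow> 'a \<Rightarrow> 'a" where
  "quad_factor T n r = - (T^5*n*r) + T^4*n^2*r^2 - 2*T^4*n^2*r + T^4*n^2 - 2*T^4*n*r^2 - 2*T^4*n*r
    + T^4*r^2 + 2*T^3*n^2*r^2 - 4*T^3*n^2*r + 2*T^3*n^2 - 4*T^3*n*r^2 + 4*T^3*n*r + 2*T^3*n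
    + 2*T^3*r^2 + 2*T^3*r + T^2*n^2*r^2 - 2*T^2*n^2*r + T^2*n^2 - 2*T^2*n*r^2 + 18*T^2*n*r
    - 4*T^2*n + T^2*r^2 - 4*T^2*r + T^2 - 3*T*n*r - 6*T*n - 6*T*r - 6*T + 9"

text \<open>By the cubic equation, \<open>1 - e\<^sup>2\<close> and \<open>1 - d\<^sup>2\<close> are rational functions of \<open>m\<^sup>2\<close> and \<open>r\<^sup>2\<close>. In these variables
  the kernel equation \<open>(1 - e\<^sup>2)(1 - d\<^sup>2) = 16 t\<^sup>2\<close> splits, owing to the equation of \<open>T\<close>, into the
  Moebius relation and one further factor.\<close>

lemma kernel_mobius:
  fixes T t2 d e m r :: "'a::field_char_0"
  defines "a \<equiv> 1 + T" and "b \<equiv> 3 - T"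
  assumes T: "256 * t2 * T^3 = (T - 1) * (T + 3)^3"
    and c3: "2 * e * (1 - T * m^2) = m * (b - a * m^2)"
    and cr: "2 * d * (1 - T * r^2) = r * (b - a * r^2)"
    and k: "(1 - e^2) * (1 - d^2) = 16 * t2"
    and nz: "quad_factor T (m^2) (r^2) \<noteq> 0"
  shows "T * a^2 * m^2 * r^2 - 4 * T * (m^2 + r^2) + a * b = 0"
proof -
  have sq: "4 * (1 - e^2) * (1 - T * m^2)^2 = (4 - a^2 * m^2) * (1 - m^2)^2"
    if "2 * e * (1 - T * m^2) = m * (b - a * m^2)" for e m
  proof -
    have "4 * (1 - e^2) * (1 - T * m^2)^2 = 4 * (1 - T * m^2)^2 - (2 * e * (1 - T * m^2))^2"
      by (simp add: algebra_simps power2_eq_square)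
    also have "\<dots> = 4 * (1 - T * m^2)^2 - (m * (b - a * m^2))^2" unfolding that ..
    also have "\<dots> = (4 - a^2 * m^2) * (1 - m^2)^2" unfolding a_def b_def by Groebner_Basis.algebra
    finally show ?thesis .
  qed
  have "T^3 * ((4 - a^2 * m^2) * (1 - m^2)^2) * ((4 - a^2 * r^2) * (1 - r^2)^2)
      = 16 * T^3 * ((1 - e^2) * (1 - d^2)) * ((1 - T * m^2)^2 * (1 - T * r^2)^2)"
    unfolding sq[OF c3, symmetric] sq[OF cr, symmetric] by (simp add: algebra_simps)
  also have "\<dots> = (256 * t2 * T^3) * ((1 - T * m^2)^2 * (1 - T * r^2)^2)"
    unfolding k by (simp add: algebra_simps)
  also have "\<dots> = (T - 1) * (T + 3)^3 * ((1 - T * m^2)^2 * (1 - T * r^2)^2)" unfolding T ..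
  finally have f: "T^3 * ((4 - a^2 * m^2) * (1 - m^2)^2) * ((4 - a^2 * r^2) * (1 - r^2)^2)
      - (T - 1) * (T + 3)^3 * ((1 - T * m^2)^2 * (1 - T * r^2)^2) = 0" by simp
  have "T^3 * ((4 - a^2 * N) * (1 - N)^2) * ((4 - a^2 * R) * (1 - R)^2)
      - (T - 1) * (T + 3)^3 * ((1 - T * N)^2 * (1 - T * R)^2)
    = (T * a^2 * N * R - 4 * T * (N + R) + a * b) * quad_factor T N R" for N R
    unfolding a_def b_def quad_factor_def by Groebner_Basis.algebra
  from this[of "m^2" "r^2"] f show ?thesis using nz by simp
qed

text \<open>The symmetric functions of \<open>m1\<^sup>2\<close> and \<open>m2\<^sup>2\<close> that occur as denominators are, up to a common square,
  polynomials in \<open>r\<^sup>2\<close>.\<close>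

lemma one_minus_products:
  fixes T d m1 m2 r :: "'a::field_char_0"
  defines "a \<equiv> 1 + T" and "b \<equiv> 3 - T"
  assumes s: "(m1 - m2) * (a * (1 - T * r^2)) = - r * (T - 1)^2"
    and p: "m1 * m2 * (a * (1 - T * r^2)) = b - a * r^2"
  shows "(1 - m1^2) * (1 - m2^2) * (a * (1 - T * r^2))^2 = (T - 1)^2 * (a^2 * r^2 - 4) * (r^2 - 1)"
    and "(1 - T * m1^2) * (1 - T * m2^2) * (a * (1 - T * r^2))^2 = (T - 1)^4 * (1 - T * r^2)"
    and "(m1^2 + m2^2) * (a * (1 - T * r^2))^2 = r^2 * (T - 1)^4 + 2 * a * (b - a * r^2) * (1 - T * r^2)"
    and "(m1 + m2)^2 * (a * (1 - T * r^2))^2 = (a^2 * r^2 - 4) * (4 * T * r^2 - a * b)"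
  using s p unfolding a_def b_def by Groebner_Basis.algebra+

text \<open>Both sides are rational functions of \<open>R = r\<^sup>2\<close>: the left one by the Moebius relation, the right one because
  it is symmetric in \<open>m1\<^sup>2\<close> and \<open>m2\<^sup>2\<close>. The poles at \<open>n = 1\<close> and at \<open>n = 1/T\<close> are treated separately.\<close>

lemma kernel_h_additive:
  fixes z T m1 m2 m3 r :: "'a::field_char_0"
  defines "a \<equiv> 1 + T" and "b \<equiv> 3 - T"
  assumes T: "T = z^2"
    and s: "(m1 - m2) * (a * (1 - T * r^2)) = - r * (T - 1)^2"
    and p: "m1 * m2 * (a * (1 - T * r^2)) = b - a * r^2"
    and mob: "T * a^2 * m3^2 * r^2 - 4 * T * (m3^2 + r^2) + a * b = 0"
    and nz: "z \<noteq> 0" "T \<noteq> 1" "T \<noteq> -3" "a \<noteq> 0" "1 - T * r^2 \<noteq> 0" "a^2 * r^2 - 4 \<noteq> 0" "r^2 \<noteq> 1"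
  shows "h_fun z (m3^2) = h_fun z (m1^2) + h_fun z (m2^2)"
proof -
  define R D where "R = r^2" and "D = 1 - T * R"
  have T0: "T \<noteq> 0" and T1: "T - 1 \<noteq> 0" and T3: "T + 3 \<noteq> 0" and D0: "D \<noteq> 0" and E0: "a^2 * R - 4 \<noteq> 0"
    and R1: "R - 1 \<noteq> 0"
    using nz T by (auto simp: D_def R_def eq_neg_iff_add_eq_0)
  note om = one_minus_products[of m1 m2 T r, folded a_def b_def, OF s p, folded R_def, folded D_def]
  have aD: "a * D \<noteq> 0" using nz D0 by simp
  have n12: "1 - m1^2 \<noteq> 0" "1 - m2^2 \<noteq> 0"
  proof -
    have "(T - 1)^2 * (a^2 * R - 4) * (R - 1) \<noteq> 0" using T1 E0 R1 by simp
    then show "1 - m1^2 \<noteq> 0" "1 - m2^2 \<noteq> 0" unfolding om(1)[symmetric] by auto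
  qed
  have t12: "1 - T * m1^2 \<noteq> 0" "1 - T * m2^2 \<noteq> 0"
  proof -
    have "(T - 1)^4 * D \<noteq> 0" using T1 D0 by simp
    then show "1 - T * m1^2 \<noteq> 0" "1 - T * m2^2 \<noteq> 0" unfolding om(2)[symmetric] by auto
  qed
  have n3: "(1 - m3^2) * (T * (a^2 * R - 4)) = - (T - 1) * (T + 3) * D"
    and t3: "(1 - T * m3^2) * (a^2 * R - 4) = (T - 1)^2 * (R - 1)"
    using mob unfolding D_def R_def a_def b_def by Groebner_Basis.algebra+
  have n30: "1 - m3^2 \<noteq> 0" and t30: "1 - T * m3^2 \<noteq> 0" using n3 t3 T0 T1 T3 D0 E0 R1 by auto
  define i where "i n = 1 / (1 - n)" for n :: 'a
  define j where "j n = 1 / (1 - T * n)" for n :: 'a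
  have h: "12 * z^3 * h_fun z n = a^2 - (T - 1) * (T + 3) * i n - (T - 1)^2 * j n" for n
    using nz(1) by (simp add: h_fun_def i_def j_def a_def T)
  have i3: "i (m3^2) * (T - 1) * (T + 3) * D = - T * (a^2 * R - 4)"
    using n3 n30 by (simp add: i_def field_simps)
  have j3: "j (m3^2) * (T - 1)^2 * (R - 1) = a^2 * R - 4"
    using t3 t30 by (simp add: j_def field_simps)
  have inv_add: "(1 / u + 1 / v) * (u * v) = u + v" if "u \<noteq> 0" "v \<noteq> 0" for u v :: 'a
    using that by (simp add: field_simps)
  have "(i (m1^2) + i (m2^2)) * ((1 - m1^2) * (1 - m2^2)) = 2 - (m1^2 + m2^2)"
    unfolding i_def inv_add[OF n12] by simp
  then have "(i (m1^2) + i (m2^2)) * ((1 - m1^2) * (1 - m2^2) * (a * D)^2) = 2 * (a * D)^2 - (m1^2 + m2^2) * (a * D)^2"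
    by Groebner_Basis.algebra
  then have i12: "(i (m1^2) + i (m2^2)) * ((T - 1)^2 * (a^2 * R - 4) * (R - 1))
      = 2 * (a * D)^2 - (R * (T - 1)^4 + 2 * a * (b - a * R) * D)"
    unfolding om(1) om(3) .
  have "(j (m1^2) + j (m2^2)) * ((1 - T * m1^2) * (1 - T * m2^2)) = 2 - T * (m1^2 + m2^2)"
    unfolding j_def inv_add[OF t12] by (simp add: algebra_simps)
  then have "(j (m1^2) + j (m2^2)) * ((1 - T * m1^2) * (1 - T * m2^2) * (a * D)^2)
      = 2 * (a * D)^2 - T * ((m1^2 + m2^2) * (a * D)^2)"
    by Groebner_Basis.algebra
  then have j12: "(j (m1^2) + j (m2^2)) * ((T - 1)^4 * D)
      = 2 * (a * D)^2 - T * (R * (T - 1)^4 + 2 * a * (b - a * R) * D)"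
    unfolding om(2) om(3) .
  define I where "I = (T - 1) * (T + 3) * (i (m1^2) + i (m2^2))"
  define J where "J = (T - 1)^2 * (j (m1^2) + j (m2^2))"
  have "(T - 1)^2 * (I * ((a^2 * R - 4) * (R - 1))
      - (T + 3) * (4 * a - (2 * a * (1 + 3 * T) + (T - 1)^3) * R + 2 * a^2 * T * R^2)) = 0"
    using i12 unfolding I_def D_def a_def b_def by Groebner_Basis.algebra
  then have I: "I * ((a^2 * R - 4) * (R - 1))
      = (T + 3) * (4 * a - (2 * a * (1 + 3 * T) + (T - 1)^3) * R + 2 * a^2 * T * R^2)" using T1 by simp
  have "(T - 1)^2 * (J * D - (2 * a * D - T * R * (T - 1)^2)) = 0"
    using j12 unfolding J_def D_def a_def b_def by Groebner_Basis.algebra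
  then have J: "J * D = 2 * a * D - T * R * (T - 1)^2" using T1 by simp
  define I3 where "I3 = i (m3^2) * (T - 1) * (T + 3)"
  define J3 where "J3 = j (m3^2) * (T - 1)^2"
  have "D * (a^2 * R - 4) * (R - 1) * (I + J - a^2 - I3 - J3)
      = (I * ((a^2 * R - 4) * (R - 1))) * D + (J * D) * (a^2 * R - 4) * (R - 1)
        - a^2 * (D * (a^2 * R - 4) * (R - 1)) - (I3 * D) * (a^2 * R - 4) * (R - 1)
        - (J3 * (R - 1)) * D * (a^2 * R - 4)"
    by (simp add: algebra_simps)
  also have "\<dots> = 0"
    unfolding I J i3[folded I3_def] j3[folded J3_def] unfolding D_def a_def by Groebner_Basis.algebra
  finally have "I + J - a^2 - I3 - J3 = 0" using D0 E0 R1 by simp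
  moreover have "12 * z^3 * (h_fun z (m3^2) - (h_fun z (m1^2) + h_fun z (m2^2))) = I + J - a^2 - I3 - J3"
    unfolding right_diff_distrib distrib_left h I_def J_def I3_def J3_def by (simp add: algebra_simps)
  ultimately show ?thesis using nz(1) by simp
qed

text \<open>The difference is antisymmetric, hence \<open>m1 + m2\<close> times a rational function of \<open>R = r\<^sup>2\<close> and \<open>d\<close>. The
  hypothesis \<open>m3\<close> replaces \<open>m1 + m2\<close> by a multiple of the value \<open>m3\<close> of \<open>m\<close> at \<open>Y\<^sup>2\<close>.\<close>

lemma kernel_h_difference:
  fixes z T m1 m2 m3 r d :: "'a::field_char_0"
  defines "a \<equiv> 1 + T" and "b \<equiv> 3 - T"
  assumes T: "T = z^2"
    and s: "(m1 - m2) * (a * (1 - T * r^2)) = - r * (T - 1)^2"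
    and p: "m1 * m2 * (a * (1 - T * r^2)) = b - a * r^2"
    and d: "2 * d * (1 - T * r^2) = r * (b - a * r^2)"
    and mob: "T * a^2 * m3^2 * r^2 - 4 * T * (m3^2 + r^2) + a * b = 0"
    and m3: "m3 * (z * (4 - a^2 * r^2)) = (m1 + m2) * (a * (1 - T * r^2))"
    and nz: "z \<noteq> 0" "T \<noteq> 1" "T \<noteq> -3" "a \<noteq> 0" "1 - T * r^2 \<noteq> 0" "a^2 * r^2 - 4 \<noteq> 0" "r^2 \<noteq> 1"
      "d \<noteq> 0"
  shows "m3 * ((b - a * m3^2) / (12 * (1 - T * m3^2)) - a^2 * (1 - m3^2) / (4 * (b - T * a * m3^2)))
    = (h_fun z (m1^2) - h_fun z (m2^2)) / d"
proof -
  define R D where "R = r^2" and "D = 1 - T * R"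
  define E where "E = a^2 * R - 4"
  have T0: "T \<noteq> 0" and T1: "T - 1 \<noteq> 0" and T3: "T + 3 \<noteq> 0" and D0: "D \<noteq> 0" and E0: "E \<noteq> 0"
    and R1: "R - 1 \<noteq> 0"
    using nz T by (auto simp: D_def R_def E_def eq_neg_iff_add_eq_0)
  have Br: "b - a * R \<noteq> 0" and r0: "r \<noteq> 0" using d nz(8) D0 unfolding D_def R_def by auto
  note om = one_minus_products[of m1 m2 T r, folded a_def b_def, OF s p, folded R_def, folded D_def, folded E_def]
  have n12: "1 - m1^2 \<noteq> 0" "1 - m2^2 \<noteq> 0"
  proof -
    have "(T - 1)^2 * E * (R - 1) \<noteq> 0" using T1 E0 R1 by simp
    then show "1 - m1^2 \<noteq> 0" "1 - m2^2 \<noteq> 0" unfolding om(1)[symmetric] by auto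
  qed
  have t12: "1 - T * m1^2 \<noteq> 0" "1 - T * m2^2 \<noteq> 0"
  proof -
    have "(T - 1)^4 * D \<noteq> 0" using T1 D0 by simp
    then show "1 - T * m1^2 \<noteq> 0" "1 - T * m2^2 \<noteq> 0" unfolding om(2)[symmetric] by auto
  qed
  have n3: "(1 - m3^2) * (T * E) = - (T - 1) * (T + 3) * D"
    and t3: "(1 - T * m3^2) * E = (T - 1)^2 * (R - 1)"
    and b3: "(b - a * m3^2) * (T * E) = (T - 1)^2 * (b - a * T * R)"
    and c3: "(b - T * a * m3^2) * E = (T - 1) * (T + 3) * (b - a * R)"
    using mob unfolding D_def R_def E_def a_def b_def by Groebner_Basis.algebra+
  have nz3: "1 - T * m3^2 \<noteq> 0" "b - T * a * m3^2 \<noteq> 0" using t3 c3 T1 T3 E0 R1 Br by auto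
  have f1: "(b - a * m3^2) / (12 * (1 - T * m3^2)) = (b - a * T * R) / (12 * T * (R - 1))"
  proof -
    have "(T - 1)^2 * E * ((b - a * m3^2) * (T * (R - 1)) - (b - a * T * R) * (1 - T * m3^2)) = 0"
      using t3 b3 by Groebner_Basis.algebra
    then have "(b - a * m3^2) * (T * (R - 1)) = (b - a * T * R) * (1 - T * m3^2)" using T1 E0 by simp
    then have "(b - a * m3^2) * (12 * T * (R - 1)) = (b - a * T * R) * (12 * (1 - T * m3^2))"
      by Groebner_Basis.algebra
    then show ?thesis using nz3 T0 R1 by (subst frac_eq_eq) auto
  qed
  have f2: "a^2 * (1 - m3^2) / (4 * (b - T * a * m3^2)) = - (a^2 * D / (4 * T * (b - a * R)))"
  proof -
    have "(T - 1) * (T + 3) * E * ((1 - m3^2) * (T * (b - a * R)) + D * (b - T * a * m3^2)) = 0"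
      using n3 c3 by Groebner_Basis.algebra
    then have "(1 - m3^2) * (T * (b - a * R)) = - (D * (b - T * a * m3^2))"
      using T1 T3 E0 by (simp add: eq_neg_iff_add_eq_0)
    then have "(a^2 * (1 - m3^2)) * (4 * T * (b - a * R)) = (- (a^2 * D)) * (4 * (b - T * a * m3^2))"
      by Groebner_Basis.algebra
    then show ?thesis unfolding minus_divide_left using nz3 T0 Br by (subst frac_eq_eq) auto
  qed
  define i where "i = 1 / ((1 - m1^2) * (1 - m2^2))"
  define j where "j = 1 / ((1 - T * m1^2) * (1 - T * m2^2))"
  have i: "i * ((T - 1)^2 * E * (R - 1)) = (a * D)^2"
    using n12 unfolding om(1)[symmetric] i_def by simp
  have j: "j * (T - 1)^4 = a^2 * D"
  proof -
    have "j * ((T - 1)^4 * D) = (a * D)^2" using t12 unfolding om(2)[symmetric] j_def by simp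
    then have "D * (j * (T - 1)^4 - a^2 * D) = 0" by Groebner_Basis.algebra
    then show ?thesis using D0 by simp
  qed
  have inv_diff: "1 / u - 1 / v = (v - u) * (1 / (u * v))" if "u \<noteq> 0" "v \<noteq> 0" for u v :: 'a
    using that by (simp add: field_simps)
  have "1 / (1 - m1^2) - 1 / (1 - m2^2) = (m1^2 - m2^2) * i"
    and "1 / (1 - T * m1^2) - 1 / (1 - T * m2^2) = T * (m1^2 - m2^2) * j"
    unfolding inv_diff[OF n12] inv_diff[OF t12] i_def j_def by (simp_all add: right_diff_distrib)
  then have hd: "12 * z^3 * (h_fun z (m1^2) - h_fun z (m2^2))
      = - (m1^2 - m2^2) * ((T - 1) * (T + 3) * i + (T - 1)^2 * T * j)"
    using nz(1) unfolding h_fun_def T[symmetric] right_diff_distrib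
    by (simp add: diff_divide_distrib right_diff_distrib) (Groebner_Basis.algebra)
  have "(T - 1)^2 * E * (R - 1) * ((T - 1) * (T + 3) * i + (T - 1)^2 * T * j)
      = (T - 1) * (T + 3) * (i * ((T - 1)^2 * E * (R - 1))) + T * E * (R - 1) * (j * (T - 1)^4)"
    by Groebner_Basis.algebra
  also have "\<dots> = a^2 * D * ((T - 1) * (T + 3) * D + T * E * (R - 1))"
    unfolding i j by Groebner_Basis.algebra
  finally have ij: "(T - 1)^2 * E * (R - 1) * ((T - 1) * (T + 3) * i + (T - 1)^2 * T * j)
      = a^2 * D * ((T - 1) * (T + 3) * D + T * E * (R - 1))" .
  have md: "(m1^2 - m2^2) * (a * (b - a * R)) = - 2 * d * (m1 + m2) * (T - 1)^2"
  proof -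
    have "D * r * ((m1^2 - m2^2) * (a * (b - a * R)) + 2 * d * (m1 + m2) * (T - 1)^2) = 0"
      using s d unfolding D_def R_def by Groebner_Basis.algebra
    then show ?thesis using D0 r0 by (simp add: eq_neg_iff_add_eq_0)
  qed
  have m3': "m3 * (z * E) = - (m1 + m2) * (a * D)" using m3 unfolding E_def D_def R_def by Groebner_Basis.algebra
  define q where "q = (h_fun z (m1^2) - h_fun z (m2^2)) / d"
  have qd: "q * d = h_fun z (m1^2) - h_fun z (m2^2)" using nz(8) by (simp add: q_def)
  have "(12 * z^3 * (q * d)) * (a * (b - a * R)) * (E * (R - 1))
      = - ((m1^2 - m2^2) * (a * (b - a * R))) * ((T - 1) * (T + 3) * i + (T - 1)^2 * T * j) * (E * (R - 1))"
    unfolding qd hd by Groebner_Basis.algebra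
  also have "\<dots> = 2 * d * (m1 + m2) * ((T - 1)^2 * E * (R - 1) * ((T - 1) * (T + 3) * i + (T - 1)^2 * T * j))"
    unfolding md by Groebner_Basis.algebra
  also have "\<dots> = 2 * d * (m1 + m2) * (a^2 * D * ((T - 1) * (T + 3) * D + T * E * (R - 1)))"
    unfolding ij ..
  also have "\<dots> = - 2 * d * a * (m3 * (z * E)) * ((T - 1) * (T + 3) * D + T * E * (R - 1))"
    unfolding m3' by Groebner_Basis.algebra
  finally have "z * d * a * E * (12 * z^2 * q * (b - a * R) * (R - 1)
      + 2 * m3 * ((T - 1) * (T + 3) * D + T * E * (R - 1))) = 0"
    by Groebner_Basis.algebra
  then have "12 * T * q * (b - a * R) * (R - 1) = - 2 * m3 * ((T - 1) * (T + 3) * D + T * E * (R - 1))"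
    using nz E0 unfolding T by (simp add: eq_neg_iff_add_eq_0)
  also have "\<dots> = m3 * ((b - a * T * R) * (b - a * R) + 3 * a^2 * D * (R - 1))"
    unfolding D_def E_def a_def b_def by Groebner_Basis.algebra
  finally have fin: "12 * T * q * (b - a * R) * (R - 1)
      = m3 * ((b - a * T * R) * (b - a * R) + 3 * a^2 * D * (R - 1))" .
  define s1 s2 where "s1 = (b - a * T * R) / (12 * T * (R - 1))" and "s2 = a^2 * D / (4 * T * (b - a * R))"
  have s1: "s1 * (12 * T * (R - 1)) = b - a * T * R" using T0 R1 by (simp add: s1_def)
  have s2: "s2 * (4 * T * (b - a * R)) = a^2 * D" using T0 Br by (simp add: s2_def)
  have "12 * T * (b - a * R) * (R - 1) * (m3 * (s1 + s2))
      = m3 * ((s1 * (12 * T * (R - 1))) * (b - a * R) + 3 * (s2 * (4 * T * (b - a * R))) * (R - 1))"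
    by (simp add: algebra_simps)
  also have "\<dots> = 12 * T * (b - a * R) * (R - 1) * q" unfolding s1 s2 using fin by (simp add: mult_ac)
  finally have "m3 * (s1 + s2) = q" using T0 R1 Br by simp
  then show ?thesis unfolding f1 f2 s1_def[symmetric] s2_def[symmetric] q_def by simp
qed

definition B_num :: "'a::comm_ring_1 \<Rightarrow> 'a \<Rightarrow> 'a" where
  "B_num T v = (T * v - T + 3 * v + 1) * (- T * v^2 - 2 * T * v + v^2 + T + 2 * v + 3)"

definition B_den :: "'a::comm_ring_1 \<Rightarrow> 'a \<Rightarrow> 'a" where
  "B_den T v = 2 * (v + 1) * (T^2 * v^2 - 2 * T^2 * v + 2 * T * v^2 + T^2 - 3 * v^2 + 2 * T - 6 * v - 3)"

text \<open>The closed form of \<open>B\<close> in the coordinate \<open>m\<close>, in the shape that \<open>kernel_h_difference\<close> produces.\<close>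

lemma B_fraction_eq:
  fixes T v m e X :: "'a::field_char_0"
  defines "a \<equiv> 1 + T" and "b \<equiv> 3 - T"
  assumes m: "m * (1 + v) = 1 - v"
    and c: "2 * e * (1 - T * m^2) = m * (b - a * m^2)"
    and nz: "1 - T * m^2 \<noteq> 0" "b - T * a * m^2 \<noteq> 0"
  shows "B_num T v = (m * ((b - a * m^2) / (12 * (1 - T * m^2)) - a^2 * (1 - m^2) / (4 * (b - T * a * m^2)))
      - 1/2 - e/6) * B_den T v"
proof -
  have vm: "v * (1 + m) = 1 - m" and v1: "(1 + v) * (1 + m) = 2" using m by (simp_all add: algebra_simps)
  have m1: "1 + m \<noteq> 0" using v1 by auto
  have num: "B_num T v * (1 + m)^3 = 4 * (2 - a * m) * (b + 2 * a * m + a * m^2)"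
  proof -
    have "B_num T v * (1 + m)^3 = (T * (v * (1 + m)) - T * (1 + m) + 3 * (v * (1 + m)) + (1 + m))
      * (- T * (v * (1 + m))^2 - 2 * T * (v * (1 + m)) * (1 + m) + (v * (1 + m))^2 + (T + 3) * (1 + m)^2
        + 2 * (v * (1 + m)) * (1 + m))"
      unfolding B_num_def by Groebner_Basis.algebra
    then show ?thesis unfolding vm a_def b_def by Groebner_Basis.algebra
  qed
  have den: "B_den T v * (1 + m)^3 = - 16 * (b - T * a * m^2)"
  proof -
    have "B_den T v * (1 + m)^3 = 2 * (v * (1 + m) + (1 + m))
      * (T^2 * (v * (1 + m))^2 - 2 * T^2 * (v * (1 + m)) * (1 + m) + 2 * T * (v * (1 + m))^2
        + T^2 * (1 + m)^2 - 3 * (v * (1 + m))^2 + 2 * T * (1 + m)^2 - 6 * (v * (1 + m)) * (1 + m) - 3 * (1 + m)^2)"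
      unfolding B_den_def by Groebner_Basis.algebra
    then show ?thesis unfolding vm a_def b_def by Groebner_Basis.algebra
  qed
  define s1 s2 where "s1 = (b - a * m^2) / (12 * (1 - T * m^2))"
    and "s2 = a^2 * (1 - m^2) / (4 * (b - T * a * m^2))"
  have "4 * (b - T * a * m^2) \<noteq> 0" using nz by simp
  then have "a^2 * (1 - m^2) = s2 * (4 * (b - T * a * m^2))"
    unfolding s2_def by (rule nonzero_divide_eq_eq[THEN iffD1, OF _ refl])
  then have s2: "4 * s2 * (b - T * a * m^2) = a^2 * (1 - m^2)" by (simp only: mult_ac)
  have "6 * (m * s1) = e"
  proof -
    have "12 * (1 - T * m^2) \<noteq> 0" using nz by simp
    then have "b - a * m^2 = s1 * (12 * (1 - T * m^2))"
      unfolding s1_def by (rule nonzero_divide_eq_eq[THEN iffD1, OF _ refl])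
    then have "12 * s1 * (1 - T * m^2) = b - a * m^2" by (simp only: mult_ac)
    then have "(1 - T * m^2) * (2 * (6 * (m * s1) - e)) = 0" using c by Groebner_Basis.algebra
    then show ?thesis using nz by simp
  qed
  then have e: "m * (s1 - s2) - 1/2 - e/6 = - (m * s2) - 1/2" by (simp add: algebra_simps)
  have "((- (m * s2) - 1/2) * B_den T v) * (1 + m)^3
      = (m * (4 * s2 * (b - T * a * m^2)) * 4 + 8 * (b - T * a * m^2))"
    unfolding mult.assoc[of _ "B_den T v"] den by (simp add: algebra_simps)
  also have "\<dots> = B_num T v * (1 + m)^3" unfolding num s2 unfolding a_def b_def by Groebner_Basis.algebra
  finally show ?thesis using m1 unfolding s1_def[symmetric] s2_def[symmetric] e by simp
qed

lemma kernel_nonzero: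
  fixes T d m1 m2 m3 r :: "'a::field_char_0"
  defines "a \<equiv> 1 + T" and "b \<equiv> 3 - T"
  assumes s: "(m1 - m2) * (a * (1 - T * r^2)) = - r * (T - 1)^2"
    and p: "m1 * m2 * (a * (1 - T * r^2)) = b - a * r^2"
    and d: "2 * d * (1 - T * r^2) = r * (b - a * r^2)"
    and mob: "T * a^2 * m3^2 * r^2 - 4 * T * (m3^2 + r^2) + a * b = 0"
    and nz: "T \<noteq> 1" "T \<noteq> -3" "1 - T * r^2 \<noteq> 0" "a^2 * r^2 - 4 \<noteq> 0" "r^2 \<noteq> 1" "d \<noteq> 0"
  shows "1 - T * m1^2 \<noteq> 0" and "1 - T * m2^2 \<noteq> 0" and "1 - T * m3^2 \<noteq> 0" and "b - T * a * m3^2 \<noteq> 0"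
proof -
  have T1: "T - 1 \<noteq> 0" and T3: "T + 3 \<noteq> 0" and R1: "r^2 - 1 \<noteq> 0"
    using nz by (auto simp: eq_neg_iff_add_eq_0)
  have Br: "b - a * r^2 \<noteq> 0" using d nz by auto
  note om = one_minus_products[of m1 m2 T r, folded a_def b_def, OF s p]
  have "(T - 1)^4 * (1 - T * r^2) \<noteq> 0" using T1 nz by simp
  then show "1 - T * m1^2 \<noteq> 0" "1 - T * m2^2 \<noteq> 0" unfolding om(2)[symmetric] by auto
  have t3: "(1 - T * m3^2) * (a^2 * r^2 - 4) = (T - 1)^2 * (r^2 - 1)"
    and c3: "(b - T * a * m3^2) * (a^2 * r^2 - 4) = (T - 1) * (T + 3) * (b - a * r^2)"
    using mob unfolding a_def b_def by Groebner_Basis.algebra+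
  show "1 - T * m3^2 \<noteq> 0" "b - T * a * m3^2 \<noteq> 0" using t3 c3 T1 T3 nz R1 Br by auto
qed

text \<open>On the branch of interest \<open>T - 1\<close> and \<open>m3\<^sup>2 - 1\<close> are divisible by \<open>D = t\<^sup>2\<close>. The factor is then divisible by
  \<open>D\<^sup>2\<close>, and the leading coefficient displayed here decides that it does not vanish.\<close>

lemma quad_factor_expand:
  fixes D t u r :: "'a::idom"
  shows "quad_factor (1 + D * t) (1 + D * u) r = D^2 * (4*u^2*(r-1)^2 - 16*t*u*(r-1) - 16*t^2*(r-1)
    + D * (- (D^3*t^5*u*r) + D^3*t^4*u^2*r^2 - 2*D^3*t^4*u^2*r + D^3*t^4*u^2 - D^2*t^5*r - 11*D^2*t^4*u*r
      + 2*D^2*t^4*u + 6*D^2*t^3*u^2*r^2 - 12*D^2*t^3*u^2*r + 6*D^2*t^3*u^2 - 9*D*t^4*r + D*t^4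
      - 38*D*t^3*u*r + 14*D*t^3*u + 13*D*t^2*u^2*r^2 - 26*D*t^2*u^2*r + 13*D*t^2*u^2 - 24*t^3*r + 8*t^3
      - 44*t^2*u*r + 28*t^2*u + 12*t*u^2*r^2 - 24*t*u^2*r + 12*t*u^2))"
  unfolding quad_factor_def by Groebner_Basis.algebra

section \<open>Existence and uniqueness of the parametrizing series\<close>

text \<open>The series \<open>T + 3\<close> has the invertible constant term \<open>4\<close>, so the fraction can be cleared.\<close>

lemma is_T_iff: "is_T T \<longleftrightarrow> fps_nth T 0 = 1 \<and> 256 * fps_X^2 * T^3 = (T - 1) * (T + 3)^3"
proof (cases "fps_nth T 0 = 1")
  case True
  have u: "fps_nth ((T + 3)^3) 0 \<noteq> 0" using True by (simp add: fps_nth_power_0 fps_numeral_nth)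
  define q where "q = T^3 / (T + 3)^3"
  have q: "q * (T + 3)^3 = T^3"
    using u by (simp add: q_def fps_divide_unit inverse_mult_eq_1 mult.assoc)
  have d0: "(T + 3)^3 \<noteq> 0"
  proof
    assume "(T + 3)^3 = 0"
    then show False using u by (simp only: fps_zero_nth)
  qed
  have "T = 1 + 256 * fps_X^2 * q \<longleftrightarrow> T - 1 = 256 * fps_X^2 * q" by (auto simp: algebra_simps)
  also have "\<dots> \<longleftrightarrow> (T - 1) * (T + 3)^3 = 256 * fps_X^2 * q * (T + 3)^3" using d0 by simp
  also have "\<dots> \<longleftrightarrow> 256 * fps_X^2 * T^3 = (T - 1) * (T + 3)^3" by (simp only: mult.assoc q) auto
  finally have "T = 1 + 256 * fps_X^2 * (T^3 / (T + 3)^3) \<longleftrightarrow> 256 * fps_X^2 * T^3 = (T - 1) * (T + 3)^3"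
    by (simp only: q_def)
  then show ?thesis using True by (simp add: is_T_def)
qed (simp add: is_T_def)

lemma ex1_T: "\<exists>!T. is_T T"
proof -
  define f :: "rat fps poly" where "f = [:-27, 0, 18, 8 - 256 * fps_X^2, 1:]"
  have "\<exists>!T. fps_nth T 0 = 1 \<and> poly f T = 0"
    by (rule hensel[where w = "1/64"]) (simp_all add: f_def pderiv_pCons fps_numeral_nth)
  moreover have "poly f T = 0 \<longleftrightarrow> 256 * fps_X^2 * T^3 = (T - 1) * (T + 3)^3" for T
  proof -
    have "poly f T = (T - 1) * (T + 3)^3 - 256 * fps_X^2 * T^3"
      unfolding f_def by (simp add: algebra_simps power2_eq_square power3_eq_cube)
    then show ?thesis by auto
  qed
  ultimately show ?thesis unfolding is_T_iff by simp
qed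

lemma ex1_sqrt:
  assumes "is_T T"
  shows "\<exists>!Z. is_sqrt T Z"
proof -
  define f :: "rat fps poly" where "f = [:-T, 0, 1:]"
  have "\<exists>!Z. fps_nth Z 0 = 1 \<and> poly f Z = 0"
    using assms by (intro hensel[where w = "1/2"]) (simp_all add: f_def pderiv_pCons is_T_def)
  moreover have "poly f Z = 0 \<longleftrightarrow> Z^2 = T" for Z
    by (auto simp: f_def power2_eq_square algebra_simps)
  ultimately show ?thesis unfolding is_sqrt_def by simp
qed

definition const_ser :: "rat fps \<Rightarrow> rat poly fps" where
  "const_ser F = Abs_fps (\<lambda>n. [:fps_nth F n:])"

lemma const_ser_hom: "comm_ring_hom const_ser"
  unfolding const_ser_def by (intro coefficientwise_hom, unfold_locales) (simp_all add: one_pCons)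

lemma is_V_iff: "is_V T V \<longleftrightarrow> fps_nth V 0 = 0 \<and> 1 - const_ser T + 3 * V + V * const_ser T
    = fps_const [:0, 1:] * V^2 * (3 + V + const_ser T - V * const_ser T)"
  by (simp add: is_V_def const_ser_def Let_def)

lemma ex1_V:
  assumes "is_T T"
  shows "\<exists>!V. is_V T V"
proof -
  let ?T = "const_ser T"
  define x where "x = (fps_const [:0, 1:] :: rat poly fps)"
  define f where "f = [:1 - ?T, 3 + ?T, - x * (3 + ?T), - x * (1 - ?T):]"
  have T0: "fps_nth ?T 0 = 1" using assms by (simp add: is_T_def const_ser_def one_pCons)
  have "\<exists>!V. fps_nth V 0 = 0 \<and> poly f V = 0"
    by (rule hensel[where w = "[:1/4:]"]) (simp_all add: f_def pderiv_pCons fps_numeral_nth T0 numeral_poly one_pCons)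
  moreover have "poly f V = (1 - ?T + 3 * V + V * ?T) - x * V^2 * (3 + V + ?T - V * ?T)" for V
    unfolding f_def by (simp add: algebra_simps power2_eq_square)
  ultimately show ?thesis unfolding is_V_iff x_def[symmetric] by simp
qed

section \<open>Substituting a series for the variable\<close>

definition fps_poly :: "'a::field_char_0 fps \<Rightarrow> rat poly \<Rightarrow> 'a fps" where
  "fps_poly \<eta> p = poly (map_poly (\<lambda>r. fps_const (of_rat r)) p) \<eta>"

text \<open>Substitution for \<open>x\<close> in a series in \<open>t\<close> with coefficients in \<open>\<rat>[x]\<close>. Any series \<open>\<eta>\<close> in \<open>t\<close> is allowed, since
  each coefficient is a polynomial.\<close>

definition subst :: "'a::field_char_0 fps \<Rightarrow> rat poly fps \<Rightarrow> 'a fps" where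
  "subst \<eta> F = series_eval (fps_poly \<eta>) F"

definition ser_of_rat :: "rat fps \<Rightarrow> 'a::field_char_0 fps" where
  "ser_of_rat F = Abs_fps (\<lambda>n. of_rat (fps_nth F n))"

lemma const_of_rat_hom: "comm_ring_hom (\<lambda>r. fps_const (of_rat r) :: 'a::field_char_0 fps)"
  by (intro comp_ring_hom[OF fps_const_hom] of_rat_hom)

lemma fps_poly_hom: "comm_ring_hom (fps_poly \<eta>)"
  unfolding fps_poly_def by (rule poly_eval_hom) (rule const_of_rat_hom)

lemma subst_hom: "comm_ring_hom (subst \<eta>)"
  unfolding subst_def by (rule series_eval_hom) (rule fps_poly_hom)

lemma ser_of_rat_hom: "comm_ring_hom ser_of_rat"
  unfolding ser_of_rat_def by (intro coefficientwise_hom of_rat_hom)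

lemma fps_poly_pCons: "fps_poly \<eta> (pCons c p) = fps_const (of_rat c) + \<eta> * fps_poly \<eta> p"
  by (simp add: fps_poly_def Polynomial.map_poly_pCons)

lemma fps_poly_const [simp]: "fps_poly \<eta> [:c:] = fps_const (of_rat c)"
  by (simp add: fps_poly_def Polynomial.map_poly_pCons)

lemma fps_poly_fps_const: "fps_poly (fps_const b) p = fps_const (poly_at b p)"
proof -
  interpret f: comm_ring_hom "fps_const :: 'a \<Rightarrow> 'a fps" by (rule fps_const_hom)
  have "map_poly (\<lambda>r. fps_const (of_rat r) :: 'a fps) p = map_poly fps_const (map_poly of_rat p)"
    by (subst map_poly_map_poly) (simp_all add: o_def)
  then show ?thesis by (simp add: fps_poly_def poly_at_def f.poly_map_poly)
qed

lemma subst_X [simp]: "subst \<eta> fps_X = fps_X"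
  unfolding subst_def by (rule series_eval_X) (rule fps_poly_hom)

lemma subst_const: "subst \<eta> (fps_const p) = fps_poly \<eta> p"
  unfolding subst_def by (rule series_eval_const) (rule fps_poly_hom)

lemma subst_const_ser: "subst \<eta> (const_ser F) = ser_of_rat F"
proof (rule fps_ext)
  fix n
  have "fps_nth (subst \<eta> (const_ser F)) n = (\<Sum>k\<le>n. if k = n then of_rat (fps_nth F n) else 0)"
    unfolding subst_def series_eval_nth by (rule sum.cong) (auto simp: const_ser_def)
  then show "fps_nth (subst \<eta> (const_ser F)) n = fps_nth (ser_of_rat F) n" by (simp add: ser_of_rat_def)
qed

lemma eval1_subst: "eval1 F b = fps_to_fls (subst (fps_const b) F)"
  by (simp add: subst_def fps_poly_fps_const[abs_def] series_eval_consts eval1_alt)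

lemma eval0_ser_of_rat: "eval0 F = fps_to_fls (ser_of_rat F)"
  by (simp add: eval0_def ser_of_rat_def)

definition square_var :: "rat poly fps \<Rightarrow> rat poly fps" where
  "square_var F = Abs_fps (\<lambda>n. pcompose (fps_nth F n) [:0, 0, 1:])"

lemma subst_square_var: "subst \<eta> (square_var F) = subst (\<eta>^2) F"
proof -
  interpret c: comm_ring_hom "\<lambda>r. fps_const (of_rat r) :: 'a fps" by (rule const_of_rat_hom)
  have "fps_poly \<eta> (pcompose p [:0, 0, 1:]) = fps_poly (\<eta>^2) p" for p
    by (simp add: fps_poly_def c.map_poly_pcompose poly_pcompose Polynomial.map_poly_pCons power2_eq_square)
  then show ?thesis by (simp add: subst_def series_eval_def square_var_def)
qed

section \<open>Uniqueness on the kernel curve\<close>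

text \<open>An identity that holds at one transcendental value of \<open>x\<close> holds identically. Working at a point of
  an arbitrary field covers both coordinates \<open>x\<close> and \<open>y\<close> at once.\<close>

locale transcendental_point =
  fixes a :: "'a::field_char_0"
  assumes transcendental: "poly_at a p = 0 \<Longrightarrow> p = 0"
begin

definition u where "u = a + 1 / a"

lemma a_nonzero: "a \<noteq> 0"
  using transcendental[of "[:0, 1:]"] by auto

lemma poly_at_sqr: "poly_at a [:c, 0, 1:] = of_rat c + a^2"
  by (simp add: poly_at_def Polynomial.map_poly_pCons power2_eq_square)

lemma a2_plus_1: "a^2 + 1 \<noteq> 0" and a2_minus_1: "a^2 - 1 \<noteq> 0"
  using transcendental[of "[:1, 0, 1:]"] transcendental[of "[:-1, 0, 1:]"]
  by (auto simp: poly_at_sqr add.commute of_rat_minus)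

lemma au: "a * u = a^2 + 1"
  using a_nonzero by (simp add: u_def field_simps power2_eq_square)

lemma u_nonzero: "u \<noteq> 0"
  using au a2_plus_1 by auto

text \<open>If \<open>p(u) = 0\<close>, then \<open>a\<^sup>N p((a\<^sup>2 + 1)/a)\<close> is a polynomial in \<open>a\<close> with the leading coefficient of
  \<open>p\<close>.\<close>

lemma u_transcendental:
  assumes "poly_at u p = 0"
  shows "p = 0"
proof (rule ccontr)
  assume p: "p \<noteq> 0"
  define N where "N = degree p"
  define s :: "rat poly" where "s = [:1, 0, 1:]"
  define h where "h = (\<Sum>k\<le>N. smult (coeff p k) (s ^ k * monom 1 (N - k)))"
  interpret h: comm_ring_hom "poly_at a" by (rule poly_at_hom)
  have sm: "poly_at a (smult c q) = of_rat c * poly_at a q" for c q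
    using h.hom_mult[of "[:c:]" q] by simp
  have mon: "poly_at a (monom 1 k) = a ^ k" for k
    using h.hom_power[of "[:0,1:]" k] by (simp add: monom_altdef)
  have "poly_at a h = (\<Sum>k\<le>N. of_rat (coeff p k) * ((a^2 + 1) ^ k * a ^ (N - k)))"
    by (simp add: h_def h.hom_sum sm h.hom_mult h.hom_power mon s_def poly_at_sqr add.commute)
  also have "\<dots> = (\<Sum>k\<le>N. a ^ N * (of_rat (coeff p k) * u ^ k))"
  proof (rule sum.cong[OF refl])
    fix k assume "k \<in> {..N}"
    then have "a ^ N = a ^ k * a ^ (N - k)" by (simp add: power_add[symmetric])
    then show "of_rat (coeff p k) * ((a^2 + 1) ^ k * a ^ (N - k)) = a ^ N * (of_rat (coeff p k) * u ^ k)"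
      by (simp add: au[symmetric] power_mult_distrib)
  qed
  also have "\<dots> = a ^ N * poly_at u p"
    unfolding poly_at_def sum_distrib_left[symmetric]
    by (subst poly_bounded_sum[of N]) (auto simp: coeff_map_poly N_def coeff_eq_0)
  finally have "h = 0" using assms transcendental by simp
  have deg: "degree (s ^ k) = 2 * k" for k by (simp add: degree_power_eq s_def)
  have "coeff (s ^ k * monom 1 (N - k)) (2 * N) = 0" if "k < N" for k
  proof (rule coeff_eq_0)
    have "degree (s ^ k * monom 1 (N - k)) \<le> 2 * k + (N - k)"
      using degree_mult_le[of "s ^ k" "monom 1 (N - k)"] by (simp add: deg degree_monom_eq)
    then show "degree (s ^ k * monom 1 (N - k)) < 2 * N" using that by linarith
  qed
  then have "coeff h (2 * N) = (\<Sum>k\<le>N. if k = N then coeff p N * coeff (s ^ N) (2 * N) else 0)"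
    unfolding h_def coeff_sum by (intro sum.cong refl) auto
  also have "\<dots> = coeff p N"
    using lead_coeff_power[of s N] by (simp add: deg) (simp add: s_def)
  finally show False using \<open>h = 0\<close> p by (simp add: N_def)
qed

definition Y where "Y = (THE y. fps_nth y 0 = 0 \<and> y = fps_X * fps_const u * (1 + y^2))"

text \<open>The branch of the kernel that is a power series in \<open>t\<close>.\<close>

lemma ex1_Y: "\<exists>!y. fps_nth y 0 = 0 \<and> y = fps_X * fps_const u * (1 + y^2)"
proof -
  define g where "g = fps_X * fps_const u"
  define f where "f = [:g, -1, g:]"
  have "\<exists>!y. fps_nth y 0 = 0 \<and> poly f y = 0"
    by (rule hensel[where w = "-1"]) (simp_all add: f_def pderiv_pCons g_def)
  moreover have "poly f y = 0 \<longleftrightarrow> y = g * (1 + y^2)" for y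
    by (auto simp: f_def algebra_simps power2_eq_square)
  ultimately show ?thesis by (simp add: g_def)
qed

lemma Y_0: "fps_nth Y 0 = 0" and Y_eq: "Y = fps_X * fps_const u * (1 + Y^2)"
  using theI'[OF ex1_Y] unfolding Y_def by blast+

definition y1 where "y1 = fps_const u * (1 + Y^2)"

lemma Y_y1: "Y = fps_X * y1" and y1_0: "fps_nth y1 0 = u"
  using Y_eq by (simp_all add: y1_def mult.assoc Y_0 power2_eq_square)

lemma Y_1: "fps_nth Y 1 = u"
  using Y_y1 y1_0 by simp

lemma Y_power_nth: "fps_nth (Y^k) j = (if j < k then 0 else if j = k then u^k else fps_nth (Y^k) j)"
proof -
  have "Y^k = fps_X^k * y1^k" by (simp add: Y_y1[symmetric] power_mult_distrib[symmetric])
  then show ?thesis by (simp add: fps_X_power_mult_nth y1_0 fps_nth_power_0)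
qed

text \<open>The series \<open>Y\<close> is \<open>t\<close> times a series with constant term \<open>u\<close>. In \<open>F(Y)\<close> the terms of lowest total degree
  in \<open>t\<close> and \<open>x\<close> contribute a nonzero polynomial in \<open>u\<close> to the lowest coefficient, and \<open>u\<close>
  is transcendental.\<close>

lemma subst_Y_inj:
  assumes "subst Y F = 0"
  shows "F = 0"
proof (rule ccontr)
  assume "F \<noteq> 0"
  then obtain m where "fps_nth F m \<noteq> 0" by (auto simp: fps_eq_iff)
  then obtain k where "coeff (fps_nth F m) k \<noteq> 0" by (auto simp: poly_eq_iff)
  then have ex: "\<exists>w m k. m + k = w \<and> coeff (fps_nth F m) k \<noteq> 0" by blast
  define w where "w = (LEAST w. \<exists>m k. m + k = w \<and> coeff (fps_nth F m) k \<noteq> 0)"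
  have "\<exists>m k. m + k = w \<and> coeff (fps_nth F m) k \<noteq> 0" unfolding w_def by (rule LeastI_ex[OF ex])
  then obtain m k where mk: "m + k = w" "coeff (fps_nth F m) k \<noteq> 0" by blast
  have z: "coeff (fps_nth F m) k = 0" if "m + k < w" for m k
    using not_less_Least[OF that[unfolded w_def]] by blast
  have "fps_nth (fps_poly Y (fps_nth F m)) (w - m) = of_rat (coeff (fps_nth F m) (w - m)) * u ^ (w - m)"
    if m: "m \<le> w" for m
  proof -
    let ?p = "fps_nth F m" and ?j = "w - m"
    let ?N = "max (degree ?p) ?j"
    have "fps_poly Y ?p = (\<Sum>k\<le>?N. fps_const (of_rat (coeff ?p k)) * Y ^ k)"
      unfolding fps_poly_def by (subst poly_bounded_sum[of ?N]) (auto simp: coeff_map_poly coeff_eq_0)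
    then have "fps_nth (fps_poly Y ?p) ?j = (\<Sum>k\<le>?N. of_rat (coeff ?p k) * fps_nth (Y ^ k) ?j)"
      by (simp add: fps_sum_nth)
    also have "\<dots> = (\<Sum>k\<le>?N. if k = ?j then of_rat (coeff ?p k) * u ^ k else 0)"
    proof (rule sum.cong[OF refl])
      fix k
      show "of_rat (coeff ?p k) * fps_nth (Y ^ k) ?j = (if k = ?j then of_rat (coeff ?p k) * u ^ k else 0)"
      proof (cases "k < ?j")
        case True
        then have "coeff ?p k = 0" using z[of m k] m by linarith
        then show ?thesis using True by simp
      qed (auto simp: Y_power_nth[of k ?j])
    qed
    also have "\<dots> = of_rat (coeff ?p ?j) * u ^ ?j" by simp
    finally show ?thesis .
  qed
  then have "fps_nth (subst Y F) w = (\<Sum>m\<le>w. of_rat (coeff (fps_nth F m) (w - m)) * u ^ (w - m))"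
    unfolding subst_def series_eval_nth by simp
  also have "\<dots> = (\<Sum>j\<le>w. of_rat (coeff (fps_nth F (w - j)) j) * u ^ j)"
    by (rule sum.reindex_bij_witness[where i = "\<lambda>j. w - j" and j = "\<lambda>j. w - j"]) auto
  also have "\<dots> = poly_at u (\<Sum>j\<le>w. monom (coeff (fps_nth F (w - j)) j) j)"
    unfolding poly_at_def
    by (subst poly_bounded_sum[of w]) (auto simp: coeff_map_poly coeff_sum)
  finally have "(\<Sum>j\<le>w. monom (coeff (fps_nth F (w - j)) j) j) = 0"
    using assms u_transcendental by simp
  then have "coeff (\<Sum>j\<le>w. monom (coeff (fps_nth F (w - j)) j) j) k = 0" by simp
  then show False using mk by (auto simp: coeff_sum)
qed

text \<open>The powers \<open>a\<^sup>k\<close> and \<open>a\<^sup>-\<^sup>k\<close> with \<open>k > 0\<close> do not interfere. Multiplication by \<open>a\<^sup>N\<close> turns this into an identity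
  between polynomials.\<close>

lemma reflect_sum_zero:
  assumes "poly_at a p + poly_at (1 / a) p = 0" and "coeff p 0 = 0"
  shows "p = 0"
proof (rule ccontr)
  assume p: "p \<noteq> 0"
  let ?N = "degree p"
  interpret h: comm_ring_hom "poly_at a" by (rule poly_at_hom)
  have mon: "poly_at a (monom 1 k) = a ^ k" for k
    using h.hom_power[of "[:0,1:]" k] by (simp add: monom_altdef)
  have d: "degree (map_poly of_rat p :: 'a poly) = ?N" by (rule degree_map_poly) auto
  have "map_poly of_rat (reflect_poly p) = reflect_poly (map_poly of_rat p :: 'a poly)"
    by (intro poly_eqI) (simp add: coeff_map_poly coeff_reflect_poly d)
  then have "poly_at a (reflect_poly p) = a ^ ?N * poly_at (1 / a) p"
    using poly_reflect_poly_nz[OF a_nonzero, of "map_poly of_rat p"] by (simp add: poly_at_def d inverse_eq_divide)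
  then have "poly_at a (monom 1 ?N * p + reflect_poly p) = a ^ ?N * (poly_at a p + poly_at (1 / a) p)"
    by (simp add: h.hom_add h.hom_mult mon algebra_simps)
  then have "monom 1 ?N * p + reflect_poly p = 0" using assms transcendental by simp
  then have "coeff (monom 1 ?N * p + reflect_poly p) (2 * ?N) = 0" by simp
  moreover have "?N > 0" using assms(2) p by (metis degree_0_id gr0I pCons_0_0 of_nat_0)
  ultimately have "coeff p ?N = 0" by (simp add: coeff_monom_mult coeff_reflect_poly)
  then show False using p by simp
qed

lemma fps_poly_Y_01:
  "fps_nth (fps_poly Y p) 0 = of_rat (coeff p 0)" "fps_nth (fps_poly Y p) 1 = u * of_rat (coeff p 1)"
proof -
  have 0: "fps_nth (fps_poly Y p) 0 = of_rat (coeff p 0)" for p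
    by (cases p) (simp add: fps_poly_pCons Y_0)
  then show "fps_nth (fps_poly Y p) 0 = of_rat (coeff p 0)" .
  obtain c q where "p = pCons c q" by (cases p)
  then show "fps_nth (fps_poly Y p) 1 = u * of_rat (coeff p 1)"
    using 0[of q] Y_0 Y_1 by (simp add: fps_poly_pCons fps_mult_nth atLeast0AtMost)
qed

text \<open>After division by a power of \<open>t\<close> the lowest coefficient of \<open>F\<close> is nonzero. Since \<open>Y\<close> has order \<open>1\<close> in \<open>t\<close>
  and \<open>F(0) = 0\<close>, the left side and the last term on the right agree at order \<open>1\<close>, and \<open>reflect_sum_zero\<close> applies to
  what remains.\<close>

lemma homogeneous_zero:
  assumes zero: "\<And>n. coeff (fps_nth F n) 0 = 0"
    and eq: "subst Y F = fps_X * (fps_const (u^2) * (subst (fps_const a) F + subst (fps_const (1/a)) F)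
      + fps_const u * ser_of_rat (Abs_fps (\<lambda>n. coeff (fps_nth F n) 1)))"
  shows "F = 0"
proof (rule ccontr)
  assume F: "F \<noteq> 0"
  define n where "n = subdegree F"
  define G where "G = fps_shift n F"
  have FG: "F = fps_X ^ n * G" by (simp add: G_def n_def subdegree_decompose[symmetric] mult.commute)
  have G0: "fps_nth G 0 \<noteq> 0" using F by (simp add: G_def n_def nth_subdegree_nonzero)
  have s: "subst \<eta> F = fps_X ^ n * subst \<eta> G" for \<eta> :: "'a fps"
  proof -
    interpret s: comm_ring_hom "subst \<eta>" by (rule subst_hom)
    show ?thesis by (simp add: FG s.hom_mult s.hom_power)
  qed
  have r: "ser_of_rat (Abs_fps (\<lambda>n. coeff (fps_nth F n) 1))
      = (fps_X ^ n * ser_of_rat (Abs_fps (\<lambda>n. coeff (fps_nth G n) 1)) :: 'a fps)"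
    by (intro fps_ext) (simp add: ser_of_rat_def FG fps_X_power_mult_nth)
  have "fps_X ^ n * subst Y G = fps_X ^ n * (fps_X * (fps_const (u^2) * (subst (fps_const a) G + subst (fps_const (1/a)) G)
      + fps_const u * ser_of_rat (Abs_fps (\<lambda>n. coeff (fps_nth G n) 1))))"
    using eq unfolding s r by (simp add: algebra_simps)
  then have eqG: "subst Y G = fps_X * (fps_const (u^2) * (subst (fps_const a) G + subst (fps_const (1/a)) G)
      + fps_const u * ser_of_rat (Abs_fps (\<lambda>n. coeff (fps_nth G n) 1)))"
    by simp
  have "coeff (fps_nth G 1) 0 = 0" using zero[of "n + 1"] by (simp add: G_def add.commute)
  then have "fps_nth (subst Y G) 1 = u * of_rat (coeff (fps_nth G 0) 1)"
    by (simp add: subst_def series_eval_nth fps_poly_Y_01[simplified])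
  moreover have "fps_nth (subst (fps_const b) G) 0 = poly_at b (fps_nth G 0)" for b :: 'a
    by (simp add: subst_def series_eval_nth fps_poly_fps_const)
  ultimately have "u^2 * (poly_at a (fps_nth G 0) + poly_at (1/a) (fps_nth G 0)) = 0"
    unfolding eqG by (simp add: ser_of_rat_def)
  then have "poly_at a (fps_nth G 0) + poly_at (1/a) (fps_nth G 0) = 0" using u_nonzero by simp
  then have "fps_nth G 0 = 0"
    by (rule reflect_sum_zero) (use zero[of n] in \<open>simp add: G_def\<close>)
  then show False using G0 by simp
qed

section \<open>The equations on the kernel curve\<close>

definition subst2 :: "'a fps \<Rightarrow> 'a fps \<Rightarrow> rat poly poly fps \<Rightarrow> 'a fps" where
  "subst2 \<xi> \<eta> F = series_eval (\<lambda>p. poly (map_poly (fps_poly \<xi>) p) \<eta>) F"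

lemma subst2_hom: "comm_ring_hom (subst2 \<xi> \<eta>)"
  unfolding subst2_def by (rule series_eval_hom) (rule poly_eval_hom[OF fps_poly_hom])

lemma subst2_simps:
  "subst2 \<xi> \<eta> fps_X = fps_X" "subst2 \<xi> \<eta> (fps_const var_x) = \<xi>" "subst2 \<xi> \<eta> (fps_const var_y) = \<eta>"
  "subst2 \<xi> \<eta> (fps_const [:[:c:]:]) = fps_const (of_rat c)"
  "subst2 \<xi> \<eta> (in_x F) = subst \<xi> F" "subst2 \<xi> \<eta> (in_y F) = subst \<eta> F"
  "subst2 \<xi> \<eta> (in_const R) = ser_of_rat R"
proof -
  interpret p: comm_ring_hom "fps_poly \<xi>" by (rule fps_poly_hom)
  note hom = poly_eval_hom[OF fps_poly_hom[of \<xi>], of \<eta>]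
  show "subst2 \<xi> \<eta> fps_X = fps_X" unfolding subst2_def by (rule series_eval_X[OF hom])
  show "subst2 \<xi> \<eta> (fps_const var_x) = \<xi>" "subst2 \<xi> \<eta> (fps_const var_y) = \<eta>"
    "subst2 \<xi> \<eta> (fps_const [:[:c:]:]) = fps_const (of_rat c)"
    unfolding subst2_def series_eval_const[OF hom]
    by (simp_all add: Polynomial.map_poly_pCons fps_poly_pCons)
  show "subst2 \<xi> \<eta> (in_x F) = subst \<xi> F"
    by (simp add: subst2_def subst_def series_eval_def in_x_def Polynomial.map_poly_pCons)
  have "map_poly (fps_poly \<xi>) (map_poly (\<lambda>c. [:c:]) p) = map_poly (\<lambda>r. fps_const (of_rat r)) p" for p
    by (intro poly_eqI) (simp add: coeff_map_poly)
  then show "subst2 \<xi> \<eta> (in_y F) = subst \<eta> F"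
    by (simp add: subst2_def subst_def series_eval_def in_y_def fps_poly_def)
  have "subst2 \<xi> \<eta> (in_const R) = series_eval (\<lambda>r. fps_const (of_rat r)) R"
    by (simp add: subst2_def series_eval_def in_const_def Polynomial.map_poly_pCons)
  then show "subst2 \<xi> \<eta> (in_const R) = ser_of_rat R"
    by (simp add: series_eval_consts ser_of_rat_def)
qed

abbreviation "t \<equiv> fls_X :: 'a fls"
abbreviation "c x \<equiv> fls_const (x :: 'a)"
definition "Yl = fps_to_fls Y"
definition "A_at \<eta> = fps_to_fls (subst \<eta> A_ser)"
definition "BY = fps_to_fls (subst Y B_ser)"
definition "M10 = (eval0 (coeff_series M_ser 1 0) :: 'a fls)"

lemma Yl_eq: "Yl = t * c u * (1 + Yl^2)"
proof -
  interpret f: comm_ring_hom "fps_to_fls :: 'a fps \<Rightarrow> 'a fls" by (rule fps_to_fls_hom)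
  show ?thesis using arg_cong[OF Y_eq, of fps_to_fls]
    by (simp add: Yl_def f.hom_mult f.hom_add f.hom_power)
qed

lemma Yl_nonzero: "Yl \<noteq> 0"
proof -
  have "Y \<noteq> 0" using Y_1 u_nonzero by auto
  then show ?thesis by (simp add: Yl_def)
qed

text \<open>The functional equation at \<open>(b, Y)\<close>. The equation of \<open>Y\<close> cancels its left side and
  simplifies the right one.\<close>

lemma kernel_vanishes:
  assumes b: "b * u = b^2 + 1" "b \<noteq> 0"
  shows "2/3 * c b * c u * Yl - 2 * t * (c u)^2 * A_at (fps_const b) + (c b - 1 / c b) * Yl * BY
    + A_at Y - t * c u * M10 = 0"
proof -
  interpret f: comm_ring_hom "fps_to_fls :: 'a fps \<Rightarrow> 'a fls" by (rule fps_to_fls_hom)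
  interpret s: comm_ring_hom "subst2 (fps_const b) Y" by (rule subst2_hom)
  interpret k: field_hom "fls_const :: 'a \<Rightarrow> 'a fls" by (rule fls_const_hom)
  have cb0: "c b \<noteq> 0" and cu0: "c u \<noteq> 0" using b u_nonzero by auto
  have bu: "c b * c u = (c b)^2 + 1"
    by (metis b(1) k.hom_add k.hom_mult k.hom_one k.hom_power)
  have two_thirds: "c (of_rat (2/3)) = 2/3"
  proof -
    have "(of_rat (2/3) :: 'a) = 2/3" by (simp only: of_rat_divide of_rat_numeral_eq)
    then show ?thesis by (simp only: fls_const_divide_const[symmetric] fls_const_numeral)
  qed
  note arg_cong[OF M_ser_functional_equation, of "\<lambda>F. fps_to_fls (subst2 (fps_const b) Y F)"]
  note fe = this[unfolded s.hom_mult s.hom_add s.hom_minus s.hom_power s.hom_one s.hom_numeral subst2_simps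
      f.hom_mult f.hom_add f.hom_minus f.hom_power f.hom_one f.hom_numeral fps_X_to_fls fps_const_to_fls
      two_thirds Yl_def[symmetric] BY_def[symmetric] A_at_def[symmetric] eval0_ser_of_rat[symmetric] M10_def[symmetric]]
  have ker: "c b * Yl - t * ((c b)^2 + 1) * (Yl^2 + 1) = 0"
    using Yl_eq bu by Groebner_Basis.algebra
  let ?B = "(c b - 1 / c b) * c b"
  have B: "?B = (c b)^2 - 1" using cb0 by (simp add: left_diff_distrib power2_eq_square)
  have z: "2/3 * (c b)^2 * Yl^2 - 2 * t * Yl * ((c b)^2 + 1) * A_at (fps_const b) + t * Yl * ((c b)^2 - 1) * (Yl^2 + 1) * BY
      + t * c b * (Yl^2 + 1) * A_at Y - t * c b * Yl * M10 = 0"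
    using fe ker by simp
  define W where "W = 2/3 * c b * c u * Yl - 2 * t * (c u)^2 * A_at (fps_const b) + (c b - 1 / c b) * Yl * BY
    + A_at Y - t * c u * M10"
  have "c b * Yl * W = 2/3 * (c b)^2 * c u * Yl^2 - 2 * t * Yl * c b * (c u)^2 * A_at (fps_const b)
      + ?B * Yl^2 * BY + c b * Yl * A_at Y - c b * Yl * t * c u * M10"
    by (simp add: W_def algebra_simps power2_eq_square del: fls_const_mult_const)
  also have "\<dots> = c u * (2/3 * (c b)^2 * Yl^2 - 2 * t * Yl * ((c b)^2 + 1) * A_at (fps_const b) + t * Yl * ((c b)^2 - 1) * (Yl^2 + 1) * BY
      + t * c b * (Yl^2 + 1) * A_at Y - t * c b * Yl * M10)"
  proof -
    have e: "Yl^2 = Yl * (t * c u * (1 + Yl^2))" "c b * Yl * A_at Y = c b * (t * c u * (1 + Yl^2)) * A_at Y"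
      using Yl_eq by (metis power2_eq_square, metis)
    have "?B * Yl^2 * BY = ((c b)^2 - 1) * (Yl * (t * c u * (1 + Yl^2))) * BY"
      unfolding B using e(1) by simp
    then show ?thesis unfolding e(2) bu[symmetric] by (simp add: algebra_simps power2_eq_square del: fls_const_mult_const)
  qed
  also have "\<dots> = 0" unfolding z by simp
  finally have "W = 0" using cb0 Yl_nonzero by simp
  then show ?thesis by (simp add: W_def)
qed

text \<open>The equations at \<open>(a, Y)\<close> and \<open>(1/a, Y)\<close> have the same \<open>Y\<close>. The term with \<open>B(Y)\<close> changes its sign and drops out
  of the sum; the terms with \<open>A(Y)\<close> drop out of the difference.\<close>

lemma kernel_sum:
  "A_at Y + (c u)^2 * Yl / 3 = t * (c u)^2 * (A_at (fps_const a) + A_at (fps_const (1/a))) + t * c u * M10"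
  and kernel_difference:
  "(c a - 1 / c a) * (Yl * BY + c u * Yl / 3) = t * (c u)^2 * (A_at (fps_const a) - A_at (fps_const (1/a)))"
proof -
  have ca: "c a \<noteq> 0" using a_nonzero by simp
  have inv: "c (1/a) = 1 / c a" by (simp only: fls_const_divide_const[symmetric] fls_const_1)
  have cu: "c u = c a + 1 / c a" unfolding u_def fls_plus_const[symmetric] inv ..
  have 1: "2/3 * c a * c u * Yl - 2 * t * (c u)^2 * A_at (fps_const a) + (c a - 1 / c a) * Yl * BY
    + A_at Y - t * c u * M10 = 0"
    by (rule kernel_vanishes[OF au a_nonzero])
  have "(1/a) * u = (1/a)^2 + 1" using a_nonzero by (simp add: u_def field_simps power2_eq_square)
  from kernel_vanishes[OF this]
  have 2: "2/3 * (1 / c a) * c u * Yl - 2 * t * (c u)^2 * A_at (fps_const (1/a)) + (1 / c a - c a) * Yl * BY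
    + A_at Y - t * c u * M10 = 0"
    unfolding inv using a_nonzero by simp
  define x x' where "x = c a" and "x' = 1 / c a"
  show "A_at Y + (c u)^2 * Yl / 3 = t * (c u)^2 * (A_at (fps_const a) + A_at (fps_const (1/a))) + t * c u * M10"
    using 1 2 cu unfolding x_def[symmetric] x'_def[symmetric] by Groebner_Basis.algebra
  show "(c a - 1 / c a) * (Yl * BY + c u * Yl / 3) = t * (c u)^2 * (A_at (fps_const a) - A_at (fps_const (1/a)))"
    using 1 2 cu unfolding x_def[symmetric] x'_def[symmetric] by Groebner_Basis.algebra
qed

end

section \<open>The parametrizing series\<close>

text \<open>The fields \<open>T0\<close>, \<open>Z0\<close>, \<open>V0\<close> are kept arbitrary so that the results apply to any solution of the defining
  equations.\<close>

locale parametrization =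
  fixes T0 Z0 :: "rat fps" and V0 :: "rat poly fps"
  assumes is_T: "is_T T0" and is_sqrt: "is_sqrt T0 Z0" and is_V: "is_V T0 V0"
begin

lemma T0_0: "fps_nth T0 0 = 1" and T0_eq: "256 * fps_X^2 * T0^3 = (T0 - 1) * (T0 + 3)^3"
  using is_T by (simp_all add: is_T_iff)

lemma Z0_0: "fps_nth Z0 0 = 1" and Z0_eq: "Z0^2 = T0"
  using is_sqrt by (simp_all add: is_sqrt_def)

lemma V0_0: "fps_nth V0 0 = 0"
  and V0_eq: "1 - const_ser T0 + 3 * V0 + V0 * const_ser T0
    = fps_const [:0, 1:] * V0^2 * (3 + V0 + const_ser T0 - V0 * const_ser T0)"
  using is_V by (simp_all add: is_V_iff)

text \<open>The leading terms \<open>T = 1 + 4 t\<^sup>2 + \<dots>\<close> and, below, \<open>V = t\<^sup>2 + \<dots>\<close> suffice to identify the branch of each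
  algebraic equation.\<close>

lemma T0_decompose: obtains \<tau> where "T0 = 1 + fps_X^2 * \<tau>" "fps_nth \<tau> 0 = 4"
proof
  define i where "i = inverse ((T0 + 3)^3)"
  have c: "fps_nth ((T0 + 3)^3) 0 = 64" by (simp add: fps_nth_power_0 fps_numeral_nth T0_0)
  have i: "(T0 + 3)^3 * i = 1" unfolding i_def by (rule inverse_mult_eq_1') (simp add: c)
  have "T0 - 1 = (T0 - 1) * (T0 + 3)^3 * i" by (simp add: mult.assoc i)
  also have "\<dots> = fps_X^2 * (256 * T0^3 * i)" unfolding T0_eq[symmetric] by (simp add: mult_ac)
  finally show "T0 = 1 + fps_X^2 * (256 * T0^3 * i)" by (simp add: algebra_simps)
  show "fps_nth (256 * T0^3 * i) 0 = 4" using c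
    by (simp add: i_def fps_nth_power_0 fps_numeral_nth T0_0)
qed

lemma subst_V_cubic:
  fixes \<eta> :: "'a::field_char_0 fps"
  defines "T \<equiv> ser_of_rat T0" and "v \<equiv> subst \<eta> V0"
  shows "1 - T + 3 * v + v * T = \<eta> * v^2 * (3 + v + T - v * T)"
proof -
  interpret s: comm_ring_hom "subst \<eta>" by (rule subst_hom)
  show ?thesis using arg_cong[OF V0_eq, of "subst \<eta>"]
    by (simp add: s.hom_add s.hom_minus s.hom_mult s.hom_power s.hom_numeral subst_const_ser subst_const
        fps_poly_pCons fps_poly_def[of _ 0] T_def v_def)
qed

lemma subst_V_0: "fps_nth (subst \<eta> V0) 0 = 0"
proof -
  interpret p: comm_ring_hom "fps_poly \<eta>" by (rule fps_poly_hom)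
  show ?thesis by (simp add: subst_def series_eval_nth V0_0)
qed

lemma ser_T_0: "fps_nth (ser_of_rat T0) 0 = 1" and ser_Z_0: "fps_nth (ser_of_rat Z0) 0 = 1"
  by (simp_all add: ser_of_rat_def T0_0 Z0_0)

lemma ser_Z_sq: "(ser_of_rat Z0)^2 = ser_of_rat T0"
proof -
  interpret s: comm_ring_hom ser_of_rat by (rule ser_of_rat_hom)
  show ?thesis by (simp add: Z0_eq[symmetric] s.hom_power)
qed

lemma ser_T_decompose:
  obtains \<tau> where "ser_of_rat T0 = 1 + fps_X^2 * \<tau>" "fps_nth \<tau> 0 = (4 :: 'a::field_char_0)"
proof -
  obtain \<sigma> where s: "T0 = 1 + fps_X^2 * \<sigma>" "fps_nth \<sigma> 0 = 4" by (rule T0_decompose)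
  interpret s: comm_ring_hom "ser_of_rat :: _ \<Rightarrow> 'a fps" by (rule ser_of_rat_hom)
  have X: "ser_of_rat fps_X = (fps_X :: 'a fps)" by (intro fps_ext) (simp add: ser_of_rat_def fps_X_def)
  show ?thesis
  proof
    show "ser_of_rat T0 = 1 + fps_X^2 * (ser_of_rat \<sigma> :: 'a fps)"
      by (subst s(1)) (simp add: s.hom_add s.hom_mult s.hom_power X)
    show "fps_nth (ser_of_rat \<sigma>) 0 = (4 :: 'a)" by (simp add: ser_of_rat_def s(2))
  qed
qed

lemma subst_V_decompose:
  fixes \<eta> :: "'a::field_char_0 fps"
  obtains W where "subst \<eta> V0 = fps_X^2 * W" "fps_nth W 0 = 1"
proof -
  define T where "T = (ser_of_rat T0 :: 'a fps)"
  define v where "v = subst \<eta> V0"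
  obtain \<tau> where t: "T = 1 + fps_X^2 * \<tau>" "fps_nth \<tau> 0 = 4" unfolding T_def by (rule ser_T_decompose)
  have cubic: "1 - T + 3 * v + v * T = \<eta> * v^2 * (3 + v + T - v * T)"
    using subst_V_cubic[of \<eta>] by (simp add: T_def v_def)
  define v' where "v' = fps_shift 1 v"
  have vX: "v = fps_X * v'" using subst_V_0[of \<eta>]
    by (intro fps_ext) (simp add: v'_def v_def fps_X_mult_nth)
  define i where "i = inverse (3 + T)"
  have c: "fps_nth (3 + T) 0 = 4" by (simp add: fps_numeral_nth T_def ser_T_0)
  have i: "(3 + T) * i = 1" unfolding i_def by (rule inverse_mult_eq_1') (use c in simp)
  define W where "W = (\<tau> + \<eta> * v'^2 * (3 + v + T - v * T)) * i"
  have "v * (3 + T) = (T - 1) + \<eta> * v^2 * (3 + v + T - v * T)"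
    unfolding cubic[symmetric] by (simp add: algebra_simps)
  also have "\<dots> = fps_X^2 * (\<tau> + \<eta> * v'^2 * (3 + v + T - v * T))"
    using t(1) by (subst (1) vX) (simp add: algebra_simps power_mult_distrib)
  finally have "v * ((3 + T) * i) = fps_X^2 * W" unfolding W_def by (simp only: mult.assoc[symmetric])
  then have vW: "v = fps_X^2 * W" by (simp add: i)
  then have "fps_nth v' 0 = 0" by (simp add: v'_def fps_X_power_mult_nth)
  then have "fps_nth W 0 = 1"
    using t(2) c by (simp add: W_def i_def power2_eq_square)
  then show ?thesis using that[of W] vW v_def by simp
qed

text \<open>The closed form of \<open>t\<^sup>2 A(x) / x\<close>, a function of \<open>x\<^sup>2\<close>, is a power series in \<open>t\<close> with polynomial coefficients, as the
  denominator has the invertible constant term \<open>192\<close>. So it can be specialized by \<open>subst\<close>.\<close>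

lemma R_exists: "\<exists>R. R * R_den (const_ser Z0) V0 = R_num (const_ser Z0) V0"
proof -
  let ?D = "R_den (const_ser Z0) V0"
  have Z: "fps_nth (const_ser Z0) 0 = 1" by (simp add: const_ser_def Z0_0 one_pCons)
  have D0: "fps_nth ?D 0 = 192"
    by (simp add: R_den_def fps_nth_power_0 fps_numeral_nth Z V0_0 power2_eq_square)
  have "\<exists>!G. fps_nth G 0 = [:1/192:] \<and> poly [:-1, ?D:] G = 0"
    by (rule hensel[where w = "[:1/192:]"]) (simp_all add: pderiv_pCons D0 numeral_poly one_pCons)
  then obtain G where "G * ?D = 1" by (auto simp: algebra_simps)
  then have "(R_num (const_ser Z0) V0 * G) * ?D = R_num (const_ser Z0) V0" by (simp add: mult.assoc)
  then show ?thesis by blast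
qed

definition R0 where "R0 = (SOME R. R * R_den (const_ser Z0) V0 = R_num (const_ser Z0) V0)"

lemma R0: "R0 * R_den (const_ser Z0) V0 = R_num (const_ser Z0) V0"
  unfolding R0_def by (rule someI_ex[OF R_exists])

lemma subst_R0:
  "subst \<eta> R0 * R_den (ser_of_rat Z0) (subst \<eta> V0) = R_num (ser_of_rat Z0) (subst \<eta> V0)"
proof -
  interpret s: comm_ring_hom "subst \<eta>" by (rule subst_hom)
  show ?thesis using arg_cong[OF R0, of "subst \<eta>"]
    by (simp add: R_den_def R_num_def N_poly_def s.hom_add s.hom_minus s.hom_uminus s.hom_mult s.hom_power
        s.hom_numeral subst_const_ser)
qed

definition TT :: "'a::field_char_0 fls" where "TT = eval0 T0"
definition ZZ :: "'a::field_char_0 fls" where "ZZ = eval0 Z0"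
definition VV :: "'a::field_char_0 fps \<Rightarrow> 'a fls" where "VV \<eta> = fps_to_fls (subst \<eta> V0)"

lemma fls_nonzeroI: "fps_nth f 0 \<noteq> 0 \<Longrightarrow> fps_to_fls f \<noteq> 0"
  by auto

lemma TT_ZZ: "(TT :: 'a::field_char_0 fls) = ZZ^2"
  using ser_Z_sq[where 'a = 'a] by (simp add: TT_def ZZ_def eval0_ser_of_rat fps_to_fls_power[symmetric])

lemma TT_eq: "256 * fls_X^2 * TT^3 = (TT - 1) * (TT + 3 :: 'a::field_char_0 fls)^3"
proof -
  interpret e: comm_ring_hom "eval0 :: rat fps \<Rightarrow> 'a fls" by (rule eval0_hom)
  have X: "eval0 fps_X = (fls_X :: 'a fls)"
  proof -
    have "Abs_fps (\<lambda>n. of_rat (fps_nth fps_X n)) = (fps_X :: 'a fps)" by (intro fps_ext) (simp add: fps_X_def)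
    then show ?thesis by (simp add: eval0_def)
  qed
  show ?thesis using arg_cong[OF T0_eq, of "eval0 :: _ \<Rightarrow> 'a fls"]
    by (simp add: TT_def X e.hom_mult e.hom_add e.hom_minus e.hom_power e.hom_numeral)
qed

lemma VV_cubic: "1 - TT + 3 * VV \<eta> + VV \<eta> * TT
    = fps_to_fls \<eta> * VV \<eta>^2 * (3 + VV \<eta> + TT - VV \<eta> * TT)"
proof -
  interpret f: comm_ring_hom "fps_to_fls :: 'a fps \<Rightarrow> 'a fls" by (rule fps_to_fls_hom)
  show ?thesis using arg_cong[OF subst_V_cubic[of \<eta>], of fps_to_fls]
    by (simp add: VV_def TT_def eval0_ser_of_rat f.hom_mult f.hom_add f.hom_minus f.hom_power f.hom_numeral)
qed

lemma ZZ_nonzero: "ZZ \<noteq> (0 :: 'a::field_char_0 fls)"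
  unfolding ZZ_def eval0_ser_of_rat by (rule fls_nonzeroI) (simp add: ser_Z_0)

lemma TT_not_1: "TT \<noteq> (1 :: 'a::field_char_0 fls)"
proof
  assume "TT = (1 :: 'a fls)"
  then have "ser_of_rat T0 = (1 :: 'a fps)" by (simp add: TT_def eval0_ser_of_rat)
  moreover obtain \<tau> where "ser_of_rat T0 = 1 + fps_X^2 * \<tau>" "fps_nth \<tau> 0 = (4 :: 'a)" by (rule ser_T_decompose)
  ultimately show False by auto
qed

lemma VV_nonzero: "VV \<eta> \<noteq> 0"
  using VV_cubic[of \<eta>] TT_not_1 by auto

lemma VV_plus_1: "1 + VV \<eta> \<noteq> 0"
proof -
  have "1 + VV \<eta> = fps_to_fls (1 + subst \<eta> V0)" by (simp add: VV_def)
  then show ?thesis using fls_nonzeroI[of "1 + subst \<eta> V0"] by (simp add: subst_V_0)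
qed

lemma VZ_nonzero: "VV \<eta> * ZZ - VV \<eta> - ZZ - 1 \<noteq> 0"
proof -
  let ?f = "subst \<eta> V0 * ser_of_rat Z0 - subst \<eta> V0 - ser_of_rat Z0 - 1"
  have "VV \<eta> * ZZ - VV \<eta> - ZZ - 1 = fps_to_fls ?f"
    by (simp add: VV_def ZZ_def eval0_ser_of_rat fls_times_fps_to_fls)
  moreover have "fps_to_fls ?f \<noteq> 0" by (rule fls_nonzeroI) (simp add: subst_V_0 ser_Z_0)
  ultimately show ?thesis by (simp only: simp_thms)
qed

lemma R_den_nonzero: "R_den ZZ (VV \<eta>) \<noteq> 0"
  using ZZ_nonzero VV_plus_1[of \<eta>] VZ_nonzero[of \<eta>] by (simp add: R_den_def add.commute)

lemma R_eval: "fps_to_fls (subst \<eta> R0) = R_num ZZ (VV \<eta>) / R_den ZZ (VV \<eta>)"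
proof -
  interpret f: comm_ring_hom "fps_to_fls :: 'a fps \<Rightarrow> 'a fls" by (rule fps_to_fls_hom)
  have "fps_to_fls (subst \<eta> R0) * R_den ZZ (VV \<eta>) = R_num ZZ (VV \<eta>)"
    using arg_cong[OF subst_R0[of \<eta>], of fps_to_fls]
    by (simp add: R_den_def R_num_def N_poly_def ZZ_def VV_def eval0_ser_of_rat f.hom_add f.hom_minus f.hom_uminus
        f.hom_mult f.hom_power f.hom_numeral)
  then show ?thesis using R_den_nonzero[of \<eta>] by (simp add: eq_divide_eq)
qed

text \<open>This denominator vanishes at \<open>t = 0\<close>, to order exactly \<open>2\<close>.\<close>

lemma B_den_nonzero: "B_den TT (VV \<eta>) \<noteq> 0"
proof -
  interpret f: comm_ring_hom "fps_to_fls :: 'a fps \<Rightarrow> 'a fls" by (rule fps_to_fls_hom)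
  obtain \<tau> where t: "ser_of_rat T0 = 1 + fps_X^2 * \<tau>" "fps_nth \<tau> 0 = (4 :: 'a)" by (rule ser_T_decompose)
  obtain W where W: "subst \<eta> V0 = fps_X^2 * W" "fps_nth W 0 = 1" by (rule subst_V_decompose)
  let ?T = "ser_of_rat T0 :: 'a fps" and ?v = "subst \<eta> V0"
  define g where "g = 2 * (?v + 1) * (\<tau> * (?T + 3) - W * (2 * ?T^2 + 6) + fps_X^2 * W^2 * (?T^2 + 2 * ?T - 3))"
  have "B_den ?T ?v = fps_X^2 * g"
    unfolding B_den_def g_def W(1) t(1) by Groebner_Basis.algebra
  moreover have "fps_nth g 0 = 16"
    by (simp add: g_def fps_numeral_nth subst_V_0 ser_T_0 t(2) W(2) power2_eq_square)
  then have "g \<noteq> 0" by auto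
  ultimately have "fps_to_fls (B_den ?T ?v) \<noteq> 0" by simp
  moreover have "B_den TT (VV \<eta>) = fps_to_fls (B_den ?T ?v)"
    by (simp add: B_den_def TT_def VV_def eval0_ser_of_rat f.hom_add f.hom_minus f.hom_uminus
        f.hom_mult f.hom_power f.hom_numeral)
  ultimately show ?thesis by simp
qed

text \<open>At \<open>x = 0\<close> the equation of \<open>V\<close> is linear and gives \<open>(1 + T) m = 2\<close>.\<close>

lemma R_at_0: "fps_to_fls (subst 0 R0) = g0_fun ZZ"
proof -
  define v m where "v = VV (0 :: 'a fps)" and "m = (1 - v) / (1 + v)"
  define T where "T = (TT :: 'a fls)"
  have v1: "1 + v \<noteq> 0" by (simp add: v_def VV_plus_1)
  have T: "T = ZZ^2" by (simp add: T_def TT_ZZ)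
  have cubic: "1 - T + 3 * v + v * T = 0" using VV_cubic[of 0] by (simp add: v_def T_def)
  have mv: "m * (1 + v) = 1 - v" using v1 by (simp add: m_def)
  have a0: "1 + T \<noteq> 0"
  proof -
    have "1 + T = fps_to_fls (1 + ser_of_rat T0)" by (simp add: T_def TT_def eval0_ser_of_rat)
    then show ?thesis using fls_nonzeroI[of "1 + ser_of_rat T0 :: 'a fps"] by (simp add: ser_T_0)
  qed
  have "(1 + v) * ((1 + T) * m - 2) = 0" using mv cubic by Groebner_Basis.algebra
  then have am: "(1 + T) * m = 2" using v1 by simp
  have T1: "T - 1 \<noteq> 0" using TT_not_1 by (simp add: T_def)
  have "(1 - T * m^2) * (1 + T)^2 = (1 + T)^2 - T * ((1 + T) * m)^2" by Groebner_Basis.algebra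
  then have q: "(1 - T * m^2) * (1 + T)^2 = (T - 1)^2" unfolding am by Groebner_Basis.algebra
  then have n1: "1 - T * m^2 \<noteq> 0" using T1 by auto
  have "(1 + 0) * (R_num ZZ v / R_den ZZ v) = h_fun ZZ (m^2) - (-1) / 6 + 1/6 - g0_fun ZZ"
  proof (rule h_fun_eq)
    show "m = (1 - v) / (1 + v)" by (simp add: m_def)
    show "1 - ZZ^2 + 3 * v + v * ZZ^2 = 0 * v^2 * (3 + v + ZZ^2 - v * ZZ^2)"
      using cubic by (simp add: T)
    show "v \<noteq> -1" using v1 by (auto simp: eq_neg_iff_add_eq_0 add.commute)
    show "v \<noteq> 0" "v * ZZ - v - ZZ - 1 \<noteq> 0" using VV_nonzero VZ_nonzero by (simp_all add: v_def)
    show "1 - ZZ^2 * m^2 \<noteq> 0" using n1 by (simp add: T)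
  qed (simp_all add: ZZ_nonzero)
  moreover have "h_fun ZZ (m^2) = 2 * g0_fun ZZ - 1/3"
  proof -
    define p1 p2 where "p1 = (T - 1) * (T + 3) / (1 - m^2)" and "p2 = (T - 1)^2 / (1 - T * m^2)"
    have T3: "T + 3 \<noteq> 0"
    proof -
      have "T + 3 = fps_to_fls (ser_of_rat T0 + 3)" by (simp add: T_def TT_def eval0_ser_of_rat)
      then show ?thesis using fls_nonzeroI[of "ser_of_rat T0 + 3 :: 'a fps"] by (simp add: ser_T_0 fps_numeral_nth)
    qed
    have "(1 - m^2) * (1 + T)^2 = (1 + T)^2 - ((1 + T) * m)^2" by Groebner_Basis.algebra
    then have d: "(1 - m^2) * (1 + T)^2 = (T - 1) * (T + 3)" unfolding am by Groebner_Basis.algebra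
    then have "1 - m^2 \<noteq> 0" using T1 T3 by auto
    then have "p1 = (1 + T)^2" unfolding p1_def d[symmetric] by simp
    moreover have "p2 = (1 + T)^2" unfolding p2_def q[symmetric] using n1 by simp
    ultimately have "h_fun ZZ (m^2) = - ((1 + T)^2 / (12 * ZZ^3))"
      by (simp add: h_fun_def T[symmetric] p1_def[symmetric] p2_def[symmetric])
    then show ?thesis using ZZ_nonzero by (simp add: g0_fun_def T[symmetric] field_simps)
  qed
  ultimately show ?thesis by (simp add: R_eval v_def)
qed

end

section \<open>The closed forms\<close>

locale kernel_curve = transcendental_point a + parametrization T0 Z0 V0
  for a :: "'a::field_char_0" and T0 Z0 V0
begin

definition d where "d = (a^2 - 1) / (a^2 + 1)"

lemma d_nonzero: "d \<noteq> 0" and d2_not_1: "d^2 - 1 \<noteq> 0"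
proof -
  show "d \<noteq> 0" using a2_plus_1 a2_minus_1 by (simp add: d_def)
  have "(d^2 - 1) * (a^2 + 1)^2 = - 4 * a^2"
  proof -
    have "d * (a^2 + 1) = a^2 - 1" using a2_plus_1 by (simp add: d_def)
    then have "(d * (a^2 + 1))^2 = (a^2 - 1)^2" by simp
    then show ?thesis by Groebner_Basis.algebra
  qed
  then show "d^2 - 1 \<noteq> 0" using a_nonzero by auto
qed

text \<open>The closed form of \<open>t\<^sup>2 (x + 1/x) A(x)\<close> at \<open>x\<^sup>2 = \<eta>\<close>.\<close>

definition G_at where "G_at \<eta> = (1 + fps_to_fls \<eta>) * (R_num ZZ (VV \<eta>) / R_den ZZ (VV \<eta>))"

text \<open>The two relations that the closed forms have to satisfy on the kernel. The proof supplies the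
  algebraic identities above with their hypotheses: all nonvanishing conditions and all choices of branches are
  decided by constant terms in \<open>t\<close>.\<close>

lemma closed_forms_on_kernel:
  fixes e :: "'a fls"
  defines "e \<equiv> (Yl^2 - 1) / (Yl^2 + 1)"
  shows "G_at (Y^2) + (e + 1) / 6 = G_at (fps_const (a^2)) + G_at (fps_const (1/a^2)) + g0_fun ZZ"
    and "B_num TT (VV (Y^2)) = ((G_at (fps_const (a^2)) - G_at (fps_const (1/a^2))) / c d - (e + 1) / 6) * B_den TT (VV (Y^2))"
proof -
  interpret f: comm_ring_hom "fps_to_fls :: 'a fps \<Rightarrow> 'a fls" by (rule fps_to_fls_hom)
  interpret k: field_hom "fls_const :: 'a \<Rightarrow> 'a fls" by (rule fls_const_hom)
  define T Z where "T = (TT :: 'a fls)" and "Z = (ZZ :: 'a fls)"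
  define Tf Zf where "Tf = (ser_of_rat T0 :: 'a fps)" and "Zf = (ser_of_rat Z0 :: 'a fps)"
  define vf where "vf \<eta> = subst \<eta> V0" for \<eta> :: "'a fps"
  define mf where "mf \<eta> = (1 - vf \<eta>) * inverse (1 + vf \<eta>)" for \<eta> :: "'a fps"
  define m where "m \<eta> = fps_to_fls (mf \<eta>)" for \<eta>
  have Tf: "T = fps_to_fls Tf" and Zf: "Z = fps_to_fls Zf"
    by (simp_all add: T_def Tf_def TT_def Z_def Zf_def ZZ_def eval0_ser_of_rat)
  have Tf0: "fps_nth Tf 0 = 1" and Zf0: "fps_nth Zf 0 = 1" by (simp_all add: Tf_def Zf_def ser_T_0 ser_Z_0)
  have vf0: "fps_nth (vf \<eta>) 0 = 0" for \<eta> by (simp add: vf_def subst_V_0)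
  have i1: "(1 + vf \<eta>) * inverse (1 + vf \<eta>) = 1" for \<eta> by (rule inverse_mult_eq_1') (simp add: vf0)
  have mf0: "fps_nth (mf \<eta>) 0 = 1" for \<eta> by (simp add: mf_def vf0)
  have mf1: "mf \<eta> * (1 + vf \<eta>) = 1 - vf \<eta>" for \<eta>
    using i1[of \<eta>] unfolding mf_def by (metis mult.assoc mult.commute mult.right_neutral)
  have VVf: "VV \<eta> = fps_to_fls (vf \<eta>)" for \<eta> by (simp add: VV_def vf_def)
  have m_mult: "m \<eta> * (1 + VV \<eta>) = 1 - VV \<eta>" for \<eta>
    using arg_cong[OF mf1[of \<eta>], of fps_to_fls] by (simp add: m_def VVf f.hom_mult f.hom_add f.hom_minus)
  have m_eq: "m \<eta> = (1 - VV \<eta>) / (1 + VV \<eta>)" for \<eta>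
    using m_mult[of \<eta>] VV_plus_1[of \<eta>] by (simp add: eq_divide_eq)
  have V1: "VV \<eta> \<noteq> -1" for \<eta> using VV_plus_1[of \<eta>] by (auto simp: eq_neg_iff_add_eq_0 add.commute)
  define m1 m2 m3 where "m1 = m (fps_const (a^2))" and "m2 = m (fps_const (1/a^2))" and "m3 = m (Y^2)"
  define A B where "A = 1 + T" and "B = 3 - T"
  \<comment> \<open>the three points \<open>a\<^sup>2\<close>, \<open>1/a\<^sup>2\<close>, \<open>Y\<^sup>2\<close> at which \<open>V\<close> is evaluated\<close>
  define x1 x2 x3 where "x1 = fps_to_fls (fps_const (a^2))" and "x2 = fps_to_fls (fps_const (1/a^2))"
    and "x3 = fps_to_fls (Y^2)"
  have x3: "x3 = Yl^2" by (simp add: x3_def Yl_def f.hom_power)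
  have x1: "x1 = c (a^2)" and x2: "x2 = c (1/a^2)" by (simp_all add: x1_def x2_def)
  have x1nz: "x1 + 1 \<noteq> 0"
  proof -
    have "x1 + 1 = c (a^2 + 1)" by (simp only: x1 k.hom_add k.hom_one)
    then show ?thesis using a2_plus_1 by simp
  qed
  have x2nz: "x2 + 1 \<noteq> 0"
  proof -
    have "x2 + 1 = c (1/a^2 + 1)" by (simp only: x2 k.hom_add k.hom_one)
    moreover have "1/a^2 + 1 = (a^2 + 1) / a^2" using a_nonzero by (simp add: field_simps)
    ultimately show ?thesis using a2_plus_1 a_nonzero by simp
  qed
  have x3nz: "x3 + 1 \<noteq> 0"
  proof -
    have "x3 + 1 = fps_to_fls (Y^2 + 1)" by (simp add: x3_def)
    then show ?thesis using fls_nonzeroI[of "Y^2 + 1"] by (simp add: Y_0 power2_eq_square)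
  qed
  have d1: "c d = (x1 - 1) / (x1 + 1)"
    by (simp only: x1 d_def fls_const_divide_const[symmetric] k.hom_add k.hom_minus k.hom_one)
  have d2: "- c d = (x2 - 1) / (x2 + 1)"
  proof -
    have "(1/a^2 - 1) / (1/a^2 + 1) = - d"
    proof -
      have "(1/a^2 - 1) * a^2 = 1 - a^2" "(1/a^2 + 1) * a^2 = a^2 + 1"
        using a_nonzero by (simp_all add: left_diff_distrib distrib_right)
      then have "(1/a^2 - 1) / (1/a^2 + 1) = (1 - a^2) / (a^2 + 1)"
        using a_nonzero by (metis mult_divide_mult_cancel_right power_not_zero)
      then show ?thesis by (simp add: d_def minus_divide_left)
    qed
    moreover have "(x2 - 1) / (x2 + 1) = c ((1/a^2 - 1) / (1/a^2 + 1))"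
      by (simp only: x2 fls_const_divide_const[symmetric] k.hom_add k.hom_minus k.hom_one)
    ultimately show ?thesis by (simp only: k.hom_uminus)
  qed
  have e3: "e = (x3 - 1) / (x3 + 1)" by (simp add: e_def x3)
  have xn1: "x1 \<noteq> -1" "x2 \<noteq> -1" "x3 \<noteq> -1" using x1nz x2nz x3nz by (auto simp: eq_neg_iff_add_eq_0)
  have TZ: "T = Z^2" by (simp add: T_def Z_def TT_ZZ)
  have cub: "1 - T + 3 * VV \<eta> + VV \<eta> * T = fps_to_fls \<eta> * VV \<eta>^2 * (3 + VV \<eta> + T - VV \<eta> * T)" for \<eta>
    unfolding T_def by (rule VV_cubic)
  have c1: "2 * c d * (1 - T * m1^2) = m1 * (B - A * m1^2)"
    unfolding A_def B_def by (rule cubic_in_m[OF V1 xn1(1) _ d1]) (simp add: m1_def m_eq, simp only: x1_def cub)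
  have "2 * (- c d) * (1 - T * m2^2) = m2 * (B - A * m2^2)"
    unfolding A_def B_def by (rule cubic_in_m[OF V1 xn1(2) _ d2]) (simp add: m2_def m_eq, simp only: x2_def cub)
  then have c2: "- 2 * c d * (1 - T * m2^2) = m2 * (B - A * m2^2)" by simp
  have c3: "2 * e * (1 - T * m3^2) = m3 * (B - A * m3^2)"
    unfolding A_def B_def by (rule cubic_in_m[OF V1 xn1(3) _ e3]) (simp add: m3_def m_eq, simp only: x3_def cub)
  \<comment> \<open>the third root of the cubic of \<open>m1\<close> and \<open>-m2\<close>, from the sum \<open>2 d T / (1 + T)\<close> of the three roots\<close>
  define rf where "rf = fps_const (2 * d) * Tf * inverse (1 + Tf) - mf (fps_const (a^2)) + mf (fps_const (1/a^2))"
  define r where "r = fps_to_fls rf"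
  have rf0: "fps_nth rf 0 = d" by (simp add: rf_def Tf0 mf0)
  have "(1 + Tf) * inverse (1 + Tf) = 1" by (rule inverse_mult_eq_1') (simp add: Tf0)
  then have "(1 + Tf) * (rf + mf (fps_const (a^2)) - mf (fps_const (1/a^2))) = fps_const (2 * d) * Tf"
    unfolding rf_def by Groebner_Basis.algebra
  then have "A * (r + m1 - m2) = c (2 * d) * T"
    unfolding A_def r_def m1_def m2_def m_def Tf
    by (metis f.hom_add f.hom_minus f.hom_mult f.hom_one fps_const_to_fls)
  then have r: "A * (r + m1 - m2) = 2 * c d * T" by (simp only: k.hom_mult fls_const_numeral)
  have m120: "m1 + m2 \<noteq> 0"
  proof -
    have "m1 + m2 = fps_to_fls (mf (fps_const (a^2)) + mf (fps_const (1/a^2)))" by (simp add: m1_def m2_def m_def)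
    then show ?thesis using fls_nonzeroI[of "mf (fps_const (a^2)) + mf (fps_const (1/a^2))"] by (simp add: mf0)
  qed
  have r0: "r \<noteq> 0" unfolding r_def by (rule fls_nonzeroI) (simp add: rf0 d_nonzero)
  have A0: "A \<noteq> 0"
  proof -
    have "A = fps_to_fls (1 + Tf)" by (simp add: A_def Tf)
    then show ?thesis using fls_nonzeroI[of "1 + Tf"] by (simp add: Tf0)
  qed
  have T3: "T \<noteq> -3"
  proof -
    have "T + 3 = fps_to_fls (Tf + 3)" by (simp add: Tf)
    then have "T + 3 \<noteq> 0" using fls_nonzeroI[of "Tf + 3"] by (simp add: Tf0 fps_numeral_nth)
    then show ?thesis by auto
  qed
  have T1: "T \<noteq> 1" by (simp add: T_def TT_not_1)
  have D0: "1 - T * r^2 \<noteq> 0"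
  proof -
    have "1 - T * r^2 = fps_to_fls (1 - Tf * rf^2)" by (simp add: r_def Tf f.hom_mult f.hom_power)
    moreover have "fps_nth (1 - Tf * rf^2) 0 \<noteq> 0" using d2_not_1 by (simp add: Tf0 rf0 fps_nth_power_0)
    ultimately show ?thesis using fls_nonzeroI by (simp only:)
  qed
  have E0: "A^2 * r^2 - 4 \<noteq> 0"
  proof -
    have "A^2 * r^2 - 4 = fps_to_fls ((1 + Tf)^2 * rf^2 - 4)"
      by (simp add: r_def A_def Tf f.hom_mult f.hom_power)
    moreover have "fps_nth ((1 + Tf)^2 * rf^2 - 4) 0 = 4 * (d^2 - 1)" by (simp add: Tf0 rf0 fps_nth_power_0 fps_numeral_nth)
    then have "fps_nth ((1 + Tf)^2 * rf^2 - 4) 0 \<noteq> 0" using d2_not_1 by simp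
    ultimately show ?thesis using fls_nonzeroI by (simp only:)
  qed
  have R1: "r^2 \<noteq> 1"
  proof -
    have "r^2 - 1 = fps_to_fls (rf^2 - 1)" by (simp add: r_def f.hom_power)
    moreover have "fps_nth (rf^2 - 1) 0 \<noteq> 0" using d2_not_1 by (simp add: rf0 fps_nth_power_0)
    ultimately have "r^2 - 1 \<noteq> 0" using fls_nonzeroI by (simp only:)
    then show ?thesis by simp
  qed
  note vieta = kernel_vieta[of "c d" T m1 m2 r, folded A_def B_def, OF c1 c2 r m120 r0 A0]
  \<comment> \<open>the equation of \<open>Y\<close>, in terms of \<open>e\<close> and \<open>d\<close>, which are rational in \<open>Y\<^sup>2\<close> and \<open>a\<^sup>2\<close>\<close>
  have kern: "(1 - e^2) * (1 - (c d)^2) = 16 * t^2"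
  proof -
    have "e * (Yl^2 + 1) = Yl^2 - 1" using x3nz by (simp add: e_def x3)
    then have "(1 - e^2) * (Yl^2 + 1)^2 = 4 * Yl^2" by Groebner_Basis.algebra
    also have "\<dots> = 4 * (t * c u * (1 + Yl^2))^2" using Yl_eq by metis
    finally have "(Yl^2 + 1)^2 * (1 - e^2 - 4 * t^2 * (c u)^2) = 0" by Groebner_Basis.algebra
    then have 1: "1 - e^2 = 4 * t^2 * (c u)^2" using x3nz x3 by simp
    have "(1 - d^2) * u^2 = 4"
    proof -
      have "d * (a^2 + 1) = a^2 - 1" using a2_plus_1 by (simp add: d_def)
      then have "a^2 * ((1 - d^2) * u^2 - 4) = 0" using au by Groebner_Basis.algebra
      then show ?thesis using a_nonzero by simp
    qed
    then have "c ((1 - d^2) * u^2) = 4" by simp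
    then have "(1 - (c d)^2) * (c u)^2 = 4" by (simp only: k.hom_mult k.hom_minus k.hom_one k.hom_power)
    moreover have "4 * t^2 * (c u)^2 * (1 - (c d)^2) = 4 * t^2 * ((1 - (c d)^2) * (c u)^2)"
      by (simp only: mult_ac)
    ultimately show ?thesis unfolding 1 by simp
  qed
  \<comment> \<open>\<open>T\<close> and \<open>m3\<^sup>2\<close> are \<open>1\<close> up to order \<open>t\<^sup>2\<close>, which excludes this factor\<close>
  obtain \<tau> where t: "Tf = 1 + fps_X^2 * \<tau>" "fps_nth \<tau> 0 = 4" unfolding Tf_def by (rule ser_T_decompose)
  obtain W where W: "vf (Y^2) = fps_X^2 * W" "fps_nth W 0 = 1" unfolding vf_def by (rule subst_V_decompose)
  have quad: "quad_factor T (m3^2) (r^2) \<noteq> 0"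
  proof -
    define i where "i = inverse (1 + vf (Y^2))"
    define \<mu> where "\<mu> = - 4 * W * i^2"
    have ii: "(1 + vf (Y^2)) * i = 1" unfolding i_def by (rule i1)
    have "(mf (Y^2))^2 = 1 - 4 * vf (Y^2) * i^2" unfolding mf_def i_def[symmetric] using ii by Groebner_Basis.algebra
    then have n: "(mf (Y^2))^2 = 1 + fps_X^2 * \<mu>" unfolding W(1) \<mu>_def by (simp add: algebra_simps)
    have \<mu>0: "fps_nth \<mu> 0 = -4"
      by (simp add: \<mu>_def W(2) i_def fps_nth_power_0 vf0 fps_numeral_nth)
    have "\<exists>q. quad_factor Tf ((mf (Y^2))^2) (rf^2) = (fps_X^2)^2 * (4*\<mu>^2*(rf^2-1)^2 - 16*\<tau>*\<mu>*(rf^2-1)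
        - 16*\<tau>^2*(rf^2-1) + fps_X^2 * q)"
      unfolding n t(1) quad_factor_expand by blast
    then obtain q where q: "quad_factor Tf ((mf (Y^2))^2) (rf^2) = (fps_X^2)^2 * (4*\<mu>^2*(rf^2-1)^2
        - 16*\<tau>*\<mu>*(rf^2-1) - 16*\<tau>^2*(rf^2-1) + fps_X^2 * q)" by blast
    have "fps_nth (4*\<mu>^2*(rf^2-1)^2 - 16*\<tau>*\<mu>*(rf^2-1) - 16*\<tau>^2*(rf^2-1) + fps_X^2 * q) 0 = 64 * (d^2 - 1)^2"
      by (simp add: \<mu>0 t(2) rf0 fps_nth_power_0 fps_numeral_nth)
    then have "4*\<mu>^2*(rf^2-1)^2 - 16*\<tau>*\<mu>*(rf^2-1) - 16*\<tau>^2*(rf^2-1) + fps_X^2 * q \<noteq> 0"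
      using d2_not_1 by (metis fps_zero_nth mult_eq_0_iff power_not_zero zero_neq_numeral)
    then have "quad_factor Tf ((mf (Y^2))^2) (rf^2) \<noteq> 0" unfolding q by simp
    then have "fps_to_fls (quad_factor Tf ((mf (Y^2))^2) (rf^2)) \<noteq> 0" by simp
    moreover have "quad_factor T (m3^2) (r^2) = fps_to_fls (quad_factor Tf ((mf (Y^2))^2) (rf^2))"
      by (simp add: quad_factor_def Tf m3_def m_def r_def f.hom_add f.hom_minus f.hom_uminus f.hom_mult f.hom_power
          f.hom_numeral)
    ultimately show ?thesis by simp
  qed
  have Teq: "256 * t^2 * T^3 = (T - 1) * (T + 3)^3" unfolding T_def by (rule TT_eq)
  have mob: "T * A^2 * m3^2 * r^2 - 4 * T * (m3^2 + r^2) + A * B = 0"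
    unfolding A_def B_def
    by (rule kernel_mobius[OF Teq _ _ kern quad]) (use c3 vieta(1) in \<open>simp_all add: A_def B_def\<close>)
  have Z0: "Z \<noteq> 0" by (simp add: Z_def ZZ_nonzero)
  have dc0: "c d \<noteq> 0" using d_nonzero by simp
  have add: "h_fun Z (m3^2) = h_fun Z (m1^2) + h_fun Z (m2^2)"
    by (rule kernel_h_additive[OF TZ, where r = r])
      (use vieta mob Z0 T1 T3 A0 D0 E0 R1 in \<open>simp_all add: A_def B_def\<close>)
  \<comment> \<open>the Moebius relation gives this only up to sign; the constant terms in \<open>t\<close> choose the sign\<close>
  have m3: "m3 * (Z * (4 - A^2 * r^2)) = (m1 + m2) * (A * (1 - T * r^2))"
  proof -
    have om: "(m1 + m2)^2 * (A * (1 - T * r^2))^2 = (A^2 * r^2 - 4) * (4 * T * r^2 - A * B)"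
      unfolding A_def B_def
      by (rule one_minus_products(4)) (use vieta in \<open>simp_all add: A_def B_def\<close>)
    have "((m1 + m2) * (A * (1 - T * r^2)))^2 = (m3 * (Z * (4 - A^2 * r^2)))^2"
    proof -
      have "(m3 * (Z * (4 - A^2 * r^2)))^2 = (A^2 * r^2 - 4) * (T * m3^2 * (A^2 * r^2 - 4))"
        unfolding TZ by Groebner_Basis.algebra
      also have "T * m3^2 * (A^2 * r^2 - 4) = 4 * T * r^2 - A * B" using mob by Groebner_Basis.algebra
      finally show ?thesis using om by (simp add: power_mult_distrib)
    qed
    then have "(m1 + m2) * (A * (1 - T * r^2)) = m3 * (Z * (4 - A^2 * r^2))
        \<or> (m1 + m2) * (A * (1 - T * r^2)) = - (m3 * (Z * (4 - A^2 * r^2)))"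
      by (simp only: power2_eq_iff)
    moreover have "(m1 + m2) * (A * (1 - T * r^2)) + m3 * (Z * (4 - A^2 * r^2)) \<noteq> 0"
    proof -
      let ?g = "(mf (fps_const (a^2)) + mf (fps_const (1/a^2))) * ((1 + Tf) * (1 - Tf * rf^2))
          + mf (Y^2) * (Zf * (4 - (1 + Tf)^2 * rf^2))"
      have "fps_nth ?g 0 = - 8 * (d^2 - 1)"
        by (simp add: mf0 Tf0 Zf0 rf0 fps_nth_power_0 fps_numeral_nth)
      then have "fps_nth ?g 0 \<noteq> 0" using d2_not_1 by simp
      moreover have "(m1 + m2) * (A * (1 - T * r^2)) + m3 * (Z * (4 - A^2 * r^2)) = fps_to_fls ?g"
        by (simp add: m1_def m2_def m3_def m_def r_def A_def Tf Zf f.hom_mult f.hom_power)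
      ultimately show ?thesis using fls_nonzeroI by (simp only:)
    qed
    ultimately show ?thesis by auto
  qed
  have diff: "m3 * ((B - A * m3^2) / (12 * (1 - T * m3^2)) - A^2 * (1 - m3^2) / (4 * (B - T * A * m3^2)))
    = (h_fun Z (m1^2) - h_fun Z (m2^2)) / c d"
    unfolding A_def B_def
    by (rule kernel_h_difference[OF TZ, where r = r])
      (use vieta mob m3 Z0 T1 T3 A0 D0 E0 R1 dc0 in \<open>simp_all add: A_def B_def\<close>)
  note nonzero = kernel_nonzero[of m1 m2 T r "c d" m3, folded A_def B_def, OF vieta(2,3,1) mob T1 T3 D0 E0 R1 dc0]
  have G: "G_at \<eta> = h_fun Z ((m \<eta>)^2) - ((fps_to_fls \<eta> - 1) / (fps_to_fls \<eta> + 1)) / 6 + 1/6 - g0_fun Z"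
    if "fps_to_fls \<eta> \<noteq> -1" "1 - T * (m \<eta>)^2 \<noteq> 0" for \<eta>
    unfolding G_at_def Z_def
  proof (rule h_fun_eq)
    show "1 - ZZ^2 + 3 * VV \<eta> + VV \<eta> * ZZ^2 = fps_to_fls \<eta> * VV \<eta>^2 * (3 + VV \<eta> + ZZ^2 - VV \<eta> * ZZ^2)"
      using cub[of \<eta>] by (simp add: TZ Z_def)
    show "1 - ZZ^2 * (m \<eta>)^2 \<noteq> 0" using that by (simp add: TZ Z_def)
  qed (use that V1 VV_nonzero VZ_nonzero ZZ_nonzero in \<open>simp_all add: m_eq\<close>)
  have G1: "G_at (fps_const (a^2)) = h_fun Z (m1^2) - c d / 6 + 1/6 - g0_fun Z"
    by (rule G[of "fps_const (a^2)", folded m1_def x1_def, OF xn1(1) nonzero(1), folded d1])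
  have G2: "G_at (fps_const (1/a^2)) = h_fun Z (m2^2) + c d / 6 + 1/6 - g0_fun Z"
    using G[of "fps_const (1/a^2)", folded m2_def x2_def, OF xn1(2) nonzero(2), folded d2] by simp
  have G3: "G_at (Y^2) = h_fun Z (m3^2) - e / 6 + 1/6 - g0_fun Z"
    by (rule G[of "Y^2", folded m3_def x3_def, OF xn1(3) nonzero(3), folded e3])
  show "G_at (Y^2) + (e + 1) / 6 = G_at (fps_const (a^2)) + G_at (fps_const (1/a^2)) + g0_fun ZZ"
    unfolding G1 G2 G3 add by (simp add: Z_def add_divide_distrib)
  have "B_num T (VV (Y^2)) = (m3 * ((B - A * m3^2) / (12 * (1 - T * m3^2)) - A^2 * (1 - m3^2) / (4 * (B - T * A * m3^2)))
      - 1/2 - e/6) * B_den T (VV (Y^2))"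
    unfolding A_def B_def
    by (rule B_fraction_eq) (use m_mult[of "Y^2"] c3 nonzero in \<open>simp_all add: A_def B_def m3_def\<close>)
  also have "m3 * ((B - A * m3^2) / (12 * (1 - T * m3^2)) - A^2 * (1 - m3^2) / (4 * (B - T * A * m3^2))) - 1/2 - e/6
    = (G_at (fps_const (a^2)) - G_at (fps_const (1/a^2))) / c d - (e + 1) / 6"
  proof -
    define w where "w = (h_fun Z (m1^2) - h_fun Z (m2^2)) / c d"
    have "(G_at (fps_const (a^2)) - G_at (fps_const (1/a^2))) = (h_fun Z (m1^2) - h_fun Z (m2^2)) - c d / 3"
      unfolding G1 G2 by simp
    then have "(G_at (fps_const (a^2)) - G_at (fps_const (1/a^2))) / c d = w - (c d / 3) / c d"
      by (simp only: w_def diff_divide_distrib)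
    also have "(c d / 3) / c d = 1/3" using dc0 by simp
    finally show ?thesis unfolding diff w_def[symmetric] by (simp add: add_divide_distrib)
  qed
  finally show "B_num TT (VV (Y^2)) = ((G_at (fps_const (a^2)) - G_at (fps_const (1/a^2))) / c d - (e + 1) / 6) * B_den TT (VV (Y^2))"
    by (simp only: T_def)
qed

definition A_closed :: "rat poly fps" where "A_closed = fps_const [:0, 1:] * square_var R0"

lemma subst_A_closed: "subst \<eta> A_closed = \<eta> * subst (\<eta>^2) R0"
proof -
  interpret s: comm_ring_hom "subst \<eta>" by (rule subst_hom)
  show ?thesis by (simp add: A_closed_def s.hom_mult subst_const fps_poly_pCons fps_poly_def[of _ 0] subst_square_var)
qed

lemma A_closed_0: "coeff (fps_nth A_closed n) 0 = 0"
  by (simp add: A_closed_def)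

text \<open>The coefficient of \<open>x\<close> in the closed form is the value of \<open>R0\<close> at \<open>0\<close>; it plays the role of \<open>M\<^bsub>1,0\<^esub>\<close>.\<close>

lemma A_closed_1: "ser_of_rat (Abs_fps (\<lambda>n. coeff (fps_nth A_closed n) 1)) = (subst 0 R0 :: 'a fps)"
proof -
  have "coeff (fps_nth A_closed n) 1 = coeff (fps_nth R0 n) 0" for n
    by (simp add: A_closed_def square_var_def coeff_pCons) (metis One_nat_def coeff_pCons_0 coeff_pCons_Suc coeff_pcompose_0 poly_0_coeff_0)
  moreover have "fps_poly (0 :: 'a fps) = (\<lambda>p. fps_const (of_rat (coeff p 0)))"
  proof
    show "fps_poly (0 :: 'a fps) p = fps_const (of_rat (coeff p 0))" for p
      by (cases p) (simp add: fps_poly_pCons)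
  qed
  ultimately show ?thesis by (simp add: ser_of_rat_def subst_def series_eval_consts)
qed

lemma tuY: "t * c u * Yl = ((Yl^2 - 1) / (Yl^2 + 1) + 1) / 2"
proof -
  have nz: "Yl^2 + 1 \<noteq> 0"
  proof -
    have "Yl^2 + 1 = fps_to_fls (Y^2 + 1)" by (simp add: Yl_def fps_to_fls_power)
    then show ?thesis using fls_nonzeroI[of "Y^2 + 1"] by (simp add: Y_0 power2_eq_square)
  qed
  have "(Yl^2 - 1) / (Yl^2 + 1) + 1 = 2 * Yl^2 / (Yl^2 + 1)" using nz by (simp add: field_simps)
  moreover have "2 * Yl^2 = (2 * (t * c u * Yl)) * (Yl^2 + 1)"
  proof -
    have "2 * Yl^2 = 2 * (Yl * (t * c u * (1 + Yl^2)))" using Yl_eq by (metis power2_eq_square)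
    then show ?thesis by (simp only: mult_ac add.commute)
  qed
  ultimately have "(Yl^2 - 1) / (Yl^2 + 1) + 1 = (2 * (t * c u * Yl)) * (Yl^2 + 1) / (Yl^2 + 1)"
    by (simp only:)
  then show ?thesis using nz by simp
qed

lemma tuY6: "((Yl^2 - 1) / (Yl^2 + 1) + 1) / 6 = t * c u * Yl / 3"
  unfolding tuY divide_divide_eq_left by simp

lemma G_at_A_closed:
  assumes "b \<noteq> 0"
  shows "(c b + 1 / c b) * fps_to_fls (subst (fps_const b) A_closed) = G_at (fps_const (b^2))"
proof -
  have "c b \<noteq> 0" using assms by simp
  then have e: "(c b + 1 / c b) * c b = 1 + c b * c b" by (simp add: distrib_right)
  have "fps_to_fls (subst (fps_const b) A_closed) = c b * fps_to_fls (subst (fps_const (b^2)) R0)"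
    by (simp add: subst_A_closed fls_times_fps_to_fls power2_eq_square)
  then have "(c b + 1 / c b) * fps_to_fls (subst (fps_const b) A_closed)
      = ((c b + 1 / c b) * c b) * fps_to_fls (subst (fps_const (b^2)) R0)" by (simp only: mult.assoc)
  then show ?thesis unfolding e by (simp add: G_at_def R_eval power2_eq_square)
qed

lemma c_inverse: "c (1/a) = 1 / c a"
  by (simp only: fls_const_divide_const[symmetric] fls_const_1)

lemma c_u: "c u = c a + 1 / c a" "c u = c (1/a) + 1 / c (1/a)"
proof -
  show "c u = c a + 1 / c a" unfolding u_def fls_plus_const[symmetric] c_inverse ..
  then show "c u = c (1/a) + 1 / c (1/a)" unfolding c_inverse using a_nonzero by simp
qed

lemma A_closed_kernel:
  "fps_to_fls (subst Y A_closed) + t^2 * (c u)^2 * Yl / 3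
    = t * ((c u)^2 * (fps_to_fls (subst (fps_const a) A_closed) + fps_to_fls (subst (fps_const (1/a)) A_closed))
      + c u * fps_to_fls (subst 0 R0))"
proof -
  let ?e = "(Yl^2 - 1) / (Yl^2 + 1)"
  define S1 S2 S3 where "S1 = fps_to_fls (subst (fps_const a) A_closed)"
    and "S2 = fps_to_fls (subst (fps_const (1/a)) A_closed)" and "S3 = fps_to_fls (subst Y A_closed)"
  have g1: "c u * S1 = G_at (fps_const (a^2))"
    using G_at_A_closed[OF a_nonzero] by (simp only: S1_def c_u(1))
  have a': "1/a \<noteq> 0" and sq: "(1/a)^2 = 1/a^2" using a_nonzero by (simp_all add: power_divide)
  have g2: "c u * S2 = G_at (fps_const (1/a^2))"
    using G_at_A_closed[OF a'] by (simp only: S2_def c_u(2) sq)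
  have "S3 = Yl * fps_to_fls (subst (Y^2) R0)"
    by (simp add: S3_def subst_A_closed fls_times_fps_to_fls Yl_def)
  also have "\<dots> = (t * c u * (1 + Yl^2)) * fps_to_fls (subst (Y^2) R0)" using Yl_eq by metis
  also have "\<dots> = t * c u * G_at (Y^2)" by (simp add: G_at_def R_eval Yl_def fps_to_fls_power)
  finally have g3: "S3 = t * c u * G_at (Y^2)" .
  have "t^2 * (c u)^2 * Yl / 3 = t * c u * ((?e + 1) / 6)"
    unfolding tuY6 by (simp add: power2_eq_square mult_ac del: fls_const_mult_const)
  then have "S3 + t^2 * (c u)^2 * Yl / 3 = t * c u * (G_at (Y^2) + (?e + 1) / 6)"
    unfolding g3 by (simp only: distrib_left)
  also have "\<dots> = t * c u * (c u * S1 + c u * S2 + fps_to_fls (subst 0 R0))"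
    unfolding closed_forms_on_kernel(1) g1 g2 R_at_0 ..
  finally show ?thesis unfolding S1_def S2_def S3_def by (simp add: algebra_simps power2_eq_square del: fls_const_mult_const)
qed

text \<open>The difference of the two sides satisfies the homogeneous equation of \<open>homogeneous_zero\<close>.\<close>

lemma A_closed: "fps_X^2 * A_ser = A_closed"
proof -
  interpret f: comm_ring_hom "fps_to_fls :: 'a fps \<Rightarrow> 'a fls" by (rule fps_to_fls_hom)
  interpret k: field_hom "fls_const :: 'a \<Rightarrow> 'a fls" by (rule fls_const_hom)
  define F where "F = fps_X^2 * A_ser - A_closed"
  have s: "subst \<eta> F = fps_X^2 * subst \<eta> A_ser - subst \<eta> A_closed" for \<eta> :: "'a fps"
  proof -
    interpret s: comm_ring_hom "subst \<eta>" by (rule subst_hom)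
    show ?thesis by (simp add: F_def s.hom_minus s.hom_mult s.hom_power)
  qed
  have r: "ser_of_rat (Abs_fps (\<lambda>n. coeff (fps_nth F n) 1))
      = (fps_X^2 * ser_of_rat (coeff_series M_ser 1 0) - subst 0 R0 :: 'a fps)"
  proof -
    have "coeff (fps_nth A_ser n) 1 = fps_nth (coeff_series M_ser 1 0) n" for n
      by (simp add: A_ser_def coeff_series_def)
    then have "(ser_of_rat (Abs_fps (\<lambda>n. coeff (fps_nth F n) 1)) :: 'a fps)
        = fps_X^2 * ser_of_rat (coeff_series M_ser 1 0) - ser_of_rat (Abs_fps (\<lambda>n. coeff (fps_nth A_closed n) 1))"
      by (intro fps_ext) (simp add: ser_of_rat_def F_def fps_X_power_mult_nth of_rat_diff)
    then show ?thesis unfolding A_closed_1 .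
  qed
  have "F = 0"
  proof (rule homogeneous_zero)
    show "coeff (fps_nth F n) 0 = 0" for n
      by (simp add: F_def A_closed_0 fps_X_power_mult_nth coeff_A_ser M_coeff_00)
    have "fps_to_fls (subst Y F) = fps_to_fls (fps_X * (fps_const (u^2) * (subst (fps_const a) F + subst (fps_const (1/a)) F)
      + fps_const u * ser_of_rat (Abs_fps (\<lambda>n. coeff (fps_nth F n) 1))))"
    proof -
      define S1 S2 S3 where "S1 = fps_to_fls (subst (fps_const a) A_closed)"
        and "S2 = fps_to_fls (subst (fps_const (1/a)) A_closed)" and "S3 = fps_to_fls (subst Y A_closed)"
      define A1 A2 A3 where "A1 = A_at (fps_const a)" and "A2 = A_at (fps_const (1/a))" and "A3 = A_at Y"
      have 1: "A3 + (c u)^2 * Yl / 3 = t * (c u)^2 * (A1 + A2) + t * c u * M10"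
        using kernel_sum by (simp only: A1_def A2_def A3_def)
      have 2: "S3 + t^2 * (c u)^2 * Yl / 3 = t * ((c u)^2 * (S1 + S2) + c u * fps_to_fls (subst 0 R0))"
        using A_closed_kernel by (simp only: S1_def S2_def S3_def)
      have "t^2 * A3 - S3 = t^2 * (A3 + (c u)^2 * Yl / 3) - (S3 + t^2 * (c u)^2 * Yl / 3)"
        by (simp add: algebra_simps)
      also have "\<dots> = t * ((c u)^2 * ((t^2 * A1 - S1) + (t^2 * A2 - S2)) + c u * (t^2 * M10 - fps_to_fls (subst 0 R0)))"
        unfolding 1 2 by (simp add: algebra_simps del: fls_const_mult_const)
      finally show ?thesis
        unfolding s r by (simp add: f.hom_mult f.hom_minus f.hom_add f.hom_power A1_def A2_def A3_def A_at_def S1_def S2_def S3_def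
            M10_def eval0_ser_of_rat k.hom_power del: fls_const_mult_const)
    qed
    then show "subst Y F = fps_X * (fps_const (u^2) * (subst (fps_const a) F + subst (fps_const (1/a)) F)
      + fps_const u * ser_of_rat (Abs_fps (\<lambda>n. coeff (fps_nth F n) 1)))"
      unfolding fps_to_fls_eq_iff .
  qed
  then show ?thesis by (simp add: F_def)
qed

text \<open>With \<open>A\<close> known, the second relation on the kernel gives the value of \<open>B\<close> at \<open>Y\<close>, and substitution of \<open>Y\<close> is
  injective.\<close>

lemma B_closed:
  "fps_X * fps_const [:0, 1:] * B_ser * B_den (const_ser T0) (square_var V0) = B_num (const_ser T0) (square_var V0)"
proof -
  interpret f: comm_ring_hom "fps_to_fls :: 'a fps \<Rightarrow> 'a fls" by (rule fps_to_fls_hom)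
  interpret s: comm_ring_hom "subst Y" by (rule subst_hom)
  let ?e = "(Yl^2 - 1) / (Yl^2 + 1)"
  define S1 S2 where "S1 = fps_to_fls (subst (fps_const a) A_closed)"
    and "S2 = fps_to_fls (subst (fps_const (1/a)) A_closed)"
  have sA: "subst \<eta> A_closed = fps_X^2 * subst \<eta> A_ser" for \<eta> :: "'a fps"
  proof -
    interpret s: comm_ring_hom "subst \<eta>" by (rule subst_hom)
    show ?thesis by (simp add: A_closed[symmetric] s.hom_mult s.hom_power)
  qed
  have S: "S1 = t^2 * A_at (fps_const a)" "S2 = t^2 * A_at (fps_const (1/a))"
    by (simp_all add: S1_def S2_def sA A_at_def f.hom_mult f.hom_power)
  have a': "1/a \<noteq> 0" and sq: "(1/a)^2 = 1/a^2" using a_nonzero by (simp_all add: power_divide)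
  have g: "c u * S1 = G_at (fps_const (a^2))" "c u * S2 = G_at (fps_const (1/a^2))"
    using G_at_A_closed[OF a_nonzero, folded c_u(1)] G_at_A_closed[OF a', folded c_u(2)]
    by (simp_all only: S1_def S2_def sq)
  define x where "x = c a - 1 / c a"
  have xd: "x = c d * c u"
  proof -
    have "d * (a * u) = a^2 - 1" unfolding au d_def using a2_plus_1 by simp
    then have "d * u = a - 1/a" using a_nonzero by (simp add: field_simps power2_eq_square)
    then have "c (d * u) = c (a - 1/a)" by simp
    interpret k: field_hom "fls_const :: 'a \<Rightarrow> 'a fls" by (rule fls_const_hom)
    show ?thesis using \<open>c (d * u) = c (a - 1/a)\<close> by (simp only: k.hom_mult k.hom_minus c_inverse x_def)
  qed
  have cu0: "c u \<noteq> 0" and cd0: "c d \<noteq> 0" using u_nonzero d_nonzero by auto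
  have "c d * c u * (t * (Yl * BY) + t * c u * Yl / 3) = t * (x * (Yl * BY + c u * Yl / 3))"
    unfolding xd by (simp add: algebra_simps del: fls_const_mult_const)
  also have "\<dots> = t * (t * (c u)^2 * (A_at (fps_const a) - A_at (fps_const (1/a))))"
    using kernel_difference by (simp only: x_def)
  also have "\<dots> = c u * (c u * S1 - c u * S2)"
    unfolding S by (simp add: algebra_simps power2_eq_square del: fls_const_mult_const)
  finally have "c u * (c d * (t * (Yl * BY) + t * c u * Yl / 3)) = c u * (c u * S1 - c u * S2)"
    by (simp only: mult_ac)
  then have "c d * (t * (Yl * BY) + t * c u * Yl / 3) = G_at (fps_const (a^2)) - G_at (fps_const (1/a^2))"
    unfolding g by (rule mult_left_cancel[THEN iffD1, OF cu0])
  then have "t * (Yl * BY) + t * c u * Yl / 3 = (G_at (fps_const (a^2)) - G_at (fps_const (1/a^2))) / c d"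
    unfolding nonzero_eq_divide_eq[OF cd0] by (simp only: mult.commute[of _ "c d"])
  then have "t * (Yl * BY) = (G_at (fps_const (a^2)) - G_at (fps_const (1/a^2))) / c d - (?e + 1) / 6"
    unfolding tuY6 by (simp only: eq_diff_eq)
  then have eq: "B_num TT (VV (Y^2)) = t * (Yl * BY) * B_den TT (VV (Y^2))"
    using closed_forms_on_kernel(2) by (simp only:)
  define F where "F = fps_X * fps_const [:0, 1:] * B_ser * B_den (const_ser T0) (square_var V0)
    - B_num (const_ser T0) (square_var V0)"
  have "fps_to_fls (subst Y F) = t * (Yl * BY) * B_den TT (VV (Y^2)) - B_num TT (VV (Y^2))"
    by (simp add: F_def B_den_def B_num_def s.hom_add s.hom_minus s.hom_uminus s.hom_mult s.hom_power s.hom_numeral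
        f.hom_add f.hom_minus f.hom_uminus f.hom_mult f.hom_power f.hom_numeral subst_const_ser subst_square_var
        subst_const fps_poly_pCons fps_poly_def[of _ 0] Yl_def BY_def TT_def VV_def eval0_ser_of_rat mult.assoc)
  then have "subst Y F = 0" using eq by simp
  then have "F = 0" by (rule subst_Y_inj)
  then show ?thesis by (simp add: F_def)
qed

lemma A_value:
  "fls_X^2 * eval1 A_ser a * R_den ZZ (eval1 V0 (a^2)) = fls_const a * R_num ZZ (eval1 V0 (a^2))"
proof -
  interpret f: comm_ring_hom "fps_to_fls :: 'a fps \<Rightarrow> 'a fls" by (rule fps_to_fls_hom)
  interpret s: comm_ring_hom "subst (fps_const a)" by (rule subst_hom)
  have "fls_X^2 * eval1 A_ser a = fps_to_fls (subst (fps_const a) A_closed)"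
    by (simp add: A_closed[symmetric] eval1_subst s.hom_mult s.hom_power f.hom_mult f.hom_power)
  also have "\<dots> = fls_const a * (R_num ZZ (eval1 V0 (a^2)) / R_den ZZ (eval1 V0 (a^2)))"
    by (simp add: subst_A_closed f.hom_mult R_eval VV_def eval1_subst power2_eq_square)
  finally show ?thesis using R_den_nonzero[of "fps_const (a^2)"] by (simp add: VV_def eval1_subst)
qed

lemma B_value:
  "fls_X * fls_const a * eval1 B_ser a * B_den TT (eval1 V0 (a^2)) = B_num TT (eval1 V0 (a^2))"
proof -
  interpret f: comm_ring_hom "fps_to_fls :: 'a fps \<Rightarrow> 'a fls" by (rule fps_to_fls_hom)
  interpret s: comm_ring_hom "subst (fps_const a)" by (rule subst_hom)
  show ?thesis using arg_cong[OF B_closed, of "\<lambda>F. fps_to_fls (subst (fps_const a) F)"]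
    by (simp add: B_den_def B_num_def s.hom_add s.hom_minus s.hom_uminus s.hom_mult s.hom_power s.hom_numeral
        f.hom_add f.hom_minus f.hom_uminus f.hom_mult f.hom_power f.hom_numeral subst_const_ser subst_square_var
        subst_const fps_poly_pCons fps_poly_def[of _ 0] TT_def eval1_subst eval0_ser_of_rat power2_eq_square)
qed

lemma M10_value: "fls_X^2 * eval0 (coeff_series M_ser 1 0) = (g0_fun ZZ :: 'a fls)"
proof -
  have "coeff (fps_nth A_closed n) 1 = fps_nth (fps_X^2 * coeff_series M_ser 1 0) n" for n
    by (simp add: A_closed[symmetric] fps_X_power_mult_nth A_ser_def coeff_series_def)
  then have "(ser_of_rat (Abs_fps (\<lambda>n. coeff (fps_nth A_closed n) 1)) :: 'a fps)
      = ser_of_rat (fps_X^2 * coeff_series M_ser 1 0)" by (simp add: fps_nth_inverse)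
  also have "\<dots> = fps_X^2 * ser_of_rat (coeff_series M_ser 1 0)"
    by (intro fps_ext) (simp add: ser_of_rat_def fps_X_power_mult_nth)
  finally have "subst 0 R0 = (fps_X^2 * ser_of_rat (coeff_series M_ser 1 0) :: 'a fps)" unfolding A_closed_1 .
  then have "fps_to_fls (subst 0 R0) = (fls_X^2 * eval0 (coeff_series M_ser 1 0) :: 'a fls)"
    by (simp add: eval0_ser_of_rat fls_times_fps_to_fls fps_to_fls_power)
  then show ?thesis by (simp only: R_at_0)
qed

end

section \<open>Finite extensions of subfields\<close>

definition subfield_set :: "'a::field set \<Rightarrow> bool" where
  "subfield_set K \<longleftrightarrow> 1 \<in> K \<and> (\<forall>a\<in>K. \<forall>b\<in>K. a - b \<in> K \<and> a * b \<in> K) \<and> (\<forall>a\<in>K. inverse a \<in> K)"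

lemma subfield_gen_field: "subfield_set (gen_field S)"
  by (auto simp: subfield_set_def intro: gen_field.intros)

context
  fixes K :: "'a::field set"
  assumes K: "subfield_set K"
begin

lemma sub_1: "1 \<in> K" and sub_diff: "a \<in> K \<Longrightarrow> b \<in> K \<Longrightarrow> a - b \<in> K"
  and sub_mult: "a \<in> K \<Longrightarrow> b \<in> K \<Longrightarrow> a * b \<in> K" and sub_inverse: "a \<in> K \<Longrightarrow> inverse a \<in> K"
  using K by (auto simp: subfield_set_def)

lemma sub_0: "0 \<in> K"
  using sub_diff[OF sub_1 sub_1] by simp

lemma sub_uminus: "a \<in> K \<Longrightarrow> - a \<in> K"
  using sub_diff[OF sub_0] by simp

lemma sub_add: "a \<in> K \<Longrightarrow> b \<in> K \<Longrightarrow> a + b \<in> K"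
  using sub_diff[of a "-b"] sub_uminus by simp

lemma sub_divide: "a \<in> K \<Longrightarrow> b \<in> K \<Longrightarrow> a / b \<in> K"
  by (simp add: divide_inverse sub_mult sub_inverse)

lemma sub_sum: "(\<And>i. i \<in> I \<Longrightarrow> f i \<in> K) \<Longrightarrow> sum f I \<in> K"
  by (induction I rule: infinite_finite_induct) (auto intro: sub_0 sub_add)

lemma sub_power: "a \<in> K \<Longrightarrow> a ^ n \<in> K"
  by (induction n) (auto intro: sub_1 sub_mult)

lemma sub_numeral: "numeral n \<in> K"
proof -
  have "of_nat k \<in> K" for k by (induction k) (auto intro: sub_0 sub_1 sub_add)
  then show ?thesis by (metis of_nat_numeral)
qed

text \<open>A homogeneous system with more unknowns than equations has a nontrivial solution; one equation is
  eliminated at a time.\<close>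

lemma homogeneous_system:
  fixes n :: nat
  assumes "\<And>i j. a i j \<in> K"
  shows "\<exists>c. (\<forall>i. c i \<in> K) \<and> (\<exists>i\<le>n. c i \<noteq> 0) \<and> (\<forall>j<n. (\<Sum>i\<le>n. c i * a i j) = 0)"
  using assms
proof (induction n arbitrary: a)
  case 0
  then show ?case by (intro exI[of _ "\<lambda>_. 1"]) (auto simp: sub_1)
next
  case (Suc n)
  show ?case
  proof (cases "\<exists>i0\<le>Suc n. a i0 n \<noteq> 0")
    case False
    obtain c where c: "\<forall>i. c i \<in> K" "\<exists>i\<le>n. c i \<noteq> 0" "\<forall>j<n. (\<Sum>i\<le>n. c i * a i j) = 0"
      using Suc.IH[of a] Suc.prems by blast
    show ?thesis
    proof (intro exI[of _ "\<lambda>i. if i \<le> n then c i else 0"] conjI allI impI)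
      show "\<exists>i\<le>Suc n. (if i \<le> n then c i else 0) \<noteq> 0" using c(2) by (metis le_SucI)
      fix j assume "j < Suc n"
      have "(\<Sum>i\<le>Suc n. (if i \<le> n then c i else 0) * a i j) = (\<Sum>i\<le>n. c i * a i j)"
        by simp
      also have "\<dots> = 0" using c(3) False \<open>j < Suc n\<close> by (cases "j = n") auto
      finally show "(\<Sum>i\<le>Suc n. (if i \<le> n then c i else 0) * a i j) = 0" .
    qed (use c sub_0 in auto)
  next
    case True
    then obtain i0 where i0: "i0 \<le> Suc n" "a i0 n \<noteq> 0" by blast
    define s where "s i = (if i < i0 then i else Suc i)" for i
    define b where "b i j = a (s i) j - a (s i) n / a i0 n * a i0 j" for i j
    have "b i j \<in> K" for i j unfolding b_def by (intro sub_diff sub_mult sub_divide Suc.prems)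
    then obtain c where c: "\<forall>i. c i \<in> K" "\<exists>i\<le>n. c i \<noteq> 0" "\<forall>j<n. (\<Sum>i\<le>n. c i * b i j) = 0"
      using Suc.IH[of b] by blast
    \<comment> \<open>\<open>s\<close> skips the pivot \<open>i0\<close>, whose unknown \<open>e\<close> is recovered from the eliminated equation\<close>
    define e where "e = - (\<Sum>i\<le>n. c i * a (s i) n) / a i0 n"
    define d where "d i = (if i = i0 then e else if i < i0 then c i else c (i - 1))" for i
    have ds: "d (s i) = c i" for i by (simp add: d_def s_def)
    have s_inj: "inj_on s {..n}" by (auto simp: inj_on_def s_def split: if_splits)
    have s_im: "{..Suc n} = insert i0 (s ` {..n})"
    proof (intro subset_antisym subsetI)
      fix i assume i: "i \<in> {..Suc n}"
      consider "i = i0" | "i < i0" | "i > i0" by linarith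
      then show "i \<in> insert i0 (s ` {..n})"
      proof cases
        case 2
        then have "i = s i" "i \<le> n" using i0 by (auto simp: s_def)
        then show ?thesis by blast
      next
        case 3
        then have "i = s (i - 1)" "i - 1 \<le> n" using i by (auto simp: s_def)
        then show ?thesis by blast
      qed simp
    qed (use i0 in \<open>auto simp: s_def\<close>)
    have s_ni: "i0 \<notin> s ` {..n}" by (auto simp: s_def)
    have sum: "(\<Sum>i\<le>Suc n. d i * a i j) = e * a i0 j + (\<Sum>i\<le>n. c i * a (s i) j)" for j
    proof -
      have "d i0 = e" by (simp add: d_def)
      then show ?thesis unfolding s_im using s_ni
        by (subst sum.insert) (simp_all add: sum.reindex[OF s_inj] ds)
    qed
    show ?thesis
    proof (intro exI[of _ d] conjI allI impI)
      have "e \<in> K" unfolding e_def by (intro sub_divide sub_uminus sub_sum sub_mult Suc.prems) (use c in auto)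
      then show "d i \<in> K" for i using c by (simp add: d_def)
      obtain i where "i \<le> n" "c i \<noteq> 0" using c by blast
      then show "\<exists>i\<le>Suc n. d i \<noteq> 0" using ds[of i] by (intro exI[of _ "s i"]) (auto simp: s_def)
      fix j assume j: "j < Suc n"
      show "(\<Sum>i\<le>Suc n. d i * a i j) = 0"
      proof (cases "j = n")
        case True
        then show ?thesis unfolding sum using i0 by (simp add: e_def)
      next
        case False
        then have "(\<Sum>i\<le>n. c i * b i j) = 0" using c(3) j by simp
        then have "(\<Sum>i\<le>n. c i * a (s i) j) = (\<Sum>i\<le>n. c i * a (s i) n) / a i0 n * a i0 j"
          by (simp add: b_def right_diff_distrib sum_subtractf sum_distrib_right sum_divide_distrib mult.assoc)
        then show ?thesis unfolding sum by (simp add: e_def)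
      qed
    qed
  qed
qed

text \<open>Dimensions are only ever bounded from above, so the generators \<open>e\<close> may be dependent and repeated.\<close>

definition fspan :: "nat \<Rightarrow> (nat \<Rightarrow> 'a) \<Rightarrow> 'a set" where
  "fspan n e = {\<Sum>i<n. c i * e i | c. \<forall>i. c i \<in> K}"

lemma fspanI: "(\<And>i. c i \<in> K) \<Longrightarrow> (\<Sum>i<n. c i * e i) \<in> fspan n e"
  by (auto simp: fspan_def)

lemma fspan_add: "u \<in> fspan n e \<Longrightarrow> v \<in> fspan n e \<Longrightarrow> u + v \<in> fspan n e"
proof -
  assume "u \<in> fspan n e" "v \<in> fspan n e"
  then obtain c d where c: "u = (\<Sum>i<n. c i * e i)" "\<forall>i. c i \<in> K" and d: "v = (\<Sum>i<n. d i * e i)" "\<forall>i. d i \<in> K"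
    by (auto simp: fspan_def)
  have "u + v = (\<Sum>i<n. (c i + d i) * e i)" by (simp add: c d sum.distrib distrib_right)
  then show ?thesis using c d by (auto intro!: fspanI sub_add)
qed

lemma fspan_scale: "k \<in> K \<Longrightarrow> v \<in> fspan n e \<Longrightarrow> k * v \<in> fspan n e"
proof -
  assume k: "k \<in> K" and "v \<in> fspan n e"
  then obtain d where d: "v = (\<Sum>i<n. d i * e i)" "\<forall>i. d i \<in> K" by (auto simp: fspan_def)
  have "k * v = (\<Sum>i<n. (k * d i) * e i)" by (simp add: d sum_distrib_left mult.assoc)
  then show ?thesis using k d by (auto intro!: fspanI sub_mult)
qed

lemma fspan_0: "0 \<in> fspan n e"
  using fspanI[of "\<lambda>_. 0" e n] sub_0 by simp

lemma fspan_sum: "(\<And>i. i \<in> I \<Longrightarrow> f i \<in> fspan n e) \<Longrightarrow> sum f I \<in> fspan n e"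
  by (induction I rule: infinite_finite_induct) (auto intro: fspan_0 fspan_add)

lemma fspan_base: "i < n \<Longrightarrow> e i \<in> fspan n e"
proof -
  assume i: "i < n"
  have "(\<Sum>j<n. (if j = i then 1 else 0) * e j) = (\<Sum>j<n. if j = i then e j else 0)"
    by (rule sum.cong) auto
  also have "\<dots> = e i" using i by simp
  finally show ?thesis using fspanI[of "\<lambda>j. if j = i then 1 else 0" e n] sub_0 sub_1 by simp
qed

lemma fspan_dependent:
  assumes "\<And>i. f i \<in> fspan n e"
  shows "\<exists>c. (\<forall>i. c i \<in> K) \<and> (\<exists>i\<le>n. c i \<noteq> 0) \<and> (\<Sum>i\<le>n. c i * f i) = 0"
proof -
  have "\<forall>i. \<exists>a. (\<forall>j. a j \<in> K) \<and> f i = (\<Sum>j<n. a j * e j)"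
    using assms by (fastforce simp: fspan_def)
  then obtain a where a: "\<And>i j. a i j \<in> K" "\<And>i. f i = (\<Sum>j<n. a i j * e j)" by metis
  obtain c where c: "\<forall>i. c i \<in> K" "\<exists>i\<le>n. c i \<noteq> 0" "\<forall>j<n. (\<Sum>i\<le>n. c i * a i j) = 0"
    using homogeneous_system[of a n] a(1) by blast
  have "(\<Sum>i\<le>n. c i * f i) = (\<Sum>i\<le>n. \<Sum>j<n. c i * a i j * e j)"
    by (simp add: a(2) sum_distrib_left mult.assoc)
  also have "\<dots> = (\<Sum>j<n. (\<Sum>i\<le>n. c i * a i j) * e j)"
    by (subst sum.swap) (simp add: sum_distrib_right)
  finally show ?thesis using c by auto
qed

lemma annihilating_polynomial:
  assumes "\<And>i. b ^ i \<in> fspan n e"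
  shows "\<exists>q. q \<noteq> 0 \<and> set (coeffs q) \<subseteq> K \<and> poly q b = 0 \<and> degree q \<le> n"
proof -
  obtain c where c: "\<forall>i. c i \<in> K" "\<exists>i\<le>n. c i \<noteq> 0" "(\<Sum>i\<le>n. c i * b ^ i) = 0"
    using fspan_dependent[of "\<lambda>i. b ^ i" n e] assms by blast
  define q where "q = (\<Sum>i\<le>n. monom (c i) i)"
  have co: "coeff q i = (if i \<le> n then c i else 0)" for i by (simp add: q_def coeff_sum)
  have "q \<noteq> 0" using c(2) co by (metis coeff_0)
  moreover have "degree q \<le> n" by (rule degree_le) (simp add: co)
  moreover have "poly q b = 0" using c(3) by (simp add: q_def poly_sum poly_monom)
  moreover have "set (coeffs q) \<subseteq> K" using c(1) co sub_0 by (auto simp: coeffs_def)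
  ultimately show ?thesis by blast
qed

text \<open>The span of the powers of \<open>\<alpha>\<close> is closed under multiplication by \<open>\<alpha>\<close>. An inverse of \<open>u\<close> is a polynomial in
  \<open>u\<close>, obtained from a polynomial that annihilates \<open>u\<close> and has nonzero constant coefficient.\<close>

lemma adjoin_root:
  assumes p: "set (coeffs p) \<subseteq> K" "p \<noteq> 0" "poly p \<alpha> = 0"
  shows "subfield_set (fspan (degree p) (\<lambda>i. \<alpha> ^ i))" and "K \<subseteq> fspan (degree p) (\<lambda>i. \<alpha> ^ i)"
    and "\<alpha> \<in> fspan (degree p) (\<lambda>i. \<alpha> ^ i)"
proof -
  define n where "n = degree p"
  define L where "L = fspan n (\<lambda>i. \<alpha> ^ i)"
  have n0: "n > 0"
  proof (rule ccontr)
    assume "\<not> n > 0"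
    then have "degree p = 0" by (simp add: n_def)
    then obtain k where "p = [:k:]" by (rule degree_eq_zeroE)
    then show False using p by simp
  qed
  have pc: "coeff p i \<in> K" for i
    using p(1) sub_0 by (metis coeff_in_coeffs coeff_eq_0 leI subsetD p(2))
  have one: "1 \<in> L" using fspan_base[of 0 n "\<lambda>i. \<alpha> ^ i"] n0 by (simp add: L_def)
  have KL: "k \<in> L" if "k \<in> K" for k using fspan_scale[OF that one[unfolded L_def]] by (simp add: L_def)
  have top: "\<alpha> ^ n \<in> L"
  proof -
    have "(\<Sum>i<n. coeff p i * \<alpha> ^ i) + coeff p n * \<alpha> ^ n = 0"
      using p(3) by (simp add: poly_altdef n_def lessThan_Suc_atMost[symmetric])
    then have "coeff p n * \<alpha> ^ n = - (\<Sum>i<n. coeff p i * \<alpha> ^ i)" by (simp add: eq_neg_iff_add_eq_0 add.commute)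
    moreover have "coeff p n \<noteq> 0" using p(2) by (simp add: n_def)
    ultimately have "\<alpha> ^ n = (- inverse (coeff p n)) * (\<Sum>i<n. coeff p i * \<alpha> ^ i)"
      by (simp add: field_simps)
    then show ?thesis unfolding L_def
      by (simp only:) (intro fspan_scale fspanI sub_uminus sub_inverse pc)
  qed
  have mult_alpha: "\<alpha> * v \<in> L" if v: "v \<in> L" for v
  proof -
    obtain c where c: "v = (\<Sum>i<n. c i * \<alpha> ^ i)" "\<forall>i. c i \<in> K" using v by (auto simp: L_def fspan_def)
    have "\<alpha> ^ Suc i \<in> L" if "i < n" for i
      using that top fspan_base[of "Suc i" n "\<lambda>i. \<alpha> ^ i"] by (cases "Suc i = n") (auto simp: L_def)
    then have "(\<Sum>i<n. c i * \<alpha> ^ Suc i) \<in> L"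
      unfolding L_def by (intro fspan_sum fspan_scale) (use c in auto)
    moreover have "\<alpha> * v = (\<Sum>i<n. c i * \<alpha> ^ Suc i)" by (simp add: c sum_distrib_left mult_ac)
    ultimately show ?thesis by simp
  qed
  have "\<alpha> ^ i * v \<in> L" if v: "v \<in> L" for v i
    by (induction i) (use v mult_alpha in \<open>auto simp: mult.assoc\<close>)
  then have mult: "u * v \<in> L" if "u \<in> L" "v \<in> L" for u v
  proof -
    obtain c where c: "u = (\<Sum>i<n. c i * \<alpha> ^ i)" "\<forall>i. c i \<in> K" using \<open>u \<in> L\<close> by (auto simp: L_def fspan_def)
    have "u * v = (\<Sum>i<n. c i * (\<alpha> ^ i * v))" by (simp add: c sum_distrib_right mult.assoc)
    moreover have "(\<Sum>i<n. c i * (\<alpha> ^ i * v)) \<in> L"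
      unfolding L_def by (rule fspan_sum, rule fspan_scale)
        (use c \<open>v \<in> L\<close> \<open>\<And>v i. v \<in> L \<Longrightarrow> \<alpha> ^ i * v \<in> L\<close> in \<open>auto simp: L_def\<close>)
    ultimately show ?thesis by simp
  qed
  have diff: "u - v \<in> L" if "u \<in> L" "v \<in> L" for u v
    using fspan_add[OF that(1)[unfolded L_def] fspan_scale[OF sub_uminus[OF sub_1] that(2)[unfolded L_def]]]
    by (simp add: L_def)
  have pow: "u ^ i \<in> L" if "u \<in> L" for u i by (induction i) (use one mult that in auto)
  have inv: "inverse u \<in> L" if u: "u \<in> L" for u
  proof (cases "u = 0")
    case False
    obtain q where q: "q \<noteq> 0" "set (coeffs q) \<subseteq> K" "poly q u = 0"
      using annihilating_polynomial[of u n "\<lambda>i. \<alpha> ^ i"] pow[OF u] by (auto simp: L_def)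
    define r where "r = Polynomial.order 0 q"
    obtain q' where q': "q = [:0, 1:] ^ r * q'" "\<not> [:0, 1:] dvd q'"
      using order_decomp[OF q(1), of 0] by (auto simp: r_def)
    have q'0: "coeff q' 0 \<noteq> 0" using q'(2) by (simp add: poly_eq_0_iff_dvd[of q' 0, simplified, symmetric] poly_0_coeff_0)
    have c: "coeff q' i \<in> K" for i
    proof -
      have "coeff q' i = coeff q (i + r)"
        by (simp add: q'(1) monom_altdef[of 1 r, simplified, symmetric] coeff_monom_mult)
      then show ?thesis using q(2) sub_0 by (metis coeff_in_coeffs coeff_eq_0 leI subsetD q(1))
    qed
    have "poly q' u = 0" using q(3) False by (simp add: q'(1))
    obtain k s where ks: "q' = pCons k s" by (cases q')
    have "k + u * poly s u = 0" using \<open>poly q' u = 0\<close> ks by simp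
    moreover have "k \<noteq> 0" using q'0 ks by simp
    ultimately have "u * poly s u = - k" "k \<noteq> 0" by (simp_all add: eq_neg_iff_add_eq_0 add.commute)
    then have "u * (- inverse k * poly s u) = 1" using mult.left_commute[of u "- inverse k" "poly s u"] by simp
    then have "inverse u = - inverse k * poly s u" using False by (metis inverse_unique)
    moreover have "poly s u \<in> L"
    proof -
      have "coeff s i \<in> K" for i using c[of "Suc i"] ks by simp
      then show ?thesis unfolding poly_altdef L_def
        by (intro fspan_sum fspan_scale) (use pow[OF u] in \<open>auto simp: L_def\<close>)
    qed
    moreover have "- inverse k \<in> K" using c[of 0] ks by (auto intro!: sub_uminus sub_inverse)
    ultimately show ?thesis unfolding L_def by (simp only: fspan_scale)
  qed (use fspan_0 in \<open>simp add: L_def\<close>)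
  show "subfield_set (fspan (degree p) (\<lambda>i. \<alpha> ^ i))"
    using one diff mult inv by (simp add: subfield_set_def L_def n_def)
  show "K \<subseteq> fspan (degree p) (\<lambda>i. \<alpha> ^ i)" using KL by (auto simp: L_def n_def)
  show "\<alpha> \<in> fspan (degree p) (\<lambda>i. \<alpha> ^ i)" using mult_alpha[OF one] by (simp add: L_def n_def)
qed

text \<open>A minimal polynomial is found by linear dependence among the powers of \<open>b\<close>; the two bounds pin down its
  degree.\<close>

lemma algebraic_of_degreeI:
  assumes up: "\<And>i. b ^ i \<in> fspan n e"
    and low: "\<And>q. q \<noteq> 0 \<Longrightarrow> set (coeffs q) \<subseteq> K \<Longrightarrow> poly q b = 0 \<Longrightarrow> n \<le> degree q"
  shows "algebraic_of_degree K b n"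
proof -
  obtain q where q: "q \<noteq> 0" "set (coeffs q) \<subseteq> K" "poly q b = 0" "degree q \<le> n"
    using annihilating_polynomial[of b n e] up by blast
  define k where "k = inverse (lead_coeff q)"
  have k: "k \<noteq> 0" "k \<in> K"
  proof -
    have "lead_coeff q \<in> K" using q by (meson coeff_in_coeffs order_refl subsetD)
    then show "k \<in> K" by (simp add: k_def sub_inverse)
  qed (use q in \<open>simp add: k_def\<close>)
  have "set (coeffs (smult k q)) \<subseteq> K"
    using q(2) k by (auto simp: coeffs_smult intro: sub_mult)
  moreover have "lead_coeff (smult k q) = 1" using q(1) by (simp add: k_def)
  moreover have "degree q = n" using low q by fastforce
  ultimately have "minimal_polynomial K b (smult k q)"
    using low q k by (auto simp: minimal_polynomial_def)
  then show ?thesis unfolding algebraic_of_degree_def using \<open>degree q = n\<close> k by (intro exI) auto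
qed

end

lemma fspan_tower:
  assumes K: "subfield_set K" and L: "subfield_set (fspan K n e)"
  shows "fspan (fspan K n e) m f \<subseteq> fspan K (n * m) (\<lambda>k. e (k mod n) * f (k div n))"
proof
  fix v assume "v \<in> fspan (fspan K n e) m f"
  then obtain c where c: "v = (\<Sum>i<m. c i * f i)" "\<forall>i. c i \<in> fspan K n e"
    by (auto simp: fspan_def[OF L])
  then have "\<forall>i. \<exists>a. (\<forall>j. a j \<in> K) \<and> c i = (\<Sum>j<n. a j * e j)" by (fastforce simp: fspan_def[OF K])
  then obtain a where a: "\<And>i j. a i j \<in> K" "\<And>i. c i = (\<Sum>j<n. a i j * e j)" by metis
  have "v = (\<Sum>i<m. \<Sum>j<n. a i j * (e j * f i))" by (simp add: c a(2) sum_distrib_right mult.assoc)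
  also have "\<dots> \<in> fspan K (n * m) (\<lambda>k. e (k mod n) * f (k div n))"
  proof (rule fspan_sum[OF K], rule fspan_sum[OF K], rule fspan_scale[OF K], rule a(1))
    fix i j assume ij: "i \<in> {..<m}" "j \<in> {..<n}"
    have "n * Suc i \<le> n * m" using ij by (intro mult_le_mono2) auto
    then have "j + n * i < n * m" using ij by simp
    moreover have "(j + n * i) mod n = j" "(j + n * i) div n = i" using ij by auto
    ultimately show "e j * f i \<in> fspan K (n * m) (\<lambda>k. e (k mod n) * f (k div n))"
      using fspan_base[OF K, of "j + n * i" "n * m" "\<lambda>k. e (k mod n) * f (k div n)"] by simp
  qed
  finally show "v \<in> fspan K (n * m) (\<lambda>k. e (k mod n) * f (k div n))" .
qed

section \<open>Transcendence of the coordinates\<close>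

lemma rat_hom_unique:
  fixes h :: "rat \<Rightarrow> 'a::field_char_0"
  assumes "comm_ring_hom h"
  shows "h r = of_rat r"
proof -
  interpret h: comm_ring_hom h by fact
  obtain a b where ab: "r = of_int a / of_int b" "b \<noteq> 0"
  proof
    obtain a b where q: "quotient_of r = (a, b)" by (cases "quotient_of r")
    show "r = of_int (fst (quotient_of r)) / of_int (snd (quotient_of r))"
      using quotient_of_div[OF q] q by simp
    show "snd (quotient_of r) \<noteq> 0" using quotient_of_denom_pos[OF q] q by simp
  qed
  have "h r * of_int b = h (r * of_int b)" by (simp add: h.hom_mult h.hom_of_int)
  also have "r * of_int b = of_int a" using ab by (simp add: field_simps)
  also have "h (of_int a) = of_int a" by (rule h.hom_of_int)
  finally have "h r = of_int a / of_int b" using ab(2) by (simp add: eq_divide_eq)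
  then show ?thesis using ab by (simp add: of_rat_divide)
qed

lemma to_fract_hom: "comm_ring_hom (to_fract :: 'a::idom \<Rightarrow> 'a fract)"
  by unfold_locales (simp_all add: to_fract_def One_fract_def Zero_fract_def)

lemma poly2_at_indets: "poly2_at indet_x indet_y p = to_fract p"
proof -
  interpret f: comm_ring_hom "to_fract :: rat poly poly \<Rightarrow> ratfun" by (rule to_fract_hom)
  interpret h1: comm_ring_hom "poly_at indet_x" by (rule poly_at_hom)
  have r: "of_rat r = to_fract [:[:r:]:]" for r
  proof -
    have "comm_ring_hom (\<lambda>r. to_fract ([:[:r:]:] :: rat poly poly))"
      by (intro comp_ring_hom[OF to_fract_hom], unfold_locales) (simp_all add: one_pCons)
    then show ?thesis by (rule rat_hom_unique[symmetric])
  qed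
  have X: "indet_x = to_fract [:[:0, 1:]:]" and Y: "indet_y = to_fract [:0, 1:]"
    by (simp_all add: indet_x_def indet_y_def to_fract_def)
  have 1: "poly_at indet_x c = to_fract [:c:]" for c
  proof (induction c)
    case (pCons r c)
    have "poly_at indet_x (pCons r c) = of_rat r + indet_x * poly_at indet_x c"
      by (simp add: poly_at_def Polynomial.map_poly_pCons)
    also have "\<dots> = to_fract ([:[:r:]:] + [:[:0, 1:]:] * [:c:])"
      by (simp only: r f.hom_add f.hom_mult X[symmetric] pCons.IH)
    finally show ?case by simp
  qed simp
  show ?thesis
  proof (induction p)
    case (pCons c p)
    have "poly2_at indet_x indet_y (pCons c p) = poly_at indet_x c + indet_y * poly2_at indet_x indet_y p"
      by (simp add: poly2_at_def Polynomial.map_poly_pCons)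
    also have "\<dots> = to_fract ([:c:] + [:0, 1:] * p)"
      by (simp only: 1 f.hom_add f.hom_mult Y[symmetric] pCons.IH)
    finally show ?case by simp
  qed (simp add: poly2_at_def)
qed

lemma eval2_indets_inj: "eval2 F indet_x indet_y = eval2 G indet_x indet_y \<longleftrightarrow> F = G"
  by (auto simp: eval2_alt poly2_at_indets fps_eq_iff)

lemma transcendental_x: "transcendental_point indet_x"
proof
  fix p assume "poly_at indet_x p = 0"
  then have "poly2_at indet_x indet_y [:p:] = 0" by simp
  then have "[:p:] = 0" unfolding poly2_at_indets by simp
  then show "p = 0" by simp
qed

lemma transcendental_y: "transcendental_point indet_y"
proof
  fix p assume "poly_at indet_y p = 0"
  then have "poly2_at indet_x indet_y (map_poly (\<lambda>c. [:c:]) p) = 0" by simp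
  then have "map_poly (\<lambda>c. [:c:]) p = 0" unfolding poly2_at_indets by simp
  then show "p = 0" using map_poly_eq_0_iff[of "\<lambda>c. [:c:]" p] by simp
qed

section \<open>Specialization of algebraic relations\<close>

text \<open>A partial homomorphism, given by its graph: \<open>single\<close> says that every relation among the first components
  also holds among the second ones. Graphs make it easy to enlarge the domain step by step.\<close>

locale specialization =
  fixes \<Gamma> :: "('a::idom \<times> 'b::idom) set"
  assumes one: "(1, 1) \<in> \<Gamma>"
    and diff: "(a, b) \<in> \<Gamma> \<Longrightarrow> (c, d) \<in> \<Gamma> \<Longrightarrow> (a - c, b - d) \<in> \<Gamma>"
    and mult: "(a, b) \<in> \<Gamma> \<Longrightarrow> (c, d) \<in> \<Gamma> \<Longrightarrow> (a * c, b * d) \<in> \<Gamma>"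
    and single: "(0, b) \<in> \<Gamma> \<Longrightarrow> b = 0"
begin

lemma zero: "(0, 0) \<in> \<Gamma>"
  using diff[OF one one] by simp

lemma uminus: "(a, b) \<in> \<Gamma> \<Longrightarrow> (- a, - b) \<in> \<Gamma>"
  using diff[OF zero] by simp

lemma add: "(a, b) \<in> \<Gamma> \<Longrightarrow> (c, d) \<in> \<Gamma> \<Longrightarrow> (a + c, b + d) \<in> \<Gamma>"
  using diff[of a b "-c" "-d"] uminus by simp

lemma of_int: "(of_int n, of_int n) \<in> \<Gamma>"
proof -
  have "(of_nat k, of_nat k) \<in> \<Gamma>" for k by (induction k) (use zero one add in auto)
  then show ?thesis using uminus by (cases n rule: int_cases2) auto
qed

lemma power: "(a, b) \<in> \<Gamma> \<Longrightarrow> (a ^ n, b ^ n) \<in> \<Gamma>"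
  by (induction n) (auto intro: one mult)

lemma poly_eval:
  assumes "\<And>c. c \<in> set (coeffs p) \<Longrightarrow> (h c, k c) \<in> \<Gamma>" and "(a, b) \<in> \<Gamma>" and "h 0 = 0" and "k 0 = 0"
  shows "(poly (map_poly h p) a, poly (map_poly k p) b) \<in> \<Gamma>"
  using assms(1)
proof (induction p)
  case (pCons c p)
  have "(h c, k c) \<in> \<Gamma>" using pCons(3)[of c] pCons(1) by (cases "p = 0") auto
  moreover have "(poly (map_poly h p) a, poly (map_poly k p) b) \<in> \<Gamma>"
    using pCons by (cases "p = 0") auto
  ultimately show ?case
    using assms by (auto simp: Polynomial.map_poly_pCons intro!: add mult)
qed (simp add: zero)

end

definition adjoin_pair :: "('a::comm_ring_1 \<times> 'b::comm_ring_1) set \<Rightarrow> 'a \<Rightarrow> 'b \<Rightarrow> ('a \<times> 'b) set" where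
  "adjoin_pair \<Gamma> \<tau> \<beta> = {(a0 + a1 * \<tau>, b0 + b1 * \<beta>) | a0 a1 b0 b1. (a0, b0) \<in> \<Gamma> \<and> (a1, b1) \<in> \<Gamma>}"

lemma adjoin_pairI: "(a0, b0) \<in> \<Gamma> \<Longrightarrow> (a1, b1) \<in> \<Gamma> \<Longrightarrow> (a0 + a1 * \<tau>, b0 + b1 * \<beta>) \<in> adjoin_pair \<Gamma> \<tau> \<beta>"
  by (auto simp: adjoin_pair_def)

text \<open>If \<open>\<sigma>\<close> fixes the domain and changes the sign of \<open>\<tau>\<close>, then \<open>a0 + a1 \<tau> = 0\<close> implies \<open>a0 - a1 \<tau> = 0\<close>, so
  \<open>a0 = a1 = 0\<close>. Hence \<open>\<tau>\<close> may be sent to any square root of the image of \<open>\<tau>\<^sup>2\<close>.\<close>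

lemma adjoin_square_root:
  fixes \<Gamma> :: "('a::idom \<times> 'b::idom) set"
  assumes "specialization \<Gamma>" and square: "(\<tau>^2, \<beta>^2) \<in> \<Gamma>"
    and \<sigma>: "comm_ring_hom \<sigma>" "\<sigma> \<tau> = - \<tau>" "\<And>a b. (a, b) \<in> \<Gamma> \<Longrightarrow> \<sigma> a = a" and nz: "\<tau> \<noteq> 0" "(2::'a) \<noteq> 0"
  shows "specialization (adjoin_pair \<Gamma> \<tau> \<beta>)" and "\<Gamma> \<subseteq> adjoin_pair \<Gamma> \<tau> \<beta>" and "(\<tau>, \<beta>) \<in> adjoin_pair \<Gamma> \<tau> \<beta>"
proof -
  interpret s: specialization \<Gamma> by fact
  interpret h: comm_ring_hom \<sigma> by fact
  show sub: "\<Gamma> \<subseteq> adjoin_pair \<Gamma> \<tau> \<beta>"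
  proof
    fix p assume "p \<in> \<Gamma>"
    then show "p \<in> adjoin_pair \<Gamma> \<tau> \<beta>"
      using adjoin_pairI[of "fst p" "snd p" \<Gamma> 0 0 \<tau> \<beta>] s.zero by simp
  qed
  show "(\<tau>, \<beta>) \<in> adjoin_pair \<Gamma> \<tau> \<beta>"
    using adjoin_pairI[OF s.zero s.one, of \<tau> \<beta>] by simp
  show "specialization (adjoin_pair \<Gamma> \<tau> \<beta>)"
  proof
    show "(1, 1) \<in> adjoin_pair \<Gamma> \<tau> \<beta>" using sub s.one by blast
  next
    fix a b c d assume "(a, b) \<in> adjoin_pair \<Gamma> \<tau> \<beta>" "(c, d) \<in> adjoin_pair \<Gamma> \<tau> \<beta>"
    then obtain a0 a1 b0 b1 c0 c1 d0 d1 where e: "a = a0 + a1 * \<tau>" "b = b0 + b1 * \<beta>" "c = c0 + c1 * \<tau>" "d = d0 + d1 * \<beta>"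
      and m: "(a0, b0) \<in> \<Gamma>" "(a1, b1) \<in> \<Gamma>" "(c0, d0) \<in> \<Gamma>" "(c1, d1) \<in> \<Gamma>"
      by (auto simp: adjoin_pair_def)
    have "((a0 - c0) + (a1 - c1) * \<tau>, (b0 - d0) + (b1 - d1) * \<beta>) \<in> adjoin_pair \<Gamma> \<tau> \<beta>"
      by (intro adjoin_pairI s.diff m)
    then show "(a - c, b - d) \<in> adjoin_pair \<Gamma> \<tau> \<beta>" by (simp add: e algebra_simps)
    have "((a0 * c0 + a1 * c1 * \<tau>^2) + (a0 * c1 + a1 * c0) * \<tau>, (b0 * d0 + b1 * d1 * \<beta>^2) + (b0 * d1 + b1 * d0) * \<beta>)
      \<in> adjoin_pair \<Gamma> \<tau> \<beta>"
      by (intro adjoin_pairI s.add s.mult m square)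
    then show "(a * c, b * d) \<in> adjoin_pair \<Gamma> \<tau> \<beta>" by (simp add: e algebra_simps power2_eq_square)
  next
    fix b assume "(0, b) \<in> adjoin_pair \<Gamma> \<tau> \<beta>"
    then obtain a0 a1 b0 b1 where e: "a0 + a1 * \<tau> = 0" "b = b0 + b1 * \<beta>" and m: "(a0, b0) \<in> \<Gamma>" "(a1, b1) \<in> \<Gamma>"
      by (auto simp: adjoin_pair_def)
    have "\<sigma> (a0 + a1 * \<tau>) = a0 - a1 * \<tau>" using \<sigma>(3)[OF m(1)] \<sigma>(3)[OF m(2)] \<sigma>(2)
      by (simp add: h.hom_add h.hom_mult)
    then have "a0 - a1 * \<tau> = 0" using e by simp
    then have "(a0 + a1 * \<tau>) + (a0 - a1 * \<tau>) = 0" using e by simp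
    then have "2 * a0 = 0" by simp
    then have "a0 = 0" using nz(2) by simp
    moreover have "a1 = 0" using e nz(1) \<open>a0 = 0\<close> by simp
    ultimately have "b0 = 0" "b1 = 0" using m s.single by auto
    then show "b = 0" using e by simp
  qed
qed

lemma adjoin_fixed:
  assumes "comm_ring_hom \<sigma>" "\<And>a b. (a, b) \<in> \<Gamma> \<Longrightarrow> \<sigma> a = a" "\<sigma> \<tau> = \<tau>" "(a, b) \<in> adjoin_pair \<Gamma> \<tau> \<beta>"
  shows "\<sigma> a = a"
proof -
  interpret h: comm_ring_hom \<sigma> by fact
  obtain a0 a1 b0 b1 where "a = a0 + a1 * \<tau>" "(a0, b0) \<in> \<Gamma>" "(a1, b1) \<in> \<Gamma>"
    using assms(4) by (auto simp: adjoin_pair_def)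
  then show ?thesis using assms(2,3) by (simp add: h.hom_add h.hom_mult)
qed

text \<open>Fractions whose denominator specializes to a unit, inside a ring that contains the domain by
  \<open>\<iota>\<close>.\<close>

definition fraction_pairs :: "('c::comm_ring_1 \<Rightarrow> 'a::idom) \<Rightarrow> ('c \<times> 'b::idom) set \<Rightarrow> ('a \<times> 'b) set" where
  "fraction_pairs \<iota> \<Gamma> = {(a, b). \<exists>c d c' d'. (c, d) \<in> \<Gamma> \<and> (c', d') \<in> \<Gamma> \<and> d dvd 1 \<and> a * \<iota> c = \<iota> c' \<and> b * d = d'}"

lemma fraction_pairsI:
  "(c, d) \<in> \<Gamma> \<Longrightarrow> (c', d') \<in> \<Gamma> \<Longrightarrow> d dvd 1 \<Longrightarrow> a * \<iota> c = \<iota> c' \<Longrightarrow> b * d = d' \<Longrightarrow> (a, b) \<in> fraction_pairs \<iota> \<Gamma>"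
  unfolding fraction_pairs_def by blast

lemma fraction_pairs_sub:
  assumes "specialization \<Gamma>" and "comm_ring_hom \<iota>" and "(c, d) \<in> \<Gamma>"
  shows "(\<iota> c, d) \<in> fraction_pairs \<iota> \<Gamma>"
proof -
  interpret s: specialization \<Gamma> by fact
  interpret h: comm_ring_hom \<iota> by fact
  show ?thesis by (rule fraction_pairsI[OF s.one assms(3)]) auto
qed

lemma fraction_specialization:
  fixes \<iota> :: "'c::idom \<Rightarrow> 'a::idom"
  assumes "specialization \<Gamma>" and "comm_ring_hom \<iota>" and inj: "\<And>c. \<iota> c = 0 \<Longrightarrow> c = 0"
  shows "specialization (fraction_pairs \<iota> \<Gamma>)"
proof -
  interpret s: specialization \<Gamma> by fact
  interpret h: comm_ring_hom \<iota> by fact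
  show ?thesis
  proof
    show "(1, 1) \<in> fraction_pairs \<iota> \<Gamma>" using fraction_pairs_sub[OF assms(1,2) s.one] by simp
  next
    fix a b a' b' assume "(a, b) \<in> fraction_pairs \<iota> \<Gamma>" "(a', b') \<in> fraction_pairs \<iota> \<Gamma>"
    then obtain p q p' q' u v u' v' where m: "(p, q) \<in> \<Gamma>" "(p', q') \<in> \<Gamma>" "(u, v) \<in> \<Gamma>" "(u', v') \<in> \<Gamma>"
      and un: "q dvd 1" "v dvd 1" and e: "a * \<iota> p = \<iota> p'" "b * q = q'" "a' * \<iota> u = \<iota> u'" "b' * v = v'"
      unfolding fraction_pairs_def by blast
    have un': "q * v dvd 1" using un by (metis mult_dvd_mono mult_1)
    show "(a - a', b - b') \<in> fraction_pairs \<iota> \<Gamma>"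
    proof (rule fraction_pairsI[OF s.mult[OF m(1,3)] s.diff[OF s.mult[OF m(2,3)] s.mult[OF m(4,1)]] un'])
      show "(a - a') * \<iota> (p * u) = \<iota> (p' * u - u' * p)"
        by (simp add: h.hom_mult h.hom_minus e[symmetric] algebra_simps)
      show "(b - b') * (q * v) = q' * v - v' * q" by (simp add: e[symmetric] algebra_simps)
    qed
    show "(a * a', b * b') \<in> fraction_pairs \<iota> \<Gamma>"
    proof (rule fraction_pairsI[OF s.mult[OF m(1,3)] s.mult[OF m(2,4)] un'])
      show "a * a' * \<iota> (p * u) = \<iota> (p' * u')"
        by (simp add: h.hom_mult e[symmetric] algebra_simps)
      show "b * b' * (q * v) = q' * v'" by (simp add: e[symmetric] algebra_simps)
    qed
  next
    fix b assume "(0, b) \<in> fraction_pairs \<iota> \<Gamma>"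
    then obtain c d c' d' where m: "(c, d) \<in> \<Gamma>" "(c', d') \<in> \<Gamma>" "d dvd 1" and e: "0 * \<iota> c = \<iota> c'" "b * d = d'"
      unfolding fraction_pairs_def by blast
    have "c' = 0" using e inj by simp
    then have "d' = 0" using m s.single by blast
    then show "b = 0" using e m by auto
  qed
qed

lemma fraction_divide:
  fixes \<iota> :: "'c::idom \<Rightarrow> 'a::idom"
  assumes "specialization \<Gamma>" and "comm_ring_hom \<iota>"
    and m: "(u, v) \<in> fraction_pairs \<iota> \<Gamma>" "(u', v') \<in> fraction_pairs \<iota> \<Gamma>" and unit: "v dvd 1"
    and e: "a * u = u'" "b * v = v'"
  shows "(a, b) \<in> fraction_pairs \<iota> \<Gamma>"
proof -
  interpret s: specialization \<Gamma> by fact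
  interpret h: comm_ring_hom \<iota> by fact
  obtain c d c' d' where c: "(c, d) \<in> \<Gamma>" "(c', d') \<in> \<Gamma>" "d dvd 1" "u * \<iota> c = \<iota> c'" "v * d = d'"
    using m(1) unfolding fraction_pairs_def by blast
  obtain p q p' q' where p: "(p, q) \<in> \<Gamma>" "(p', q') \<in> \<Gamma>" "q dvd 1" "u' * \<iota> p = \<iota> p'" "v' * q = q'"
    using m(2) unfolding fraction_pairs_def by blast
  have "v * d * q dvd 1" using unit c(3) p(3) by (metis mult_dvd_mono mult_1)
  then have un: "d' * q dvd 1" using c by simp
  show ?thesis
  proof (rule fraction_pairsI[OF s.mult[OF c(2) p(1)] s.mult[OF p(2) c(1)] un])
    have "a * \<iota> (c' * p) = (a * u) * \<iota> c * \<iota> p" by (simp add: h.hom_mult c(4)[symmetric] mult_ac)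
    also have "\<dots> = \<iota> (p' * c)" by (simp add: e h.hom_mult p(4)[symmetric] mult_ac)
    finally show "a * \<iota> (c' * p) = \<iota> (p' * c)" .
    have "b * (d' * q) = (b * v) * d * q" by (simp add: c(5)[symmetric] mult_ac)
    also have "\<dots> = q' * d" by (simp add: e p(5)[symmetric] mult_ac)
    finally show "b * (d' * q) = q' * d" .
  qed
qed

section \<open>Henselian rings\<close>

text \<open>Simple roots lift along \<open>\<pi>\<close>. This property passes from a ring to its ring of power series, which
  provides local rings in several variables.\<close>

locale henselian =
  fixes \<pi> :: "'a::idom \<Rightarrow> 'f::field"
  assumes hom: "comm_ring_hom \<pi>"
    and lift: "\<And>f a. poly (map_poly \<pi> f) a = 0 \<Longrightarrow> poly (pderiv (map_poly \<pi> f)) a \<noteq> 0 \<Longrightarrow> \<exists>b. \<pi> b = a \<and> poly f b = 0"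
begin

text \<open>An inverse is a simple root of a polynomial of degree one.\<close>

lemma unit:
  assumes "\<pi> u \<noteq> 0"
  shows "u dvd 1"
proof -
  interpret h: comm_ring_hom \<pi> by (rule hom)
  obtain b where "poly [:-1, u:] b = 0"
    using lift[of "[:-1, u:]" "inverse (\<pi> u)"] assms
    by (auto simp: Polynomial.map_poly_pCons h.hom_uminus pderiv_pCons)
  then have "1 = u * b" by (simp add: mult.commute add.commute eq_neg_iff_add_eq_0[symmetric])
  then show ?thesis by (rule dvdI)
qed

end

lemma henselian_field: "henselian (\<lambda>a :: 'f::field. a)"
proof (rule henselian.intro)
  show "comm_ring_hom (\<lambda>a :: 'f. a)" by unfold_locales simp_all
qed (auto simp: map_poly_id')

text \<open>The root is lifted first to the constant terms and then, by Newton's iteration, to the series.\<close>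

lemma henselian_fps:
  assumes "henselian (\<pi> :: 'a::idom \<Rightarrow> 'f::field)"
  shows "henselian (\<lambda>F. \<pi> (fps_nth F 0))"
proof -
  interpret p: henselian \<pi> by fact
  interpret h: comm_ring_hom \<pi> by (rule p.hom)
  interpret n: comm_ring_hom "\<lambda>F :: 'a fps. fps_nth F 0" by (rule fps_nth_0_hom)
  show ?thesis
  proof (rule henselian.intro)
    show "comm_ring_hom (\<lambda>F. \<pi> (fps_nth F 0))" by (rule comp_ring_hom[OF p.hom fps_nth_0_hom])
  next
    fix f :: "'a fps poly" and a :: 'f
    define g where "g = map_poly (\<lambda>F. fps_nth F 0) f"
    have m: "map_poly (\<lambda>F. \<pi> (fps_nth F 0)) f = map_poly \<pi> g"
      unfolding g_def by (subst map_poly_map_poly) (simp_all add: o_def)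
    assume a: "poly (map_poly (\<lambda>F. \<pi> (fps_nth F 0)) f) a = 0" "poly (pderiv (map_poly (\<lambda>F. \<pi> (fps_nth F 0)) f)) a \<noteq> 0"
    obtain b where b: "\<pi> b = a" "poly g b = 0" using p.lift[of g a] a unfolding m by blast
    have "map_poly \<pi> (pderiv g) = pderiv (map_poly \<pi> g)"
      by (intro poly_eqI) (simp add: coeff_map_poly coeff_pderiv h.hom_mult h.hom_add h.hom_of_nat)
    then have "\<pi> (poly (pderiv g) b) \<noteq> 0" using a(2) b(1) unfolding m by (metis h.poly_map_poly)
    then obtain w where w: "1 = poly (pderiv g) b * w" using p.unit by (meson dvdE)
    have g_eval: "fps_nth (poly q (fps_const b)) 0 = poly (map_poly (\<lambda>F. fps_nth F 0) q) b" for q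
      using n.poly_map_poly[of q "fps_const b"] by simp
    have "map_poly (\<lambda>F. fps_nth F 0) (pderiv f) = pderiv g"
      by (intro poly_eqI) (simp add: g_def coeff_map_poly coeff_pderiv)
    then have "\<exists>!v. fps_nth v 0 = b \<and> poly f v = 0"
      by (intro hensel[where w = w]) (simp_all add: g_eval g_def[symmetric] b w[symmetric])
    then show "\<exists>v. \<pi> (fps_nth v 0) = a \<and> poly f v = 0" using b by blast
  qed
qed

text \<open>A polynomial is determined by its Taylor expansion at \<open>c\<close>.\<close>

lemma eval_shift_inj:
  fixes p :: "'a::idom poly"
  assumes "poly (map_poly fps_const p) (fps_const c + fps_X) = 0"
  shows "p = 0"
proof -
  interpret f: comm_ring_hom "fps_const :: 'a \<Rightarrow> 'a fps" by (rule fps_const_hom)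
  have X: "poly (map_poly fps_const q) fps_X = Abs_fps (coeff q)" for q :: "'a poly"
  proof (induction q)
    case (pCons a q)
    then show ?case
      by (intro fps_ext) (simp add: Polynomial.map_poly_pCons fps_X_mult_nth coeff_pCons split: nat.splits)
  qed (simp add: fps_zero_def)
  have "poly (map_poly fps_const (pcompose p [:c, 1:])) fps_X = 0"
    using assms by (simp add: f.map_poly_pcompose poly_pcompose Polynomial.map_poly_pCons)
  then have "coeff (pcompose p [:c, 1:]) n = 0" for n unfolding X by (metis fps_nth_Abs_fps fps_zero_nth)
  then have "pcompose p [:c, 1:] = 0" by (simp add: poly_eq_iff)
  then show ?thesis by (simp add: pcompose_eq_0)
qed

section \<open>Symmetries and independence of the parameters\<close>

text \<open>The substitution \<open>t \<mapsto> -t\<close>.\<close>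

definition flip_t :: "'a::comm_ring_1 fps \<Rightarrow> 'a fps" where
  "flip_t F = Abs_fps (\<lambda>n. (-1)^n * fps_nth F n)"

lemma flip_t_hom: "comm_ring_hom flip_t"
proof -
  have "flip_t (F * G) = flip_t F * flip_t G" for F G :: "'a fps"
  proof (rule fps_ext)
    fix n
    have "(-1)^n * (fps_nth F i * fps_nth G (n - i)) = ((-1)^i * fps_nth F i) * ((-1)^(n-i) * fps_nth G (n - i))"
      if "i \<le> n" for i
    proof -
      have "(-1 :: 'a)^n = (-1)^i * (-1)^(n-i)" using that by (simp add: power_add[symmetric])
      then show ?thesis by (simp add: mult_ac)
    qed
    then show "fps_nth (flip_t (F * G)) n = fps_nth (flip_t F * flip_t G) n"
      by (simp add: flip_t_def fps_mult_nth sum_distrib_left)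
  qed
  moreover have "flip_t 1 = (1 :: 'a fps)" by (intro fps_ext) (simp add: flip_t_def)
  ultimately show ?thesis
    by unfold_locales (auto intro!: fps_ext simp: flip_t_def algebra_simps)
qed

lemma flip_t_X: "flip_t fps_X = - fps_X"
  by (intro fps_ext) (simp add: flip_t_def fps_X_def)

lemma flip_t_const: "flip_t (fps_const c) = fps_const c"
  by (intro fps_ext) (simp add: flip_t_def)

lemma flip_t_fixed_iff: "flip_t (F :: 'a::{idom,ring_char_0} fps) = F \<longleftrightarrow> (\<forall>n. odd n \<longrightarrow> fps_nth F n = 0)"
proof -
  have "(-1)^n * c = c \<longleftrightarrow> even n \<or> c = 0" for n and c :: 'a
    by (cases "even n") auto
  then show ?thesis by (auto simp: fps_eq_iff flip_t_def)
qed

context parametrization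
begin

text \<open>The defining equations contain \<open>t\<close> only through \<open>t\<^sup>2\<close>, and their solutions are unique.\<close>

lemma T0_even: "odd n \<Longrightarrow> fps_nth T0 n = 0"
proof -
  interpret f: comm_ring_hom "flip_t :: rat fps \<Rightarrow> rat fps" by (rule flip_t_hom)
  have "is_T (flip_t T0)"
    using arg_cong[OF T0_eq, of flip_t] T0_0 unfolding is_T_iff
    by (simp add: f.hom_mult f.hom_add f.hom_minus f.hom_power f.hom_numeral flip_t_X) (simp add: flip_t_def)
  then have "flip_t T0 = T0" using ex1_T is_T by blast
  then show "odd n \<Longrightarrow> fps_nth T0 n = 0" by (simp add: flip_t_fixed_iff)
qed

lemma Z0_even: "odd n \<Longrightarrow> fps_nth Z0 n = 0"
proof -
  interpret f: comm_ring_hom "flip_t :: rat fps \<Rightarrow> rat fps" by (rule flip_t_hom)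
  have "flip_t T0 = T0" using T0_even by (simp add: flip_t_fixed_iff)
  then have "is_sqrt T0 (flip_t Z0)"
    using arg_cong[OF Z0_eq, of flip_t] Z0_0 unfolding is_sqrt_def
    by (simp add: f.hom_power) (simp add: flip_t_def)
  then have "flip_t Z0 = Z0" using ex1_sqrt[OF is_T] is_sqrt by blast
  then show "odd n \<Longrightarrow> fps_nth Z0 n = 0" by (simp add: flip_t_fixed_iff)
qed

lemma V0_even: "odd n \<Longrightarrow> fps_nth V0 n = 0"
proof -
  interpret f: comm_ring_hom "flip_t :: rat poly fps \<Rightarrow> rat poly fps" by (rule flip_t_hom)
  have "flip_t (const_ser T0) = const_ser T0" using T0_even by (simp add: flip_t_fixed_iff const_ser_def)
  then have "is_V T0 (flip_t V0)"
    using arg_cong[OF V0_eq, of flip_t] V0_0 unfolding is_V_iff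
    by (simp add: f.hom_mult f.hom_add f.hom_minus f.hom_power f.hom_numeral flip_t_const) (simp add: flip_t_def)
  then have "flip_t V0 = V0" using ex1_V[OF is_T] is_V by blast
  then show "odd n \<Longrightarrow> fps_nth V0 n = 0" by (simp add: flip_t_fixed_iff)
qed

end

text \<open>If \<open>v\<close> has infinitely many specializations to a ring that contains the coefficients of \<open>F\<close>, then \<open>F\<close> has
  infinitely many roots there.\<close>

lemma transcendental_by_specialization:
  fixes F :: "'d::idom poly" and emb :: "'d \<Rightarrow> 'e::comm_ring_1"
  assumes hom: "\<And>n. comm_ring_hom (h n)" and id: "\<And>n c. h n (emb c) = c" and "emb 0 = 0"
    and inj: "inj (\<lambda>n::nat. h n v)" and root: "poly (map_poly emb F) v = 0"
  shows "F = 0"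
proof (rule ccontr)
  assume "F \<noteq> 0"
  have "poly F (h n v) = 0" for n
  proof -
    interpret h: comm_ring_hom "h n" by (rule hom)
    have "map_poly (h n) (map_poly emb F) = F"
      by (subst map_poly_map_poly) (simp_all add: assms o_def map_poly_id')
    then show ?thesis using h.poly_map_poly[of "map_poly emb F" v] root by simp
  qed
  then have "range (\<lambda>n. h n v) \<subseteq> {c. poly F c = 0}" by auto
  then show False
    using poly_roots_finite[OF \<open>F \<noteq> 0\<close>] inj by (meson finite_subset range_inj_infinite)
qed

definition flip_x :: "rat poly poly fps \<Rightarrow> rat poly poly fps" where
  "flip_x F = Abs_fps (\<lambda>n. map_poly (\<lambda>c. pcompose c [:0, -1:]) (fps_nth F n))"

definition flip_y :: "rat poly poly fps \<Rightarrow> rat poly poly fps" where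
  "flip_y F = Abs_fps (\<lambda>n. pcompose (fps_nth F n) [:0, -1:])"

lemma pcompose_hom: "comm_ring_hom (\<lambda>p :: 'c::comm_ring_1 poly. pcompose p q)"
  by unfold_locales (simp_all add: pcompose_add pcompose_mult pcompose_1)

lemma flip_x_hom: "comm_ring_hom flip_x"
proof -
  interpret p: comm_ring_hom "\<lambda>c :: rat poly. pcompose c [:0, -1:]" by (rule pcompose_hom)
  interpret m: map_poly_comm_ring_hom "\<lambda>c :: rat poly. pcompose c [:0, -1:]" ..
  have "comm_ring_hom (map_poly (\<lambda>c :: rat poly. pcompose c [:0, -1:]))" ..
  then show ?thesis unfolding flip_x_def by (rule coefficientwise_hom)
qed

lemma flip_y_hom: "comm_ring_hom flip_y"
  unfolding flip_y_def by (intro coefficientwise_hom pcompose_hom)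

lemma square_fixed: "pcompose (pcompose p [:0, 0, 1:]) [:0, -1:] = pcompose p [:0, 0, 1 :: 'c::comm_ring_1:]"
proof -
  have "pcompose [:0, 0, 1 :: 'c:] [:0, -1:] = [:0, 0, 1:]" by (simp add: pcompose_pCons)
  then show ?thesis by (simp add: pcompose_assoc[symmetric])
qed

lemma const_poly_hom: "comm_ring_hom (\<lambda>c :: 'c::comm_ring_1. [:c:])"
  by unfold_locales (simp_all add: one_pCons)

lemma flips_variables:
  "flip_x fps_X = fps_X" "flip_y fps_X = fps_X" "flip_y (fps_const var_x) = fps_const var_x"
  "flip_x (fps_const var_x) = - fps_const var_x" "flip_y (fps_const var_y) = - fps_const var_y"
  by (auto intro!: fps_ext simp: flip_x_def flip_y_def fps_X_def Polynomial.map_poly_pCons pcompose_pCons pcompose_1 one_pCons)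

text \<open>Evaluation of integral polynomials in three variables; the innermost variable goes to \<open>a\<close>. It serves
  both for the parameters \<open>z, v, v'\<close> and for the variables \<open>t, x, y\<close>.\<close>

definition eval3 :: "'a::comm_ring_1 \<Rightarrow> 'a \<Rightarrow> 'a \<Rightarrow> int poly poly poly \<Rightarrow> 'a" where
  "eval3 a b c f = poly (map_poly (\<lambda>p. poly (map_poly (\<lambda>q. poly (map_poly of_int q) a) p) b) f) c"

lemma of_int_hom: "comm_ring_hom (of_int :: int \<Rightarrow> 'a::comm_ring_1)"
  by unfold_locales simp_all

lemma eval3_hom: "comm_ring_hom (eval3 a b c)"
  unfolding eval3_def by (intro poly_eval_hom of_int_hom)

lemma eval3_vars: "eval3 a b c [:[:[:0, 1:]:]:] = a" "eval3 a b c [:[:0, 1:]:] = b" "eval3 a b c [:0, 1:] = c"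
  by (simp_all add: eval3_def Polynomial.map_poly_pCons)

lemma in_const_hom: "comm_ring_hom in_const"
  unfolding in_const_def by (intro coefficientwise_hom, unfold_locales) (simp_all add: one_pCons)

lemma in_x_hom: "comm_ring_hom in_x"
  unfolding in_x_def by (intro coefficientwise_hom, unfold_locales) (simp_all add: one_pCons)

lemma in_x_const_ser: "in_x (const_ser F) = in_const F"
  by (simp add: in_x_def const_ser_def in_const_def)

lemma const_ser_0: "const_ser 0 = 0" and in_x_0: "in_x 0 = 0"
  by (simp_all add: const_ser_def in_x_def fps_eq_iff)

context parametrization
begin

definition Zs where "Zs = in_const Z0"
definition Vx where "Vx = in_x (square_var V0)"
definition Vy where "Vy = in_y (square_var V0)"

lemma Z0_decompose: obtains \<zeta> where "Z0 = 1 + fps_X^2 * \<zeta>" "fps_nth \<zeta> 0 = 2"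
proof -
  obtain \<tau> where t: "T0 = 1 + fps_X^2 * \<tau>" "fps_nth \<tau> 0 = 4" by (rule T0_decompose)
  define i where "i = inverse (Z0 + 1)"
  have c: "fps_nth (Z0 + 1) 0 = 2" by (simp add: Z0_0)
  have i: "(Z0 + 1) * i = 1" unfolding i_def by (rule inverse_mult_eq_1') (simp add: Z0_0)
  have "Z0 - 1 = (Z0 - 1) * (Z0 + 1) * i" by (simp add: mult.assoc i)
  also have "(Z0 - 1) * (Z0 + 1) = fps_X^2 * \<tau>" using Z0_eq t(1) by (simp add: algebra_simps power2_eq_square)
  finally have "Z0 = 1 + fps_X^2 * (\<tau> * i)" by (simp add: algebra_simps)
  moreover have "fps_nth (\<tau> * i) 0 = 2" using c t(2) by (simp add: i_def)
  ultimately show ?thesis using that by blast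
qed

text \<open>The constant term of \<open>Z\<close> is \<open>1\<close> but \<open>Z\<close> is not constant: in \<open>F(Z)\<close> every factor \<open>Z - 1\<close> is nonzero, and the
  remaining factor has a nonzero constant term.\<close>

lemma Z0_transcendental:
  assumes "poly (map_poly of_int q) Z0 = 0"
  shows "q = 0"
proof (rule ccontr)
  assume "q \<noteq> 0"
  interpret f: comm_ring_hom "fps_const :: rat \<Rightarrow> rat fps" by (rule fps_const_hom)
  interpret m: map_poly_comm_ring_hom "fps_const :: rat \<Rightarrow> rat fps" ..
  define q' :: "rat poly" where "q' = map_poly of_int q"
  have "q' \<noteq> 0" using \<open>q \<noteq> 0\<close> by (simp add: q'_def map_poly_eq_0_iff)
  then obtain p where p: "q' = [:-1, 1:] ^ Polynomial.order 1 q' * p" "\<not> [:-1, 1:] dvd p"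
    using order_decomp by blast
  then have p1: "poly p 1 \<noteq> 0" by (simp add: poly_eq_0_iff_dvd)
  obtain \<zeta> where z: "Z0 = 1 + fps_X^2 * \<zeta>" "fps_nth \<zeta> 0 = 2" by (rule Z0_decompose)
  have "map_poly of_int q = map_poly fps_const q'"
    unfolding q'_def by (subst map_poly_map_poly) (simp_all add: o_def fps_of_int)
  then have "poly (map_poly fps_const q') Z0 = 0" using assms by simp
  then have "(Z0 - 1) ^ Polynomial.order 1 q' * poly (map_poly fps_const p) Z0 = 0"
    by (subst (asm) p(1)) (simp add: m.hom_mult m.hom_power Polynomial.map_poly_pCons f.hom_uminus del: fps_const_neg)
  moreover have "Z0 - 1 \<noteq> 0" using z by auto
  ultimately have "poly (map_poly fps_const p) Z0 = 0" by simp
  moreover have "fps_nth (poly (map_poly fps_const p) Z0) 0 = poly p 1"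
    by (induction p) (auto simp: Polynomial.map_poly_pCons Z0_0)
  ultimately show False using p1 by simp
qed

definition V_at :: "nat \<Rightarrow> rat fps" where "V_at n = subst (fps_const (of_nat n ^ 2)) V0"

lemma V_at_nth: "fps_nth (V_at n) k = poly (fps_nth V0 k) (of_nat n ^ 2)"
  unfolding V_at_def subst_def fps_poly_fps_const[abs_def] series_eval_consts
  by (simp add: poly_at_def map_poly_id')

text \<open>The equation of \<open>V\<close> is linear in \<open>x\<close>, with a coefficient that does not vanish on \<open>V\<close>. Thus \<open>V\<close> determines \<open>x\<close>.\<close>

lemma V_at_inj: "inj V_at"
proof (rule injI)
  fix n m assume e: "V_at n = V_at m"
  define v where "v = V_at n"
  define T where "T = (ser_of_rat T0 :: rat fps)"
  obtain W where "v = fps_X^2 * W" "fps_nth W 0 = 1"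
    unfolding v_def V_at_def by (rule subst_V_decompose)
  then have v0: "v \<noteq> 0" by auto
  have v1: "fps_nth v 0 = 0" by (simp add: v_def V_at_def subst_V_0)
  have c: "1 - T + 3 * v + v * T = fps_const (of_nat k ^ 2) * v^2 * (3 + v + T - v * T)" if "V_at k = v" for k
    using subst_V_cubic[of "fps_const (of_nat k ^ 2 :: rat)"] that by (simp add: V_at_def[symmetric] T_def)
  have "fps_const (of_nat n ^ 2) * (v^2 * (3 + v + T - v * T)) = fps_const (of_nat m ^ 2) * (v^2 * (3 + v + T - v * T))"
    using c[of n] c[of m] e by (simp add: v_def mult.assoc)
  moreover have "fps_nth (3 + v + T - v * T) 0 = 4" using v1 by (simp add: fps_numeral_nth T_def ser_T_0)
  then have "3 + v + T - v * T \<noteq> 0" by (metis fps_zero_nth zero_neq_numeral)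
  ultimately have "(of_nat n :: rat) ^ 2 = of_nat m ^ 2" using v0 by simp
  then show "n = m" by simp
qed

text \<open>The variables are specialized one after the other: \<open>y\<close> to integers, to eliminate \<open>V(y\<^sup>2)\<close>, and then \<open>x\<close>, to
  eliminate \<open>V(x\<^sup>2)\<close>.\<close>

lemma parameters_independent:
  assumes "eval3 Zs Vx Vy f = 0"
  shows "f = 0"
proof -
  interpret cx: comm_ring_hom in_x by (rule in_x_hom)
  interpret cc: comm_ring_hom const_ser by (rule const_ser_hom)
  let ?g = "\<lambda>q. poly (map_poly of_int q) Z0 :: rat fps"
  let ?h = "\<lambda>p. poly (map_poly (\<lambda>q. const_ser (?g q)) p) (square_var V0)"
  have cI: "const_ser (?g q) = poly (map_poly of_int q) (const_ser Z0)" for q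
  proof -
    have "map_poly const_ser (map_poly of_int q) = map_poly of_int q"
      by (subst map_poly_map_poly) (simp_all add: o_def cc.hom_of_int)
    then show ?thesis using cc.poly_map_poly[of "map_poly of_int q" Z0] by simp
  qed
  have xI: "in_x (?h p) = poly (map_poly (\<lambda>q. poly (map_poly of_int q) Zs) p) Vx" for p
  proof -
    have "in_x (const_ser (?g q)) = poly (map_poly of_int q) Zs" for q
    proof -
      have "map_poly in_x (map_poly of_int q) = map_poly of_int q"
        by (subst map_poly_map_poly) (simp_all add: o_def cx.hom_of_int)
      then show ?thesis using cx.poly_map_poly[of "map_poly of_int q" "const_ser Z0"] by (simp add: cI Zs_def in_x_const_ser)
    qed
    then have "map_poly in_x (map_poly (\<lambda>q. const_ser (?g q)) p) = map_poly (\<lambda>q. poly (map_poly of_int q) Zs) p"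
      by (subst map_poly_map_poly) (simp_all add: o_def const_ser_0)
    then show ?thesis using cx.poly_map_poly[of "map_poly (\<lambda>q. const_ser (?g q)) p" "square_var V0"] by (simp add: Vx_def)
  qed
  have "map_poly in_x (map_poly ?h f) = map_poly (\<lambda>p. poly (map_poly (\<lambda>q. poly (map_poly of_int q) Zs) p) Vx) f"
    by (subst map_poly_map_poly) (simp_all add: o_def xI)
  then have root: "poly (map_poly in_x (map_poly ?h f)) Vy = 0" using assms by (simp add: eval3_def)
  have "map_poly ?h f = 0"
  proof (rule transcendental_by_specialization[where emb = in_x and v = Vy and
        h = "\<lambda>n F. Abs_fps (\<lambda>k. poly (fps_nth F k) [:of_nat n:])"])
    show "comm_ring_hom (\<lambda>F. Abs_fps (\<lambda>k. poly (fps_nth F k) [:of_nat n :: rat:]))" for n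
      by (intro coefficientwise_hom, unfold_locales) simp_all
    interpret k: comm_ring_hom "\<lambda>c :: rat. [:c:]" by unfold_locales (simp_all add: one_pCons)
    have "poly (map_poly (\<lambda>c. [:c:]) p) [:r:] = [:poly p r:]" for p and r :: rat by (rule k.poly_map_poly)
    then have "Abs_fps (\<lambda>k. poly (fps_nth Vy k) [:of_nat n:]) = const_ser (V_at n)" for n
      unfolding Vy_def in_y_def square_var_def const_ser_def fps_nth_Abs_fps
      by (simp only: V_at_nth poly_pcompose) (simp add: power2_eq_square)
    then show "inj (\<lambda>n. Abs_fps (\<lambda>k. poly (fps_nth Vy k) [:of_nat n:]))"
      using V_at_inj by (auto simp: inj_def const_ser_def fps_eq_iff)
  qed (use root in \<open>simp_all add: in_x_def in_x_0 fps_eq_iff\<close>)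
  then have h0: "?h (coeff f i) = 0" for i
    by (metis (no_types, lifting) coeff_0 coeff_map_poly map_poly_0 poly_0)
  have "coeff f i = 0" for i
  proof -
    define p where "p = coeff f i"
    have "map_poly const_ser (map_poly ?g p) = map_poly (\<lambda>q. const_ser (?g q)) p"
      by (subst map_poly_map_poly) (simp_all add: o_def const_ser_0)
    then have root: "poly (map_poly const_ser (map_poly ?g p)) (square_var V0) = 0"
      using h0[of i] by (simp add: p_def)
    have "map_poly ?g p = 0"
    proof (rule transcendental_by_specialization[where emb = const_ser and v = "square_var V0" and
          h = "\<lambda>n F. Abs_fps (\<lambda>k. poly (fps_nth F k) (of_nat n))"])
      show "comm_ring_hom (\<lambda>F. Abs_fps (\<lambda>k. poly (fps_nth F k) (of_nat n :: rat)))" for n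
        by (intro coefficientwise_hom, unfold_locales) simp_all
      have "Abs_fps (\<lambda>k. poly (fps_nth (square_var V0) k) (of_nat n)) = V_at n" for n
        by (intro fps_ext) (simp add: V_at_nth square_var_def poly_pcompose power2_eq_square)
      then show "inj (\<lambda>n. Abs_fps (\<lambda>k. poly (fps_nth (square_var V0) k) (of_nat n)))"
        using V_at_inj by simp
    qed (use root in \<open>simp_all add: const_ser_def const_ser_0 fps_eq_iff\<close>)
    then have "?g (coeff p j) = 0" for j
      by (metis (no_types, lifting) coeff_0 coeff_map_poly map_poly_0 poly_0)
    then have "coeff p j = 0" for j by (rule Z0_transcendental)
    then show ?thesis by (simp add: poly_eq_iff p_def)
  qed
  then show ?thesis by (simp add: poly_eq_iff)
qed

lemma flips_fix:
  "flip_t Zs = Zs" "flip_t Vx = Vx" "flip_t Vy = Vy"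
  "flip_x Zs = Zs" "flip_x Vx = Vx" "flip_x Vy = Vy"
  "flip_y Zs = Zs" "flip_y Vx = Vx" "flip_y Vy = Vy"
proof -
  interpret c: comm_ring_hom "\<lambda>c :: rat. [:c:]" by (rule const_poly_hom)
  show "flip_t Zs = Zs" "flip_t Vx = Vx" "flip_t Vy = Vy"
    using Z0_even V0_even by (auto simp: flip_t_fixed_iff Zs_def Vx_def Vy_def in_const_def in_x_def in_y_def square_var_def)
  show "flip_x Zs = Zs" by (simp add: flip_x_def Zs_def in_const_def Polynomial.map_poly_pCons)
  have "map_poly (\<lambda>c. pcompose c [:0, -1:]) [:pcompose p [:0, 0, 1:]:] = [:pcompose p [:0, 0, 1:]:]" for p :: "rat poly"
    using square_fixed[of p] by (simp add: Polynomial.map_poly_pCons)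
  then show "flip_x Vx = Vx" unfolding flip_x_def Vx_def in_x_def square_var_def fps_nth_Abs_fps by (simp only:)
  show "flip_x Vy = Vy"
    unfolding flip_x_def Vy_def in_y_def by (intro fps_ext) (simp add: map_poly_map_poly o_def)
  show "flip_y Zs = Zs" by (simp add: flip_y_def Zs_def in_const_def)
  show "flip_y Vx = Vx" by (simp add: flip_y_def Vx_def in_x_def)
  show "flip_y Vy = Vy"
  proof -
    have "map_poly (\<lambda>c. [:c:]) (pcompose p [:0, 0, 1:]) = pcompose (map_poly (\<lambda>c. [:c:]) p) [:0, 0, 1:]" for p :: "rat poly"
      by (simp add: c.map_poly_pcompose Polynomial.map_poly_pCons pCons_one)
    then show ?thesis
      unfolding flip_y_def Vy_def in_y_def square_var_def fps_nth_Abs_fps by (simp only: square_fixed)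
  qed
qed

end

lemma eval3_fixed:
  assumes "comm_ring_hom h" and "h a = a" "h b = b" "h c = c"
  shows "h (eval3 a b c f) = eval3 a b c f"
proof -
  interpret h: comm_ring_hom h by fact
  have 1: "h (poly (map_poly of_int q) a) = poly (map_poly of_int q) a" for q
    by (induction q) (simp_all add: Polynomial.map_poly_pCons h.hom_add h.hom_mult h.hom_of_int assms)
  have 2: "h (poly (map_poly (\<lambda>q. poly (map_poly of_int q) a) p) b) = poly (map_poly (\<lambda>q. poly (map_poly of_int q) a) p) b" for p
    by (induction p) (simp_all add: Polynomial.map_poly_pCons h.hom_add h.hom_mult 1 assms)
  show ?thesis unfolding eval3_def
    by (induction f) (simp_all add: Polynomial.map_poly_pCons h.hom_add h.hom_mult 2 assms)
qed

section \<open>Values at a point of the curve\<close>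

abbreviation "var_t \<equiv> (fps_X :: rat poly poly fps)"
abbreviation (input) "X \<equiv> indet_x"
abbreviation (input) "Y \<equiv> indet_y"

lemma X_nonzero: "X \<noteq> 0" and Y_nonzero: "Y \<noteq> 0"
  by (simp_all add: indet_x_def indet_y_def Zero_fract_def eq_fract)

lemma Vx_eval: "eval2 (in_x (square_var V)) a b = eval1 V (a^2)"
  by (simp add: eval2_in_x eval1_subst subst_square_var)

lemma Vy_eval: "eval2 (in_y (square_var V)) a b = eval1 V (b^2)"
  by (simp add: eval2_in_y eval1_subst subst_square_var)

text \<open>The functional equation solved for \<open>M\<close> and multiplied by \<open>3 x y\<^sup>2\<close>. In this form it can be specialized
  to any field in which the coefficient of \<open>M\<close> is nonzero.\<close>

lemma M_cleared:
  fixes a b :: "'a::field_char_0"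
  assumes "a \<noteq> 0" and "b \<noteq> 0"
  defines "x \<equiv> fls_const a" and "y \<equiv> fls_const b" and "t \<equiv> fls_X"
  shows "eval2 M_ser a b * (6 * y * (x * y - t * (x^2 + 1) * (y^2 + 1)))
    = 2 * x^2 * y^2 - 6 * t * y * (x^2 + 1) * eval1 A_ser a
      + 3 * t * y * (x^2 - 1) * (y^2 + 1) * eval1 B_ser b + 3 * t * x * (y^2 + 1) * eval1 A_ser b
      - 3 * t * x * y * eval0 (coeff_series M_ser 1 0)
      + 3 * y * (x * y - t * (x^2 + 1) * (y^2 + 1)) * eval1 B_ser b"
proof -
  have nz: "x \<noteq> 0" "y \<noteq> 0" using assms by simp_all
  define u w where "u = 1 / x" and "w = 1 / y"
  have u: "x * u = 1" and w: "y * w = 1" using nz by (simp_all add: u_def w_def)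
  note fe = M_functional_equation[OF assms(1,2), unfolded eval2_M_y0 eval2_M_x0, folded x_def y_def t_def, folded u_def w_def]
  define m where "m = eval2 M_ser a b"
  define k where "k = eval0 (coeff_series M_ser 1 0 :: rat fps) * (1 :: 'a fls)"
  define ax ay bY where "ax = eval1 A_ser a" and "ay = eval1 A_ser b" and "bY = eval1 B_ser b"
  define q where "q = 2 * x / 3"
  have q: "3 * q = 2 * x" by (simp add: q_def)
  have "(1 - t * (x + u) * (y + w)) * (2 * m - bY)
      = q - 2 * t * w * (x + u) * ax + t * (x - u) * (y + w) * bY + t * (1 + w^2) * ay - t * w * k"
    using fe by (simp add: m_def k_def ax_def ay_def bY_def q_def)
  then have "m * (6 * y * (x * y - t * (x^2 + 1) * (y^2 + 1)))
    = 2 * x^2 * y^2 - 6 * t * y * (x^2 + 1) * ax + 3 * t * y * (x^2 - 1) * (y^2 + 1) * bY + 3 * t * x * (y^2 + 1) * ay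
      - 3 * t * x * y * k + 3 * y * (x * y - t * (x^2 + 1) * (y^2 + 1)) * bY"
    using u w q by Groebner_Basis.algebra
  then show ?thesis by (simp add: m_def k_def ax_def ay_def bY_def)
qed

lemma id_hom: "comm_ring_hom (\<lambda>a :: 'c::comm_ring_1. a)"
  by unfold_locales simp_all

lemma two_nonzero: "(2 :: rat poly poly fps) \<noteq> 0"
proof
  assume "(2 :: rat poly poly fps) = 0"
  then have "fps_nth (2 :: rat poly poly fps) 0 = 0" by (simp only: fps_zero_nth)
  then show False by (simp add: fps_numeral_nth)
qed

lemma eval2_zero_imp: "eval2 F X Y = 0 \<Longrightarrow> F = 0"
  using eval2_indets_inj[of F 0] by (simp add: eval2_alt fps_zero_def[symmetric] poly2_at_indets)

text \<open>A local ring with residue map \<open>\<pi>\<close>, together with a solution of the equations that link \<open>t, x, y\<close>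
  to the parameters \<open>Z\<close>, \<open>V(x\<^sup>2)\<close>, \<open>V(y\<^sup>2)\<close>. By \<open>units\<close>, the fractions for \<open>t\<^sup>2\<close>, \<open>x\<^sup>2\<close> and \<open>y\<^sup>2\<close> are defined at
  this point.\<close>

locale curve_point = parametrization T0 Z0 V0 + henselian \<pi>
  for T0 Z0 :: "rat fps" and V0 :: "rat poly fps" and \<pi> :: "'b::idom \<Rightarrow> 'f::field" +
  fixes th xh yh zh vxh vyh :: 'b
  assumes z_eq: "256 * zh^6 * th^2 = (zh^2 - 1) * (zh^2 + 3)^3"
    and vx_eq: "1 - zh^2 + 3 * vxh + vxh * zh^2 = xh^2 * vxh^2 * (3 + vxh + zh^2 - vxh * zh^2)"
    and vy_eq: "1 - zh^2 + 3 * vyh + vyh * zh^2 = yh^2 * vyh^2 * (3 + vyh + zh^2 - vyh * zh^2)"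
    and units: "\<pi> (256 * zh^6) \<noteq> 0" "\<pi> (vxh^2 * (3 + vxh + zh^2 - vxh * zh^2)) \<noteq> 0"
      "\<pi> (vyh^2 * (3 + vyh + zh^2 - vyh * zh^2)) \<noteq> 0"
begin

text \<open>The specialization at the point is built in stages: polynomials in the independent parameters, fractions of
  these inside \<open>\<rat>[x,y][[t]]\<close>, then \<open>t\<close>, \<open>x\<close> and \<open>y\<close> as square roots, and finally fractions in the field of Laurent
  series.\<close>

definition \<Gamma>0 where "\<Gamma>0 = range (\<lambda>f. (eval3 Zs Vx Vy f, eval3 zh vxh vyh f))"
definition \<Gamma>1 where "\<Gamma>1 = fraction_pairs (\<lambda>a. a) \<Gamma>0"
definition \<Gamma>2 where "\<Gamma>2 = adjoin_pair \<Gamma>1 var_t th"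
definition \<Gamma>3 where "\<Gamma>3 = adjoin_pair \<Gamma>2 (fps_const var_x) xh"
definition \<Gamma>4 where "\<Gamma>4 = adjoin_pair \<Gamma>3 (fps_const var_y) yh"
definition \<Gamma> where "\<Gamma> = fraction_pairs (\<lambda>F. eval2 F X Y) \<Gamma>4"

lemma spec0: "specialization \<Gamma>0"
proof -
  interpret s: comm_ring_hom "eval3 Zs Vx Vy" by (rule eval3_hom)
  interpret b: comm_ring_hom "eval3 zh vxh vyh" by (rule eval3_hom)
  have I: "(eval3 Zs Vx Vy f, eval3 zh vxh vyh f) \<in> \<Gamma>0" for f by (simp add: \<Gamma>0_def)
  show ?thesis
  proof
    show "(1, 1) \<in> \<Gamma>0" using I[of 1] by simp
    show "b = 0" if m: "(0, b) \<in> \<Gamma>0" for b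
    proof -
      obtain f where f: "0 = eval3 Zs Vx Vy f" "b = eval3 zh vxh vyh f" using m by (auto simp: \<Gamma>0_def)
      then show ?thesis using parameters_independent[OF f(1)[symmetric]] by simp
    qed
    fix a b c d assume "(a, b) \<in> \<Gamma>0" "(c, d) \<in> \<Gamma>0"
    then obtain f g where "a = eval3 Zs Vx Vy f" "b = eval3 zh vxh vyh f" "c = eval3 Zs Vx Vy g" "d = eval3 zh vxh vyh g"
      by (auto simp: \<Gamma>0_def)
    then show "(a - c, b - d) \<in> \<Gamma>0" "(a * c, b * d) \<in> \<Gamma>0"
      using I[of "f - g"] I[of "f * g"]
      by (simp_all add: s.hom_minus b.hom_minus s.hom_mult b.hom_mult)
  qed
qed

lemma spec1: "specialization \<Gamma>1"
  unfolding \<Gamma>1_def by (rule fraction_specialization[OF spec0 id_hom])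

lemma sub1: "\<Gamma>0 \<subseteq> \<Gamma>1"
  unfolding \<Gamma>1_def using fraction_pairs_sub[OF spec0 id_hom] by auto

lemma gens0: "(Zs, zh) \<in> \<Gamma>0" "(Vx, vxh) \<in> \<Gamma>0" "(Vy, vyh) \<in> \<Gamma>0"
proof -
  have I: "(eval3 Zs Vx Vy f, eval3 zh vxh vyh f) \<in> \<Gamma>0" for f by (simp add: \<Gamma>0_def)
  show "(Zs, zh) \<in> \<Gamma>0" "(Vx, vxh) \<in> \<Gamma>0" "(Vy, vyh) \<in> \<Gamma>0"
    using I[of "[:[:[:0, 1:]:]:]"] I[of "[:[:0, 1:]:]"] I[of "[:0, 1:]"] by (simp_all only: eval3_vars)
qed

text \<open>An element \<open>a\<close> of the second stage satisfies \<open>a c = c'\<close> with \<open>c\<close> and \<open>c'\<close> fixed and \<open>c \<noteq> 0\<close>.\<close>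

lemma fixed1:
  assumes "comm_ring_hom \<sigma>" "\<sigma> Zs = Zs" "\<sigma> Vx = Vx" "\<sigma> Vy = Vy" "(a, b) \<in> \<Gamma>1"
  shows "\<sigma> a = a"
proof -
  interpret h: comm_ring_hom \<sigma> by fact
  obtain c d c' d' where m: "(c, d) \<in> \<Gamma>0" "(c', d') \<in> \<Gamma>0" "d dvd 1" "a * c = c'" "b * d = d'"
    using assms(5) unfolding \<Gamma>1_def fraction_pairs_def by blast
  have "\<sigma> c = c" "\<sigma> c' = c'" using m eval3_fixed[OF assms(1-4)] by (auto simp: \<Gamma>0_def)
  then have "\<sigma> a * c = a * c" using m(4) h.hom_mult by metis
  moreover have "c \<noteq> 0"
  proof
    assume "c = 0"
    then have "d = 0" using m(1) specialization.single[OF spec0] by blast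
    then show False using m(3) by simp
  qed
  ultimately show ?thesis by simp
qed

lemma Z_eq: "256 * Zs^6 * var_t^2 = (Zs^2 - 1) * (Zs^2 + 3)^3"
proof -
  interpret c: comm_ring_hom in_const by (rule in_const_hom)
  have X: "in_const fps_X = var_t" by (intro fps_ext) (simp add: in_const_def fps_X_def one_pCons)
  have "256 * fps_X^2 * Z0^6 = (Z0^2 - 1) * (Z0^2 + 3)^3"
    using T0_eq unfolding Z0_eq[symmetric] by (simp add: power_mult[symmetric])
  from arg_cong[OF this, of in_const] show ?thesis
    by (simp add: Zs_def c.hom_mult c.hom_minus c.hom_add c.hom_power c.hom_numeral X mult_ac)
qed

lemma Vx_eq: "1 - Zs^2 + 3 * Vx + Vx * Zs^2 = (fps_const var_x)^2 * Vx^2 * (3 + Vx + Zs^2 - Vx * Zs^2)"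
  and Vy_eq: "1 - Zs^2 + 3 * Vy + Vy * Zs^2 = (fps_const var_y)^2 * Vy^2 * (3 + Vy + Zs^2 - Vy * Zs^2)"
proof -
  interpret e: comm_ring_hom "\<lambda>F. eval2 F X Y" by (rule eval2_hom)
  have Z: "eval2 Zs X Y = (ZZ :: ratfun fls)" by (simp add: Zs_def eval2_in_const ZZ_def)
  have c: "1 - ZZ^2 + 3 * eval1 V0 (a^2) + eval1 V0 (a^2) * ZZ^2
    = (fls_const a)^2 * (eval1 V0 (a^2))^2 * (3 + eval1 V0 (a^2) + ZZ^2 - eval1 V0 (a^2) * ZZ^2)" for a :: ratfun
    using VV_cubic[of "fps_const (a^2)"] unfolding TT_ZZ VV_def eval1_subst[symmetric]
    by (simp add: fls_const_power)
  have x: "eval2 (fps_const var_x) X Y = fls_const X" and y: "eval2 (fps_const var_y) X Y = fls_const Y"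
    unfolding eval2_fps_const by simp_all
  have vx: "eval2 Vx X Y = eval1 V0 (X^2)" and vy: "eval2 Vy X Y = eval1 V0 (Y^2)"
    by (simp_all add: Vx_def Vy_def Vx_eval Vy_eval)
  have "eval2 (1 - Zs^2 + 3 * Vx + Vx * Zs^2) X Y
    = eval2 ((fps_const var_x)^2 * Vx^2 * (3 + Vx + Zs^2 - Vx * Zs^2)) X Y"
    using c[of X] by (simp add: e.hom_mult e.hom_minus e.hom_add e.hom_power e.hom_numeral x vx Z del: fps_const_power)
  then show "1 - Zs^2 + 3 * Vx + Vx * Zs^2 = (fps_const var_x)^2 * Vx^2 * (3 + Vx + Zs^2 - Vx * Zs^2)"
    by (simp only: eval2_indets_inj)
  have "eval2 (1 - Zs^2 + 3 * Vy + Vy * Zs^2) X Y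
    = eval2 ((fps_const var_y)^2 * Vy^2 * (3 + Vy + Zs^2 - Vy * Zs^2)) X Y"
    using c[of Y] by (simp add: e.hom_mult e.hom_minus e.hom_add e.hom_power e.hom_numeral y vy Z del: fps_const_power)
  then show "1 - Zs^2 + 3 * Vy + Vy * Zs^2 = (fps_const var_y)^2 * Vy^2 * (3 + Vy + Zs^2 - Vy * Zs^2)"
    by (simp only: eval2_indets_inj)
qed

lemma squares1: "(var_t^2, th^2) \<in> \<Gamma>1" "((fps_const var_x)^2, xh^2) \<in> \<Gamma>1" "((fps_const var_y)^2, yh^2) \<in> \<Gamma>1"
proof -
  interpret s: specialization \<Gamma>0 by (rule spec0)
  have num: "(numeral n, numeral n) \<in> \<Gamma>0" for n using s.of_int[of "numeral n"] by simp
  note in0 = s.mult s.diff s.add s.power gens0 num s.one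
  show "(var_t^2, th^2) \<in> \<Gamma>1" unfolding \<Gamma>1_def
  proof (rule fraction_pairsI)
    show "(256 * Zs^6, 256 * zh^6) \<in> \<Gamma>0" "((Zs^2 - 1) * (Zs^2 + 3)^3, (zh^2 - 1) * (zh^2 + 3)^3) \<in> \<Gamma>0"
      by (intro in0)+
  qed (use unit[OF units(1)] Z_eq z_eq in \<open>simp_all add: mult.commute\<close>)
  show "((fps_const var_x)^2, xh^2) \<in> \<Gamma>1" unfolding \<Gamma>1_def
  proof (rule fraction_pairsI)
    show "(Vx^2 * (3 + Vx + Zs^2 - Vx * Zs^2), vxh^2 * (3 + vxh + zh^2 - vxh * zh^2)) \<in> \<Gamma>0"
      "(1 - Zs^2 + 3 * Vx + Vx * Zs^2, 1 - zh^2 + 3 * vxh + vxh * zh^2) \<in> \<Gamma>0"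
      by (intro in0)+
  qed (use unit[OF units(2)] Vx_eq vx_eq in \<open>simp_all only: mult.assoc\<close>)
  show "((fps_const var_y)^2, yh^2) \<in> \<Gamma>1" unfolding \<Gamma>1_def
  proof (rule fraction_pairsI)
    show "(Vy^2 * (3 + Vy + Zs^2 - Vy * Zs^2), vyh^2 * (3 + vyh + zh^2 - vyh * zh^2)) \<in> \<Gamma>0"
      "(1 - Zs^2 + 3 * Vy + Vy * Zs^2, 1 - zh^2 + 3 * vyh + vyh * zh^2) \<in> \<Gamma>0"
      by (intro in0)+
  qed (use unit[OF units(3)] Vy_eq vy_eq in \<open>simp_all only: mult.assoc\<close>)
qed

lemma spec2: "specialization \<Gamma>2" and sub2: "\<Gamma>1 \<subseteq> \<Gamma>2" and t2: "(var_t, th) \<in> \<Gamma>2"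
  unfolding \<Gamma>2_def
  using adjoin_square_root[OF spec1 squares1(1) flip_t_hom flip_t_X fixed1[OF flip_t_hom flips_fix(1-3)] fps_X_neq_zero two_nonzero] by auto

lemma spec3: "specialization \<Gamma>3" and sub3: "\<Gamma>2 \<subseteq> \<Gamma>3" and x3: "(fps_const var_x, xh) \<in> \<Gamma>3"
proof -
  have "flip_x a = a" if "(a, b) \<in> \<Gamma>2" for a b
    by (rule adjoin_fixed[OF flip_x_hom fixed1[OF flip_x_hom flips_fix(4-6)] flips_variables(1) that[unfolded \<Gamma>2_def]])
  note fixed = this
  have sq: "((fps_const var_x)^2, xh^2) \<in> \<Gamma>2" using squares1 sub2 by blast
  have nz: "fps_const var_x \<noteq> 0" by simp
  show "specialization \<Gamma>3" "\<Gamma>2 \<subseteq> \<Gamma>3" "(fps_const var_x, xh) \<in> \<Gamma>3"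
    unfolding \<Gamma>3_def
    using adjoin_square_root[OF spec2 sq flip_x_hom flips_variables(4) fixed nz two_nonzero] by simp_all
qed

lemma spec4: "specialization \<Gamma>4" and sub4: "\<Gamma>3 \<subseteq> \<Gamma>4" and y4: "(fps_const var_y, yh) \<in> \<Gamma>4"
proof -
  have 2: "flip_y a = a" if "(a, b) \<in> \<Gamma>2" for a b
    by (rule adjoin_fixed[OF flip_y_hom fixed1[OF flip_y_hom flips_fix(7-9)] flips_variables(2) that[unfolded \<Gamma>2_def]])
  have "flip_y a = a" if "(a, b) \<in> \<Gamma>3" for a b
    by (rule adjoin_fixed[OF flip_y_hom 2 flips_variables(3) that[unfolded \<Gamma>3_def]])
  note fixed = this
  have sq: "((fps_const var_y)^2, yh^2) \<in> \<Gamma>3" using squares1 sub2 sub3 by blast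
  have nz: "fps_const var_y \<noteq> 0" by simp
  show "specialization \<Gamma>4" "\<Gamma>3 \<subseteq> \<Gamma>4" "(fps_const var_y, yh) \<in> \<Gamma>4"
    unfolding \<Gamma>4_def
    using adjoin_square_root[OF spec3 sq flip_y_hom flips_variables(5) fixed nz two_nonzero] by simp_all
qed

lemma spec: "specialization \<Gamma>"
  unfolding \<Gamma>_def by (rule fraction_specialization[OF spec4 eval2_hom eval2_zero_imp])

lemma sub: "(F, b) \<in> \<Gamma>4 \<Longrightarrow> (eval2 F X Y, b) \<in> \<Gamma>"
  unfolding \<Gamma>_def by (rule fraction_pairs_sub[OF spec4 eval2_hom])

lemma t_spec: "(fls_X, th) \<in> \<Gamma>"
  using sub[of var_t th] t2 sub3 sub4 by (auto simp: eval2_fps_X)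

lemma x_spec: "(fls_const X, xh) \<in> \<Gamma>"
  using sub[of "fps_const var_x" xh] x3 sub4 by (auto simp: eval2_fps_const)

lemma y_spec: "(fls_const Y, yh) \<in> \<Gamma>"
  using sub[of "fps_const var_y" yh] y4 by (auto simp: eval2_fps_const)

text \<open>The residue of a specialization of \<open>w\<close>. Passing to the residue field loses the uniqueness of the lift but leaves
  numbers that can be computed.\<close>

definition value_at :: "ratfun fls \<Rightarrow> 'f \<Rightarrow> bool" where
  "value_at w r \<longleftrightarrow> (\<exists>b. (w, b) \<in> \<Gamma> \<and> \<pi> b = r)"

lemma value_vars: "value_at fls_X (\<pi> th)" "value_at (fls_const X) (\<pi> xh)" "value_at (fls_const Y) (\<pi> yh)"
  using t_spec x_spec y_spec by (auto simp: value_at_def)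

lemma value_params: "value_at ZZ (\<pi> zh)" "value_at (eval1 V0 (X^2)) (\<pi> vxh)" "value_at (eval1 V0 (Y^2)) (\<pi> vyh)"
proof -
  have "\<Gamma>0 \<subseteq> \<Gamma>4" using sub1 sub2 sub3 sub4 by blast
  then have "(eval2 Zs X Y, zh) \<in> \<Gamma>" "(eval2 Vx X Y, vxh) \<in> \<Gamma>" "(eval2 Vy X Y, vyh) \<in> \<Gamma>"
    using gens0 sub by blast+
  then show "value_at ZZ (\<pi> zh)" "value_at (eval1 V0 (X^2)) (\<pi> vxh)" "value_at (eval1 V0 (Y^2)) (\<pi> vyh)"
    unfolding value_at_def by (auto simp: Zs_def eval2_in_const ZZ_def Vx_def Vy_def Vx_eval Vy_eval)
qed

lemma value_add: "value_at w r \<Longrightarrow> value_at w' r' \<Longrightarrow> value_at (w + w') (r + r')"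
  and value_diff: "value_at w r \<Longrightarrow> value_at w' r' \<Longrightarrow> value_at (w - w') (r - r')"
  and value_mult: "value_at w r \<Longrightarrow> value_at w' r' \<Longrightarrow> value_at (w * w') (r * r')"
  and value_uminus: "value_at w r \<Longrightarrow> value_at (- w) (- r)"
  and value_power: "value_at w r \<Longrightarrow> value_at (w ^ n) (r ^ n)"
  and value_numeral: "value_at (numeral k) (numeral k)"
  and value_one: "value_at 1 1"
proof -
  interpret s: specialization \<Gamma> by (rule spec)
  interpret h: comm_ring_hom \<pi> by (rule hom)
  show "value_at w r \<Longrightarrow> value_at w' r' \<Longrightarrow> value_at (w + w') (r + r')"
    unfolding value_at_def by (elim exE conjE, rule exI, rule conjI, erule (1) s.add, simp add: h.hom_add)
  show "value_at w r \<Longrightarrow> value_at w' r' \<Longrightarrow> value_at (w - w') (r - r')"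
    unfolding value_at_def by (elim exE conjE, rule exI, rule conjI, erule (1) s.diff, simp add: h.hom_minus)
  show "value_at w r \<Longrightarrow> value_at w' r' \<Longrightarrow> value_at (w * w') (r * r')"
    unfolding value_at_def by (elim exE conjE, rule exI, rule conjI, erule (1) s.mult, simp add: h.hom_mult)
  show "value_at w r \<Longrightarrow> value_at (- w) (- r)"
    unfolding value_at_def by (elim exE conjE, rule exI, rule conjI, erule s.uminus, simp add: h.hom_uminus)
  show "value_at w r \<Longrightarrow> value_at (w ^ n) (r ^ n)"
    unfolding value_at_def by (elim exE conjE, rule exI, rule conjI, erule s.power, simp add: h.hom_power)
  have "(numeral k, numeral k) \<in> \<Gamma>" using s.of_int[of "numeral k"] by simp
  then show "value_at (numeral k) (numeral k)" unfolding value_at_def using h.hom_numeral by blast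
  show "value_at 1 1" unfolding value_at_def using s.one h.hom_one by blast
qed

lemmas value_rules = value_add value_diff value_mult value_uminus value_power value_numeral value_one value_vars value_params

text \<open>The closed forms are fractions; their values are determined by cleared equations, as long as the
  denominator does not vanish in the residue field.\<close>

lemma value_quotient:
  assumes "w * u = u'" and "value_at u s" and "value_at u' s'" and "s \<noteq> 0" and "r * s = s'"
  shows "value_at w r"
proof -
  interpret h: comm_ring_hom \<pi> by (rule hom)
  obtain b b' where b: "(u, b) \<in> \<Gamma>" "\<pi> b = s" "(u', b') \<in> \<Gamma>" "\<pi> b' = s'"
    using assms by (auto simp: value_at_def)
  have d: "b dvd 1" using unit b assms by auto
  then obtain i where i: "1 = b * i" by (rule dvdE)
  have e: "(b' * i) * b = b'" using i by (metis mult.assoc mult.commute mult.right_neutral)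
  have "(w, b' * i) \<in> \<Gamma>"
    unfolding \<Gamma>_def
    by (rule fraction_divide[OF spec4 eval2_hom b(1)[unfolded \<Gamma>_def] b(3)[unfolded \<Gamma>_def] d assms(1) e])
  moreover have "\<pi> (b' * i) * s = r * s" using arg_cong[OF e, of \<pi>] b assms by (simp add: h.hom_mult)
  then have "\<pi> (b' * i) = r" using assms(4) mult_right_cancel by blast
  ultimately show ?thesis by (auto simp: value_at_def)
qed

lemma value_A:
  assumes "value_at (fls_const a) x" "value_at (eval1 V0 (a^2)) v" "transcendental_point (a :: ratfun)"
    and "(\<pi> th)^2 * R_den (\<pi> zh) v \<noteq> 0" and "r * ((\<pi> th)^2 * R_den (\<pi> zh) v) = x * R_num (\<pi> zh) v"
  shows "value_at (eval1 A_ser a) r"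
proof -
  interpret k: kernel_curve a T0 Z0 V0 by (intro kernel_curve.intro assms parametrization_axioms)
  show ?thesis
  proof (rule value_quotient[OF _ _ _ assms(4,5)])
    show "eval1 A_ser a * (fls_X^2 * R_den ZZ (eval1 V0 (a^2))) = fls_const a * R_num ZZ (eval1 V0 (a^2))"
      using k.A_value by (simp only: mult_ac)
    show "value_at (fls_X^2 * R_den ZZ (eval1 V0 (a^2))) ((\<pi> th)^2 * R_den (\<pi> zh) v)"
      "value_at (fls_const a * R_num ZZ (eval1 V0 (a^2))) (x * R_num (\<pi> zh) v)"
      unfolding R_den_def R_num_def N_poly_def by (intro value_rules assms(1,2))+
  qed
qed

lemma value_B:
  assumes "value_at (fls_const a) x" "value_at (eval1 V0 (a^2)) v" "transcendental_point (a :: ratfun)"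
    and "\<pi> th * x * B_den ((\<pi> zh)^2) v \<noteq> 0" and "r * (\<pi> th * x * B_den ((\<pi> zh)^2) v) = B_num ((\<pi> zh)^2) v"
  shows "value_at (eval1 B_ser a) r"
proof -
  interpret k: kernel_curve a T0 Z0 V0 by (intro kernel_curve.intro assms parametrization_axioms)
  show ?thesis
  proof (rule value_quotient[OF _ _ _ assms(4,5)])
    show "eval1 B_ser a * (fls_X * fls_const a * B_den (ZZ^2) (eval1 V0 (a^2))) = B_num (ZZ^2) (eval1 V0 (a^2))"
      using k.B_value unfolding TT_ZZ by (simp only: mult_ac)
    show "value_at (fls_X * fls_const a * B_den (ZZ^2) (eval1 V0 (a^2))) (\<pi> th * x * B_den ((\<pi> zh)^2) v)"
      "value_at (B_num (ZZ^2) (eval1 V0 (a^2))) (B_num ((\<pi> zh)^2) v)"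
      unfolding B_den_def B_num_def by (intro value_rules assms(1,2))+
  qed
qed

lemma value_M10:
  assumes "24 * (\<pi> zh)^3 * (\<pi> th)^2 \<noteq> 0" and "r * (24 * (\<pi> zh)^3 * (\<pi> th)^2) = 4 * (\<pi> zh)^3 - (1 + (\<pi> zh)^2)^2"
  shows "value_at (eval0 (coeff_series M_ser 1 0)) r"
proof -
  interpret k: kernel_curve X T0 Z0 V0 by (intro kernel_curve.intro transcendental_x parametrization_axioms)
  show ?thesis
  proof (rule value_quotient[OF _ _ _ assms])
    have "24 * ZZ^3 * g0_fun ZZ = (4 * ZZ^3 - (1 + ZZ^2)^2 :: ratfun fls)"
      using ZZ_nonzero[where 'a = ratfun] by (simp add: g0_fun_def right_diff_distrib)
    moreover have "eval0 (coeff_series M_ser 1 0) * (24 * ZZ^3 * fls_X^2)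
        = 24 * ZZ^3 * (fls_X^2 * eval0 (coeff_series M_ser 1 0) :: ratfun fls)" by (simp only: mult_ac)
    ultimately show "eval0 (coeff_series M_ser 1 0) * (24 * ZZ^3 * fls_X^2) = (4 * ZZ^3 - (1 + ZZ^2)^2 :: ratfun fls)"
      unfolding k.M10_value by simp
    show "value_at (24 * ZZ^3 * fls_X^2) (24 * (\<pi> zh)^3 * (\<pi> th)^2)"
      "value_at (4 * ZZ^3 - (1 + ZZ^2)^2) (4 * (\<pi> zh)^3 - (1 + (\<pi> zh)^2)^2)"
      by (intro value_rules)+
  qed
qed

lemma value_M:
  fixes a b :: ratfun
  defines "t \<equiv> \<pi> th"
  assumes nz: "a \<noteq> 0" "b \<noteq> 0" and vals: "value_at (fls_const a) x" "value_at (fls_const b) y"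
    "value_at (eval1 A_ser a) ax" "value_at (eval1 A_ser b) ay" "value_at (eval1 B_ser b) bY"
    "value_at (eval0 (coeff_series M_ser 1 0)) k"
    and nz': "6 * y * (x * y - t * (x^2 + 1) * (y^2 + 1)) \<noteq> 0"
    and eq: "r * (6 * y * (x * y - t * (x^2 + 1) * (y^2 + 1)))
    = 2 * x^2 * y^2 - 6 * t * y * (x^2 + 1) * ax + 3 * t * y * (x^2 - 1) * (y^2 + 1) * bY + 3 * t * x * (y^2 + 1) * ay
      - 3 * t * x * y * k + 3 * y * (x * y - t * (x^2 + 1) * (y^2 + 1)) * bY"
  shows "value_at (eval2 M_ser a b) r"
  by (rule value_quotient[OF M_cleared[OF nz] _ _ nz' eq]) (unfold t_def, (intro value_rules vals)+)

lemma value_P: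
  assumes "value_at (eval2 M_ser X Y) m" "value_at (eval2 M_ser Y X) m'" "value_at (eval1 B_ser X) bX" "value_at (eval1 B_ser Y) bY"
    and "\<pi> xh * \<pi> yh \<noteq> 0" and "r * (\<pi> xh * \<pi> yh) = \<pi> yh * (m - bY) + \<pi> xh * (m' - bX)"
  shows "value_at (eval2 P_ser X Y) r"
proof (rule value_quotient[OF _ _ _ assms(5,6)])
  show "eval2 P_ser X Y * (fls_const X * fls_const Y)
    = fls_const Y * (eval2 M_ser X Y - eval1 B_ser Y) + fls_const X * (eval2 M_ser Y X - eval1 B_ser X)"
    using X_nonzero Y_nonzero unfolding eval2_P_eq[OF X_nonzero Y_nonzero] eval2_M_x0
    by (simp add: field_simps del: fls_const_mult_const)
qed (intro value_rules assms)+

end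

section \<open>The degree is at least the number of distinct values\<close>

text \<open>An index type with 571 elements, over which \<open>mod_ring\<close> is the field of integers modulo 571.\<close>

typedef residue_index = "{0..<571::nat}"
  by (rule exI[of _ 0]) simp

text \<open>A proper divisor would come with one below \<open>24\<close>, as \<open>24\<^sup>2 > 571\<close>.\<close>

lemma prime_571: "prime (571 :: nat)"
proof (rule prime_nat_naiveI)
  have small: "k = 1" if k: "k dvd 571" "k < 24" for k :: nat
  proof (rule ccontr)
    assume "k \<noteq> 1"
    moreover have "k \<noteq> 0" using k(1) by (intro notI) simp
    ultimately have "k \<in> {2..<24}" using k(2) by simp
    then have "k \<in> set [2..<24]" unfolding set_upt .
    moreover have "\<forall>k \<in> set [2..<24]. \<not> k dvd (571 :: nat)" by (simp add: upt_rec)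
    ultimately show False using k(1) by blast
  qed
  fix n :: nat assume "n dvd 571"
  then obtain m where m: "571 = n * m" by (rule dvdE)
  have "\<not> (24 \<le> n \<and> 24 \<le> m)"
  proof
    assume "24 \<le> n \<and> 24 \<le> m"
    then have "24 * 24 \<le> n * m" by (intro mult_le_mono) auto
    then show False using m by simp
  qed
  moreover have "m dvd 571" unfolding m by simp
  ultimately have "n = 1 \<or> m = 1" using small \<open>n dvd 571\<close> by (meson not_less)
  then show "n = 1 \<or> n = 571" using m by auto
qed simp

lemma card_residue_index: "CARD(residue_index) = 571"
  using type_definition.card[OF type_definition_residue_index] by simp

instance residue_index :: finite
proof
  have "finite (Abs_residue_index ` {0..<571})" by simp
  then show "finite (UNIV :: residue_index set)"
    using type_definition.univ[OF type_definition_residue_index] by simp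
qed

instance residue_index :: prime_card
proof
  show "prime CARD(residue_index)" unfolding card_residue_index by (rule prime_571)
qed

type_synonym gf = "residue_index mod_ring"

lemma gf_of_int_eq_0_iff: "(of_int a :: gf) = 0 \<longleftrightarrow> 571 dvd a"
  unfolding of_int_of_int_mod_ring by (transfer, simp only: card_residue_index) (simp add: dvd_eq_mod_eq_0)

lemma gf_of_int_eq_iff: "(of_int a :: gf) = of_int b \<longleftrightarrow> a mod 571 = b mod 571"
  using gf_of_int_eq_0_iff[of "a - b"] by (simp add: mod_eq_dvd_iff)

definition residue :: "gf fps fps fps \<Rightarrow> gf" where
  "residue F = fps_nth (fps_nth (fps_nth F 0) 0) 0"

lemma residue_henselian: "henselian residue"
  using henselian_fps[OF henselian_fps[OF henselian_fps[OF henselian_field[where 'f = gf]]]]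
  unfolding residue_def[abs_def] .

text \<open>The point \<open>(218, 253, 73)\<close> modulo 571, displaced by independent infinitesimals: the three coordinates then
  satisfy no polynomial relation modulo 571.\<close>

definition pt_t :: "gf fps fps fps" where "pt_t = fps_const (fps_const (fps_const 218 + fps_X))"
definition pt_x :: "gf fps fps fps" where "pt_x = fps_const (fps_const (fps_const 253) + fps_X)"
definition pt_y :: "gf fps fps fps" where "pt_y = fps_const (fps_const (fps_const 73)) + fps_X"

lemma residue_pt: "residue pt_t = 218" "residue pt_x = 253" "residue pt_y = 73"
  by (simp_all add: residue_def pt_t_def pt_x_def pt_y_def)

text \<open>One variable at a time: evaluation at a displaced point adds nothing to the kernel on the
  coefficients.\<close>

lemma evaluation_kernel:
  fixes h :: "'a::idom \<Rightarrow> 'b::idom"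
  assumes "h 0 = 0" and ker: "\<And>a. h a = 0 \<Longrightarrow> m dvd a"
    and "poly (map_poly (\<lambda>a. fps_const (h a)) p) (fps_const c + fps_X) = 0"
  shows "[:m:] dvd p"
proof -
  have "map_poly (\<lambda>a. fps_const (h a)) p = map_poly fps_const (map_poly h p)"
    by (subst map_poly_map_poly) (simp_all add: assms(1) o_def)
  then have "map_poly h p = 0" using assms(3) eval_shift_inj by metis
  then have "h (coeff p i) = 0" for i using coeff_map_poly[of h p i] assms(1) by simp
  then have "m dvd coeff p i" for i using ker by blast
  then show ?thesis unfolding const_poly_dvd_iff by blast
qed

lemma eval3_pt_kernel:
  assumes "eval3 pt_t pt_x pt_y f = 0"
  shows "[:[:[:571:]:]:] dvd f"
proof -
  define h1 :: "int poly \<Rightarrow> gf fps"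
    where "h1 q = poly (map_poly (\<lambda>a. fps_const (of_int a)) q) (fps_const 218 + fps_X)" for q
  define h2 :: "int poly poly \<Rightarrow> gf fps fps"
    where "h2 p = poly (map_poly (\<lambda>q. fps_const (h1 q)) p) (fps_const (fps_const 253) + fps_X)" for p
  interpret c1: comm_ring_hom "fps_const :: gf fps \<Rightarrow> gf fps fps" by (rule fps_const_hom)
  interpret c2: comm_ring_hom "fps_const :: gf fps fps \<Rightarrow> gf fps fps fps" by (rule fps_const_hom)
  have h0: "h1 0 = 0" "h2 0 = 0" by (simp_all add: h1_def h2_def)
  have 1: "poly (map_poly of_int q) pt_t = fps_const (fps_const (h1 q))" for q
    unfolding h1_def pt_t_def
  proof (induction q)
    case (pCons a q)
    have "(of_int a :: gf fps fps fps) = fps_const (fps_const (fps_const (of_int a)))" by (simp add: fps_of_int)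
    then show ?case using pCons
      by (simp add: Polynomial.map_poly_pCons c1.hom_add c2.hom_add c1.hom_mult c2.hom_mult
          del: fps_const_add fps_const_mult)
  qed simp
  have 2: "poly (map_poly (\<lambda>q. poly (map_poly of_int q) pt_t) p) pt_x = fps_const (h2 p)" for p
    unfolding h2_def pt_x_def 1
    by (induction p) (simp_all add: Polynomial.map_poly_pCons h0 c2.hom_add c2.hom_mult del: fps_const_add fps_const_mult)
  have "[:571:] dvd q" if "h1 q = 0" for q
    using that unfolding h1_def by (rule evaluation_kernel[rotated 2]) (simp_all add: gf_of_int_eq_0_iff)
  then have "[:[:571:]:] dvd p" if "h2 p = 0" for p
    using that unfolding h2_def by - (rule evaluation_kernel[where h = h1], auto simp: h0)
  then show ?thesis
    using assms unfolding eval3_def 2 unfolding pt_y_def by - (rule evaluation_kernel[where h = h2], auto simp: h0)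
qed

abbreviation "generic_point \<equiv> eval3 fls_X (fls_const X) (fls_const Y)"

text \<open>Elements of \<open>\<rat>(x,y,t)\<close> as fractions of integral polynomials.\<close>

lemma gen_field_fraction:
  assumes "a \<in> gen_field {fls_const X, fls_const Y, fls_X}"
  shows "\<exists>c d. generic_point d \<noteq> 0 \<and> a * generic_point d = generic_point c"
proof -
  interpret g: comm_ring_hom generic_point by (rule eval3_hom)
  from assms show ?thesis
  proof (induction rule: gen_field.induct)
    case (incl a)
    then show ?case
      using eval3_vars[of "fls_X :: ratfun fls" "fls_const X" "fls_const Y"] g.hom_one
      by (metis insertE mult.right_neutral singletonD zero_neq_one)
  next
    case one
    then show ?case using g.hom_one by (metis mult.right_neutral zero_neq_one)
  next
    case (diff a b)
    then obtain c d c' d' where *: "generic_point d \<noteq> 0" "a * generic_point d = generic_point c"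
      "generic_point d' \<noteq> 0" "b * generic_point d' = generic_point c'" by blast
    show ?case
      by (rule exI[of _ "c * d' - c' * d"], rule exI[of _ "d * d'"])
        (use * in \<open>simp add: g.hom_mult g.hom_minus *(2,4)[symmetric] algebra_simps\<close>)
  next
    case (mult a b)
    then obtain c d c' d' where *: "generic_point d \<noteq> 0" "a * generic_point d = generic_point c"
      "generic_point d' \<noteq> 0" "b * generic_point d' = generic_point c'" by blast
    show ?case
      by (rule exI[of _ "c * c'"], rule exI[of _ "d * d'"])
        (use * in \<open>simp add: g.hom_mult *(2,4)[symmetric] algebra_simps\<close>)
  next
    case (inverse a)
    then obtain c d where *: "generic_point d \<noteq> 0" "a * generic_point d = generic_point c" by blast
    show ?case
    proof (cases "a = 0")
      case True
      then show ?thesis using g.hom_one g.hom_zero by (metis inverse_zero mult_zero_left zero_neq_one)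
    next
      case False
      then have "generic_point c \<noteq> 0" using * by auto
      moreover have "inverse a * generic_point c = generic_point d"
        unfolding *(2)[symmetric] using False by simp
      ultimately show ?thesis by blast
    qed
  qed
qed

lemma common_denominator:
  fixes n :: nat
  assumes "\<And>i. a i \<in> gen_field {fls_const X, fls_const Y, fls_X}"
  shows "\<exists>D c. generic_point D \<noteq> 0 \<and> (\<forall>i\<le>n. a i * generic_point D = generic_point (c i))"
proof (induction n)
  case 0
  obtain c d where "generic_point d \<noteq> 0" "a 0 * generic_point d = generic_point c"
    using gen_field_fraction[OF assms] by blast
  then show ?case by (intro exI[of _ d] exI[of _ "\<lambda>_. c"]) auto
next
  case (Suc n)
  interpret g: comm_ring_hom generic_point by (rule eval3_hom)
  obtain D c where D: "generic_point D \<noteq> 0" "\<forall>i\<le>n. a i * generic_point D = generic_point (c i)"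
    using Suc by blast
  obtain e d where e: "generic_point d \<noteq> 0" "a (Suc n) * generic_point d = generic_point e"
    using gen_field_fraction[OF assms] by blast
  show ?case
  proof (intro exI[of _ "D * d"] exI[of _ "\<lambda>i. if i = Suc n then e * D else c i * d"] conjI allI impI)
    show "generic_point (D * d) \<noteq> 0" using D e by (simp add: g.hom_mult)
    fix i assume i: "i \<le> Suc n"
    show "a i * generic_point (D * d) = generic_point (if i = Suc n then e * D else c i * d)"
    proof (cases "i = Suc n")
      case True
      have "a (Suc n) * (generic_point D * generic_point d) = (a (Suc n) * generic_point d) * generic_point D"
        by (simp only: mult_ac)
      then show ?thesis using True e by (simp add: g.hom_mult)
    next
      case False
      then have "a i * generic_point D = generic_point (c i)" using D i by simp
      then show ?thesis using False by (simp add: g.hom_mult mult.assoc[symmetric])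
    qed
  qed
qed

text \<open>Division by 571 lowers the absolute value of any nonzero coefficient, so it comes to an end.\<close>

lemma remove_content:
  fixes Q :: "int poly poly poly poly"
  assumes "Q \<noteq> 0" and "poly (map_poly generic_point Q) w = 0"
  shows "\<exists>Q'. \<not> [:[:[:[:571:]:]:]:] dvd Q' \<and> poly (map_poly generic_point Q') w = 0 \<and> degree Q' \<le> degree Q"
proof -
  interpret g: comm_ring_hom generic_point by (rule eval3_hom)
  define cf where "cf i j k l Q = coeff (coeff (coeff (coeff Q i) j) k) l" for i j k l and Q :: "int poly poly poly poly"
  have "lead_coeff (lead_coeff (lead_coeff (lead_coeff Q))) \<noteq> 0" using assms(1) by simp
  then have "\<exists>i j k l. cf i j k l Q \<noteq> 0" unfolding cf_def by blast
  then obtain i j k l where "cf i j k l Q \<noteq> 0" by blast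
  then show ?thesis using assms(2)
  proof (induction "nat \<bar>cf i j k l Q\<bar>" arbitrary: Q rule: less_induct)
    case less
    show ?case
    proof (cases "[:[:[:[:571:]:]:]:] dvd Q")
      case True
      then obtain R where R: "Q = [:[:[:[:571:]:]:]:] * R" by (rule dvdE)
      have "cf i j k l Q = 571 * cf i j k l R" by (simp add: R cf_def)
      then have lt: "nat \<bar>cf i j k l R\<bar> < nat \<bar>cf i j k l Q\<bar>" and nz: "cf i j k l R \<noteq> 0"
        using less.prems(1) by auto
      have "map_poly generic_point Q = smult 571 (map_poly generic_point R)"
      proof (rule poly_eqI)
        have "generic_point [:[:[:571:]:]:] = 571" by (simp add: eval3_def Polynomial.map_poly_pCons)
        then show "coeff (map_poly generic_point Q) n = coeff (smult 571 (map_poly generic_point R)) n" for n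
          using g.hom_mult[of "[:[:[:571:]:]:]" "coeff R n"] by (simp add: R coeff_map_poly)
      qed
      then have "poly (map_poly generic_point R) w = 0" using less.prems(2) by simp
      then obtain Q' where "\<not> [:[:[:[:571:]:]:]:] dvd Q'" "poly (map_poly generic_point Q') w = 0" "degree Q' \<le> degree R"
        using less.hyps[OF lt nz] by blast
      moreover have "degree R = degree Q" by (simp add: R)
      ultimately show ?thesis by auto
    qed (use less in blast)
  qed
qed

text \<open>After removal of factors 571, the annihilating polynomial stays nonzero at the displaced point. By
  \<open>single\<close>, every specialization of \<open>w\<close> is a root of it, and specializations with distinct residues are distinct.\<close>

lemma degree_at_least_values:
  fixes S :: "gf set"
  assumes pts: "\<And>r. r \<in> S \<Longrightarrow> \<exists>\<Gamma> b. specialization \<Gamma> \<and> (fls_X, pt_t) \<in> \<Gamma> \<and> (fls_const X, pt_x) \<in> \<Gamma> \<and>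
      (fls_const Y, pt_y) \<in> \<Gamma> \<and> (w, b) \<in> \<Gamma> \<and> residue b = r"
    and q: "q \<noteq> 0" "set (coeffs q) \<subseteq> gen_field {fls_const X, fls_const Y, fls_X}" "poly q w = 0"
  shows "card S \<le> degree q"
proof -
  interpret g: comm_ring_hom generic_point by (rule eval3_hom)
  interpret p: comm_ring_hom "eval3 pt_t pt_x pt_y" by (rule eval3_hom)
  let ?K = "gen_field {fls_const X, fls_const Y, fls_X}"
  define n where "n = degree q"
  have "0 \<in> ?K" by (rule sub_0[OF subfield_gen_field])
  then have "coeff q i \<in> ?K" for i
    using q(2) coeff_in_coeffs[OF q(1), of i] by (cases "i \<le> degree q") (auto simp: coeff_eq_0)
  then obtain D c where D: "generic_point D \<noteq> 0" "\<forall>i\<le>n. coeff q i * generic_point D = generic_point (c i)"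
    using common_denominator[of "coeff q" n] by blast
  define Q where "Q = (\<Sum>i\<le>n. monom (c i) i)"
  have cQ: "coeff Q i = (if i \<le> n then c i else 0)" for i by (simp add: Q_def coeff_sum)
  have Qq: "map_poly generic_point Q = smult (generic_point D) q"
  proof (rule poly_eqI)
    fix i show "coeff (map_poly generic_point Q) i = coeff (smult (generic_point D) q) i"
      using D(2) by (cases "i \<le> n") (auto simp: coeff_map_poly cQ mult.commute n_def coeff_eq_0)
  qed
  have "Q \<noteq> 0" using Qq D q by auto
  moreover have "poly (map_poly generic_point Q) w = 0" using Qq q by simp
  ultimately obtain Q' where Q': "\<not> [:[:[:[:571:]:]:]:] dvd Q'" "poly (map_poly generic_point Q') w = 0" "degree Q' \<le> degree Q"
    using remove_content by blast
  have "degree Q \<le> n" by (rule degree_le) (simp add: cQ)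
  define R where "R = map_poly (eval3 pt_t pt_x pt_y) Q'"
  have "R \<noteq> 0"
  proof
    assume "R = 0"
    then have "eval3 pt_t pt_x pt_y (coeff Q' i) = 0" for i
      using coeff_map_poly[of "eval3 pt_t pt_x pt_y" Q' i] by (simp add: R_def)
    then show False using Q'(1) eval3_pt_kernel by (simp add: const_poly_dvd_iff)
  qed
  have "S \<subseteq> residue ` {b. poly R b = 0}"
  proof
    fix r assume "r \<in> S"
    then obtain \<Gamma> b where s: "specialization \<Gamma>" and m: "(fls_X, pt_t) \<in> \<Gamma>" "(fls_const X, pt_x) \<in> \<Gamma>"
      "(fls_const Y, pt_y) \<in> \<Gamma>" "(w, b) \<in> \<Gamma>" and r: "residue b = r" using pts by blast
    interpret s: specialization \<Gamma> by fact
    have "(generic_point f, eval3 pt_t pt_x pt_y f) \<in> \<Gamma>" for f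
      unfolding eval3_def by (intro s.poly_eval s.of_int m) simp_all
    then have "(poly (map_poly generic_point Q') w, poly R b) \<in> \<Gamma>"
      unfolding R_def by (intro s.poly_eval m) simp_all
    then have "poly R b = 0" using Q'(2) s.single by simp
    then show "r \<in> residue ` {b. poly R b = 0}" using r by blast
  qed
  moreover have fin: "finite {b. poly R b = 0}" using \<open>R \<noteq> 0\<close> by (rule poly_roots_finite)
  ultimately have "card S \<le> card (residue ` {b. poly R b = 0})" by (intro card_mono) auto
  also have "\<dots> \<le> card {b. poly R b = 0}" using fin by (rule card_image_le)
  also have "\<dots> \<le> degree R" using \<open>R \<noteq> 0\<close> by (rule card_poly_roots_bound)
  also have "\<dots> \<le> degree Q'" unfolding R_def by (rule degree_map_poly_le)
  also have "\<dots> \<le> n" using Q'(3) \<open>degree Q \<le> n\<close> by simp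
  finally show ?thesis by (simp add: n_def)
qed

text \<open>The three equations are solved by lifting simple roots: first \<open>z\<close>, then the two cubics over it.\<close>

lemma (in parametrization) point_exists:
  fixes z v1 v2 :: gf
  assumes z: "256 * z^6 * 218^2 = (z^2 - 1) * (z^2 + 3)^3" "- 72 * z^3 + 6 * (256 * 218^2 - 8) * z^5 - 8 * z^7 \<noteq> 0"
    "256 * z^6 \<noteq> 0"
    and v1: "1 - z^2 + 3 * v1 + v1 * z^2 = 253^2 * v1^2 * (3 + v1 + z^2 - v1 * z^2)"
      "3 + z^2 - 2 * 253^2 * (3 + z^2) * v1 - 3 * 253^2 * (1 - z^2) * v1^2 \<noteq> 0"
      "v1^2 * (3 + v1 + z^2 - v1 * z^2) \<noteq> 0"
    and v2: "1 - z^2 + 3 * v2 + v2 * z^2 = 73^2 * v2^2 * (3 + v2 + z^2 - v2 * z^2)"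
      "3 + z^2 - 2 * 73^2 * (3 + z^2) * v2 - 3 * 73^2 * (1 - z^2) * v2^2 \<noteq> 0"
      "v2^2 * (3 + v2 + z^2 - v2 * z^2) \<noteq> 0"
  shows "\<exists>zh vxh vyh. curve_point T0 Z0 V0 residue pt_t pt_x pt_y zh vxh vyh \<and>
    residue zh = z \<and> residue vxh = v1 \<and> residue vyh = v2"
proof -
  interpret h: henselian residue by (rule residue_henselian)
  interpret r: comm_ring_hom residue by (rule h.hom)
  note rs = r.hom_add r.hom_mult r.hom_minus r.hom_uminus r.hom_power r.hom_numeral residue_pt
  \<comment> \<open>the equation of \<open>Z\<close>, expanded in powers of \<open>Z\<close>\<close>
  define fz where "fz = [:27, 0, 0, 0, -18, 0, 256 * pt_t^2 - 8, 0, -1:]"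
  have pz: "poly fz a = 256 * a^6 * pt_t^2 - (a^2 - 1) * (a^2 + 3)^3" for a
    unfolding fz_def by (simp add: algebra_simps power2_eq_square power3_eq_cube eval_nat_numeral)
  have mz: "map_poly residue fz = [:27, 0, 0, 0, -18, 0, 256 * 218^2 - 8, 0, -1:]"
    by (simp add: fz_def Polynomial.map_poly_pCons rs)
  obtain zh where zh: "residue zh = z" "poly fz zh = 0"
  proof -
    have "poly (map_poly residue fz) z = 0"
    proof -
      have "poly (map_poly residue fz) z = 256 * z^6 * 218^2 - (z^2 - 1) * (z^2 + 3)^3"
        unfolding mz by (simp add: algebra_simps power2_eq_square power3_eq_cube eval_nat_numeral)
      then show ?thesis using z(1) by simp
    qed
    moreover have "poly (pderiv (map_poly residue fz)) z \<noteq> 0"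
    proof -
      have "poly (pderiv (map_poly residue fz)) z = - 72 * z^3 + 6 * (256 * 218^2 - 8) * z^5 - 8 * z^7"
        unfolding mz by (simp add: pderiv_pCons algebra_simps eval_nat_numeral)
      then show ?thesis using z(2) by simp
    qed
    ultimately show ?thesis using h.lift that by blast
  qed
  have cubic: "\<exists>vh. residue vh = v \<and> 1 - zh^2 + 3 * vh + vh * zh^2 = xh^2 * vh^2 * (3 + vh + zh^2 - vh * zh^2)"
    if x: "residue xh = x" and v: "1 - z^2 + 3 * v + v * z^2 = x^2 * v^2 * (3 + v + z^2 - v * z^2)"
      "3 + z^2 - 2 * x^2 * (3 + z^2) * v - 3 * x^2 * (1 - z^2) * v^2 \<noteq> 0" for xh x v
  proof -
    define f where "f = [:1 - zh^2, 3 + zh^2, - (xh^2 * (3 + zh^2)), - (xh^2 * (1 - zh^2)):]"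
    have pf: "poly f a = (1 - zh^2 + 3 * a + a * zh^2) - xh^2 * a^2 * (3 + a + zh^2 - a * zh^2)" for a
      unfolding f_def by (simp add: algebra_simps power2_eq_square)
    have mf: "map_poly residue f = [:1 - z^2, 3 + z^2, - (x^2 * (3 + z^2)), - (x^2 * (1 - z^2)):]"
      by (simp add: f_def Polynomial.map_poly_pCons rs x zh)
    have "poly (map_poly residue f) v = (1 - z^2 + 3 * v + v * z^2) - x^2 * v^2 * (3 + v + z^2 - v * z^2)"
      unfolding mf by (simp add: algebra_simps power2_eq_square)
    then have 0: "poly (map_poly residue f) v = 0" using v(1) by simp
    have "poly (pderiv (map_poly residue f)) v = 3 + z^2 - 2 * x^2 * (3 + z^2) * v - 3 * x^2 * (1 - z^2) * v^2"
      unfolding mf by (simp add: pderiv_pCons algebra_simps power2_eq_square)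
    then have "poly (pderiv (map_poly residue f)) v \<noteq> 0" using v(2) by simp
    from h.lift[OF 0 this] show ?thesis by (auto simp: pf)
  qed
  obtain vxh where vxh: "residue vxh = v1" "1 - zh^2 + 3 * vxh + vxh * zh^2 = pt_x^2 * vxh^2 * (3 + vxh + zh^2 - vxh * zh^2)"
    using cubic[OF residue_pt(2) v1(1,2)] by blast
  obtain vyh where vyh: "residue vyh = v2" "1 - zh^2 + 3 * vyh + vyh * zh^2 = pt_y^2 * vyh^2 * (3 + vyh + zh^2 - vyh * zh^2)"
    using cubic[OF residue_pt(3) v2(1,2)] by blast
  have "curve_point T0 Z0 V0 residue pt_t pt_x pt_y zh vxh vyh"
  proof (intro curve_point.intro parametrization_axioms residue_henselian curve_point_axioms.intro)
    show "256 * zh^6 * pt_t^2 = (zh^2 - 1) * (zh^2 + 3)^3" using zh(2) pz[of zh] by simp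
  qed (use z(3) v1(3) v2(3) vxh vyh zh in \<open>simp_all add: rs del: power_eq_0_iff mult_eq_0_iff\<close>)
  then show ?thesis using zh vxh vyh by blast
qed

section \<open>Seventy-two points over a finite field\<close>

text \<open>The solutions \<open>Z\<close>, \<open>V(x\<^sup>2)\<close>, \<open>V(y\<^sup>2)\<close> differ from point to point, and with them \<open>\<Gamma>\<close>; the images
  of \<open>t\<close>, \<open>x\<close>, \<open>y\<close> do not.\<close>

definition has_value :: "ratfun fls \<Rightarrow> gf \<Rightarrow> bool" where
  "has_value w r \<longleftrightarrow> (\<exists>\<Gamma> b. specialization \<Gamma> \<and> (fls_X, pt_t) \<in> \<Gamma> \<and> (fls_const X, pt_x) \<in> \<Gamma> \<and>
      (fls_const Y, pt_y) \<in> \<Gamma> \<and> (w, b) \<in> \<Gamma> \<and> residue b = r)"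

text \<open>The equation of \<open>Z\<close>, the simplicity of the root, the unit conditions, and the value \<open>k\<close> of \<open>M\<^bsub>1,0\<^esub>\<close>, as
  congruences between integers.\<close>

definition check_z :: "int \<Rightarrow> int \<Rightarrow> bool" where
  "check_z z k \<longleftrightarrow>
    (256 * z^6 * 218^2 - (z^2 - 1) * (z^2 + 3)^3) mod 571 = 0 \<and>
    (- 72 * z^3 + 6 * (256 * 218^2 - 8) * z^5 - 8 * z^7) mod 571 \<noteq> 0 \<and>
    (256 * z^6) mod 571 \<noteq> 0 \<and>
    (24 * z^3 * 218^2) mod 571 \<noteq> 0 \<and>
    (k * (24 * z^3 * 218^2) - (4 * z^3 - (1 + z^2)^2)) mod 571 = 0"

text \<open>The same for a root \<open>v\<close> of the cubic at \<open>x\<close>, with the values \<open>a\<close> of \<open>A(x)\<close> and \<open>b\<close> of \<open>B(x)\<close>.\<close>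

definition check_v :: "int \<Rightarrow> int \<Rightarrow> int \<times> int \<times> int \<Rightarrow> bool" where
  "check_v z x = (\<lambda>(v, a, b).
    (1 - z^2 + 3 * v + v * z^2 - x^2 * v^2 * (3 + v + z^2 - v * z^2)) mod 571 = 0 \<and>
    (3 + z^2 - 2 * x^2 * (3 + z^2) * v - 3 * x^2 * (1 - z^2) * v^2) mod 571 \<noteq> 0 \<and>
    (v^2 * (3 + v + z^2 - v * z^2)) mod 571 \<noteq> 0 \<and>
    (218^2 * R_den z v) mod 571 \<noteq> 0 \<and>
    (a * (218^2 * R_den z v) - x * R_num z v) mod 571 = 0 \<and>
    (218 * x * B_den (z^2) v) mod 571 \<noteq> 0 \<and>
    (b * (218 * x * B_den (z^2) v) - B_num (z^2) v) mod 571 = 0)"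

text \<open>For each of the eight roots \<open>z\<close> with the value of \<open>M\<^bsub>1,0\<^esub>\<close>: the three roots of the cubic at \<open>x = 253\<close> and
  the three at \<open>y = 73\<close>, with the values of \<open>A\<close> and \<open>B\<close> there. At this point all equations split into linear
  factors, and the values of \<open>M\<close> and of \<open>P\<close> are distinct.\<close>

definition table :: "((int \<times> int) \<times> (int \<times> int \<times> int) list \<times> (int \<times> int \<times> int) list) list" where
  "table = [
    ((123, 181), [(115, 552, 88), (187, 420, 113), (432, 346, 144)], [(132, 568, 28), (173, 19, 296), (429, 424, 220)]),
    ((148, 459), [(6, 117, 119), (62, 543, 542), (89, 131, 255)], [(155, 195, 361), (238, 400, 420), (335, 453, 334)]),
    ((150, 183), [(156, 539, 420), (216, 17, 314), (488, 27, 182)], [(101, 570, 464), (221, 189, 198), (538, 166, 453)]),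
    ((250, 551), [(61, 502, 274), (126, 564, 134), (508, 175, 508)], [(72, 87, 455), (162, 62, 279), (461, 369, 381)]),
    ((321, 267), [(61, 94, 274), (126, 32, 134), (508, 421, 508)], [(72, 332, 455), (162, 357, 279), (461, 50, 381)]),
    ((421, 64), [(156, 57, 420), (216, 8, 314), (488, 569, 182)], [(101, 420, 464), (221, 230, 198), (538, 253, 453)]),
    ((423, 359), [(6, 479, 119), (62, 53, 542), (89, 465, 255)], [(155, 224, 361), (238, 19, 420), (335, 537, 334)]),
    ((448, 66), [(115, 44, 88), (187, 176, 113), (432, 250, 144)], [(132, 422, 28), (173, 400, 296), (429, 566, 220)])]"

lemma table_correct:
  "list_all (\<lambda>((z, k), ps, qs). check_z z k \<and> list_all (check_v z 253) ps \<and> list_all (check_v z 73) qs) table"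
  by code_simp

definition points :: "((int \<times> int) \<times> (int \<times> int \<times> int) \<times> (int \<times> int \<times> int)) list" where
  "points = concat (map (\<lambda>(zk, ps, qs). concat (map (\<lambda>p. map (\<lambda>q. (zk, p, q)) qs) ps)) table)"

text \<open>The coefficients of \<open>M_cleared\<close> at \<open>t = 218\<close>.\<close>

definition M_den :: "'a::comm_ring_1 \<Rightarrow> 'a \<Rightarrow> 'a" where
  "M_den x y = 6 * y * (x * y - 218 * (x^2 + 1) * (y^2 + 1))"

definition M_num :: "'a::comm_ring_1 \<Rightarrow> 'a \<Rightarrow> 'a \<Rightarrow> 'a \<Rightarrow> 'a \<Rightarrow> 'a \<Rightarrow> 'a" where
  "M_num x y ax ay b k = 2 * x^2 * y^2 - 6 * 218 * y * (x^2 + 1) * ax + 3 * 218 * y * (x^2 - 1) * (y^2 + 1) * b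
     + 3 * 218 * x * (y^2 + 1) * ay - 3 * 218 * x * y * k + 3 * y * (x * y - 218 * (x^2 + 1) * (y^2 + 1)) * b"

text \<open>The factors \<open>316\<close>, \<open>441\<close> and \<open>200\<close> are the inverses modulo 571 of \<open>M_den 253 73\<close>, \<open>M_den 73 253\<close> and
  \<open>253 \<sqdot> 73\<close>.\<close>

definition M_val :: "(int \<times> int) \<times> (int \<times> int \<times> int) \<times> (int \<times> int \<times> int) \<Rightarrow> int" where
  "M_val = (\<lambda>((z, k), (v, a, b), (v', a', b')). 316 * M_num 253 73 a a' b' k mod 571)"

definition M_val' :: "(int \<times> int) \<times> (int \<times> int \<times> int) \<times> (int \<times> int \<times> int) \<Rightarrow> int" where
  "M_val' = (\<lambda>((z, k), (v, a, b), (v', a', b')). 441 * M_num 73 253 a' a b k mod 571)"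

definition P_val :: "(int \<times> int) \<times> (int \<times> int \<times> int) \<times> (int \<times> int \<times> int) \<Rightarrow> int" where
  "P_val = (\<lambda>((z, k), (v, a, b), (v', a', b')).
     200 * (73 * (M_val ((z, k), (v, a, b), (v', a', b')) - b') + 253 * (M_val' ((z, k), (v, a, b), (v', a', b')) - b)) mod 571)"

definition A_val :: "(int \<times> int) \<times> (int \<times> int \<times> int) \<times> (int \<times> int \<times> int) \<Rightarrow> int" where
  "A_val = (\<lambda>((z, k), (v, a, b), (v', a', b')). a mod 571)"

definition B_val :: "(int \<times> int) \<times> (int \<times> int \<times> int) \<times> (int \<times> int \<times> int) \<Rightarrow> int" where
  "B_val = (\<lambda>((z, k), (v, a, b), (v', a', b')). b' mod 571)"

lemma distinct_values:
  "length (remdups (map M_val points)) = 72" "length (remdups (map P_val points)) = 72"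
  "length (remdups (map A_val points)) = 24" "length (remdups (map B_val points)) = 12"
  by code_simp+

lemma gf_zero: "a mod 571 = 0 \<Longrightarrow> (of_int a :: gf) = 0" and gf_nonzero: "a mod 571 \<noteq> 0 \<Longrightarrow> (of_int a :: gf) \<noteq> 0"
  by (simp_all add: gf_of_int_eq_0_iff dvd_eq_mod_eq_0)

lemma of_int_closed_forms:
  "of_int (R_den z v) = (R_den (of_int z) (of_int v) :: gf)" "of_int (R_num z v) = (R_num (of_int z) (of_int v) :: gf)"
  "of_int (B_den z v) = (B_den (of_int z) (of_int v) :: gf)" "of_int (B_num z v) = (B_num (of_int z) (of_int v) :: gf)"
  "of_int (M_num z v a a' b k) = (M_num (of_int z) (of_int v) (of_int a) (of_int a') (of_int b) (of_int k) :: gf)"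
  by (simp_all add: R_den_def R_num_def N_poly_def B_den_def B_num_def M_num_def)

lemma check_zD:
  assumes "check_z z k"
  defines "z' \<equiv> (of_int z :: gf)"
  shows "256 * z'^6 * 218^2 = (z'^2 - 1) * (z'^2 + 3)^3"
    and "- 72 * z'^3 + 6 * (256 * 218^2 - 8) * z'^5 - 8 * z'^7 \<noteq> 0"
    and "256 * z'^6 \<noteq> 0" and "24 * z'^3 * 218^2 \<noteq> 0"
    and "of_int k * (24 * z'^3 * 218^2) = 4 * z'^3 - (1 + z'^2)^2"
proof -
  note c = assms(1)[unfolded check_z_def]
  note d = c[THEN conjunct1, THEN gf_zero] c[THEN conjunct2, THEN conjunct1, THEN gf_nonzero]
    c[THEN conjunct2, THEN conjunct2, THEN conjunct1, THEN gf_nonzero]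
    c[THEN conjunct2, THEN conjunct2, THEN conjunct2, THEN conjunct1, THEN gf_nonzero]
    c[THEN conjunct2, THEN conjunct2, THEN conjunct2, THEN conjunct2, THEN gf_zero]
  note e = d[unfolded of_int_diff of_int_add of_int_mult of_int_power of_int_minus of_int_numeral of_int_1, folded z'_def]
  show "256 * z'^6 * 218^2 = (z'^2 - 1) * (z'^2 + 3)^3" using e(1) by (simp only: right_minus_eq)
  show "- 72 * z'^3 + 6 * (256 * 218^2 - 8) * z'^5 - 8 * z'^7 \<noteq> 0" by (fact e(2))
  show "256 * z'^6 \<noteq> 0" by (fact e(3))
  show "24 * z'^3 * 218^2 \<noteq> 0" by (fact e(4))
  show "of_int k * (24 * z'^3 * 218^2) = 4 * z'^3 - (1 + z'^2)^2" using e(5) by (simp only: right_minus_eq)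
qed

lemma check_vD:
  assumes "check_v z x (v, a, b)"
  defines "z' \<equiv> (of_int z :: gf)" and "x' \<equiv> (of_int x :: gf)" and "v' \<equiv> (of_int v :: gf)"
  shows "1 - z'^2 + 3 * v' + v' * z'^2 = x'^2 * v'^2 * (3 + v' + z'^2 - v' * z'^2)"
    and "3 + z'^2 - 2 * x'^2 * (3 + z'^2) * v' - 3 * x'^2 * (1 - z'^2) * v'^2 \<noteq> 0"
    and "v'^2 * (3 + v' + z'^2 - v' * z'^2) \<noteq> 0"
    and "218^2 * R_den z' v' \<noteq> 0" and "of_int a * (218^2 * R_den z' v') = x' * R_num z' v'"
    and "218 * x' * B_den (z'^2) v' \<noteq> 0" and "of_int b * (218 * x' * B_den (z'^2) v') = B_num (z'^2) v'"
proof -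
  note c = assms(1)[unfolded check_v_def prod.case]
  note d = c[THEN conjunct1, THEN gf_zero] c[THEN conjunct2, THEN conjunct1, THEN gf_nonzero]
    c[THEN conjunct2, THEN conjunct2, THEN conjunct1, THEN gf_nonzero]
    c[THEN conjunct2, THEN conjunct2, THEN conjunct2, THEN conjunct1, THEN gf_nonzero]
    c[THEN conjunct2, THEN conjunct2, THEN conjunct2, THEN conjunct2, THEN conjunct1, THEN gf_zero]
    c[THEN conjunct2, THEN conjunct2, THEN conjunct2, THEN conjunct2, THEN conjunct2, THEN conjunct1, THEN gf_nonzero]
    c[THEN conjunct2, THEN conjunct2, THEN conjunct2, THEN conjunct2, THEN conjunct2, THEN conjunct2, THEN gf_zero]
  note e = d[unfolded of_int_diff of_int_add of_int_mult of_int_closed_forms of_int_power of_int_minus of_int_numeral of_int_1,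
      folded z'_def x'_def v'_def]
  show "1 - z'^2 + 3 * v' + v' * z'^2 = x'^2 * v'^2 * (3 + v' + z'^2 - v' * z'^2)" using e(1) by (simp only: right_minus_eq)
  show "3 + z'^2 - 2 * x'^2 * (3 + z'^2) * v' - 3 * x'^2 * (1 - z'^2) * v'^2 \<noteq> 0" by (fact e(2))
  show "v'^2 * (3 + v' + z'^2 - v' * z'^2) \<noteq> 0" by (fact e(3))
  show "218^2 * R_den z' v' \<noteq> 0" by (fact e(4))
  show "of_int a * (218^2 * R_den z' v') = x' * R_num z' v'" using e(5) by (simp only: right_minus_eq)
  show "218 * x' * B_den (z'^2) v' \<noteq> 0" by (fact e(6))
  show "of_int b * (218 * x' * B_den (z'^2) v') = B_num (z'^2) v'" using e(7) by (simp only: right_minus_eq)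
qed

lemma M_solution:
  fixes r :: gf
  assumes "(c * M_den x y) mod 571 = 1" and "r = of_int (c * n mod 571)"
  shows "M_den (of_int x) (of_int y) \<noteq> (0 :: gf)" and "r * M_den (of_int x) (of_int y) = of_int n"
proof -
  have "(of_int (c * M_den x y) :: gf) = of_int 1" using assms(1) unfolding gf_of_int_eq_iff by simp
  then have i: "of_int c * M_den (of_int x) (of_int y) = (1 :: gf)" by (simp add: M_den_def)
  then show "M_den (of_int x) (of_int y) \<noteq> (0 :: gf)" by auto
  have "r = of_int (c * n)" unfolding assms(2) gf_of_int_eq_iff by simp
  then show "r * M_den (of_int x) (of_int y) = of_int n" using i by (simp add: mult_ac)
qed

context parametrization
begin

lemma point_values:
  assumes p: "p \<in> set points"
  shows "has_value (eval2 M_ser X Y) (of_int (M_val p))" and "has_value (eval2 P_ser X Y) (of_int (P_val p))"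
    and "has_value (eval1 A_ser X) (of_int (A_val p))" and "has_value (eval1 B_ser Y) (of_int (B_val p))"
proof -
  obtain z k ps qs v a b v' a' b' where row: "((z, k), ps, qs) \<in> set table"
    and mem: "(v, a, b) \<in> set ps" "(v', a', b') \<in> set qs" and pe: "p = ((z, k), (v, a, b), (v', a', b'))"
    using p unfolding points_def by auto
  have cz: "check_z z k" and cx: "check_v z 253 (v, a, b)" and cy: "check_v z 73 (v', a', b')"
    using table_correct row mem by (auto simp: list_all_iff)
  note Z = check_zD[OF cz] and VX = check_vD[OF cx, unfolded of_int_numeral] and VY = check_vD[OF cy, unfolded of_int_numeral]
  obtain zh vxh vyh where cp: "curve_point T0 Z0 V0 residue pt_t pt_x pt_y zh vxh vyh"
    and res: "residue zh = of_int z" "residue vxh = of_int v" "residue vyh = of_int v'"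
    using point_exists[OF Z(1-3) VX(1-3) VY(1-3)] by blast
  interpret c: curve_point T0 Z0 V0 residue pt_t pt_x pt_y zh vxh vyh by (rule cp)
  have hv: "has_value w r" if "c.value_at w r" for w r
    using that c.spec c.t_spec c.x_spec c.y_spec unfolding has_value_def c.value_at_def by blast
  note pts = residue_pt res
  have k: "c.value_at (eval0 (coeff_series M_ser 1 0)) (of_int k)"
    by (rule c.value_M10) (unfold pts, fact Z(4), fact Z(5))
  have ax: "c.value_at (eval1 A_ser X) (of_int a)"
    by (rule c.value_A[OF c.value_vars(2) c.value_params(2) transcendental_x]) (unfold pts, fact VX(4), fact VX(5))
  have ay: "c.value_at (eval1 A_ser Y) (of_int a')"
    by (rule c.value_A[OF c.value_vars(3) c.value_params(3) transcendental_y]) (unfold pts, fact VY(4), fact VY(5))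
  have bx: "c.value_at (eval1 B_ser X) (of_int b)"
    by (rule c.value_B[OF c.value_vars(2) c.value_params(2) transcendental_x]) (unfold pts, fact VX(6), fact VX(7))
  have bY: "c.value_at (eval1 B_ser Y) (of_int b')"
    by (rule c.value_B[OF c.value_vars(3) c.value_params(3) transcendental_y]) (unfold pts, fact VY(6), fact VY(7))
  have i1: "316 * M_den 253 73 mod 571 = (1 :: int)" and i2: "441 * M_den 73 253 mod 571 = (1 :: int)"
    by (simp_all add: M_den_def)
  have r: "of_int (M_val p) = (of_int (316 * M_num 253 73 a a' b' k mod 571) :: gf)"
    by (simp only: pe M_val_def prod.case)
  note s = M_solution[OF i1 r, unfolded of_int_closed_forms of_int_numeral, unfolded M_den_def M_num_def]
  have m: "c.value_at (eval2 M_ser X Y) (of_int (M_val p))"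
    by (rule c.value_M[OF X_nonzero Y_nonzero c.value_vars(2,3) ax ay bY k]) (unfold pts, fact s(1), fact s(2))
  have r2: "of_int (M_val' p) = (of_int (441 * M_num 73 253 a' a b k mod 571) :: gf)"
    by (simp only: pe M_val'_def prod.case)
  note s2 = M_solution[OF i2 r2, unfolded of_int_closed_forms of_int_numeral, unfolded M_den_def M_num_def]
  have m2: "c.value_at (eval2 M_ser Y X) (of_int (M_val' p))"
    by (rule c.value_M[OF Y_nonzero X_nonzero c.value_vars(3,2) ay ax bx k]) (unfold pts, fact s2(1), fact s2(2))
  have pv: "c.value_at (eval2 P_ser X Y) (of_int (P_val p))"
  proof (rule c.value_P[OF m m2 bx bY])
    have "(of_int (200 * (253 * 73)) :: gf) = of_int 1" unfolding gf_of_int_eq_iff by simp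
    then have i: "200 * (253 * 73) = (1 :: gf)" by simp
    have "(of_int (253 * 73) :: gf) \<noteq> 0" by (rule gf_nonzero) simp
    then show "residue pt_x * residue pt_y \<noteq> 0" unfolding pts by simp
    have "(of_int (P_val p) :: gf) = of_int (200 * (73 * (M_val p - b') + 253 * (M_val' p - b)))"
      unfolding P_val_def pe prod.case gf_of_int_eq_iff by simp
    also have "\<dots> * (253 * 73) = (200 * (253 * 73)) * (73 * (of_int (M_val p) - of_int b') + 253 * (of_int (M_val' p) - of_int b))"
      by (simp only: of_int_mult of_int_add of_int_diff of_int_numeral mult_ac)
    finally show "of_int (P_val p) * (residue pt_x * residue pt_y)
        = residue pt_y * (of_int (M_val p) - of_int b') + residue pt_x * (of_int (M_val' p) - of_int b)"
      unfolding pts i by simp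
  qed
  show "has_value (eval2 M_ser X Y) (of_int (M_val p))" "has_value (eval2 P_ser X Y) (of_int (P_val p))"
    using m pv hv by blast+
  have "(of_int (A_val p) :: gf) = of_int a" "(of_int (B_val p) :: gf) = of_int b'"
    unfolding A_val_def B_val_def pe prod.case gf_of_int_eq_iff by simp_all
  then show "has_value (eval1 A_ser X) (of_int (A_val p))" "has_value (eval1 B_ser Y) (of_int (B_val p))"
    using ax bY hv by simp_all
qed

end

text \<open>The values are reduced modulo 571, so distinct integers are distinct in the field.\<close>

lemma degree_lower_bound:
  assumes hv: "\<And>p. p \<in> set points \<Longrightarrow> has_value w (of_int (f p))"
    and n: "length (remdups (map f points)) = n" and red: "\<And>p. f p mod 571 = f p"
    and q: "q \<noteq> 0" "set (coeffs q) \<subseteq> gen_field {fls_const X, fls_const Y, fls_X}" "poly q w = 0"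
  shows "n \<le> degree q"
proof -
  have "inj_on (of_int :: int \<Rightarrow> gf) (set (map f points))"
    using red by (auto simp: inj_on_def gf_of_int_eq_iff)
  then have "card (of_int ` set (map f points) :: gf set) = n"
    using n by (simp add: card_image length_remdups_card_conv)
  moreover have "card (of_int ` set (map f points) :: gf set) \<le> degree q"
    by (rule degree_at_least_values[OF _ q]) (use hv in \<open>auto simp: has_value_def\<close>)
  ultimately show ?thesis by simp
qed

lemma values_reduced: "M_val p mod 571 = M_val p" "P_val p mod 571 = P_val p" "A_val p mod 571 = A_val p" "B_val p mod 571 = B_val p"
  by (simp_all add: M_val_def P_val_def A_val_def B_val_def case_prod_beta del: mod_mult_eq)

section \<open>Upper bounds for the degrees\<close>

lemma gen_field_mono: "S \<subseteq> S' \<Longrightarrow> gen_field S \<subseteq> gen_field S'"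
proof
  fix a assume "S \<subseteq> S'" "a \<in> gen_field S"
  from this(2,1) show "a \<in> gen_field S'"
    by (induction rule: gen_field.induct) (auto intro: gen_field.intros)
qed

lemma coeffs_pCons_subset: "a \<in> K \<Longrightarrow> set (coeffs p) \<subseteq> K \<Longrightarrow> set (coeffs (pCons a p)) \<subseteq> K"
  by (auto simp: coeffs_pCons_eq_cCons cCons_def)

lemmas sub_rules = sub_add sub_diff sub_uminus sub_mult sub_divide sub_numeral sub_1 sub_power

text \<open>Its coefficient of \<open>t\<^sup>0\<close> is a nonzero constant.\<close>

lemma kernel_nonvanishing:
  fixes a b :: "'a::field_char_0"
  assumes "a \<noteq> 0" "b \<noteq> 0"
  shows "6 * fls_const b * (fls_const a * fls_const b - fls_X * ((fls_const a)^2 + 1) * ((fls_const b)^2 + 1)) \<noteq> 0"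
proof
  assume "6 * fls_const b * (fls_const a * fls_const b - fls_X * ((fls_const a)^2 + 1) * ((fls_const b)^2 + 1)) = 0"
  then have "fls_const (a * b) = fls_X * fls_const ((a^2 + 1) * (b^2 + 1))"
    using assms by (simp add: fls_const_power fls_plus_const[symmetric] fls_const_mult_const[symmetric] mult.assoc
        del: fls_const_mult_const)
  from arg_cong[OF this, of "\<lambda>f. fls_nth f 0"] show False using assms by simp
qed

lemma M_in_field:
  assumes L: "subfield_set L" "fls_X \<in> L" "fls_const a \<in> L" "fls_const b \<in> L"
    "eval1 A_ser a \<in> L" "eval1 A_ser b \<in> L" "eval1 B_ser b \<in> L" "eval0 (coeff_series M_ser 1 0) \<in> L"
    and nz: "a \<noteq> 0" "(b :: 'a::field_char_0) \<noteq> 0"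
  shows "eval2 M_ser a b \<in> L"
proof -
  have "eval2 M_ser a b = (2 * (fls_const a)^2 * (fls_const b)^2 - 6 * fls_X * fls_const b * ((fls_const a)^2 + 1) * eval1 A_ser a
      + 3 * fls_X * fls_const b * ((fls_const a)^2 - 1) * ((fls_const b)^2 + 1) * eval1 B_ser b
      + 3 * fls_X * fls_const a * ((fls_const b)^2 + 1) * eval1 A_ser b
      - 3 * fls_X * fls_const a * fls_const b * eval0 (coeff_series M_ser 1 0)
      + 3 * fls_const b * (fls_const a * fls_const b - fls_X * ((fls_const a)^2 + 1) * ((fls_const b)^2 + 1)) * eval1 B_ser b)
      / (6 * fls_const b * (fls_const a * fls_const b - fls_X * ((fls_const a)^2 + 1) * ((fls_const b)^2 + 1)))"
    by (rule nonzero_eq_divide_eq[THEN iffD2, OF kernel_nonvanishing[OF nz] M_cleared[OF nz]])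
  also have "\<dots> \<in> L" by (intro sub_rules[OF L(1)] L(2-8))
  finally show ?thesis .
qed

context parametrization
begin

text \<open>If this coefficient of the equation of \<open>V\<close> vanished, then so would the other side, and their sum is
  \<open>4 (1 + V)\<close>.\<close>

lemma V_not_pole: "3 + eval1 V0 (a^2) + TT - eval1 V0 (a^2) * TT \<noteq> (0 :: 'a::field_char_0 fls)"
proof
  assume 0: "3 + eval1 V0 (a^2) + TT - eval1 V0 (a^2) * TT = (0 :: 'a fls)"
  then have "1 - TT + 3 * eval1 V0 (a^2) + eval1 V0 (a^2) * TT = 0"
    using VV_cubic[of "fps_const (a^2)"] by (simp add: VV_def eval1_subst)
  with 0 have "4 * (1 + eval1 V0 (a^2)) = 0" by Groebner_Basis.algebra
  then have "1 + eval1 V0 (a^2) = 0" unfolding mult_eq_0_iff by simp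
  then show False using VV_plus_1[of "fps_const (a^2)"] by (simp add: VV_def eval1_subst)
qed

lemma V_equation: "1 - TT + 3 * eval1 V0 (a^2) + eval1 V0 (a^2) * TT
    = (fls_const (a :: 'a::field_char_0))^2 * (eval1 V0 (a^2))^2 * (3 + eval1 V0 (a^2) + TT - eval1 V0 (a^2) * TT)"
  using VV_cubic[of "fps_const (a^2)"] by (simp add: VV_def eval1_subst fls_const_power)

lemma V_nonzero: "eval1 V0 (a^2) \<noteq> (0 :: 'a::field_char_0 fls)"
  using VV_nonzero[of "fps_const (a^2)"] by (simp add: VV_def eval1_subst)

lemma R_den_V_nonzero: "R_den ZZ (eval1 V0 (a^2)) \<noteq> (0 :: 'a::field_char_0 fls)"
  using R_den_nonzero[of "fps_const (a^2)"] by (simp add: VV_def eval1_subst)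

lemma B_den_V_nonzero: "B_den TT (eval1 V0 (a^2)) \<noteq> (0 :: 'a::field_char_0 fls)"
  using B_den_nonzero[of "fps_const (a^2)"] by (simp add: VV_def eval1_subst)

lemma A_formula:
  assumes "transcendental_point a"
  shows "eval1 A_ser a = fls_const a * R_num ZZ (eval1 V0 (a^2)) / (fls_X^2 * R_den ZZ (eval1 V0 (a^2)))"
proof -
  interpret k: kernel_curve a T0 Z0 V0 by (intro kernel_curve.intro assms parametrization_axioms)
  show ?thesis using k.A_value R_den_V_nonzero[of a] by (simp add: eq_divide_eq mult_ac)
qed

lemma B_formula:
  assumes "transcendental_point a"
  shows "eval1 B_ser a = B_num TT (eval1 V0 (a^2)) / (fls_X * fls_const a * B_den TT (eval1 V0 (a^2)))"
proof -
  interpret k: kernel_curve a T0 Z0 V0 by (intro kernel_curve.intro assms parametrization_axioms)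
  show ?thesis using k.B_value B_den_V_nonzero[of a] k.a_nonzero by (simp add: eq_divide_eq mult_ac)
qed

lemma adjoin_V:
  fixes a :: "'a::field_char_0"
  defines "v \<equiv> eval1 V0 (a^2)"
  assumes K: "subfield_set K" "TT \<in> K" "fls_const a \<in> K" and a: "a \<noteq> 0"
  shows "subfield_set (fspan K 3 (\<lambda>i. v ^ i))" "K \<subseteq> fspan K 3 (\<lambda>i. v ^ i)" "v \<in> fspan K 3 (\<lambda>i. v ^ i)"
proof -
  define p where "p = [:1 - TT, 3 + TT, - ((fls_const a)^2 * (3 + TT)), - ((fls_const a)^2 * (1 - TT)):]"
  have "- ((fls_const a)^2 * (1 - TT)) \<noteq> 0" using a TT_not_1[where 'a = 'a] by simp
  then have d: "degree p = 3" "p \<noteq> 0" unfolding p_def by simp_all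
  have c: "set (coeffs p) \<subseteq> K"
    unfolding p_def by (intro coeffs_pCons_subset sub_rules[OF K(1)] K(2,3)) simp
  have "poly p v = (1 - TT + 3 * v + v * TT) - (fls_const a)^2 * v^2 * (3 + v + TT - v * TT)"
    unfolding p_def by (simp add: algebra_simps power2_eq_square)
  then have r: "poly p v = 0" using V_equation[of a] by (simp add: v_def)
  show "subfield_set (fspan K 3 (\<lambda>i. v ^ i))" "K \<subseteq> fspan K 3 (\<lambda>i. v ^ i)" "v \<in> fspan K 3 (\<lambda>i. v ^ i)"
    using adjoin_root[OF K(1) c d(2) r] unfolding d(1) by blast+
qed

text \<open>The equation of \<open>T\<close> at \<open>T = Z\<^sup>2\<close>, an equation of degree \<open>8\<close> for \<open>Z\<close> over \<open>\<rat>(t)\<close>.\<close>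

lemma adjoin_Z:
  fixes K :: "'a::field_char_0 fls set"
  assumes K: "subfield_set K" "fls_X \<in> K"
  shows "subfield_set (fspan K 8 (\<lambda>i. ZZ ^ i))" "K \<subseteq> fspan K 8 (\<lambda>i. ZZ ^ i)" "ZZ \<in> fspan K 8 (\<lambda>i. ZZ ^ i)"
proof -
  define p where "p = [:27, 0, 0, 0, -18, 0, 256 * fls_X^2 - 8, 0, -1 :: 'a fls:]"
  have d: "degree p = 8" "p \<noteq> 0" unfolding p_def by simp_all
  have c: "set (coeffs p) \<subseteq> K"
    unfolding p_def by (intro coeffs_pCons_subset sub_rules[OF K(1)] sub_0[OF K(1)] K(2)) simp
  have "poly p ZZ = 256 * fls_X^2 * TT^3 - (TT - 1) * (TT + 3)^3"
    unfolding p_def TT_ZZ by (simp add: algebra_simps power2_eq_square power3_eq_cube eval_nat_numeral)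
  then have r: "poly p ZZ = 0" using TT_eq by simp
  show "subfield_set (fspan K 8 (\<lambda>i. ZZ ^ i))" "K \<subseteq> fspan K 8 (\<lambda>i. ZZ ^ i)" "ZZ \<in> fspan K 8 (\<lambda>i. ZZ ^ i)"
    using adjoin_root[OF K(1) c d(2) r] unfolding d(1) by blast+
qed

lemma adjoin_T:
  fixes K :: "'a::field_char_0 fls set"
  assumes K: "subfield_set K" "fls_X \<in> K"
  shows "subfield_set (fspan K 4 (\<lambda>i. TT ^ i))" "K \<subseteq> fspan K 4 (\<lambda>i. TT ^ i)" "TT \<in> fspan K 4 (\<lambda>i. TT ^ i)"
proof -
  define p where "p = [:27, 0, -18, 256 * fls_X^2 - 8, -1 :: 'a fls:]"
  have d: "degree p = 4" "p \<noteq> 0" unfolding p_def by simp_all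
  have c: "set (coeffs p) \<subseteq> K"
    unfolding p_def by (intro coeffs_pCons_subset sub_rules[OF K(1)] sub_0[OF K(1)] K(2)) simp
  have "poly p TT = 256 * fls_X^2 * TT^3 - (TT - 1) * (TT + 3)^3"
    unfolding p_def by (simp add: algebra_simps power2_eq_square power3_eq_cube)
  then have r: "poly p TT = 0" using TT_eq by simp
  show "subfield_set (fspan K 4 (\<lambda>i. TT ^ i))" "K \<subseteq> fspan K 4 (\<lambda>i. TT ^ i)" "TT \<in> fspan K 4 (\<lambda>i. TT ^ i)"
    using adjoin_root[OF K(1) c d(2) r] unfolding d(1) by blast+
qed

lemma A_in_field:
  assumes L: "subfield_set L" "fls_X \<in> L" "fls_const a \<in> L" "ZZ \<in> L" "eval1 V0 (a^2) \<in> L" and "transcendental_point a"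
  shows "eval1 A_ser a \<in> L"
  unfolding A_formula[OF assms(6)] R_num_def R_den_def N_poly_def by (intro sub_rules[OF L(1)] L(2-5))

lemma B_in_field:
  assumes L: "subfield_set L" "fls_X \<in> L" "fls_const a \<in> L" "TT \<in> L" "eval1 V0 (a^2) \<in> L" and "transcendental_point a"
  shows "eval1 B_ser a \<in> L"
  unfolding B_formula[OF assms(6)] B_num_def B_den_def by (intro sub_rules[OF L(1)] L(2-5))

lemma M10_in_field:
  assumes L: "subfield_set L" "fls_X \<in> L" "(ZZ :: ratfun fls) \<in> L"
  shows "eval0 (coeff_series M_ser 1 0) \<in> L"
proof -
  interpret k: kernel_curve X T0 Z0 V0 by (intro kernel_curve.intro transcendental_x parametrization_axioms)
  have "eval0 (coeff_series M_ser 1 0) = (g0_fun ZZ / fls_X^2 :: ratfun fls)"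
    unfolding k.M10_value[symmetric] by (rule nonzero_mult_div_cancel_left[symmetric]) simp
  moreover have "(g0_fun ZZ / fls_X^2 :: ratfun fls) \<in> L"
    unfolding g0_fun_def by (intro sub_rules[OF L(1)] L(2,3))
  ultimately show ?thesis by simp
qed

text \<open>Upper bound: \<open>A(x)\<close> lies in \<open>\<rat>(t,x)(Z)(V)\<close>, of degree at most \<open>8 \<sqdot> 3\<close>. Lower bound: \<open>A(x)\<close> has
  24 distinct values, even over the larger field \<open>\<rat>(x,y,t)\<close>.\<close>

lemma degree_A: "algebraic_of_degree (gen_field {fls_X, fls_const X}) (eval1 A_ser X) 24"
proof -
  let ?K = "gen_field {fls_X, fls_const X}"
  define L1 where "L1 = fspan ?K 8 (\<lambda>i. ZZ ^ i)"
  define L2 where "L2 = fspan L1 3 (\<lambda>i. (eval1 V0 (X^2)) ^ i)"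
  have K: "subfield_set ?K" "fls_X \<in> ?K" "fls_const X \<in> ?K"
    by (auto intro: subfield_gen_field gen_field.incl)
  note Z = adjoin_Z[OF K(1,2), folded L1_def]
  have T1: "TT \<in> L1" unfolding TT_ZZ by (intro sub_rules[OF Z(1)] Z(3))
  have x1: "fls_const X \<in> L1" using K(3) Z(2) by blast
  note V = adjoin_V[OF Z(1) T1 x1 X_nonzero, folded L2_def]
  have "eval1 A_ser X \<in> L2"
    by (rule A_in_field[OF V(1) _ _ _ V(3) transcendental_x]) (use K Z V in blast)+
  then have "(eval1 A_ser X) ^ i \<in> L2" for i by (rule sub_power[OF V(1)])
  then have up: "(eval1 A_ser X) ^ i \<in> fspan ?K (8 * 3) (\<lambda>k. ZZ ^ (k mod 8) * (eval1 V0 (X^2)) ^ (k div 8))" for i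
    using fspan_tower[OF K(1) Z(1)[unfolded L1_def], of 3 "\<lambda>i. (eval1 V0 (X^2)) ^ i"] unfolding L2_def L1_def by blast
  have "algebraic_of_degree ?K (eval1 A_ser X) (8 * 3)"
  proof (rule algebraic_of_degreeI[OF K(1) up])
    fix q assume q: "q \<noteq> 0" "set (coeffs q) \<subseteq> ?K" "poly q (eval1 A_ser X) = 0"
    have "?K \<subseteq> gen_field {fls_const X, fls_const Y, fls_X}" by (rule gen_field_mono) auto
    then have "24 \<le> degree q"
      by (intro degree_lower_bound[OF point_values(3) distinct_values(3) values_reduced(3) q(1) _ q(3)]) (use q(2) in auto)
    then show "8 * 3 \<le> degree q" by simp
  qed
  then show ?thesis by simp
qed

text \<open>The closed form of \<open>B\<close> involves \<open>Z\<close> only through \<open>T\<close>, whose degree is \<open>4\<close>; this halves the degree.\<close>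

lemma degree_B: "algebraic_of_degree (gen_field {fls_X, fls_const Y}) (eval1 B_ser Y) 12"
proof -
  let ?K = "gen_field {fls_X, fls_const Y}"
  define L1 where "L1 = fspan ?K 4 (\<lambda>i. TT ^ i)"
  define L2 where "L2 = fspan L1 3 (\<lambda>i. (eval1 V0 (Y^2)) ^ i)"
  have K: "subfield_set ?K" "fls_X \<in> ?K" "fls_const Y \<in> ?K"
    by (auto intro: subfield_gen_field gen_field.incl)
  note T = adjoin_T[OF K(1,2), folded L1_def]
  have y1: "fls_const Y \<in> L1" using K(3) T(2) by blast
  note V = adjoin_V[OF T(1) T(3) y1 Y_nonzero, folded L2_def]
  have "eval1 B_ser Y \<in> L2"
    by (rule B_in_field[OF V(1) _ _ _ V(3) transcendental_y]) (use K T V in blast)+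
  then have "(eval1 B_ser Y) ^ i \<in> L2" for i by (rule sub_power[OF V(1)])
  then have up: "(eval1 B_ser Y) ^ i \<in> fspan ?K (4 * 3) (\<lambda>k. TT ^ (k mod 4) * (eval1 V0 (Y^2)) ^ (k div 4))" for i
    using fspan_tower[OF K(1) T(1)[unfolded L1_def], of 3 "\<lambda>i. (eval1 V0 (Y^2)) ^ i"] unfolding L2_def L1_def by blast
  have "algebraic_of_degree ?K (eval1 B_ser Y) (4 * 3)"
  proof (rule algebraic_of_degreeI[OF K(1) up])
    fix q assume q: "q \<noteq> 0" "set (coeffs q) \<subseteq> ?K" "poly q (eval1 B_ser Y) = 0"
    have "?K \<subseteq> gen_field {fls_const X, fls_const Y, fls_X}" by (rule gen_field_mono) auto
    then have "12 \<le> degree q"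
      by (intro degree_lower_bound[OF point_values(4) distinct_values(4) values_reduced(4) q(1) _ q(3)]) (use q(2) in auto)
    then show "4 * 3 \<le> degree q" by simp
  qed
  then show ?thesis by simp
qed

text \<open>The tower \<open>Z\<close>, \<open>V(x\<^sup>2)\<close>, \<open>V(y\<^sup>2)\<close> has degree at most \<open>8 \<sqdot> 3 \<sqdot> 3\<close>.\<close>

lemma degree_M_P:
  "algebraic_of_degree (gen_field {fls_const X, fls_const Y, fls_X}) (eval2 M_ser X Y) 72"
  "algebraic_of_degree (gen_field {fls_const X, fls_const Y, fls_X}) (eval2 P_ser X Y) 72"
proof -
  let ?K = "gen_field {fls_const X, fls_const Y, fls_X}"
  let ?e = "\<lambda>k. (eval1 V0 (X^2)) ^ (k mod 3) * (eval1 V0 (Y^2)) ^ (k div 3)"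
  define L1 where "L1 = fspan ?K 8 (\<lambda>i. ZZ ^ i)"
  define L2 where "L2 = fspan L1 3 (\<lambda>i. (eval1 V0 (X^2)) ^ i)"
  define L3 where "L3 = fspan L2 3 (\<lambda>i. (eval1 V0 (Y^2)) ^ i)"
  have K: "subfield_set ?K" "fls_X \<in> ?K" "fls_const X \<in> ?K" "fls_const Y \<in> ?K"
    by (auto intro: subfield_gen_field gen_field.incl)
  note Z = adjoin_Z[OF K(1,2), folded L1_def]
  have T1: "TT \<in> L1" unfolding TT_ZZ by (intro sub_rules[OF Z(1)] Z(3))
  have x1: "fls_const X \<in> L1" using K(3) Z(2) by blast
  note V = adjoin_V[OF Z(1) T1 x1 X_nonzero, folded L2_def]
  have T2: "TT \<in> L2" and y2: "fls_const Y \<in> L2" using T1 K(4) Z(2) V(2) by blast+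
  note W = adjoin_V[OF V(1) T2 y2 Y_nonzero, folded L3_def]
  have in3: "fls_X \<in> L3" "fls_const X \<in> L3" "fls_const Y \<in> L3" "ZZ \<in> L3" "TT \<in> L3"
    "eval1 V0 (X^2) \<in> L3" "eval1 V0 (Y^2) \<in> L3"
    using K Z V W T1 by blast+
  note AX = A_in_field[OF W(1) in3(1,2,4,6) transcendental_x] and AY = A_in_field[OF W(1) in3(1,3,4,7) transcendental_y]
  note BX = B_in_field[OF W(1) in3(1,2,5,6) transcendental_x] and BY = B_in_field[OF W(1) in3(1,3,5,7) transcendental_y]
  note k = M10_in_field[OF W(1) in3(1,4)]
  have M: "eval2 M_ser X Y \<in> L3" by (rule M_in_field[OF W(1) in3(1-3) AX AY BY k X_nonzero Y_nonzero])
  have M': "eval2 M_ser Y X \<in> L3" by (rule M_in_field[OF W(1) in3(1,3,2) AY AX BX k Y_nonzero X_nonzero])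
  have P: "eval2 P_ser X Y \<in> L3"
    unfolding eval2_P_eq[OF X_nonzero Y_nonzero] eval2_M_x0 by (intro sub_rules[OF W(1)] in3 M M' BX BY)
  have "L3 \<subseteq> fspan L1 (3 * 3) ?e"
    unfolding L3_def L2_def by (rule fspan_tower[OF Z(1) V(1)[unfolded L2_def]])
  also have "\<dots> \<subseteq> fspan ?K (8 * (3 * 3)) (\<lambda>k. ZZ ^ (k mod 8) * ?e (k div 8))"
    unfolding L1_def by (rule fspan_tower[OF K(1) Z(1)[unfolded L1_def]])
  finally have sub: "L3 \<subseteq> fspan ?K (8 * (3 * 3)) (\<lambda>k. ZZ ^ (k mod 8) * ?e (k div 8))" .
  have "algebraic_of_degree ?K (eval2 M_ser X Y) (8 * (3 * 3))"
  proof (rule algebraic_of_degreeI[OF K(1)])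
    show "(eval2 M_ser X Y) ^ i \<in> fspan ?K (8 * (3 * 3)) (\<lambda>k. ZZ ^ (k mod 8) * ?e (k div 8))" for i
      using sub sub_power[OF W(1) M] by blast
    show "8 * (3 * 3) \<le> degree q" if "q \<noteq> 0" "set (coeffs q) \<subseteq> ?K" "poly q (eval2 M_ser X Y) = 0" for q
      using degree_lower_bound[OF point_values(1) distinct_values(1) values_reduced(1) that] by simp
  qed
  then show "algebraic_of_degree ?K (eval2 M_ser X Y) 72" by simp
  have "algebraic_of_degree ?K (eval2 P_ser X Y) (8 * (3 * 3))"
  proof (rule algebraic_of_degreeI[OF K(1)])
    show "(eval2 P_ser X Y) ^ i \<in> fspan ?K (8 * (3 * 3)) (\<lambda>k. ZZ ^ (k mod 8) * ?e (k div 8))" for i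
      using sub sub_power[OF W(1) P] by blast
    show "8 * (3 * 3) \<le> degree q" if "q \<noteq> 0" "set (coeffs q) \<subseteq> ?K" "poly q (eval2 P_ser X Y) = 0" for q
      using degree_lower_bound[OF point_values(2) distinct_values(2) values_reduced(2) that] by simp
  qed
  then show "algebraic_of_degree ?K (eval2 P_ser X Y) 72" by simp
qed

lemma parameters_generate:
  fixes a :: "'a::field_char_0"
  assumes a: "transcendental_point a"
  shows "{fls_X^2, (fls_const a)^2, fls_const a * eval1 A_ser a, fls_X * fls_const a * eval1 B_ser a}
    \<subseteq> gen_field {ZZ, eval1 V0 (a^2)}"
proof -
  let ?L = "gen_field {ZZ, eval1 V0 (a^2)}" and ?v = "eval1 V0 (a^2)"
  have L: "subfield_set ?L" "ZZ \<in> ?L" "?v \<in> ?L" by (auto intro: subfield_gen_field gen_field.incl)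
  have T: "TT \<in> ?L" unfolding TT_ZZ by (intro sub_rules[OF L(1)] L(2))
  have a0: "fls_const a \<noteq> 0" using transcendental_point.a_nonzero[OF a] by simp
  have "fls_X^2 = (TT - 1) * (TT + 3)^3 / (256 * TT^3 :: 'a fls)"
    unfolding eq_divide_eq using TT_eq ZZ_nonzero[where 'a = 'a] by (simp add: mult_ac TT_ZZ)
  also have "\<dots> \<in> ?L" by (intro sub_rules[OF L(1)] T)
  finally have t: "fls_X^2 \<in> ?L" .
  have "(fls_const a)^2 = (1 - TT + 3 * ?v + ?v * TT) / (?v^2 * (3 + ?v + TT - ?v * TT))"
    unfolding eq_divide_eq using V_equation[of a] V_nonzero[of a] V_not_pole[of a] by (simp add: mult.assoc)
  also have "\<dots> \<in> ?L" by (intro sub_rules[OF L(1)] T L(2,3))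
  finally have s: "(fls_const a)^2 \<in> ?L" .
  have "fls_const a * eval1 A_ser a = (fls_const a)^2 * R_num ZZ ?v / (fls_X^2 * R_den ZZ ?v)"
    unfolding A_formula[OF a] by (simp add: power2_eq_square)
  also have "\<dots> \<in> ?L" unfolding R_num_def R_den_def N_poly_def by (intro sub_rules[OF L(1)] L(2,3) t s)
  finally have A: "fls_const a * eval1 A_ser a \<in> ?L" .
  have "fls_X * fls_const a * eval1 B_ser a = B_num TT ?v / B_den TT ?v"
    unfolding B_formula[OF a] using a0 B_den_V_nonzero[of a] by (simp add: divide_simps)
  also have "\<dots> \<in> ?L" unfolding B_num_def B_den_def by (intro sub_rules[OF L(1)] L(2,3) T)
  finally show ?thesis using t s A by simp
qed

end

section \<open>Parity of the coefficients\<close>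

lemma even_poly_square:
  fixes p :: "'a::comm_ring_1 poly"
  assumes "\<And>i. odd i \<Longrightarrow> coeff p i = 0"
  shows "\<exists>q. p = pcompose q [:0, 0, 1:]"
  using assms
proof (induction "degree p" arbitrary: p rule: less_induct)
  case less
  obtain c r where p: "p = pCons c r" by (cases p)
  obtain d s where r: "r = pCons d s" by (cases r)
  have d: "d = 0" using less.prems[of 1] p r by simp
  show ?case
  proof (cases "s = 0")
    case True
    then show ?thesis using p r d by (intro exI[of _ "[:c:]"]) simp
  next
    case False
    have "coeff s i = 0" if "odd i" for i using less.prems[of "Suc (Suc i)"] that p r by simp
    moreover have "degree s < degree p" using False p r by simp
    ultimately obtain q where "s = pcompose q [:0, 0, 1:]" using less.hyps by blast
    then have "p = pcompose (pCons c q) [:0, 0, 1:]" using p r d by (simp add: pcompose_pCons)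
    then show ?thesis by blast
  qed
qed

lemma even_series_square:
  assumes "\<And>n i. odd i \<Longrightarrow> coeff (fps_nth H n) i = 0"
  shows "\<exists>F. square_var F = H"
proof -
  have "\<forall>n. \<exists>q. fps_nth H n = pcompose q [:0, 0, 1:]" using assms even_poly_square by blast
  then obtain f where "\<And>n. fps_nth H n = pcompose (f n) [:0, 0, 1:]" by metis
  then have "square_var (Abs_fps f) = H" by (intro fps_ext) (simp add: square_var_def)
  then show ?thesis by blast
qed

lemma square_var_nth_0: "fps_nth (square_var F) n = 0 \<Longrightarrow> fps_nth F n = 0"
  by (simp add: square_var_def pcompose_eq_0)

lemma coeff_B_ser: "coeff (fps_nth B_ser n) j = M_coeff n 0 (int j)"
  using M_ser_coeffs[of n] by (simp add: B_ser_def has_coeffs_def coeff_map_poly)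

text \<open>Each step changes the parity of both coordinates. For \<open>A\<close> this leaves even powers of \<open>t\<close> and odd powers of \<open>x\<close>,
  for \<open>B\<close> odd powers of both; the factors in front make them even.\<close>

lemma A_B_parity:
  shows "\<exists>F. (\<forall>n. odd n \<longrightarrow> fps_nth F n = 0) \<and> (\<forall>a :: 'a::field_char_0. fls_const a * eval1 A_ser a = eval1 F (a^2))"
    and "\<exists>G. (\<forall>n. odd n \<longrightarrow> fps_nth G n = 0) \<and> (\<forall>a :: 'a::field_char_0. fls_X * fls_const a * eval1 B_ser a = eval1 G (a^2))"
proof -
  have e: "eval1 F (a^2) = eval1 (square_var F) a" for F and a :: 'a by (simp add: eval1_subst subst_square_var)
  have x: "eval1 (fps_const [:0, 1:]) a = fls_const a" for a :: 'a
    by (simp add: eval1_subst subst_const fps_poly_pCons fps_poly_def[of _ 0])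
  have t: "eval1 fps_X a = fls_X" for a :: 'a by (simp add: eval1_subst)
  have A0: "M_coeff n (int k) 0 = 0" if "odd n \<or> even k" for n k
    using M_coeff_parity[of n "int k" 0] that by auto
  have B0: "M_coeff n 0 (int k) = 0" if "even n \<or> even k" for n k
    using M_coeff_parity[of n 0 "int k"] that by auto
  let ?H = "fps_const [:0, 1:] * A_ser" and ?I = "fps_X * fps_const [:0, 1:] * B_ser"
  have hA: "coeff (fps_nth ?H n) i = 0" if "odd n \<or> odd i" for n i
    using that A0 by (cases i) (auto simp: coeff_A_ser coeff_pCons)
  have hB: "coeff (fps_nth ?I n) i = 0" if "odd n \<or> odd i" for n i
    using that B0 by (cases i; cases n) (auto simp: coeff_B_ser coeff_pCons mult.assoc fps_X_mult_nth)
  obtain F where F: "square_var F = ?H" using even_series_square[of ?H] hA by blast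
  obtain G where G: "square_var G = ?I" using even_series_square[of ?I] hB by blast
  have "fps_nth ?H n = 0" "fps_nth ?I n = 0" if "odd n" for n
    using hA hB that by (auto simp only: poly_eq_iff coeff_0)
  then have z: "fps_nth F n = 0" "fps_nth G n = 0" if "odd n" for n
    using that square_var_nth_0[of F n] square_var_nth_0[of G n] unfolding F G by auto
  interpret e: comm_ring_hom "\<lambda>F. eval1 F a" for a :: 'a by (rule eval1_hom)
  show "\<exists>F. (\<forall>n. odd n \<longrightarrow> fps_nth F n = 0) \<and> (\<forall>a :: 'a. fls_const a * eval1 A_ser a = eval1 F (a^2))"
    using z(1) by (intro exI[of _ F]) (simp add: e F e.hom_mult x)
  show "\<exists>G. (\<forall>n. odd n \<longrightarrow> fps_nth G n = 0) \<and> (\<forall>a :: 'a. fls_X * fls_const a * eval1 B_ser a = eval1 G (a^2))"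
    using z(2) by (intro exI[of _ G]) (simp add: e G e.hom_mult x t)
qed

section \<open>Walks in three quadrants\<close>

theorem theorem4:
  fixes X Y :: ratfun and x y xb yb t :: "ratfun fls"
    and W :: "(int \<times> int) list set"
  assumes "X = indet_x" and "Y = indet_y"
    and "x = fls_const X" and "y = fls_const Y" and "xb = 1 / x" and "yb = 1 / y" and "t = fls_X"
    and "W = diagonal_walks three_quadrants"
  shows "\<exists>M P :: rat poly poly fps.
    walk_gf {w \<in> W. fst (last w) \<ge> 0 \<and> snd (last w) \<ge> 0} X Y = 1/3 * Q_gf X Y + eval2 P X Y \<and>
    walk_gf {w \<in> W. fst (last w) < 0} X Y
      = - (1/3) * xb^2 * Q_gf (1 / X) Y + xb * eval2 M (1 / X) Y \<and>
    algebraic_of_degree (gen_field {x, y, t}) (eval2 M X Y) 72 \<and>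
    algebraic_of_degree (gen_field {x, y, t}) (eval2 P X Y) 72 \<and>
    eval2 P X Y = xb * (eval2 M X Y - eval2 M 0 Y) + yb * (eval2 M Y X - eval2 M 0 X) \<and>
    (1 - t * (x + xb) * (y + yb)) * (2 * eval2 M X Y - eval2 M 0 Y)
      = 2 * x / 3 - 2 * t * yb * (x + xb) * eval2 M X 0
        + t * (x - xb) * (y + yb) * eval2 M 0 Y
        + t * (1 + yb^2) * eval2 M Y 0
        - t * yb * eval0 (coeff_series M 1 0) \<and>
    algebraic_of_degree (gen_field {t, x}) (eval2 M X 0) 24 \<and>
    algebraic_of_degree (gen_field {t, y}) (eval2 M 0 Y) 12 \<and>
    (\<exists>!T. is_T T) \<and>
    (\<forall>T. is_T T \<longrightarrow> (\<exists>!Z. is_sqrt T Z) \<and> (\<exists>!V. is_V T V)) \<and>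
    \<comment> \<open>From here on, the indeterminate \<open>X\<close> plays the role of \<open>sqrt x\<close>: series in \<open>x\<close> are
        evaluated at \<open>X^2\<close>, and \<open>s\<close> is \<open>sqrt x\<close> itself.\<close>
    (let s = fls_const X in
      (\<exists>F G :: rat poly fps.
        (\<forall>n. odd n \<longrightarrow> fps_nth F n = 0 \<and> fps_nth G n = 0) \<and>
        s * eval2 M X 0 = eval1 F (X^2) \<and>
        t * s * eval2 M 0 X = eval1 G (X^2)) \<and>
      (\<forall>T0 Z0 V0. is_T T0 \<and> is_sqrt T0 Z0 \<and> is_V T0 V0 \<longrightarrow>
        (let T = eval0 T0; Z = eval0 Z0; V = eval1 V0 (X^2) in
          {t^2, s^2, s * eval2 M X 0, t * s * eval2 M 0 X} \<subseteq> gen_field {Z, V} \<and>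
          t^2 / s * eval2 M X 0
            = V * (V*T - T - V - 3) * N_poly Z V
              / (48 * Z^3 * (V + 1)^2 * (V*Z - V - Z - 1)^2) \<and>
          t * s * eval2 M 0 X
            = (T*V - T + 3*V + 1) * (- T*V^2 - 2*T*V + V^2 + T + 2*V + 3)
              / (2 * (V + 1) * (T^2*V^2 - 2*T^2*V + 2*T*V^2 + T^2 - 3*V^2 + 2*T - 6*V - 3)))))"
proof -
  obtain T1 where T1: "is_T T1" using ex1_T by blast
  obtain Z1 where Z1: "is_sqrt T1 Z1" using ex1_sqrt[OF T1] by blast
  obtain V1 where V1: "is_V T1 V1" using ex1_V[OF T1] by blast
  interpret p: parametrization T1 Z1 V1 by unfold_locales (fact T1 Z1 V1)+
  have xb: "xb = 1 / fls_const indet_x" and yb: "yb = 1 / fls_const indet_y" using assms by simp_all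
  show ?thesis
    unfolding Let_def
  proof (rule exI[of _ M_ser], rule exI[of _ P_ser], intro conjI allI impI)
    show "walk_gf {w \<in> W. fst (last w) \<ge> 0 \<and> snd (last w) \<ge> 0} X Y = 1/3 * Q_gf X Y + eval2 P_ser X Y"
      unfolding assms(8) by (rule walk_gf_quadrant_part)
    show "walk_gf {w \<in> W. fst (last w) < 0} X Y = - (1/3) * xb^2 * Q_gf (1 / X) Y + xb * eval2 M_ser (1 / X) Y"
      unfolding assms(8) xb assms(1,2) by (rule walk_gf_negative_part[OF X_nonzero])
    show "algebraic_of_degree (gen_field {x, y, t}) (eval2 M_ser X Y) 72"
      "algebraic_of_degree (gen_field {x, y, t}) (eval2 P_ser X Y) 72"
      using p.degree_M_P assms by simp_all
    show "eval2 P_ser X Y = xb * (eval2 M_ser X Y - eval2 M_ser 0 Y) + yb * (eval2 M_ser Y X - eval2 M_ser 0 X)"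
      unfolding xb yb assms(1,2) by (rule eval2_P_eq[OF X_nonzero Y_nonzero])
    show "(1 - t * (x + xb) * (y + yb)) * (2 * eval2 M_ser X Y - eval2 M_ser 0 Y)
      = 2 * x / 3 - 2 * t * yb * (x + xb) * eval2 M_ser X 0
        + t * (x - xb) * (y + yb) * eval2 M_ser 0 Y
        + t * (1 + yb^2) * eval2 M_ser Y 0
        - t * yb * eval0 (coeff_series M_ser 1 0)"
      unfolding xb yb assms(1-4,7) by (rule M_functional_equation[OF X_nonzero Y_nonzero])
    show "algebraic_of_degree (gen_field {t, x}) (eval2 M_ser X 0) 24"
      "algebraic_of_degree (gen_field {t, y}) (eval2 M_ser 0 Y) 12"
      using p.degree_A p.degree_B assms by (simp_all add: eval2_M_y0 eval2_M_x0)
    show "\<exists>!T. is_T T" by (rule ex1_T)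
    show "\<exists>!Z. is_sqrt T Z" "\<exists>!V. is_V T V" if "is_T T" for T
      using ex1_sqrt[OF that] ex1_V[OF that] .
    obtain F G where F: "\<forall>n. odd n \<longrightarrow> fps_nth F n = 0" "\<forall>a :: ratfun. fls_const a * eval1 A_ser a = eval1 F (a^2)"
      and G: "\<forall>n. odd n \<longrightarrow> fps_nth G n = 0" "\<forall>a :: ratfun. fls_X * fls_const a * eval1 B_ser a = eval1 G (a^2)"
      using A_B_parity[where 'a = ratfun] by blast
    show "\<exists>F G. (\<forall>n. odd n \<longrightarrow> fps_nth F n = 0 \<and> fps_nth G n = 0) \<and>
        fls_const X * eval2 M_ser X 0 = eval1 F (X^2) \<and> t * fls_const X * eval2 M_ser 0 X = eval1 G (X^2)"
      using F G by (intro exI[of _ F] exI[of _ G]) (simp add: eval2_M_y0 eval2_M_x0 assms(7))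
  next
    fix T0 Z0 V0 assume h: "is_T T0 \<and> is_sqrt T0 Z0 \<and> is_V T0 V0"
    interpret q: parametrization T0 Z0 V0 by unfold_locales (use h in blast)+
    have T: "eval0 T0 = (q.TT :: ratfun fls)" and Z: "eval0 Z0 = (q.ZZ :: ratfun fls)" by (simp_all add: q.TT_def q.ZZ_def)
    show "{t^2, (fls_const X)^2, fls_const X * eval2 M_ser X 0, t * fls_const X * eval2 M_ser 0 X}
        \<subseteq> gen_field {eval0 Z0, eval1 V0 (X^2)}"
      unfolding Z eval2_M_y0 eval2_M_x0 assms(1,7) by (rule q.parameters_generate[OF transcendental_x])
    have a: "fls_const indet_x \<noteq> 0" using X_nonzero by simp
    have "t^2 / fls_const X * eval2 M_ser X 0 = R_num q.ZZ (eval1 V0 (X^2)) / R_den q.ZZ (eval1 V0 (X^2))"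
      unfolding eval2_M_y0 assms(1,7) q.A_formula[OF transcendental_x]
      using a q.R_den_V_nonzero[of indet_x] by (simp add: divide_simps)
    then show "t^2 / fls_const X * eval2 M_ser X 0
      = eval1 V0 (X^2) * (eval1 V0 (X^2) * eval0 T0 - eval0 T0 - eval1 V0 (X^2) - 3) * N_poly (eval0 Z0) (eval1 V0 (X^2))
        / (48 * (eval0 Z0)^3 * (eval1 V0 (X^2) + 1)^2
           * (eval1 V0 (X^2) * eval0 Z0 - eval1 V0 (X^2) - eval0 Z0 - 1)^2)"
      unfolding R_num_def R_den_def T Z q.TT_ZZ .
    have "t * fls_const X * eval2 M_ser 0 X = B_num q.TT (eval1 V0 (X^2)) / B_den q.TT (eval1 V0 (X^2))"
      unfolding eval2_M_x0 assms(1,7) q.B_formula[OF transcendental_x]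
      using a q.B_den_V_nonzero[of indet_x] by (simp add: divide_simps)
    then show "t * fls_const X * eval2 M_ser 0 X
      = (eval0 T0 * eval1 V0 (X^2) - eval0 T0 + 3 * eval1 V0 (X^2) + 1)
        * (- eval0 T0 * (eval1 V0 (X^2))^2 - 2 * eval0 T0 * eval1 V0 (X^2) + (eval1 V0 (X^2))^2 + eval0 T0 + 2 * eval1 V0 (X^2) + 3)
        / (2 * (eval1 V0 (X^2) + 1) * ((eval0 T0)^2 * (eval1 V0 (X^2))^2 - 2 * (eval0 T0)^2 * eval1 V0 (X^2)
           + 2 * eval0 T0 * (eval1 V0 (X^2))^2 + (eval0 T0)^2 - 3 * (eval1 V0 (X^2))^2 + 2 * eval0 T0 - 6 * eval1 V0 (X^2) - 3))"
      unfolding B_num_def B_den_def T .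
  qed
qed

end
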